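(* Let $n\in\mathcal{A}$ be a minimiser over $\mathcal{A}$ of $$\mathscr{F}(n)=\int_\Omega|\nabla n|^2+2t\,n\cdot\nabla\times n+t^2|n|^2\,dx+K\mathcal{H}^{2}(S_n).$$ Let $U\subset\subset\Omega$ be open and suppose that $$\overline{S}_n\cap U=\{(z,\varphi(z)) : z\in D\},$$ where $D\subset\mathbb{R}^{2}$ is an open set and $\varphi\in C^1(D,\mathbb{R})$. Then $$\int_{U\setminus\overline{S}_n}\nabla v:\nabla n+t\left(v\cdot\nabla\times n+n\cdot\nabla\times v\right)-(n\cdot v)\left(|\nabla n|^2+2t\,n\cdot\nabla\times n\right)dx=0$$ for all $v\in C_0^\infty(U,\mathbb{R}^3)$.
   Context: $\Omega=(-L_1,L_1)\times(-L_2,L_2)\times(0,1)\subset\mathbb{R}^3$, $\Omega_\epsilon=(-L_1,L_1)\times(-L_2,L_2)\times(-\epsilon,1+\epsilon)$ with $L_1,L_2,\epsilon>0$ fixed, $t\in\mathbb{R}$, $K>0$, and (here $z$ is the third coordinate) $$\mathcal{A}=\left\{n\in SBV^2(\Omega_\epsilon,\mathbb{S}^2\cup\{0\}) : n=e_1\text{ if }z\in(-\epsilon,0),\ n=e_3\text{ if }z\in(1,1+\epsilon)\right\}.$$ $S_n\subset\Omega_\epsilon$ is the approximate discontinuity set of $n$ and $\overline{S}_n$ its closure, $\nabla n$ the approximate gradient; $SBV^2$ denotes functions in $SBV$ with approximate gradient in $L^2$ and $\mathcal{H}^2(S_n)<\infty$. $A:B=\sum_{ij}A_{ij}B_{ij}$.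 *)

theory Defs
  imports "HOL-Analysis.Analysis"
begin

section \<open>Hausdorff measure\<close>

text \<open>
  The normalisation is the one for which the \<open>k\<close>-dimensional measure on a \<open>k\<close>-plane is
  Lebesgue measure. Empty covering sets cost nothing also for \<open>k = 0\<close>, where \<open>0 ^ 0 = 1\<close>;
  boundedness is required because \<^const>\<open>diameter\<close> is meaningless on unbounded sets.
\<close>

definition hausdorff_premeasure :: "nat \<Rightarrow> real \<Rightarrow> 'a::metric_space set \<Rightarrow> ennreal" where
  "hausdorff_premeasure k \<delta> A =
     (INF C \<in> {C :: nat \<Rightarrow> 'a set. A \<subseteq> (\<Union>i. C i) \<and> (\<forall>i. bounded (C i) \<and> diameter (C i) \<le> \<delta>)}.
        (\<Sum>i. if C i = {} then 0
              else ennreal (unit_ball_vol (real k) * (diameter (C i) / 2) ^ k)))"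

definition hausdorff_measure :: "nat \<Rightarrow> 'a::metric_space set \<Rightarrow> ennreal" where
  "hausdorff_measure k A = (SUP \<delta> \<in> {0<..}. hausdorff_premeasure k \<delta> A)"


section \<open>Smooth and continuously differentiable functions\<close>

primrec Ck :: "nat \<Rightarrow> ('a::euclidean_space \<Rightarrow> 'b::real_normed_vector) \<Rightarrow> bool" where
  "Ck 0 f \<longleftrightarrow> continuous_on UNIV f"
| "Ck (Suc k) f \<longleftrightarrow>
     (\<exists>f'. (\<forall>x. (f has_derivative f' x) (at x)) \<and> (\<forall>h. Ck k (\<lambda>x. f' x h)))"

text \<open>The elements of \<open>C\<^sub>0\<^sup>\<infinity>(U)\<close> are extended by zero to the whole space.\<close>

definition test_functions ::
    "'a::euclidean_space set \<Rightarrow> ('a \<Rightarrow> 'b::real_normed_vector) set" where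
  "test_functions U =
     {v. (\<forall>k. Ck k v) \<and> compact (closure {x. v x \<noteq> 0}) \<and> closure {x. v x \<noteq> 0} \<subseteq> U}"

definition C1_on :: "'a::real_normed_vector set \<Rightarrow> ('a \<Rightarrow> 'b::real_normed_vector) \<Rightarrow> bool" where
  "C1_on D f \<longleftrightarrow>
     (\<exists>f'. (\<forall>x\<in>D. (f has_derivative blinfun_apply (f' x)) (at x)) \<and> continuous_on D f')"


section \<open>Approximate limits and approximate gradients\<close>

definition ball_average :: "(real^'n \<Rightarrow> real) \<Rightarrow> real^'n \<Rightarrow> real \<Rightarrow> real" where
  "ball_average f x r = (LINT y:ball x r|lebesgue. f y) / measure lebesgue (ball x r)"

text \<open>
  The next three notions are meant for functions that are integrable near \<open>x\<close> (the Bochner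
  integral of a non-integrable function is \<open>0\<close>); below they are used only for functions that
  are integrable on an open set containing \<open>x\<close>.
\<close>

definition has_approx_limit :: "(real^'n \<Rightarrow> real^'m) \<Rightarrow> real^'n \<Rightarrow> real^'m \<Rightarrow> bool" where
  "has_approx_limit u x z \<longleftrightarrow>
     ((\<lambda>r. ball_average (\<lambda>y. norm (u y - z)) x r) \<longlongrightarrow> 0) (at_right 0)"

definition approx_disc_set :: "(real^'n) set \<Rightarrow> (real^'n \<Rightarrow> real^'m) \<Rightarrow> (real^'n) set" where
  "approx_disc_set \<Omega> u = {x \<in> \<Omega>. \<not> (\<exists>z. has_approx_limit u x z)}"

definition has_approx_gradient :: "(real^'n \<Rightarrow> real^'m) \<Rightarrow> real^'n \<Rightarrow> real^'n^'m \<Rightarrow> bool" where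
  "has_approx_gradient u x G \<longleftrightarrow>
     (\<exists>z. has_approx_limit u x z \<and>
        ((\<lambda>r. ball_average (\<lambda>y. norm (u y - z - G *v (y - x)) / r) x r) \<longlongrightarrow> 0) (at_right 0))"

text \<open>
  The entry \<open>approx_gradient u x $ i $ j\<close> is the \<open>j\<close>-th partial derivative of the \<open>i\<close>-th component,
  as in \<^const>\<open>jacobian\<close>. For functions of bounded variation it exists almost everywhere;
  elsewhere the value is irrelevant.
\<close>

definition approx_gradient :: "(real^'n \<Rightarrow> real^'m) \<Rightarrow> real^'n \<Rightarrow> real^'n^'m" where
  "approx_gradient u x = (THE G. has_approx_gradient u x G)"


section \<open>Functions of (special) bounded variation\<close>

definition finite_borel_measure_on :: "'a::topological_space set \<Rightarrow> 'a measure \<Rightarrow> bool" where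
  "finite_borel_measure_on \<Omega> \<mu> \<longleftrightarrow>
     sets \<mu> = sets borel \<and> finite_measure \<mu> \<and> emeasure \<mu> (- \<Omega>) = 0"

text \<open>
  A finite signed measure is represented by a pair \<open>(\<mu>, \<nu>)\<close> of finite measures standing for
  \<open>\<mu> - \<nu>\<close>. The following says that the distributional derivative \<open>D\<^sub>j u\<^sub>i\<close> in the open set \<open>\<Omega>\<close>
  is the finite signed measure \<open>\<mu> - \<nu>\<close>.
\<close>

definition dist_deriv_measure ::
    "(real^'n) set \<Rightarrow> (real^'n \<Rightarrow> real^'m) \<Rightarrow> 'm \<Rightarrow> 'n \<Rightarrow>
      (real^'n) measure \<Rightarrow> (real^'n) measure \<Rightarrow> bool" where
  "dist_deriv_measure \<Omega> u i j \<mu> \<nu> \<longleftrightarrow>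
     finite_borel_measure_on \<Omega> \<mu> \<and> finite_borel_measure_on \<Omega> \<nu> \<and>
     (\<forall>\<phi> \<in> test_functions \<Omega>.
        (LINT x:\<Omega>|lebesgue. u x $ i * frechet_derivative \<phi> (at x) (axis j 1)) =
        - ((LINT x|\<mu>. \<phi> x) - (LINT x|\<nu>. \<phi> x)))"

definition BV :: "(real^'n) set \<Rightarrow> (real^'n \<Rightarrow> real^'m) set" where
  "BV \<Omega> = {u. set_integrable lebesgue \<Omega> u \<and> (\<forall>i j. \<exists>\<mu> \<nu>. dist_deriv_measure \<Omega> u i j \<mu> \<nu>)}"

definition lebesgue_singular :: "'a::euclidean_space measure \<Rightarrow> bool" where
  "lebesgue_singular \<sigma> \<longleftrightarrow> (\<exists>N \<in> sets borel. emeasure lborel N = 0 \<and> emeasure \<sigma> (- N) = 0)"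

text \<open>
  Lebesgue decomposition of the signed measure \<open>\<mu> - \<nu>\<close> on \<open>\<Omega>\<close>: the absolutely continuous part has
  density \<open>g\<close>, the singular part is \<open>\<sigma> - \<tau>\<close>.
\<close>

definition lebesgue_decomposition ::
    "'a::euclidean_space set \<Rightarrow> 'a measure \<Rightarrow> 'a measure \<Rightarrow>
      ('a \<Rightarrow> real) \<Rightarrow> 'a measure \<Rightarrow> 'a measure \<Rightarrow> bool" where
  "lebesgue_decomposition \<Omega> \<mu> \<nu> g \<sigma> \<tau> \<longleftrightarrow>
     set_integrable lebesgue \<Omega> g \<and>
     finite_borel_measure_on \<Omega> \<sigma> \<and> lebesgue_singular \<sigma> \<and>
     finite_borel_measure_on \<Omega> \<tau> \<and> lebesgue_singular \<tau> \<and>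
     (\<forall>B \<in> sets borel. B \<subseteq> \<Omega> \<longrightarrow>
        measure \<mu> B - measure \<nu> B = (LINT x:B|lebesgue. g x) + (measure \<sigma> B - measure \<tau> B))"

text \<open>
  The Cantor part of the derivative of \<open>u\<close> is the restriction to \<open>\<Omega> - approx_disc_set \<Omega> u\<close> of its
  singular part; \<open>u\<close> belongs to \<open>SBV\<close> if it vanishes. By uniqueness of the derivative and of its
  Lebesgue decomposition it does not matter which representatives are chosen.
\<close>

definition SBV :: "(real^'n) set \<Rightarrow> (real^'n \<Rightarrow> real^'m) set" where
  "SBV \<Omega> = {u \<in> BV \<Omega>. \<forall>i j. \<exists>\<mu> \<nu> g \<sigma> \<tau>.
     dist_deriv_measure \<Omega> u i j \<mu> \<nu> \<and> lebesgue_decomposition \<Omega> \<mu> \<nu> g \<sigma> \<tau> \<and>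
     (\<forall>B \<in> sets borel. B \<subseteq> \<Omega> - approx_disc_set \<Omega> u \<longrightarrow> measure \<sigma> B - measure \<tau> B = 0)}"

definition SBV2 :: "(real^'n) set \<Rightarrow> (real^'n \<Rightarrow> real^'m) set" where
  "SBV2 \<Omega> = {u \<in> SBV \<Omega>.
     set_borel_measurable lebesgue \<Omega> (approx_gradient u) \<and>
     set_integrable lebesgue \<Omega> (\<lambda>x. (norm (approx_gradient u x))\<^sup>2) \<and>
     hausdorff_measure (CARD('n) - 1) (approx_disc_set \<Omega> u) < \<infinity>}"


section \<open>The variational problem\<close>

definition slab :: "real \<Rightarrow> real \<Rightarrow> real \<Rightarrow> real \<Rightarrow> (real^3) set" where
  "slab L1 L2 a b =
     {x. - L1 < x $ 1 \<and> x $ 1 < L1 \<and> - L2 < x $ 2 \<and> x $ 2 < L2 \<and> a < x $ 3 \<and> x $ 3 < b}"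

abbreviation domain :: "real \<Rightarrow> real \<Rightarrow> (real^3) set" where
  "domain L1 L2 \<equiv> slab L1 L2 0 1"

abbreviation extended_domain :: "real \<Rightarrow> real \<Rightarrow> real \<Rightarrow> (real^3) set" where
  "extended_domain L1 L2 \<epsilon> \<equiv> slab L1 L2 (- \<epsilon>) (1 + \<epsilon>)"

text \<open>As usual for functions identified up to null sets, the constraints hold almost everywhere.\<close>

definition admissible :: "real \<Rightarrow> real \<Rightarrow> real \<Rightarrow> (real^3 \<Rightarrow> real^3) set" where
  "admissible L1 L2 \<epsilon> = {n \<in> SBV2 (extended_domain L1 L2 \<epsilon>).
     AE x in lebesgue. x \<in> extended_domain L1 L2 \<epsilon> \<longrightarrow>
       n x \<in> sphere 0 1 \<union> {0} \<and>
       (x $ 3 < 0 \<longrightarrow> n x = axis 1 1) \<and>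
       (x $ 3 > 1 \<longrightarrow> n x = axis 3 1)}"

text \<open>The curl of a vector field, in terms of its gradient matrix.\<close>

definition curl_of :: "real^3^3 \<Rightarrow> real^3" where
  "curl_of G = vector [G $ 3 $ 2 - G $ 2 $ 3, G $ 1 $ 3 - G $ 3 $ 1, G $ 2 $ 1 - G $ 1 $ 2]"

text \<open>
  The inner product and norm on \<^typ>\<open>real^3^3\<close> are the Frobenius ones. For admissible \<open>n\<close> the
  integrand below is integrable and the Hausdorff measure is finite, so passing to real values
  loses nothing.
\<close>

definition energy ::
    "real \<Rightarrow> real \<Rightarrow> real \<Rightarrow> real \<Rightarrow> real \<Rightarrow> (real^3 \<Rightarrow> real^3) \<Rightarrow> real" where
  "energy L1 L2 \<epsilon> t K n =
     (LINT x:domain L1 L2|lebesgue.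
        (norm (approx_gradient n x))\<^sup>2 + 2 * t * (n x \<bullet> curl_of (approx_gradient n x))
        + t\<^sup>2 * (norm (n x))\<^sup>2)
     + K * enn2real (hausdorff_measure 2 (approx_disc_set (extended_domain L1 L2 \<epsilon>) n))"

end

theory Submission
  imports Defs
begin

text \<open>
  The competitors are \<open>w\<^sub>s = mob (s v / 2) n\<close>, where \<open>mob a\<close> is a conformal automorphism of the unit
  sphere that is extended to fix \<open>0\<close>. It depends smoothly on \<open>a\<close>, and its inverse is \<open>mob (- a)\<close>,
  so \<open>w\<^sub>s\<close> takes values in the sphere and \<open>0\<close>, coincides with \<open>n\<close> off the support of \<open>v\<close>, and has the
  same approximate discontinuity set as \<open>n\<close>. Its derivative at \<open>s = 0\<close> is \<open>v - (n \<bullet> v) n\<close>, the tangential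
  part of \<open>v\<close>.

  That \<open>w\<^sub>s\<close> belongs to \<open>SBV\<close> follows from a chain rule proved by mollification. The graph
  hypothesis makes the closure of \<open>S\<^sub>n\<close> a null set in \<open>U\<close>; off this closure the derivative of \<open>n\<close> is
  absolutely continuous, so \<open>n\<close> is approximately differentiable almost everywhere there, and the
  approximate gradient of \<open>w\<^sub>s\<close> is given by the pointwise chain rule. The surface energy does not
  depend on \<open>s\<close>, so by minimality the bulk energy of \<open>w\<^sub>s\<close> is minimal at \<open>s = 0\<close>, and dominated
  convergence of its difference quotients from both sides gives the equation.
\<close>

section \<open>Smooth functions and a mollifier\<close>

text \<open>The normalised perturbation (n + s v) / |n + s v| would not do: it sends the value 0,
  which n may take on a set of positive measure, to a multiple of v, and it is singular where n = -
  s v. Mollifications of n take values throughout the closed unit ball, so the chain rule asks for a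
  map that is smooth on the whole ball, while equality of the discontinuity sets asks for a
  continuous inverse on the sphere and 0. The family \<open>mob\<close> meets both demands. The half
  in s v / 2 compensates the factor 2 in the derivative of \<open>mob a p\<close> with respect to
  \<open>a\<close> at \<open>a = 0\<close>.

  \<open>approx_gradient\<close> is a definite description, so its value is arbitrary wherever u is
  not approximately differentiable. Off the support of v this is harmless: there the competitor
  agrees with n on an open set, and the two descriptions coincide whatever their value.

  Dominated convergence is made easy by writing every difference quotient in \<open>s\<close> as a
  closed formula in which \<open>s\<close> has been cancelled (\<open>mobX\<close>,
  \<open>mobY\<close>), so that it is defined, bounded and continuous at \<open>s = 0\<close> as
  well.\<close>

lemma Ck_Suc_imp_Ck: "Ck (Suc k) f \<Longrightarrow> Ck k f"
proof (induction k arbitrary: f)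
  case 0
  then obtain f' where f': "\<And>x. (f has_derivative f' x) (at x)" by auto
  show ?case
    unfolding Ck.simps by (rule continuous_at_imp_continuous_on) (blast intro: has_derivative_continuous f')
next
  case (Suc k)
  from Suc.prems obtain f' where f': "\<And>x. (f has_derivative f' x) (at x)"
    and Ck: "\<And>h. Ck (Suc k) (\<lambda>x. f' x h)"
    by (subst (asm) Ck.simps(2)) blast
  with Suc.IH show ?case
    by (auto simp: Ck.simps(2) simp del: Ck.simps(1) intro!: exI[of _ f'])
qed

lemma Ck_const [simp]: "Ck k (\<lambda>x. c)"
  by (induction k arbitrary: c) (auto intro!: exI[of _ "\<lambda>x h. 0"])

lemma Ck_add: "Ck k f \<Longrightarrow> Ck k g \<Longrightarrow> Ck k (\<lambda>x. f x + g x)"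
proof (induction k arbitrary: f g)
  case 0
  then show ?case by (auto intro: continuous_intros)
next
  case (Suc k)
  from Suc.prems obtain f' g' where
    "\<And>x. (f has_derivative f' x) (at x)" "\<And>h. Ck k (\<lambda>x. f' x h)"
    "\<And>x. (g has_derivative g' x) (at x)" "\<And>h. Ck k (\<lambda>x. g' x h)"
    by auto
  then show ?case using Suc.IH
    by (auto intro!: exI[of _ "\<lambda>x h. f' x h + g' x h"] has_derivative_add)
qed

lemma Ck_mult:
  fixes f g :: "'a::euclidean_space \<Rightarrow> real"
  shows "Ck k f \<Longrightarrow> Ck k g \<Longrightarrow> Ck k (\<lambda>x. f x * g x)"
proof (induction k arbitrary: f g)
  case 0
  then show ?case by (auto intro: continuous_intros)
next
  case (Suc k)
  from Suc.prems obtain f' g' where f':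
    "\<And>x. (f has_derivative f' x) (at x)" "\<And>h. Ck k (\<lambda>x. f' x h)" and g':
    "\<And>x. (g has_derivative g' x) (at x)" "\<And>h. Ck k (\<lambda>x. g' x h)"
    by auto
  have fg: "Ck k f" "Ck k g" using Suc.prems Ck_Suc_imp_Ck by blast+
  show ?case unfolding Ck.simps(2)
    by (rule exI[of _ "\<lambda>x h. f x * g' x h + f' x h * g x"])
      (use f' g' fg Suc.IH in \<open>auto intro!: has_derivative_mult Ck_add\<close>)
qed

lemma Ck_prod:
  fixes f :: "'i \<Rightarrow> 'a::euclidean_space \<Rightarrow> real"
  shows "(\<And>i. i \<in> I \<Longrightarrow> Ck k (f i)) \<Longrightarrow> Ck k (\<lambda>x. \<Prod>i\<in>I. f i x)"
  by (induction I rule: infinite_finite_induct) (auto intro: Ck_mult)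

lemma Ck_scaleR: "Ck k f \<Longrightarrow> Ck k (\<lambda>x. c *\<^sub>R f x)"
proof (induction k arbitrary: f)
  case 0
  then show ?case by (auto intro: continuous_intros)
next
  case (Suc k)
  from Suc.prems obtain f' where f':
    "\<And>x. (f has_derivative f' x) (at x)" "\<And>h. Ck k (\<lambda>x. f' x h)"
    by auto
  then show ?case using Suc.IH
    by (auto intro!: exI[of _ "\<lambda>x h. c *\<^sub>R f' x h"] has_derivative_scaleR_right)
qed

lemma Ck_affine: "Ck k f \<Longrightarrow> Ck k (\<lambda>x. f (c *\<^sub>R x + d))"
proof (induction k arbitrary: f)
  case 0
  then show ?case by (auto intro!: continuous_on_compose2[of UNIV f] continuous_intros)
next
  case (Suc k)
  from Suc.prems obtain f' where f':
    "\<And>x. (f has_derivative f' x) (at x)" "\<And>h. Ck k (\<lambda>x. f' x h)"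
    by auto
  have "((\<lambda>x. f (c *\<^sub>R x + d)) has_derivative (\<lambda>h. f' (c *\<^sub>R x + d) (c *\<^sub>R h))) (at x)" for x
    by (rule has_derivative_compose[of "\<lambda>x. c *\<^sub>R x + d" "\<lambda>h. c *\<^sub>R h", OF _ f'(1)])
       (auto intro!: derivative_eq_intros)
  then show ?case using f'(2)[of "c *\<^sub>R h" for h] Suc.IH
    by (auto intro!: exI[of _ "\<lambda>x h. f' (c *\<^sub>R x + d) (c *\<^sub>R h)"])
qed

section \<open>A smooth function that is flat at the origin, and the bump built from it\<close>

lemma poly_times_exp_tendsto_0:
  "((\<lambda>y::real. y ^ k * poly p y * exp (- y)) \<longlongrightarrow> 0) at_top"
proof (induction p arbitrary: k)
  case 0
  then show ?case by simp
next
  case (pCons a p)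
  \<comment> \<open>Horner's rule: the factor \<open>y\<close> in \<open>pCons a p\<close> is
    absorbed into the power, which is why the induction is over all \<open>k\<close>.\<close>
  have "((\<lambda>y::real. a * (y ^ k / exp y) + y ^ Suc k * poly p y * exp (- y)) \<longlongrightarrow> a * 0 + 0) at_top"
    by (intro tendsto_add tendsto_mult_left tendsto_power_div_exp_0 pCons.IH)
  then show ?case
    by (simp add: algebra_simps exp_minus divide_inverse)
qed

text \<open>Indexing by a polynomial makes the class closed under differentiation: with y = 1/x the
  derivative of p(y) e^(-y) is y^2 (p - p')(y) e^(-y). Smoothness is then an induction on the order
  with \<open>p\<close> arbitrary. \<open>flat 1\<close> is the classical exp(-1/x), extended by
  0.\<close>

definition flat :: "real poly \<Rightarrow> real \<Rightarrow> real" where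
  "flat p x = (if x \<le> 0 then 0 else poly p (inverse x) * exp (- inverse x))"

definition flat_deriv :: "real poly \<Rightarrow> real poly" where
  "flat_deriv p = [:0, 0, 1:] * (p - pderiv p)"

lemma flat_has_derivative: "(flat p has_real_derivative flat (flat_deriv p) x) (at x)"
proof -
  consider "x < 0" | "x > 0" | "x = 0" by linarith
  then show ?thesis
  proof cases
    case 1
    have "((\<lambda>x. 0) has_real_derivative 0) (at x)" by simp
    then have "(flat p has_real_derivative 0) (at x)"
      by (rule has_field_derivative_transform_within_open[of _ _ _ "{..<0}"])
        (use 1 in \<open>auto simp: flat_def\<close>)
    with 1 show ?thesis by (simp add: flat_def)
  next
    case 2
    have d: "(inverse has_real_derivative - ((inverse x) ^ 2)) (at x)"
      using 2 DERIV_inverse[of x] by (simp add: power2_eq_square numeral_2_eq_2)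
    have "((\<lambda>x. poly p (inverse x) * exp (- inverse x)) has_real_derivative
        poly (pderiv p) (inverse x) * (- ((inverse x) ^ 2)) * exp (- inverse x)
        + exp (- inverse x) * (- (- ((inverse x) ^ 2))) * poly p (inverse x)) (at x)"
      by (rule DERIV_mult[OF DERIV_chain2[OF poly_DERIV d]
            DERIV_chain2[OF DERIV_exp DERIV_minus[OF d]]])
    also have "poly (pderiv p) (inverse x) * (- ((inverse x) ^ 2)) * exp (- inverse x)
        + exp (- inverse x) * (- (- ((inverse x) ^ 2))) * poly p (inverse x) = flat (flat_deriv p) x"
      using 2 by (simp add: flat_def flat_deriv_def algebra_simps power2_eq_square)
    finally have "((\<lambda>x. poly p (inverse x) * exp (- inverse x)) has_real_derivative
        flat (flat_deriv p) x) (at x)" .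
    then show ?thesis
      by (rule has_field_derivative_transform_within_open[of _ _ _ "{0<..}"])
        (use 2 in \<open>auto simp: flat_def\<close>)
  next
    case 3
    \<comment> \<open>In terms of y = 1/h the difference quotient at 0 is y p(y) e^(-y).\<close>
    have "((\<lambda>y::real. y ^ 1 * poly p y * exp (- y)) \<longlongrightarrow> 0) at_top"
      by (rule poly_times_exp_tendsto_0)
    then have "((\<lambda>x::real. inverse x ^ 1 * poly p (inverse x) * exp (- inverse x)) \<longlongrightarrow> 0) (at_right 0)"
      by (rule filterlim_compose[OF _ filterlim_inverse_at_top_right])
    then have right: "((\<lambda>h. flat p h / h) \<longlongrightarrow> 0) (at_right 0)"
      by (rule Lim_transform_eventually)
        (auto simp: eventually_at_right_less flat_def divide_inverse mult_ac
          intro: eventually_mono[OF eventually_at_right_less[of 0]])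
    have left: "((\<lambda>h. flat p h / h) \<longlongrightarrow> 0) (at_left 0)"
      by (rule Lim_transform_eventually[OF tendsto_const])
        (auto simp: flat_def intro: eventually_mono[OF eventually_at_left_real[of "-1" 0]])
    have "((\<lambda>h. flat p h / h) \<longlongrightarrow> 0) (at 0)"
      using left right by (simp add: filterlim_split_at_real)
    then show ?thesis
      using 3 by (simp add: DERIV_def flat_def[of _ 0])
  qed
qed

lemma Ck_flat: "Ck k (\<lambda>x::real^'n. flat p (c + d * x $ i))"
proof (induction k arbitrary: p)
  case 0
  have "continuous_on UNIV (flat p)"
    by (meson DERIV_isCont continuous_at_imp_continuous_on flat_has_derivative)
  then show ?case
    by (auto intro!: continuous_on_compose2[of UNIV "flat p"] continuous_intros)
next
  case (Suc k)
  have "((\<lambda>x::real^'n. flat p (c + d * x $ i)) has_derivative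
      (\<lambda>h. (d * h $ i) * flat (flat_deriv p) (c + d * x $ i))) (at x)" for x
  proof -
    have "((\<lambda>x::real^'n. c + d * x $ i) has_derivative (\<lambda>h. 0 + d * h $ i)) (at x)"
      by (intro has_derivative_add has_derivative_const has_derivative_mult_right
          bounded_linear_imp_has_derivative bounded_linear_vec_nth)
    from has_derivative_compose[OF this flat_has_derivative[unfolded has_field_derivative_def]]
    show ?thesis by (simp add: mult_ac)
  qed
  then show ?case using Suc.IH
    by (auto intro!: exI[of _ "\<lambda>x h. (d * h $ i) * flat (flat_deriv p) (c + d * x $ i)"] Ck_mult)
qed

lemma flat_1_nonneg: "flat 1 x \<ge> 0" and flat_1_pos: "x > 0 \<Longrightarrow> flat 1 x > 0"
  and flat_1_zero: "x \<le> 0 \<Longrightarrow> flat 1 x = 0"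
  by (auto simp: flat_def)

lemma Ck_continuous: "Ck k f \<Longrightarrow> continuous_on UNIV f"
  by (induction k) (use Ck.simps(1) Ck_Suc_imp_Ck in blast)+

lemma integrable_continuous_supported:
  fixes f :: "'a::euclidean_space \<Rightarrow> 'b::{banach, second_countable_topology}"
  assumes "continuous_on UNIV f" "compact S" "\<And>x. x \<notin> S \<Longrightarrow> f x = 0"
  shows "integrable lborel f"
proof -
  have "integrable lborel (\<lambda>x. indicator S x *\<^sub>R f x)"
    by (intro borel_integrable_compact assms(2) continuous_on_subset[OF assms(1)]) auto
  moreover have "(\<lambda>x. indicator S x *\<^sub>R f x) = f"
    using assms(3) by (auto simp: indicator_def)
  ultimately show ?thesis by simp
qed

lemma mollifier_exists:
  obtains \<rho> :: "real^'n \<Rightarrow> real" where "\<And>k. Ck k \<rho>" "\<And>x. \<rho> x \<ge> 0" "\<And>x. norm x \<ge> 1 \<Longrightarrow> \<rho> x = 0"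
    "integral\<^sup>L lborel \<rho> = 1"
proof -
  \<comment> \<open>The factors of \<open>\<rho>0\<close> confine every coordinate to |x_i| < 1/N;
    summing over the N coordinates bounds the Euclidean norm by 1.\<close>
  define N where "N = real CARD('n)"
  define \<rho>0 :: "real^'n \<Rightarrow> real" where
    "\<rho>0 x = (\<Prod>i\<in>UNIV. flat 1 (1 + N * x $ i) * flat 1 (1 + (- N) * x $ i))" for x
  have N: "N > 0" by (simp add: N_def)
  have smooth: "Ck k \<rho>0" for k
    unfolding \<rho>0_def by (intro Ck_prod Ck_mult Ck_flat)
  have nonneg: "\<rho>0 x \<ge> 0" for x
    unfolding \<rho>0_def by (intro prod_nonneg) (simp add: flat_1_nonneg)
  have supp: "\<rho>0 x = 0" if "norm x \<ge> 1" for x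
  proof (rule ccontr)
    assume "\<rho>0 x \<noteq> 0"
    then have nz: "flat 1 (1 + N * x $ i) \<noteq> 0" "flat 1 (1 + (- N) * x $ i) \<noteq> 0" for i
      by (auto simp: \<rho>0_def)
    have *: "\<bar>x $ i\<bar> < 1 / N" for i
    proof -
      have "1 + N * x $ i > 0" "1 + (- N) * x $ i > 0"
        using nz[of i] flat_1_zero by (meson not_le)+
      then show ?thesis using N by (auto simp: field_simps abs_less_iff)
    qed
    have "norm x \<le> (\<Sum>i\<in>UNIV. \<bar>x $ i\<bar>)" by (rule norm_le_l1_cart)
    also have "\<dots> < (\<Sum>i\<in>(UNIV::'n set). 1 / N)"
      by (intro sum_strict_mono *) auto
    also have "\<dots> = 1" using N by (simp add: N_def)
    finally show False using that by simp
  qed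
  have cont: "continuous_on UNIV \<rho>0" using smooth Ck_continuous by blast
  have int: "integrable lborel \<rho>0"
    by (rule integrable_continuous_supported[OF cont compact_cball[of 0 1]])
      (use supp in auto)
  \<comment> \<open>With integral 0 the nonnegative function \<open>\<rho>0\<close> would vanish
    almost everywhere; its zero set is closed, so it would contain the origin, where
    \<open>\<rho>0\<close> is positive.\<close>
  have "integral\<^sup>L lborel \<rho>0 \<noteq> 0"
  proof
    assume "integral\<^sup>L lborel \<rho>0 = 0"
    then have "AE x in lborel. \<rho>0 x = 0"
      using integral_nonneg_eq_0_iff_AE[OF int] nonneg by auto
    then have "AE x in lebesgue. x \<in> UNIV \<longrightarrow> x \<in> {x. \<rho>0 x = 0}"
      by (auto intro: AE_completion)
    moreover have "closed {x. \<rho>0 x = 0}"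
      using closed_Collect_eq[OF cont, of "\<lambda>x. 0"] by simp
    ultimately have "(0::real^'n) \<in> {x. \<rho>0 x = 0}"
      using mem_closed_if_AE_lebesgue_open[of UNIV "{x. \<rho>0 x = 0}" 0] by auto
    then show False by (auto simp: \<rho>0_def flat_def)
  qed
  moreover have "integral\<^sup>L lborel \<rho>0 \<ge> 0" using nonneg by (simp add: integral_nonneg_AE)
  ultimately have pos: "integral\<^sup>L lborel \<rho>0 > 0" by simp
  show thesis
  proof (rule that[of "\<lambda>x. (1 / integral\<^sup>L lborel \<rho>0) * \<rho>0 x"])
    show "Ck k (\<lambda>x. (1 / integral\<^sup>L lborel \<rho>0) * \<rho>0 x)" for k
      by (intro Ck_mult Ck_const smooth)
    show "(1 / integral\<^sup>L lborel \<rho>0) * \<rho>0 x \<ge> 0" for x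
      using nonneg[of x] pos by simp
    show "(1 / integral\<^sup>L lborel \<rho>0) * \<rho>0 x = 0" if "norm x \<ge> 1" for x
      using supp[OF that] by simp
    show "integral\<^sup>L lborel (\<lambda>x. (1 / integral\<^sup>L lborel \<rho>0) * \<rho>0 x) = 1"
      using pos by simp
  qed
qed

section \<open>Ball averages and Lebesgue points\<close>

lemma set_lebesgue_integral_lebesgue_eq_lborel:
  fixes f :: "'a::euclidean_space \<Rightarrow> 'b::{banach, second_countable_topology}"
  assumes "f \<in> borel_measurable borel" "A \<in> sets borel"
  shows "set_lebesgue_integral lebesgue A f = set_lebesgue_integral lborel A f"
proof -
  have "(\<lambda>x. indicator A x *\<^sub>R f x) \<in> borel_measurable borel" using assms by measurable
  then show ?thesis unfolding set_lebesgue_integral_def by (simp add: integral_completion)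
qed

lemma set_integrable_lebesgue_iff_lborel:
  fixes f :: "'a::euclidean_space \<Rightarrow> 'b::{banach, second_countable_topology}"
  assumes "f \<in> borel_measurable borel" "A \<in> sets borel"
  shows "set_integrable lebesgue A f \<longleftrightarrow> set_integrable lborel A f"
proof -
  have "(\<lambda>x. indicator A x *\<^sub>R f x) \<in> borel_measurable borel" using assms by measurable
  then show ?thesis unfolding set_integrable_def by (simp add: integrable_completion)
qed

text \<open>Outer regularity puts \<open>E\<close> into an open \<open>G\<close> with
  \<open>M\<close>-measure below \<open>c * e\<close>. The balls inside \<open>G\<close> on which
  \<open>M\<close> exceeds \<open>c\<close> times Lebesgue measure form a Vitali cover; a countable
  disjoint subfamily covers the set up to a null set, and its total Lebesgue measure is at most the
  \<open>M\<close>-measure of \<open>G\<close> divided by \<open>c\<close>.\<close>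

lemma negligible_positive_upper_density:
  fixes M :: "'a::euclidean_space measure"
  assumes M: "finite_measure M" "sets M = sets borel"
    and E: "E \<in> sets borel" "emeasure M E = 0" and c: "c > 0"
  shows "negligible {x \<in> E. \<forall>d>0. \<exists>r. 0 < r \<and> r < d \<and>
           measure M (ball x r) > c * measure lebesgue (ball x r)}" (is "negligible ?S")
  unfolding negligible_outer_le
proof (intro allI impI)
  fix e :: real assume e: "e > 0"
  interpret finite_measure M by fact
  have "emeasure M E < ennreal (c * e)" using E c e by simp
  then have "(INF U \<in> {U. E \<subseteq> U \<and> open U}. emeasure M U) < ennreal (c * e)"
    using outer_regular[OF M(2) _ E(1)] emeasure_finite by auto
  then obtain G where G: "E \<subseteq> G" "open G" "emeasure M G < ennreal (c * e)"
    by (auto simp: INF_less_iff)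
  define K where "K = {(x, r). x \<in> ?S \<and> 0 < r \<and> ball x r \<subseteq> G \<and>
      measure M (ball x r) > c * measure lebesgue (ball x r)}"
  have "\<exists>i. i \<in> K \<and> x \<in> ball (fst i) (snd i) \<and> snd i < d" if x: "x \<in> ?S" and d: "d > 0" for x d
  proof -
    obtain d' where d': "d' > 0" "ball x d' \<subseteq> G" using G x open_contains_ball by blast
    obtain r where "0 < r" "r < min d d'" "measure M (ball x r) > c * measure lebesgue (ball x r)"
    proof -
      have "min d d' > 0" using d d'(1) by simp
      then show thesis using x that by blast
    qed
    then show ?thesis
      using x d' by (intro exI[of _ "(x, r)"]) (auto simp: K_def)
  qed
  then obtain C where C: "countable C" "C \<subseteq> K"
    "pairwise (\<lambda>i j. disjnt (ball (fst i) (snd i)) (ball (fst j) (snd j))) C"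
    "negligible (?S - (\<Union>i\<in>C. ball (fst i) (snd i)))"
    by (rule Vitali_covering_theorem_balls[of ?S K fst snd])
  let ?B = "\<lambda>i. ball (fst i) (snd i)"
  have KD: "?B i \<subseteq> G" "c * measure lebesgue (?B i) < measure M (?B i)" if "i \<in> K" for i
    using that by (cases i; simp add: K_def)+
  have disj: "disjoint_family_on ?B C"
    using C(3) by (auto simp: disjoint_family_on_def pairwise_def disjnt_def)
  have "ennreal c * emeasure lborel (\<Union>i\<in>C. ?B i) = ennreal c * (\<integral>\<^sup>+i. emeasure lborel (?B i) \<partial>count_space C)"
    by (subst emeasure_UN_countable) (use C disj in auto)
  also have "\<dots> = (\<integral>\<^sup>+i. ennreal c * emeasure lborel (?B i) \<partial>count_space C)"
    by (rule nn_integral_cmult[symmetric]) simp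
  also have "\<dots> \<le> (\<integral>\<^sup>+i. emeasure M (?B i) \<partial>count_space C)"
  proof (rule nn_integral_mono)
    fix i assume "i \<in> space (count_space C)"
    then have "i \<in> K" using C(2) by auto
    then have "c * measure lebesgue (?B i) \<le> measure M (?B i)" using KD(2) by (simp add: less_imp_le)
    then show "ennreal c * emeasure lborel (?B i) \<le> emeasure M (?B i)"
      using c emeasure_lborel_ball_finite[of "fst i" "snd i"]
      by (simp add: emeasure_eq_measure emeasure_eq_ennreal_measure ennreal_mult'[symmetric] measure_completion)
  qed
  also have "\<dots> = emeasure M (\<Union>i\<in>C. ?B i)"
    by (subst emeasure_UN_countable) (use C disj M(2) in auto)
  also have "\<dots> \<le> emeasure M G"
  proof (rule emeasure_mono)
    show "(\<Union>i\<in>C. ?B i) \<subseteq> G" using C(2) KD by blast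
  qed (use G M(2) in auto)
  also have "\<dots> \<le> ennreal (c * e)" using G(3) by simp
  finally have "ennreal c * emeasure lborel (\<Union>i\<in>C. ?B i) \<le> ennreal c * ennreal e"
    using c e by (simp add: ennreal_mult)
  then have le: "emeasure lborel (\<Union>i\<in>C. ?B i) \<le> ennreal e"
    using c by (simp add: ennreal_mult_le_mult_iff)
  have op: "open (\<Union>i\<in>C. ?B i)" by auto
  then have lm: "(\<Union>i\<in>C. ?B i) \<in> lmeasurable"
    using le by (auto intro!: fmeasurableI simp: order_le_less_trans[OF le])
  show "\<exists>T. ?S \<subseteq> T \<and> T \<in> lmeasurable \<and> measure lebesgue T \<le> e"
  proof (intro exI[of _ "(?S - (\<Union>i\<in>C. ?B i)) \<union> (\<Union>i\<in>C. ?B i)"] conjI)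
    have n: "?S - (\<Union>i\<in>C. ?B i) \<in> lmeasurable" "measure lebesgue (?S - (\<Union>i\<in>C. ?B i)) = 0"
      using C(4) by (auto simp: negligible_iff_measure)
    then show "(?S - (\<Union>i\<in>C. ?B i)) \<union> (\<Union>i\<in>C. ?B i) \<in> lmeasurable"
      using lm by blast
    have "measure lebesgue (\<Union>i\<in>C. ?B i) \<le> e"
      using le op e by (simp add: measure_def enn2real_leI)
    then show "measure lebesgue ((?S - (\<Union>i\<in>C. ?B i)) \<union> (\<Union>i\<in>C. ?B i)) \<le> e"
      using measure_Un_le[of "?S - (\<Union>i\<in>C. ?B i)" lebesgue "(\<Union>i\<in>C. ?B i)"] n lm
      by (auto simp: fmeasurableD)
  qed auto
qed

lemma measure_ball_pos: "r > 0 \<Longrightarrow> measure lebesgue (ball (x::'a::euclidean_space) r) > 0"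
  by (simp add: content_ball_pos)

text \<open>Apply the density lemma, for each threshold \<open>1 / real (Suc k)\<close>, to the
  measure with density \<open>h\<close>, which does not charge the set where \<open>h\<close>
  vanishes.\<close>

lemma ball_average_tendsto_0_on_zero_set:
  fixes h :: "real^'n \<Rightarrow> real"
  assumes h: "integrable lborel h" "\<And>x. h x \<ge> 0"
  shows "AE x in lborel. h x = 0 \<longrightarrow> ((\<lambda>r. ball_average h x r) \<longlongrightarrow> 0) (at_right 0)"
proof -
  have hm [measurable]: "h \<in> borel_measurable borel" using h(1) by auto
  define M where "M = density lborel (\<lambda>x. ennreal (h x))"
  have sM: "sets M = sets borel" by (simp add: M_def)
  have fin: "finite_measure M"
  proof (rule finite_measureI)
    have "emeasure M (space M) = (\<integral>\<^sup>+x. ennreal (h x) \<partial>lborel)"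
      unfolding M_def by (subst emeasure_density) auto
    then show "emeasure M (space M) \<noteq> \<infinity>"
      using integrableD(2)[OF h(1)] h(2) by simp
  qed
  define E where "E = {x. h x = 0}"
  have E: "E \<in> sets borel" unfolding E_def by measurable
  have "emeasure M E = (\<integral>\<^sup>+x. ennreal (h x) * indicator E x \<partial>lborel)"
    unfolding M_def by (rule emeasure_density) (use E in auto)
  also have "\<dots> = (\<integral>\<^sup>+(x::real^'n). 0 \<partial>lborel)"
    by (rule nn_integral_cong) (auto simp: E_def indicator_def)
  finally have E0: "emeasure M E = 0" by simp
  define S where "S k = {x \<in> E. \<forall>d>0. \<exists>r. 0 < r \<and> r < d \<and>
           measure M (ball x r) > (1 / real (Suc k)) * measure lebesgue (ball x r)}" for k
  have "negligible (S k)" for k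
    unfolding S_def by (rule negligible_positive_upper_density[OF fin sM E E0]) simp
  then have "negligible (\<Union>k. S k)" by (intro negligible_countable_Union) auto
  then have "AE x in lebesgue. x \<notin> (\<Union>k. S k)"
    unfolding negligible_iff_null_sets by (rule AE_not_in)
  moreover have "h x = 0 \<longrightarrow> ((\<lambda>r. ball_average h x r) \<longlongrightarrow> 0) (at_right 0)" if x: "x \<notin> (\<Union>k. S k)" for x
  proof (intro impI tendstoI)
    fix e :: real assume "h x = 0" "e > 0"
    then obtain k where k: "1 / real (Suc k) < e" using nat_approx_posE by blast
    have "x \<notin> S k" "x \<in> E" using x \<open>h x = 0\<close> by (auto simp: E_def)
    then obtain d where d: "d > 0" "\<And>r. 0 < r \<Longrightarrow> r < d \<Longrightarrow>
        measure M (ball x r) \<le> (1 / real (Suc k)) * measure lebesgue (ball x r)"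
      unfolding S_def using not_less by fastforce
    have avg: "ball_average h x r = measure M (ball x r) / measure lebesgue (ball x r)" for r
    proof -
      have "set_lebesgue_integral lebesgue (ball x r) h = (LINT y|lborel. indicator (ball x r) y *\<^sub>R h y)"
        by (subst set_lebesgue_integral_lebesgue_eq_lborel) (auto simp: set_lebesgue_integral_def)
      also have "\<dots> = enn2real (\<integral>\<^sup>+y. ennreal (indicator (ball x r) y *\<^sub>R h y) \<partial>lborel)"
        by (rule integral_eq_nn_integral) (measurable, use h in auto)
      also have "(\<integral>\<^sup>+y. ennreal (indicator (ball x r) y *\<^sub>R h y) \<partial>lborel)
           = (\<integral>\<^sup>+y. ennreal (h y) * indicator (ball x r) y \<partial>lborel)"
        by (rule nn_integral_cong) (auto simp: indicator_def)
      also have "\<dots> = emeasure M (ball x r)"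
        unfolding M_def by (rule emeasure_density[symmetric]) auto
      finally show ?thesis by (simp add: ball_average_def measure_def)
    qed
    have "\<bar>ball_average h x r\<bar> < e" if r: "0 < r" "r < d" for r
    proof -
      have "\<bar>ball_average h x r\<bar> \<le> 1 / real (Suc k)"
        using d(2)[OF r] measure_ball_pos[OF r(1), of x]
        by (auto simp: avg divide_le_eq)
      then show ?thesis using k by linarith
    qed
    then show "eventually (\<lambda>r. dist (ball_average h x r) 0 < e) (at_right 0)"
      using d(1) by (auto simp: eventually_at_right_field intro!: exI[of _ d])
  qed
  ultimately have "AE x in lebesgue. h x = 0 \<longrightarrow> ((\<lambda>r. ball_average h x r) \<longlongrightarrow> 0) (at_right 0)"
    by (rule eventually_mono)
  then show ?thesis by (simp add: AE_completion_iff)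
qed

section \<open>Calculus of ball averages\<close>

lemma ball_average_nonneg: "(\<And>y. f y \<ge> 0) \<Longrightarrow> ball_average f x r \<ge> 0"
  unfolding ball_average_def set_lebesgue_integral_def
  by (intro divide_nonneg_nonneg integral_nonneg_AE) auto

text \<open>Correct also when \<open>f\<close> is not integrable: its Bochner integral is then 0,
  and \<open>g\<close> is nonnegative almost everywhere on the ball.\<close>

lemma ball_average_mono:
  assumes "set_integrable lebesgue (ball x r) g"
    "AE y in lebesgue. y \<in> ball x r \<longrightarrow> 0 \<le> f y \<and> f y \<le> g y"
  shows "ball_average f x r \<le> ball_average g x r"
  unfolding ball_average_def
proof (rule divide_right_mono)
  show "set_lebesgue_integral lebesgue (ball x r) f \<le> set_lebesgue_integral lebesgue (ball x r) g"
    unfolding set_lebesgue_integral_def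
    by (rule integral_mono_AE') (use assms in \<open>auto simp: set_integrable_def indicator_def elim!: eventually_mono\<close>)
qed simp

lemma ball_average_add:
  assumes "set_integrable lebesgue (ball x r) f" "set_integrable lebesgue (ball x r) g"
  shows "ball_average (\<lambda>y. f y + g y) x r = ball_average f x r + ball_average g x r"
  using assms by (simp add: ball_average_def add_divide_distrib)

lemma ball_average_cmult: "ball_average (\<lambda>y. c * f y) x r = c * ball_average f x r"
  by (simp add: ball_average_def)

lemma set_integrable_ball_const: "set_integrable lebesgue (ball x r) (\<lambda>y. c :: 'b::{banach, second_countable_topology})"
  unfolding set_integrable_def
  by (rule integrable_scaleR_left, rule integrable_real_indicator)
    (use lmeasurable_ball[of x r] in \<open>auto simp: fmeasurable_def\<close>)

lemma ball_average_const: "r > 0 \<Longrightarrow> ball_average (\<lambda>y. c) x r = c"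
  using measure_ball_pos[of r x] by (simp add: ball_average_def set_lebesgue_integral_def)

lemma ball_average_sum:
  assumes "\<And>i. i \<in> I \<Longrightarrow> set_integrable lebesgue (ball x r) (f i)"
  shows "ball_average (\<lambda>y. \<Sum>i\<in>I. f i y) x r = (\<Sum>i\<in>I. ball_average (f i) x r)"
proof -
  have "set_lebesgue_integral lebesgue (ball x r) (\<lambda>y. \<Sum>i\<in>I. f i y)
      = (\<Sum>i\<in>I. set_lebesgue_integral lebesgue (ball x r) (f i))"
    unfolding set_lebesgue_integral_def scaleR_sum_right
    by (rule Bochner_Integration.integral_sum) (use assms in \<open>simp only: set_integrable_def\<close>)
  then show ?thesis by (simp add: ball_average_def sum_divide_distrib)
qed

lemma ball_average_cong_AE:
  assumes "AE y in lebesgue. y \<in> ball x r \<longrightarrow> f y = g y"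
    "set_borel_measurable lebesgue (ball x r) f"
  shows "ball_average f x r = ball_average g x r"
proof -
  have "set_lebesgue_integral lebesgue (ball x r) f = set_lebesgue_integral lebesgue (ball x r) g"
    unfolding set_lebesgue_integral_def
  proof (rule integral_cong_AE)
    show ae: "AE y in lebesgue. indicator (ball x r) y *\<^sub>R f y = indicator (ball x r) y *\<^sub>R g y"
      using assms(1) by eventually_elim (auto simp: indicator_def)
    show f: "(\<lambda>y. indicator (ball x r) y *\<^sub>R f y) \<in> borel_measurable lebesgue"
      using assms(2) by (simp add: set_borel_measurable_def)
    show "(\<lambda>y. indicator (ball x r) y *\<^sub>R g y) \<in> borel_measurable lebesgue"
      by (rule borel_measurable_AE[OF f ae])
  qed
  then show ?thesis by (simp add: ball_average_def)
qed

definition lebesgue_point :: "(real^'n \<Rightarrow> real) \<Rightarrow> real^'n \<Rightarrow> bool" where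
  "lebesgue_point f x \<longleftrightarrow> ((\<lambda>r. ball_average (\<lambda>y. \<bar>f y - f x\<bar>) x r) \<longlongrightarrow> 0) (at_right 0)"

text \<open>For rationals q' < f x < q close to \<open>f x\<close> the positive parts of f - q and
  of q' - f vanish at \<open>x\<close>, so their averages tend to 0 at almost every
  \<open>x\<close>, simultaneously for all rationals. Up to e/3 their sum bounds the oscillation of
  \<open>f\<close> around \<open>f x\<close>.\<close>

lemma AE_lebesgue_point:
  fixes f :: "real^'n \<Rightarrow> real"
  assumes f: "integrable lborel f"
  shows "AE x in lborel. lebesgue_point f x"
proof -
  have fm [measurable]: "f \<in> borel_measurable borel" using f by auto
  \<comment> \<open>The sign \<open>s\<close>, which will be 1 or -1, selects the part of
    \<open>f\<close> above or below \<open>q\<close>; the cutoff to a ball restores the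
    integrability that the constant \<open>q\<close> destroys.\<close>
  define h where "h s q R y = max 0 (s * (f y - q)) * indicator (ball 0 (real R)) y" for s q :: real and R :: nat and y
  have hint: "integrable lborel (h s q R)" for s q R
  proof (rule Bochner_Integration.integrable_bound)
    have i1: "integrable lborel (\<lambda>y. \<bar>q\<bar> * indicator (ball 0 (real R)) y)"
      by (intro integrable_mult_right integrable_real_indicator emeasure_lborel_ball_finite) auto
    show "integrable lborel (\<lambda>y. \<bar>s\<bar> * (\<bar>f y\<bar> + \<bar>q\<bar> * indicator (ball 0 (real R)) y))"
      using Bochner_Integration.integrable_add[OF integrable_abs[OF f] i1] by (rule integrable_mult_right)
    show "h s q R \<in> borel_measurable lborel" unfolding h_def
      by (intro borel_measurable_times borel_measurable_max borel_measurable_indicator borel_measurable_const borel_measurable_diff) (use fm in auto)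
    have "\<bar>max 0 (s * (f y - q))\<bar> \<le> \<bar>s\<bar> * (\<bar>f y\<bar> + \<bar>q\<bar>)" for y
    proof -
      have "\<bar>max 0 (s * (f y - q))\<bar> \<le> \<bar>s * (f y - q)\<bar>" by linarith
      also have "\<dots> \<le> \<bar>s\<bar> * (\<bar>f y\<bar> + \<bar>q\<bar>)"
        unfolding abs_mult by (intro mult_left_mono) linarith+
      finally show ?thesis .
    qed
    then show "AE y in lborel. norm (h s q R y) \<le> norm (\<bar>s\<bar> * (\<bar>f y\<bar> + \<bar>q\<bar> * indicator (ball 0 (real R)) y))"
      by (intro AE_I2) (auto simp: h_def indicator_def abs_mult)
  qed
  have "AE x in lborel. h s q R x = 0 \<longrightarrow> ((\<lambda>r. ball_average (h s q R) x r) \<longlongrightarrow> 0) (at_right 0)" for s q R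
    by (rule ball_average_tendsto_0_on_zero_set[OF hint]) (auto simp: h_def)
  then have "AE x in lborel. \<forall>R. \<forall>q\<in>\<rat>. \<forall>s\<in>{-1,1}. h s q R x = 0 \<longrightarrow>
      ((\<lambda>r. ball_average (h s q R) x r) \<longlongrightarrow> 0) (at_right 0)"
    by (simp add: AE_all_countable AE_ball_countable countable_rat)
  then show ?thesis
  proof eventually_elim
    case (elim x)
    obtain R :: nat where R: "norm x < real R" using reals_Archimedean2 by blast
    show ?case unfolding lebesgue_point_def
    proof (rule tendstoI)
      fix e :: real assume e: "e > 0"
      obtain q where q: "q \<in> \<rat>" "f x < q" "q < f x + e / 3" using Rats_dense_in_real[of "f x" "f x + e / 3"] e by auto
      obtain q' where q': "q' \<in> \<rat>" "f x - e / 3 < q'" "q' < f x" using Rats_dense_in_real[of "f x - e / 3" "f x"] e by auto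
      have "((\<lambda>r. ball_average (h 1 q R) x r) \<longlongrightarrow> 0) (at_right 0)"
        using elim q by (auto simp: h_def)
      moreover have "((\<lambda>r. ball_average (h (-1) q' R) x r) \<longlongrightarrow> 0) (at_right 0)"
        using elim q' by (auto simp: h_def)
      ultimately have "eventually (\<lambda>r. dist (ball_average (h 1 q R) x r) 0 < e / 3 \<and>
            dist (ball_average (h (-1) q' R) x r) 0 < e / 3) (at_right 0)"
        using e by (intro eventually_conj tendstoD) auto
      moreover have "eventually (\<lambda>r. r > 0 \<and> r < real R - norm x) (at_right 0)"
        using R by (auto simp: eventually_at_right_field intro!: exI[of _ "real R - norm x"])
      ultimately show "eventually (\<lambda>r. dist (ball_average (\<lambda>y. \<bar>f y - f x\<bar>) x r) 0 < e) (at_right 0)"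
      proof eventually_elim
        case (elim r)
        have sub: "ball x r \<subseteq> ball 0 (real R)"
        proof
          fix y assume "y \<in> ball x r"
          then have "norm (x - y) < r" by (simp add: dist_norm)
          moreover have "norm y \<le> norm x + norm (x - y)"
            by (metis add_diff_cancel_left' diff_add_cancel norm_minus_commute norm_triangle_ineq uminus_add_conv_diff)
          ultimately have "norm y < real R" using elim by linarith
          then show "y \<in> ball 0 (real R)" by simp
        qed
        have hset: "set_integrable lebesgue (ball x r) (h s q R)" for s q
        proof -
          have "set_integrable lborel (ball x r) (h s q R)"
            unfolding set_integrable_def by (rule integrable_mult_indicator[OF _ hint]) auto
          moreover have "h s q R \<in> borel_measurable borel" using hint by auto
          ultimately show ?thesis by (subst set_integrable_lebesgue_iff_lborel) auto
        qed
        have "ball_average (\<lambda>y. \<bar>f y - f x\<bar>) x r \<le> ball_average (\<lambda>y. (h 1 q R y + h (-1) q' R y) + e / 3) x r"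
        proof (rule ball_average_mono)
          show "set_integrable lebesgue (ball x r) (\<lambda>y. (h 1 q R y + h (-1) q' R y) + e / 3)"
            by (intro set_integral_add hset set_integrable_ball_const)
          have "\<bar>f y - f x\<bar> \<le> (h 1 q R y + h (-1) q' R y) + e / 3" if "y \<in> ball x r" for y
            using sub that q q' by (auto simp: h_def)
          then show "AE y in lebesgue. y \<in> ball x r \<longrightarrow> 0 \<le> \<bar>f y - f x\<bar> \<and> \<bar>f y - f x\<bar> \<le> (h 1 q R y + h (-1) q' R y) + e / 3"
            by (intro AE_I2) auto
        qed
        also have "\<dots> = ball_average (h 1 q R) x r + ball_average (h (-1) q' R) x r + e / 3"
          using elim by (subst ball_average_add ball_average_const | intro set_integral_add hset set_integrable_ball_const | simp)+
        also have "\<dots> < e"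
        proof -
          have "ball_average (h 1 q R) x r < e / 3" "ball_average (h (-1) q' R) x r < e / 3"
            using elim(1) unfolding dist_real_def by linarith+
          then show ?thesis by linarith
        qed
        finally show ?case
          using ball_average_nonneg[of "\<lambda>y. \<bar>f y - f x\<bar>" x r] by (simp add: dist_real_def)
      qed
    qed
  qed
qed

section \<open>Positive functionals on bounded Borel functions\<close>

definition bounded_borel :: "('a::euclidean_space \<Rightarrow> real) set" where
  "bounded_borel = {h. h \<in> borel_measurable borel \<and> bounded (range h)}"

lemma bounded_borelI: "h \<in> borel_measurable borel \<Longrightarrow> (\<And>x. \<bar>h x\<bar> \<le> C) \<Longrightarrow> h \<in> bounded_borel"
  by (auto simp: bounded_borel_def intro!: boundedI)

lemma bounded_borelE:
  assumes "h \<in> bounded_borel"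
  obtains C where "C > 0" "\<And>x. \<bar>h x\<bar> \<le> C" "h \<in> borel_measurable borel"
  using assms by (auto simp: bounded_borel_def bounded_pos)

lemma bounded_borel_indicator [simp]: "B \<in> sets borel \<Longrightarrow> indicator B \<in> bounded_borel"
  by (intro bounded_borelI[of _ 1]) (auto simp: indicator_def)

lemma bounded_borel_const [simp]: "(\<lambda>x. c) \<in> bounded_borel"
  by (intro bounded_borelI[of _ "\<bar>c\<bar>"]) auto

lemma bounded_borel_add: 
  assumes "f \<in> bounded_borel" "g \<in> bounded_borel" shows "(\<lambda>x. f x + g x) \<in> bounded_borel"
proof -
  obtain C D where "\<And>x. \<bar>f x\<bar> \<le> C" "f \<in> borel_measurable borel" "\<And>x. \<bar>g x\<bar> \<le> D" "g \<in> borel_measurable borel"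
    using assms by (meson bounded_borelE)
  then show ?thesis
    by (intro bounded_borelI[of _ "C + D"]) (auto intro: order_trans[OF abs_triangle_ineq] add_mono)
qed

lemma bounded_borel_mult: 
  assumes "f \<in> bounded_borel" "g \<in> bounded_borel" shows "(\<lambda>x. f x * g x) \<in> bounded_borel"
proof -
  obtain C D where "\<And>x. \<bar>f x\<bar> \<le> C" "f \<in> borel_measurable borel" "\<And>x. \<bar>g x\<bar> \<le> D" "g \<in> borel_measurable borel"
    using assms by (meson bounded_borelE)
  then show ?thesis
    by (intro bounded_borelI[of _ "C * D"]) (auto simp: abs_mult intro: mult_mono order_trans[OF abs_ge_zero])
qed

lemma bounded_borel_cmult: "f \<in> bounded_borel \<Longrightarrow> (\<lambda>x. c * f x) \<in> bounded_borel"
  by (intro bounded_borel_mult) auto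

lemma bounded_borel_diff: 
  "f \<in> bounded_borel \<Longrightarrow> g \<in> bounded_borel \<Longrightarrow> (\<lambda>x. f x - g x) \<in> bounded_borel"
  using bounded_borel_add[of f "\<lambda>x. (-1) * g x"] bounded_borel_cmult[of g "-1"] by simp

lemma bounded_borel_abs: 
  assumes "f \<in> bounded_borel" shows "(\<lambda>x. \<bar>f x\<bar>) \<in> bounded_borel"
  using assms by (elim bounded_borelE) (auto intro!: bounded_borelI)

text \<open>Finite measures are handled as positive linear functionals on all bounded Borel
  functions. Linearity and positivity pass to pointwise limits at once, so only countable additivity
  has to be recovered when a limit is turned back into a measure.\<close>

definition pos_functional :: "(('a::euclidean_space \<Rightarrow> real) \<Rightarrow> real) \<Rightarrow> bool" where
  "pos_functional m \<longleftrightarrow>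
     (\<forall>f\<in>bounded_borel. \<forall>g\<in>bounded_borel. m (\<lambda>x. f x + g x) = m f + m g) \<and>
     (\<forall>c. \<forall>f\<in>bounded_borel. m (\<lambda>x. c * f x) = c * m f) \<and>
     (\<forall>f\<in>bounded_borel. (\<forall>x. f x \<ge> 0) \<longrightarrow> m f \<ge> 0)"

text \<open>For a finite, finitely additive set function, continuity from above at the empty set is
  equivalent to countable additivity.\<close>

definition empty_continuous :: "(('a::euclidean_space \<Rightarrow> real) \<Rightarrow> real) \<Rightarrow> bool" where
  "empty_continuous m \<longleftrightarrow>
     (\<forall>A. range A \<subseteq> sets borel \<and> decseq A \<and> (\<Inter>i. A i) = {} \<longrightarrow> (\<lambda>i::nat. m (indicator (A i))) \<longlonglongrightarrow> 0)"

context
  fixes m :: "('a::euclidean_space \<Rightarrow> real) \<Rightarrow> real"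
  assumes m: "pos_functional m"
begin

lemma pos_functional_add: "f \<in> bounded_borel \<Longrightarrow> g \<in> bounded_borel \<Longrightarrow> m (\<lambda>x. f x + g x) = m f + m g"
  using m by (auto simp: pos_functional_def)

lemma pos_functional_cmult: "f \<in> bounded_borel \<Longrightarrow> m (\<lambda>x. c * f x) = c * m f"
  using m by (auto simp: pos_functional_def)

lemma pos_functional_nonneg: "f \<in> bounded_borel \<Longrightarrow> (\<And>x. f x \<ge> 0) \<Longrightarrow> m f \<ge> 0"
  using m by (auto simp: pos_functional_def)

lemma pos_functional_diff: 
  assumes "f \<in> bounded_borel" "g \<in> bounded_borel" shows "m (\<lambda>x. f x - g x) = m f - m g"
  using pos_functional_add[of f "\<lambda>x. (-1) * g x"] pos_functional_cmult[of g "-1"] bounded_borel_cmult[of g "-1"] assms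
  by simp

lemma pos_functional_mono: 
  assumes "f \<in> bounded_borel" "g \<in> bounded_borel" "\<And>x. f x \<le> g x" shows "m f \<le> m g"
  using pos_functional_nonneg[OF bounded_borel_diff[OF assms(2,1)]] assms pos_functional_diff[OF assms(2,1)]
  by auto

lemma pos_functional_zero: "m (\<lambda>x. 0) = 0"
  using pos_functional_cmult[of "\<lambda>x. 0" 0] by simp

lemma pos_functional_abs: 
  assumes "f \<in> bounded_borel" shows "\<bar>m f\<bar> \<le> m (\<lambda>x. \<bar>f x\<bar>)"
proof -
  have "m f \<le> m (\<lambda>x. \<bar>f x\<bar>)"
    by (rule pos_functional_mono[OF assms bounded_borel_abs[OF assms]]) auto
  moreover have "m (\<lambda>x. (-1) * f x) \<le> m (\<lambda>x. \<bar>f x\<bar>)"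
    by (rule pos_functional_mono[OF bounded_borel_cmult[OF assms] bounded_borel_abs[OF assms]]) auto
  ultimately show ?thesis using pos_functional_cmult[OF assms, of "-1"] by (auto simp: abs_le_iff)
qed

end

lemma integral_pos_functional:
  assumes "finite_measure M" "sets M = sets borel"
  shows "pos_functional (\<lambda>h. integral\<^sup>L M h)" "empty_continuous (\<lambda>h. integral\<^sup>L M h)"
proof -
  interpret finite_measure M by fact
  have int: "integrable M h" if h: "h \<in> bounded_borel" for h
  proof -
    obtain C where C: "\<And>x. \<bar>h x\<bar> \<le> C" and hm: "h \<in> borel_measurable borel" using bounded_borelE[OF h] by blast
    have "h \<in> borel_measurable M" using hm measurable_cong_sets[OF assms(2) refl] by auto
    then show ?thesis by (rule integrable_const_bound[of _ C, rotated]) (use C in auto)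
  qed
  show "pos_functional (\<lambda>h. integral\<^sup>L M h)"
    unfolding pos_functional_def by (auto simp: int intro!: integral_nonneg_AE)
  show "empty_continuous (\<lambda>h. integral\<^sup>L M h)"
    unfolding empty_continuous_def
  proof (intro allI impI)
    fix A :: "nat \<Rightarrow> 'a set"
    assume A: "range A \<subseteq> sets borel \<and> decseq A \<and> (\<Inter>i. A i) = {}"
    have sp: "space M = UNIV" using sets_eq_imp_space_eq[OF assms(2)] by simp
    have "(\<lambda>i. measure M (A i)) \<longlonglongrightarrow> measure M (\<Inter>i. A i)"
      using A by (intro finite_Lim_measure_decseq) (auto simp: assms(2))
    moreover have indI: "integral\<^sup>L M (indicator (A i)) = measure M (A i)" for i
      by (simp add: sp)
    ultimately show "(\<lambda>i. integral\<^sup>L M (indicator (A i))) \<longlonglongrightarrow> (0 :: real)"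
      using A by (simp add: sp indI)
  qed
qed

text \<open>The measure of \<open>B\<close> is \<open>m (indicator B)\<close>. Its integral agrees
  with \<open>m\<close> on step functions, and positivity makes both sides continuous under uniform
  convergence, with constants \<open>measure M UNIV\<close> and
  \<open>m (\<lambda>x. 1)\<close>.\<close>

lemma measure_of_pos_functional:
  fixes m :: "('a::euclidean_space \<Rightarrow> real) \<Rightarrow> real"
  assumes m: "pos_functional m" and cont: "empty_continuous m"
  obtains M where "finite_measure M" "sets M = sets borel"
    "\<And>B. B \<in> sets borel \<Longrightarrow> measure M B = m (indicator B)"
    "\<And>h. h \<in> bounded_borel \<Longrightarrow> integral\<^sup>L M h = m h"
proof -
  have nn: "m (indicator B) \<ge> 0" if "B \<in> sets borel" for B
    by (rule pos_functional_nonneg[OF m]) (use that in auto)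
  define f where "f B = ennreal (m (indicator B))" for B
  have "countably_additive (sets borel) f"
  proof (rule sets.empty_continuous_imp_countably_additive)
    show "positive (sets borel) f"
      using pos_functional_zero[OF m] by (simp add: positive_def f_def indicator_def[abs_def])
    show "additive (sets borel) f"
    proof (clarsimp simp: additive_def f_def)
      fix A B :: "'a set" assume AB: "A \<in> sets borel" "B \<in> sets borel" "A \<inter> B = {}"
      have "indicator (A \<union> B) = (\<lambda>x. indicator A x + indicator B x :: real)"
        using AB by (auto simp: indicator_def fun_eq_iff)
      then have "m (indicator (A \<union> B)) = m (indicator A) + m (indicator B)"
        using AB pos_functional_add[OF m, of "indicator A" "indicator B"] by simp
      then show "ennreal (m (indicator (A \<union> B))) = ennreal (m (indicator A)) + ennreal (m (indicator B))"
        using AB nn by (simp add: ennreal_plus)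
    qed
    show "\<forall>A\<in>sets borel. f A \<noteq> \<infinity>" by (simp add: f_def)
    fix A :: "nat \<Rightarrow> 'a set" assume "range A \<subseteq> sets borel" "decseq A" "(\<Inter>i. A i) = {}"
    then have "(\<lambda>i. m (indicator (A i))) \<longlonglongrightarrow> 0"
      using cont by (auto simp: empty_continuous_def)
    then show "(\<lambda>i. f (A i)) \<longlonglongrightarrow> 0"
      unfolding f_def using tendsto_ennrealI by fastforce
  qed
  define M where "M = measure_of UNIV (sets borel) f"
  have sets: "sets M = sets borel"
    unfolding M_def using sets.sigma_sets_eq[of "borel :: 'a measure"] by (simp add: sets_measure_of)
  have sp: "space M = UNIV" using sets_eq_imp_space_eq[OF sets] by simp
  have em: "emeasure M B = f B" if "B \<in> sets borel" for B
    unfolding M_def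
  proof (rule emeasure_measure_of_sigma)
    show "sigma_algebra UNIV (sets (borel :: 'a measure))"
      using sets.sigma_algebra_axioms[of "borel :: 'a measure"] by simp
    show "positive (sets borel) f"
      using pos_functional_zero[OF m] by (simp add: positive_def f_def indicator_def[abs_def])
  qed (use that \<open>countably_additive (sets borel) f\<close> in auto)
  have fin: "finite_measure M"
    by (rule finite_measureI) (use em[of UNIV] sp in \<open>auto simp: f_def\<close>)
  have meas: "measure M B = m (indicator B)" if "B \<in> sets borel" for B
    using em[OF that] nn[OF that] by (simp add: measure_def f_def)
  interpret finite_measure M by fact
  note I = integral_pos_functional(1)[OF fin sets]
  have nonneg: "integral\<^sup>L M h = m h" if h: "h \<in> bounded_borel" "\<And>x. h x \<ge> 0" for h
  proof -
    obtain C where C: "C > 0" "\<And>x. \<bar>h x\<bar> \<le> C" and hm: "h \<in> borel_measurable borel" using bounded_borelE[OF h(1)] by blast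
    have approx: "\<bar>integral\<^sup>L M h - m h\<bar> \<le> e * (measure M UNIV + m (\<lambda>x. 1))" if e: "e > 0" for e
    proof -
      \<comment> \<open>\<open>s x\<close> is \<open>e\<close> times the number of k \<ge> 1 with
        \<open>real k * e \<le> h x\<close>, that is, \<open>h x\<close> rounded down to a multiple
        of \<open>e\<close>; the bound \<open>C\<close> makes finitely many levels enough.\<close>
      define s where "s x = (\<Sum>k\<in>{1..nat \<lceil>C / e\<rceil>}. e * indicator {x. h x \<ge> real k * e} x)" for x
      have setb: "{x. h x \<ge> real k * e} \<in> sets borel" for k
        using hm by measurable
      have fin_sum: "(\<lambda>x. \<Sum>k\<in>K. e * indicator {x. h x \<ge> real k * e} x) \<in> bounded_borel \<and>
          integral\<^sup>L M (\<lambda>x. \<Sum>k\<in>K. e * indicator {x. h x \<ge> real k * e} x)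
          = m (\<lambda>x. \<Sum>k\<in>K. e * indicator {x. h x \<ge> real k * e} x)" if "finite K" for K :: "nat set"
        using that
      proof (induction K)
        case empty
        then show ?case using pos_functional_zero[OF m] by simp
      next
        case (insert k K)
        have ind: "indicator {x. h x \<ge> real k * e} \<in> (bounded_borel :: ('a \<Rightarrow> real) set)"
          using setb by simp
        have ind': "(\<lambda>x. e * indicator {x. h x \<ge> real k * e} x) \<in> (bounded_borel :: ('a \<Rightarrow> real) set)"
          by (rule bounded_borel_cmult[OF ind])
        have "integral\<^sup>L M (\<lambda>x. e * indicator {x. h x \<ge> real k * e} x) = e * measure M {x. h x \<ge> real k * e}"
          by (simp add: sp)
        also have "\<dots> = m (\<lambda>x. e * indicator {x. h x \<ge> real k * e} x)"
          using meas[OF setb] pos_functional_cmult[OF m ind] by simp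
        finally have "integral\<^sup>L M (\<lambda>x. e * indicator {x. h x \<ge> real k * e} x) = m (\<lambda>x. e * indicator {x. h x \<ge> real k * e} x)" .
        note IH1 = insert.IH[THEN conjunct1] and IH2 = insert.IH[THEN conjunct2]
        from \<open>integral\<^sup>L M (\<lambda>x. e * indicator {x. h x \<ge> real k * e} x) = m (\<lambda>x. e * indicator {x. h x \<ge> real k * e} x)\<close>
        show ?case unfolding sum.insert[OF insert.hyps]
          using bounded_borel_add[OF ind' IH1] 
          by (intro conjI) (simp_all only: pos_functional_add[OF m ind' IH1] pos_functional_add[OF I ind' IH1] IH2)
      qed
      have s: "s \<in> bounded_borel" "integral\<^sup>L M s = m s"
        using fin_sum[of "{1..nat \<lceil>C / e\<rceil>}"] by (auto simp: s_def[abs_def])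
      have hs: "\<bar>h x - s x\<bar> \<le> e" for x
      proof -
        define q where "q = nat \<lfloor>h x / e\<rfloor>"
        have hx: "h x / e \<ge> 0" using h e by simp
        have q: "real q \<le> h x / e" "h x / e < real q + 1"
          using hx unfolding q_def by linarith+
        have "h x / e \<le> C / e" using C(2)[of x] e by (simp add: divide_right_mono)
        then have qC: "q \<le> nat \<lceil>C / e\<rceil>" using q by linarith
        have "{k \<in> {1..nat \<lceil>C / e\<rceil>}. h x \<ge> real k * e} = {1..q}"
        proof -
          have iff: "h x \<ge> real k * e \<longleftrightarrow> k \<le> q" for k
          proof -
            have "h x \<ge> real k * e \<longleftrightarrow> real k \<le> h x / e" using e by (simp add: field_simps)
            then show ?thesis using q by linarith
          qed
          show ?thesis using qC by (simp only: iff) auto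
        qed
        moreover have "s x = e * real (card {k \<in> {1..nat \<lceil>C / e\<rceil>}. h x \<ge> real k * e})"
        proof -
          have "s x = (\<Sum>k\<in>{k \<in> {1..nat \<lceil>C / e\<rceil>}. h x \<ge> real k * e}. e)"
            unfolding s_def by (rule sum.mono_neutral_cong_right) (auto simp: indicator_def)
          then show ?thesis by (simp add: mult.commute)
        qed
        ultimately have "s x = e * real q" by simp
        then show ?thesis using q e by (auto simp: field_simps abs_le_iff)
      qed
      have "\<bar>integral\<^sup>L M h - integral\<^sup>L M s\<bar> \<le> e * measure M UNIV"
      proof -
        have "\<bar>integral\<^sup>L M (\<lambda>x. h x - s x)\<bar> \<le> integral\<^sup>L M (\<lambda>x. \<bar>h x - s x\<bar>)"
          by (rule pos_functional_abs[OF I bounded_borel_diff[OF h(1) s(1)]])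
        also have "\<dots> \<le> integral\<^sup>L M (\<lambda>x. e)"
          by (rule pos_functional_mono[OF I bounded_borel_abs[OF bounded_borel_diff[OF h(1) s(1)]]]) (use hs in auto)
        finally show ?thesis using pos_functional_diff[OF I h(1) s(1)] by (simp add: sp mult.commute)
      qed
      moreover have "\<bar>m h - m s\<bar> \<le> e * m (\<lambda>x. 1)"
      proof -
        have "\<bar>m (\<lambda>x. h x - s x)\<bar> \<le> m (\<lambda>x. \<bar>h x - s x\<bar>)"
          by (rule pos_functional_abs[OF m bounded_borel_diff[OF h(1) s(1)]])
        also have "\<dots> \<le> m (\<lambda>x. e * 1)"
          by (rule pos_functional_mono[OF m bounded_borel_abs[OF bounded_borel_diff[OF h(1) s(1)]]]) (use hs in auto)
        finally show ?thesis using pos_functional_diff[OF m h(1) s(1)] pos_functional_cmult[OF m, of "\<lambda>x. 1" e] by simp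
      qed
      ultimately show ?thesis using s(2) by (simp add: algebra_simps)
    qed
    show ?thesis
    proof (rule ccontr)
      assume "integral\<^sup>L M h \<noteq> m h"
      then have d: "\<bar>integral\<^sup>L M h - m h\<bar> > 0" by simp
      define T where "T = measure M UNIV + m (\<lambda>x. 1)"
      have T: "T \<ge> 0" unfolding T_def using pos_functional_nonneg[OF m, of "\<lambda>x. 1"] by (simp add: measure_nonneg)
      define e where "e = \<bar>integral\<^sup>L M h - m h\<bar> / (2 * (T + 1))"
      have "e > 0" using d T by (auto simp: e_def)
      then have "\<bar>integral\<^sup>L M h - m h\<bar> \<le> e * T" using approx T_def by simp
      also have "\<dots> \<le> e * (T + 1)" using \<open>e > 0\<close> by simp
      also have "\<dots> = \<bar>integral\<^sup>L M h - m h\<bar> / 2" using T unfolding e_def by (simp add: divide_simps)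
      finally show False using d by simp
    qed
  qed
  have "integral\<^sup>L M h = m h" if h: "h \<in> bounded_borel" for h
  proof -
    obtain C where C: "C > 0" "\<And>x. \<bar>h x\<bar> \<le> C" and hm: "h \<in> borel_measurable borel" using bounded_borelE[OF h] by blast
    \<comment> \<open>Adding the bound \<open>C\<close> reduces a signed function to the nonnegative
      case.\<close>
    have 1: "(\<lambda>x. h x + C) \<in> bounded_borel" using h by (intro bounded_borel_add) auto
    have "h x + C \<ge> 0" for x using C(2)[of x] by linarith
    then have "integral\<^sup>L M (\<lambda>x. h x + C) = m (\<lambda>x. h x + C)" by (intro nonneg 1) 
    moreover have "integral\<^sup>L M (\<lambda>x. C) = m (\<lambda>x. C)" by (rule nonneg) (use C in auto)
    ultimately show ?thesis
      using pos_functional_add[OF m h, of "\<lambda>x. C"] pos_functional_add[OF I h, of "\<lambda>x. C"] by simp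
  qed
  then show thesis using that fin sets meas by blast
qed

text \<open>
  Tychonoff's theorem yields a limit along some filter finer than \<open>sequentially\<close>, so that no
  separability is needed; the domination by \<open>N\<close> makes the limit countably additive.
\<close>

lemma pos_functional_limit:
  fixes m :: "nat \<Rightarrow> ('a::euclidean_space \<Rightarrow> real) \<Rightarrow> real"
  assumes m: "\<And>k. pos_functional (m k)" and N: "pos_functional N" "empty_continuous N"
    and dom: "\<And>k h. h \<in> bounded_borel \<Longrightarrow> (\<And>x. h x \<ge> 0) \<Longrightarrow> m k h \<le> N h"
  obtains G l where "G \<noteq> bot" "G \<le> sequentially" "pos_functional l" "empty_continuous l"
    "\<And>h. h \<in> bounded_borel \<Longrightarrow> ((\<lambda>k. m k h) \<longlongrightarrow> l h) G"
    "\<And>h. h \<in> bounded_borel \<Longrightarrow> (\<And>x. h x \<ge> 0) \<Longrightarrow> l h \<le> N h"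
proof -
  define X where "X k = (\<lambda>h. if h \<in> bounded_borel then m k h else 0)" for k
  \<comment> \<open>Outside \<open>bounded_borel\<close> the value of \<open>N\<close> is arbitrary
    and the interval may be empty; \<open>{0}\<close> holds the value that \<open>X k\<close> takes
    there.\<close>
  define S where "S h = {- N (\<lambda>x. \<bar>h x\<bar>) .. N (\<lambda>x. \<bar>h x\<bar>)} \<union> {0}" for h :: "'a \<Rightarrow> real"
  have "compactin (product_topology (\<lambda>i. euclidean) UNIV) (PiE UNIV S)"
    unfolding compactin_PiE by (auto simp: S_def compact_Un)
  then have comp: "compact (PiE UNIV S)"
    by (simp add: euclidean_product_topology)
  have XS: "X k \<in> PiE UNIV S" for k
  proof -
    have "\<bar>m k h\<bar> \<le> N (\<lambda>x. \<bar>h x\<bar>)" if "h \<in> bounded_borel" for h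
      using pos_functional_abs[OF m that, of k] dom[OF bounded_borel_abs[OF that], of k] by simp
    then show ?thesis by (force simp: X_def S_def abs_le_iff)
  qed
  have "eventually (\<lambda>x. x \<in> PiE UNIV S) (filtermap X sequentially)"
    using XS by (simp add: eventually_filtermap)
  moreover have "filtermap X sequentially \<noteq> bot" by (simp add: filtermap_bot_iff)
  ultimately obtain l where l: "inf (nhds l) (filtermap X sequentially) \<noteq> bot"
    using comp unfolding compact_filter by blast
  \<comment> \<open>\<open>l\<close> is only a cluster point of the sequence \<open>X\<close>.
    Intersecting \<open>sequentially\<close> with the preimages of the neighbourhoods of
    \<open>l\<close> gives a proper filter along which \<open>X\<close> converges to
    \<open>l\<close>.\<close>
  define G where "G = inf sequentially (filtercomap X (nhds l))"
  have G1: "G \<le> sequentially" by (simp add: G_def)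
  have G2: "filterlim X (nhds l) G"
    unfolding G_def filterlim_def
    by (rule filterlim_mono[OF filterlim_filtercomap order_refl inf_le2, unfolded filterlim_def])
  have G3: "G \<noteq> bot"
  proof
    assume "G = bot"
    then have "eventually (\<lambda>x. False) G" by simp
    then have "\<exists>P Q. eventually P sequentially \<and> eventually Q (filtercomap X (nhds l)) \<and> (\<forall>x. \<not> (P x \<and> Q x))"
      unfolding G_def eventually_inf by blast
    then obtain P Q where PQ: "eventually P sequentially" "eventually Q (filtercomap X (nhds l))"
       "\<And>x. \<not> (P x \<and> Q x)"
      by blast
    from PQ(2) obtain R where R: "eventually R (nhds l)" "\<And>x. R (X x) \<Longrightarrow> Q x"
      unfolding eventually_filtercomap by blast
    have "eventually (\<lambda>x. \<not> R (X x)) sequentially"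
      using PQ(1) by (rule eventually_mono) (use PQ(3) R(2) in blast)
    then have "eventually (\<lambda>y. \<not> R y) (filtermap X sequentially)" "eventually R (nhds l)"
      unfolding eventually_filtermap using R(1) by simp_all
    then have "eventually (\<lambda>x. False) (inf (nhds l) (filtermap X sequentially))"
      unfolding eventually_inf by blast
    then show False using l by (simp add: eventually_False)
  qed
  have lim: "((\<lambda>k. m k h) \<longlongrightarrow> l h) G" if "h \<in> bounded_borel" for h
  proof -
    have "((\<lambda>k. X k h) \<longlongrightarrow> l h) G"
      by (rule continuous_on_tendsto_compose[OF continuous_on_product_coordinates[of h] G2]) auto
    then show ?thesis using that by (simp add: X_def)
  qed
  have posl: "pos_functional l"
    unfolding pos_functional_def
  proof (intro conjI ballI allI impI)
    fix f g :: "'a \<Rightarrow> real" assume fg: "f \<in> bounded_borel" "g \<in> bounded_borel"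
    have "((\<lambda>k. m k f + m k g) \<longlongrightarrow> l f + l g) G" by (intro tendsto_add lim fg)
    then have "((\<lambda>k. m k (\<lambda>x. f x + g x)) \<longlongrightarrow> l f + l g) G"
      by (simp add: pos_functional_add[OF m fg])
    with lim[OF bounded_borel_add[OF fg]] G3 show "l (\<lambda>x. f x + g x) = l f + l g"
      using tendsto_unique by blast
  next
    fix c and f :: "'a \<Rightarrow> real" assume f: "f \<in> bounded_borel"
    have "((\<lambda>k. c * m k f) \<longlongrightarrow> c * l f) G" by (intro tendsto_mult_left lim f)
    then have "((\<lambda>k. m k (\<lambda>x. c * f x)) \<longlongrightarrow> c * l f) G"
      by (simp add: pos_functional_cmult[OF m f])
    with lim[OF bounded_borel_cmult[OF f]] G3 show "l (\<lambda>x. c * f x) = c * l f"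
      using tendsto_unique by blast
  next
    fix f :: "'a \<Rightarrow> real" assume f: "f \<in> bounded_borel" "\<forall>x. f x \<ge> 0"
    show "l f \<ge> 0"
      by (rule tendsto_lowerbound[OF lim[OF f(1)] _ G3])
        (use pos_functional_nonneg[OF m f(1)] f in auto)
  qed
  have le: "l h \<le> N h" if "h \<in> bounded_borel" "\<And>x. h x \<ge> 0" for h
    by (rule tendsto_upperbound[OF lim[OF that(1)] _ G3]) (use dom that in auto)
  have "empty_continuous l"
    unfolding empty_continuous_def
  proof (intro allI impI)
    fix A :: "nat \<Rightarrow> 'a set" assume A: "range A \<subseteq> sets borel \<and> decseq A \<and> (\<Inter>i. A i) = {}"
    then have "(\<lambda>i. N (indicator (A i))) \<longlonglongrightarrow> 0" using N by (auto simp: empty_continuous_def)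
    moreover have ind: "indicator (A i) \<in> (bounded_borel :: ('a \<Rightarrow> real) set)" for i
      using A by (intro bounded_borel_indicator) auto
    have "0 \<le> l (indicator (A i))" "l (indicator (A i)) \<le> N (indicator (A i))" for i
      using pos_functional_nonneg[OF posl ind] le[OF ind] by simp_all
    ultimately show "(\<lambda>i. l (indicator (A i))) \<longlonglongrightarrow> 0"
      by (intro tendsto_sandwich[OF _ _ tendsto_const, of 0 "\<lambda>i. l (indicator (A i))" sequentially "\<lambda>i. N (indicator (A i))"]) simp_all
  qed
  then show thesis using that G1 G3 posl lim le by blast
qed

section \<open>Mollification\<close>

lemma uniformly_continuous_supported:
  fixes f :: "'a::euclidean_space \<Rightarrow> real"
  assumes cont: "continuous_on UNIV f" and supp: "\<And>x. norm x \<ge> R \<Longrightarrow> f x = 0" and e: "e > 0"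
  obtains d where "d > 0" "\<And>x y. dist x y < d \<Longrightarrow> \<bar>f x - f y\<bar> < e"
proof -
  \<comment> \<open>With the margin 1, two points at distance less than 1 either both lie in this
    ball or both have norm at least \<open>R\<close>, where \<open>f\<close> vanishes.\<close>
  have "uniformly_continuous_on (cball 0 (R + 1)) f"
    by (intro compact_uniformly_continuous continuous_on_subset[OF cont]) auto
  then obtain d where d: "d > 0" "\<And>x y. x \<in> cball 0 (R + 1) \<Longrightarrow> y \<in> cball 0 (R + 1) \<Longrightarrow> dist y x < d \<Longrightarrow> dist (f y) (f x) < e"
    using e by (meson uniformly_continuous_on_def)
  have *: "\<bar>f x - f y\<bar> < e" if xy: "dist x y < min d 1" for x y
  proof (cases "x \<in> cball 0 (R + 1) \<and> y \<in> cball 0 (R + 1)")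
    case True
    then show ?thesis using d(2)[of y x] xy by (simp add: dist_real_def)
  next
    case False
    have "norm x \<le> norm y + dist x y" "norm y \<le> norm x + dist x y"
      using norm_triangle_sub[of x y] norm_triangle_sub[of y x] by (auto simp: dist_norm norm_minus_commute)
    then have "norm x \<ge> R" "norm y \<ge> R" using False xy by auto
    then show ?thesis using supp e by simp
  qed
  show thesis by (rule that[of "min d 1"]) (use d(1) in simp, rule *)
qed

lemma bounded_supported:
  fixes f :: "'a::euclidean_space \<Rightarrow> real"
  assumes cont: "continuous_on UNIV f" and supp: "\<And>x. norm x \<ge> R \<Longrightarrow> f x = 0"
  obtains C where "C > 0" "\<And>x. \<bar>f x\<bar> \<le> C"
proof -
  have "compact (f ` cball 0 R)"
    by (intro compact_continuous_image continuous_on_subset[OF cont]) auto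
  then have "bounded (f ` cball 0 R)" by (rule compact_imp_bounded)
  then obtain C where C: "C > 0" "\<And>y. y \<in> f ` cball 0 R \<Longrightarrow> norm y \<le> C"
    unfolding bounded_pos by blast
  have "\<bar>f x\<bar> \<le> C" for x
  proof (cases "norm x \<le> R")
    case True
    then show ?thesis using C(2)[of "f x"] by simp
  next
    case False
    then show ?thesis using supp[of x] C(1) by simp
  qed
  then show thesis by (rule that[OF C(1)])
qed

lemma integrable_bounded_mult:
  fixes f g :: "'a::euclidean_space \<Rightarrow> real"
  assumes "integrable M f" "g \<in> borel_measurable M" "\<And>x. \<bar>g x\<bar> \<le> C"
  shows "integrable M (\<lambda>x. g x * f x)"
proof (rule Bochner_Integration.integrable_bound)
  show "integrable M (\<lambda>x. C * f x)" using assms by simp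
  show "(\<lambda>x. g x * f x) \<in> borel_measurable M" using assms by measurable
  show "AE x in M. norm (g x * f x) \<le> norm (C * f x)"
    by (intro AE_I2) (auto simp: abs_mult intro!: mult_right_mono order_trans[OF assms(3) abs_ge_self])
qed

lemma continuous_borel_measurable_shift:
  fixes \<kappa> :: "'a::euclidean_space \<Rightarrow> real"
  assumes "continuous_on UNIV \<kappa>"
  shows "(\<lambda>y. \<kappa> (x - y)) \<in> borel_measurable borel"
  by (intro borel_measurable_continuous_onI continuous_on_compose2[OF assms] continuous_intros) auto

lemma continuous_on_convolution:
  fixes \<kappa> f :: "'a::euclidean_space \<Rightarrow> real"
  assumes cont: "continuous_on UNIV \<kappa>" and supp: "\<And>x. norm x \<ge> R \<Longrightarrow> \<kappa> x = 0"
    and f: "integrable lborel f"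
  shows "continuous_on UNIV (\<lambda>x. LINT y|lborel. \<kappa> (x - y) * f y)"
proof (rule continuous_at_imp_continuous_on, rule ballI)
  fix x :: 'a
  obtain C where C: "\<And>x. \<bar>\<kappa> x\<bar> \<le> C" using bounded_supported[OF cont supp] by metis
  have int: "integrable lborel (\<lambda>y. \<kappa> (x - y) * f y)" for x
    by (rule integrable_bounded_mult[OF f _ C]) (use continuous_borel_measurable_shift[OF cont] in simp)
  define I where "I = (LINT y|lborel. \<bar>f y\<bar>)"
  have I: "I \<ge> 0" by (simp add: I_def)
  show "isCont (\<lambda>x. LINT y|lborel. \<kappa> (x - y) * f y) x"
    unfolding continuous_at_eps_delta
  proof (intro allI impI)
    fix e :: real assume e: "e > 0"
    \<comment> \<open>\<open>I + 1\<close> instead of \<open>I\<close> avoids a division by zero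
      when \<open>f\<close> vanishes almost everywhere.\<close>
    have pos: "e / (2 * (I + 1)) > 0" using e I by simp
    obtain d where d: "d > 0" "\<And>x y. dist x y < d \<Longrightarrow> \<bar>\<kappa> x - \<kappa> y\<bar> < e / (2 * (I + 1))"
      using uniformly_continuous_supported[OF cont supp pos] by blast
    have "dist (LINT y|lborel. \<kappa> (z - y) * f y) (LINT y|lborel. \<kappa> (x - y) * f y) < e" if z: "dist z x < d" for z
    proof -
      have "dist (LINT y|lborel. \<kappa> (z - y) * f y) (LINT y|lborel. \<kappa> (x - y) * f y)
         = \<bar>LINT y|lborel. \<kappa> (z - y) * f y - \<kappa> (x - y) * f y\<bar>"
        by (simp add: dist_real_def int)
      also have "\<dots> \<le> (LINT y|lborel. \<bar>\<kappa> (z - y) * f y - \<kappa> (x - y) * f y\<bar>)" by (rule integral_abs_bound)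
      also have "\<dots> \<le> (LINT y|lborel. e / (2 * (I + 1)) * \<bar>f y\<bar>)"
      proof (rule integral_mono)
        show "integrable lborel (\<lambda>y. \<bar>\<kappa> (z - y) * f y - \<kappa> (x - y) * f y\<bar>)" by (intro integrable_abs Bochner_Integration.integrable_diff int)
        show "integrable lborel (\<lambda>y. e / (2 * (I + 1)) * \<bar>f y\<bar>)" using f by simp
        fix y
        have "\<bar>\<kappa> (z - y) * f y - \<kappa> (x - y) * f y\<bar> = \<bar>\<kappa> (z - y) - \<kappa> (x - y)\<bar> * \<bar>f y\<bar>"
          by (simp add: abs_mult flip: left_diff_distrib)
        also have "\<dots> \<le> e / (2 * (I + 1)) * \<bar>f y\<bar>"
          using d(2)[of "z - y" "x - y"] z by (intro mult_right_mono) (auto simp: dist_norm)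
        finally show "\<bar>\<kappa> (z - y) * f y - \<kappa> (x - y) * f y\<bar> \<le> e / (2 * (I + 1)) * \<bar>f y\<bar>" .
      qed
      also have "\<dots> = e / (2 * (I + 1)) * I" by (simp add: I_def)
      also have "\<dots> = e / 2 * (I / (I + 1))" by simp
      also have "\<dots> \<le> e / 2 * 1" using e I by (intro mult_left_mono) auto
      also have "\<dots> < e" using e by simp
      finally show ?thesis .
    qed
    then show "\<exists>d>0. \<forall>z. dist z x < d \<longrightarrow> dist (LINT y|lborel. \<kappa> (z - y) * f y) (LINT y|lborel. \<kappa> (x - y) * f y) < e"
      using d(1) by blast
  qed
qed

lemma norm_linear_le_sum_Basis:
  assumes "linear L"
  shows "norm (L (h::'a::euclidean_space)) \<le> norm h * (\<Sum>i\<in>Basis. norm (L i))"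
proof -
  have "L h = L (\<Sum>i\<in>Basis. (h \<bullet> i) *\<^sub>R i)" by (simp add: euclidean_representation)
  also have "\<dots> = (\<Sum>i\<in>Basis. (h \<bullet> i) *\<^sub>R L i)"
    by (simp add: linear_sum[OF assms] linear_scale[OF assms])
  finally have "norm (L h) \<le> (\<Sum>i\<in>Basis. \<bar>h \<bullet> i\<bar> * norm (L i))"
    by (metis (no_types, lifting) norm_scaleR norm_sum sum.cong)
  also have "\<dots> \<le> (\<Sum>i\<in>Basis. norm h * norm (L i))"
    by (intro sum_mono mult_right_mono Basis_le_norm) auto
  finally show ?thesis by (simp add: sum_distrib_left)
qed

section \<open>Differentiating a convolution with a compactly supported kernel\<close>

context
  fixes \<kappa> :: "'a::euclidean_space \<Rightarrow> real" and \<kappa>' and R :: real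
  assumes deriv: "\<And>x. (\<kappa> has_derivative \<kappa>' x) (at x)"
    and cont: "\<And>h. continuous_on UNIV (\<lambda>x. \<kappa>' x h)"
    and supp: "\<And>x. norm x \<ge> R \<Longrightarrow> \<kappa> x = 0"
begin

lemma continuous_on_kernel: "continuous_on UNIV \<kappa>"
  by (rule continuous_at_imp_continuous_on) (blast intro: has_derivative_continuous deriv)

text \<open>The radius grows by 1 so that \<open>x\<close> has a neighbourhood on which the kernel
  vanishes.\<close>

lemma kernel_deriv_supp: "norm x \<ge> R + 1 \<Longrightarrow> \<kappa>' x h = 0"
proof -
  assume x: "norm x \<ge> R + 1"
  have "((\<lambda>x. 0) has_derivative (\<lambda>h. 0)) (at x)" by simp
  then have "(\<kappa> has_derivative (\<lambda>h. 0)) (at x)"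
  proof (rule has_derivative_transform_within_open[of _ _ _ _ "- cball 0 R"])
    show "x \<in> - cball 0 R" using x by auto
  qed (use supp in auto)
  then show ?thesis using has_derivative_unique[OF deriv] by metis
qed

text \<open>Each directional derivative is continuous with compact support, hence uniformly
  continuous, and the mean value inequality gives a remainder that is small uniformly in
  \<open>a\<close>. This uniformity is what allows differentiation under the integral below.\<close>

lemma kernel_uniformly_differentiable:
  assumes "e > 0"
  obtains d where "d > 0" "\<And>a h. norm h < d \<Longrightarrow> \<bar>\<kappa> (a + h) - \<kappa> a - \<kappa>' a h\<bar> \<le> e * norm h"
proof -
  \<comment> \<open>The operator norm is estimated by a sum over the basis, hence the division by
    the dimension.\<close>
  define e' where "e' = e / real DIM('a)"
  have e': "e' > 0" using assms by (simp add: e'_def DIM_positive)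
  have "\<exists>d>0. \<forall>x y. dist x y < d \<longrightarrow> \<bar>\<kappa>' x i - \<kappa>' y i\<bar> < e'" for i
    using uniformly_continuous_supported[OF cont[of i] kernel_deriv_supp e'] by metis
  then obtain \<delta> where \<delta>: "\<And>i. \<delta> i > 0" "\<And>i x y. dist x y < \<delta> i \<Longrightarrow> \<bar>\<kappa>' x i - \<kappa>' y i\<bar> < e'"
    by metis
  define d where "d = Min (\<delta> ` (Basis :: 'a set))"
  have d: "d > 0" "\<And>i. i \<in> Basis \<Longrightarrow> d \<le> \<delta> i" using \<delta>(1) by (auto simp: d_def)
  have bl: "bounded_linear (\<kappa>' x)" for x using deriv has_derivative_bounded_linear by blast
  have "\<bar>\<kappa> (a + h) - \<kappa> a - \<kappa>' a h\<bar> \<le> e * norm h" if h: "norm h < d" for a h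
  proof -
    have "norm (\<kappa> (a + h) - \<kappa> a - \<kappa>' a ((a + h) - a)) \<le> norm ((a + h) - a) * e"
    proof (rule differentiable_bound_linearization[where S = "ball a d"])
      show "a + t *\<^sub>R (a + h - a) \<in> ball a d" if "t \<in> {0..1}" for t
      proof -
        have "norm (t *\<^sub>R h) \<le> 1 * norm h" using that unfolding norm_scaleR by (intro mult_right_mono) auto
        then show ?thesis using h by (simp add: dist_norm)
      qed
      show "(\<kappa> has_derivative \<kappa>' x) (at x within ball a d)" for x
        using deriv has_derivative_at_withinI by blast
      have "onorm (\<lambda>h. \<kappa>' x h - \<kappa>' a h) \<le> e" if x: "x \<in> ball a d" for x
      proof (rule onorm_bound)
        fix h
        have "norm (\<kappa>' x h - \<kappa>' a h) \<le> norm h * (\<Sum>i\<in>Basis. norm (\<kappa>' x i - \<kappa>' a i))"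
          by (rule norm_linear_le_sum_Basis) (intro linear_compose_sub bounded_linear.linear bl)
        also have "\<dots> \<le> norm h * (\<Sum>i\<in>(Basis :: 'a set). e')"
        proof (intro mult_left_mono sum_mono)
          fix i :: 'a assume "i \<in> Basis"
          then have "dist x a < \<delta> i" using x d(2)[of i] by (simp add: dist_commute)
          then show "norm (\<kappa>' x i - \<kappa>' a i) \<le> e'" using \<delta>(2) by (simp add: less_imp_le)
        qed auto
        finally show "norm (\<kappa>' x h - \<kappa>' a h) \<le> e * norm h" by (simp add: e'_def mult.commute)
      qed (use assms in auto)
      then show "onorm (\<kappa>' x - \<kappa>' a) \<le> e" if "x \<in> ball a d" for x using that by (simp add: fun_diff_def)
      show "a \<in> ball a d" using d by simp
    qed
    then show ?thesis by (simp add: mult.commute)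
  qed
  then show thesis using that d(1) by blast
qed

text \<open>The difference quotient falls on the kernel, and its uniform remainder is merely
  multiplied by the L1 norm of \<open>f\<close>.\<close>

lemma has_derivative_convolution:
  assumes f: "integrable lborel f"
  shows "((\<lambda>x. LINT y|lborel. \<kappa> (x - y) * f y) has_derivative (\<lambda>h. LINT y|lborel. \<kappa>' (x - y) h * f y)) (at x)"
proof -
  obtain C where C: "\<And>x. \<bar>\<kappa> x\<bar> \<le> C" using bounded_supported[OF continuous_on_kernel supp] by metis
  have int: "integrable lborel (\<lambda>y. \<kappa> (x - y) * f y)" for x
    by (rule integrable_bounded_mult[OF f _ C]) (use continuous_borel_measurable_shift[OF continuous_on_kernel] in simp)
  have int': "integrable lborel (\<lambda>y. \<kappa>' (x - y) h * f y)" for x h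
  proof -
    obtain C' where C': "\<And>x. \<bar>\<kappa>' x h\<bar> \<le> C'" using bounded_supported[OF cont kernel_deriv_supp] by metis
    show ?thesis
      by (rule integrable_bounded_mult[OF f _ C']) (use continuous_borel_measurable_shift[OF cont] in simp)
  qed
  have bl: "bounded_linear (\<kappa>' x)" for x using deriv has_derivative_bounded_linear by blast
  have lin: "linear (\<lambda>h. LINT y|lborel. \<kappa>' (x - y) h * f y)"
  proof (rule linearI)
    show "(LINT y|lborel. \<kappa>' (x - y) (a + b) * f y) = (LINT y|lborel. \<kappa>' (x - y) a * f y) + (LINT y|lborel. \<kappa>' (x - y) b * f y)" for a b
      by (simp add: linear_add[OF bounded_linear.linear[OF bl]] distrib_right int')
    show "(LINT y|lborel. \<kappa>' (x - y) (r *\<^sub>R b) * f y) = r *\<^sub>R (LINT y|lborel. \<kappa>' (x - y) b * f y)" for r b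
      by (simp add: linear_scale[OF bounded_linear.linear[OF bl]] mult.assoc)
  qed
  define I where "I = (LINT y|lborel. \<bar>f y\<bar>)"
  have I: "I \<ge> 0" by (simp add: I_def)
  show ?thesis
    unfolding has_derivative_at_alt
  proof (intro conjI allI impI)
    show "bounded_linear (\<lambda>h. LINT y|lborel. \<kappa>' (x - y) h * f y)"
      using lin by (simp add: linear_conv_bounded_linear)
    fix e :: real assume e: "e > 0"
    have pos: "e / (I + 1) > 0" using e I by simp
    obtain d where d: "d > 0" "\<And>a h. norm h < d \<Longrightarrow> \<bar>\<kappa> (a + h) - \<kappa> a - \<kappa>' a h\<bar> \<le> e / (I + 1) * norm h"
      using kernel_uniformly_differentiable[OF pos] by blast
    have "norm ((LINT y|lborel. \<kappa> (z - y) * f y) - (LINT y|lborel. \<kappa> (x - y) * f y) - (LINT y|lborel. \<kappa>' (x - y) (z - x) * f y))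
        \<le> e * norm (z - x)" if z: "norm (z - x) < d" for z
    proof -
      have "norm ((LINT y|lborel. \<kappa> (z - y) * f y) - (LINT y|lborel. \<kappa> (x - y) * f y) - (LINT y|lborel. \<kappa>' (x - y) (z - x) * f y))
         = \<bar>LINT y|lborel. (\<kappa> (z - y) * f y - \<kappa> (x - y) * f y) - \<kappa>' (x - y) (z - x) * f y\<bar>"
        by (simp add: int int')
      also have "\<dots> \<le> (LINT y|lborel. \<bar>(\<kappa> (z - y) * f y - \<kappa> (x - y) * f y) - \<kappa>' (x - y) (z - x) * f y\<bar>)"
        by (rule integral_abs_bound)
      also have "\<dots> \<le> (LINT y|lborel. e / (I + 1) * norm (z - x) * \<bar>f y\<bar>)"
      proof (rule integral_mono)
        show "integrable lborel (\<lambda>y. \<bar>(\<kappa> (z - y) * f y - \<kappa> (x - y) * f y) - \<kappa>' (x - y) (z - x) * f y\<bar>)"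
          by (intro integrable_abs Bochner_Integration.integrable_diff int int')
        show "integrable lborel (\<lambda>y. e / (I + 1) * norm (z - x) * \<bar>f y\<bar>)" using f by simp
        fix y
        have "\<bar>(\<kappa> (z - y) * f y - \<kappa> (x - y) * f y) - \<kappa>' (x - y) (z - x) * f y\<bar>
            = \<bar>\<kappa> ((x - y) + (z - x)) - \<kappa> (x - y) - \<kappa>' (x - y) (z - x)\<bar> * \<bar>f y\<bar>"
          by (simp add: abs_mult flip: left_diff_distrib)
        also have "\<dots> \<le> e / (I + 1) * norm (z - x) * \<bar>f y\<bar>"
          using d(2)[OF z, of "x - y"] by (intro mult_right_mono) auto
        finally show "\<bar>(\<kappa> (z - y) * f y - \<kappa> (x - y) * f y) - \<kappa>' (x - y) (z - x) * f y\<bar> \<le> e / (I + 1) * norm (z - x) * \<bar>f y\<bar>" .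
      qed
      also have "\<dots> = e * norm (z - x) * (I / (I + 1))" by (simp add: I_def)
      also have "\<dots> \<le> e * norm (z - x) * 1" using I e by (intro mult_left_mono) auto
      finally show ?thesis by simp
    qed
    then show "\<exists>d>0. \<forall>z. norm (z - x) < d \<longrightarrow> norm ((LINT y|lborel. \<kappa> (z - y) * f y) - (LINT y|lborel. \<kappa> (x - y) * f y) - (LINT y|lborel. \<kappa>' (x - y) (z - x) * f y)) \<le> e * norm (z - x)"
      using d(1) by blast
  qed
qed

lemma continuous_on_convolution_deriv:
  assumes f: "integrable lborel f"
  shows "continuous_on UNIV (\<lambda>x. LINT y|lborel. \<kappa>' (x - y) h * f y)"
  by (rule continuous_on_convolution[OF cont kernel_deriv_supp f])

end

text \<open>The reflected kernel y \<mapsto> \<open>\<kappa> (x - y)\<close> is itself a test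
  function, supported in \<open>cball x R\<close>. The sign that reflection produces cancels the one
  in the definition of the distributional derivative. \<open>L\<close> is left abstract because it
  will be integration against a density or against measures.\<close>

lemma convolution_dist_deriv:
  fixes f \<kappa> :: "real^'n \<Rightarrow> real"
  assumes smooth: "\<And>k. Ck k \<kappa>" and \<kappa>': "\<And>x. (\<kappa> has_derivative \<kappa>' x) (at x)"
    and supp: "\<And>z. norm z \<ge> R \<Longrightarrow> \<kappa> z = 0" and sub: "cball x R \<subseteq> V"
    and f: "f \<in> borel_measurable borel" "\<And>y. y \<notin> \<Omega> \<Longrightarrow> f y = 0" and \<Omega>: "open \<Omega>"
    and L: "\<And>\<phi>. \<phi> \<in> test_functions V \<Longrightarrow>
      (LINT x:\<Omega>|lebesgue. f x * frechet_derivative \<phi> (at x) (axis j 1)) = - L \<phi>"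
  shows "(LINT y|lborel. \<kappa>' (x - y) (axis j 1) * f y) = L (\<lambda>y. \<kappa> (x - y))"
proof -
  have *: "\<kappa> (x - y) = \<kappa> ((-1) *\<^sub>R y + x)" for y by simp
  have Ck: "Ck k (\<lambda>y. \<kappa> (x - y))" for k unfolding * by (rule Ck_affine[OF smooth])
  have der: "((\<lambda>y. \<kappa> (x - y)) has_derivative (\<lambda>h. \<kappa>' (x - y) (- h))) (at y)" for y
    by (rule has_derivative_compose[of "\<lambda>y. x - y" "\<lambda>h. - h", OF _ \<kappa>']) (auto intro!: derivative_eq_intros)
  have cl: "closure {y. \<kappa> (x - y) \<noteq> 0} \<subseteq> cball x R"
  proof (rule closure_minimal)
    show "{y. \<kappa> (x - y) \<noteq> 0} \<subseteq> cball x R"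
    proof
      fix y assume "y \<in> {y. \<kappa> (x - y) \<noteq> 0}"
      then have "\<not> norm (x - y) \<ge> R" using supp by blast
      then show "y \<in> cball x R" by (simp add: dist_norm)
    qed
  qed auto
  then have "(\<lambda>y. \<kappa> (x - y)) \<in> test_functions V"
    unfolding test_functions_def using Ck sub cl bounded_subset[OF bounded_cball cl] by (auto simp: compact_eq_bounded_closed)
  from L[OF this] have "- L (\<lambda>y. \<kappa> (x - y)) = (LINT y:\<Omega>|lebesgue. f y * \<kappa>' (x - y) (- axis j 1))"
    by (simp add: frechet_derivative_at[OF der, symmetric])
  also have "\<dots> = (LINT y:\<Omega>|lborel. f y * \<kappa>' (x - y) (- axis j 1))"
  proof (rule set_lebesgue_integral_lebesgue_eq_lborel)
    obtain k' where k': "\<And>x. (\<kappa> has_derivative k' x) (at x)" "\<And>h. Ck 0 (\<lambda>x. k' x h)"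
      using smooth[of "Suc 0"] by auto
    have "k' = \<kappa>'" using has_derivative_unique[OF k'(1) \<kappa>'] by blast
    then have "continuous_on UNIV (\<lambda>x. \<kappa>' x (- axis j 1))" using k'(2) by simp
    from continuous_borel_measurable_shift[OF this] 
    show "(\<lambda>y. f y * \<kappa>' (x - y) (- axis j 1)) \<in> borel_measurable borel" using f(1) by measurable
  qed (use \<Omega> in auto)
  also have "\<dots> = (LINT y|lborel. - (\<kappa>' (x - y) (axis j 1) * f y))"
    unfolding set_lebesgue_integral_def
  proof (rule Bochner_Integration.integral_cong[OF refl])
    fix y
    have "\<kappa>' (x - y) (- axis j 1) = - \<kappa>' (x - y) (axis j 1)"
      using \<kappa>' has_derivative_linear linear_neg by blast
    then show "indicator \<Omega> y *\<^sub>R (f y * \<kappa>' (x - y) (- axis j 1)) = - (\<kappa>' (x - y) (axis j 1) * f y)"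
      using f(2)[of y] by (auto simp: indicator_def)
  qed
  finally show ?thesis by simp
qed

section \<open>Mollification at scale \<open>d\<close>\<close>

definition base_mollifier :: "real^'n \<Rightarrow> real" where
  "base_mollifier = (SOME \<rho>. (\<forall>k. Ck k \<rho>) \<and> (\<forall>x. \<rho> x \<ge> 0) \<and> (\<forall>x. norm x \<ge> 1 \<longrightarrow> \<rho> x = 0) \<and> integral\<^sup>L lborel \<rho> = 1)"

lemma base_mollifier:
  shows Ck_base_mollifier: "Ck k base_mollifier" and base_mollifier_nonneg: "base_mollifier x \<ge> 0"
    and base_mollifier_supp: "norm x \<ge> 1 \<Longrightarrow> base_mollifier x = 0"
    and integral_base_mollifier: "integral\<^sup>L lborel base_mollifier = 1"
proof -
  have "\<exists>\<rho> :: real^'n \<Rightarrow> real. (\<forall>k. Ck k \<rho>) \<and> (\<forall>x. \<rho> x \<ge> 0) \<and> (\<forall>x. norm x \<ge> 1 \<longrightarrow> \<rho> x = 0) \<and> integral\<^sup>L lborel \<rho> = 1"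
    using mollifier_exists by metis
  from someI_ex[OF this, folded base_mollifier_def]
  show "Ck k (base_mollifier :: real^'n \<Rightarrow> real)" "base_mollifier x \<ge> 0"
    "norm x \<ge> 1 \<Longrightarrow> base_mollifier x = 0" "integral\<^sup>L lborel (base_mollifier :: real^'n \<Rightarrow> real) = 1"
    by auto
qed

definition mollifier :: "real \<Rightarrow> real^'n \<Rightarrow> real" where
  "mollifier d x = base_mollifier ((1 / d) *\<^sub>R x) / d ^ CARD('n)"

lemma Ck_mollifier: "Ck k (mollifier d)"
  unfolding mollifier_def using Ck_affine[OF Ck_base_mollifier, of k "1 / d" 0] Ck_scaleR[where c = "1 / d ^ CARD('n)"]
  by (force simp: divide_inverse mult.commute)

lemma mollifier_nonneg: "d > 0 \<Longrightarrow> mollifier d x \<ge> 0"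
  by (simp add: mollifier_def base_mollifier_nonneg)

lemma mollifier_supp: "d > 0 \<Longrightarrow> norm x \<ge> d \<Longrightarrow> mollifier d x = 0"
  by (simp add: mollifier_def base_mollifier_supp)

lemma continuous_on_mollifier: "continuous_on UNIV (mollifier d)"
  using Ck_mollifier Ck_continuous by blast

lemma mollifier_bound: "\<exists>K>0. \<forall>d>0. \<forall>x::real^'n. mollifier d x \<le> K / d ^ CARD('n)"
proof -
  obtain C where C: "C > 0" "\<And>x::real^'n. \<bar>base_mollifier x\<bar> \<le> C"
    using bounded_supported[OF Ck_continuous[OF Ck_base_mollifier] base_mollifier_supp] by metis
  show ?thesis
  proof (intro exI[of _ C] conjI allI impI)
    fix d :: real and x :: "real^'n" assume d: "d > 0"
    have "base_mollifier ((1 / d) *\<^sub>R x) \<le> C" using C(2)[of "(1 / d) *\<^sub>R x"] by linarith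
    then show "mollifier d x \<le> C / d ^ CARD('n)"
      unfolding mollifier_def using d by (intro divide_right_mono) auto
  qed (rule C(1))
qed

lemma mollifier_shift_measurable [measurable]: "(\<lambda>y. mollifier d (x - y)) \<in> borel_measurable borel"
  by (rule continuous_borel_measurable_shift[OF continuous_on_mollifier])

lemma integrable_mollifier_shift: "d > 0 \<Longrightarrow> integrable lborel (\<lambda>y. mollifier d (x - y))"
proof (rule integrable_continuous_supported[where S = "cball x d"])
  show "continuous_on UNIV (\<lambda>y. mollifier d (x - y))"
    by (intro continuous_on_compose2[OF continuous_on_mollifier] continuous_intros) auto
qed (auto simp: dist_norm intro!: mollifier_supp)

lemma integral_mollifier_shift:
  fixes x :: "real^'n"
  assumes d: "d > 0"
  shows "(LINT y|lborel. mollifier d (x - y)) = 1"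
proof -
  let ?g = "\<lambda>y::real^'n. mollifier d (x - y)"
  have "integral\<^sup>L lborel ?g = integral\<^sup>L (density (distr lborel borel (\<lambda>y. x + (- d) *\<^sub>R y)) (\<lambda>_. ennreal (\<bar>- d\<bar> ^ DIM(real^'n)))) ?g"
    by (subst lborel_affine[of "- d" x]) (use d in auto)
  also have "\<dots> = integral\<^sup>L (distr lborel borel (\<lambda>y. x + (- d) *\<^sub>R y)) (\<lambda>y. d ^ CARD('n) * ?g y)"
    by (subst integral_density) (use d in auto)
  also have "\<dots> = (LINT y|lborel. d ^ CARD('n) * ?g (x + (- d) *\<^sub>R y))"
    by (subst integral_distr) auto
  also have "\<dots> = (LINT (y::real^'n)|lborel. base_mollifier y)"
    using d by (simp add: mollifier_def)
  finally show ?thesis by (simp add: integral_base_mollifier)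
qed

definition mollify :: "real \<Rightarrow> (real^'n \<Rightarrow> real) \<Rightarrow> real^'n \<Rightarrow> real" where
  "mollify d f x = (LINT y|lborel. mollifier d (x - y) * f y)"

text \<open>Differences \<open>f y - c\<close> with a constant are not integrable over the whole
  space; for convolution with a compactly supported kernel integrability on balls is the right
  notion.\<close>

definition locally_integrable :: "('a::euclidean_space \<Rightarrow> real) \<Rightarrow> bool" where
  "locally_integrable f \<longleftrightarrow> f \<in> borel_measurable borel \<and> (\<forall>x r. set_integrable lborel (ball x r) f)"

lemma locally_integrable_bounded:
  assumes f: "f \<in> borel_measurable borel" and C: "\<And>y. \<bar>f y\<bar> \<le> C"
  shows "locally_integrable f"
  unfolding locally_integrable_def set_integrable_def
proof (intro conjI allI f)
  fix x :: 'a and r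
  show "integrable lborel (\<lambda>y. indicator (ball x r) y *\<^sub>R f y)"
  proof (rule integrableI_bounded_set[where A = "ball x r" and B = C])
    show "(\<lambda>y. indicator (ball x r) y *\<^sub>R f y) \<in> borel_measurable lborel"
      by (intro borel_measurable_scaleR borel_measurable_indicator) (use f in auto)
    show "emeasure lborel (ball x r) < \<infinity>" using emeasure_lborel_ball_finite[of x r] by simp
  qed (use C in \<open>auto simp: indicator_def\<close>)
qed

lemma locally_integrable_integrable: "integrable lborel f \<Longrightarrow> locally_integrable f"
  unfolding locally_integrable_def set_integrable_def by (auto intro: integrable_mult_indicator[of _ lborel f, simplified])

lemma locally_integrable_diff: "locally_integrable f \<Longrightarrow> locally_integrable g \<Longrightarrow> locally_integrable (\<lambda>x. f x - g x)"
  unfolding locally_integrable_def by auto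

lemma locally_integrable_abs: "locally_integrable f \<Longrightarrow> locally_integrable (\<lambda>x. \<bar>f x\<bar>)"
  unfolding locally_integrable_def by (auto intro: set_integrable_abs)

lemma locally_integrable_add: "locally_integrable f \<Longrightarrow> locally_integrable g \<Longrightarrow> locally_integrable (\<lambda>x. f x + g x)"
  unfolding locally_integrable_def by auto

lemma locally_integrable_const: "locally_integrable (\<lambda>x. c)"
  by (rule locally_integrable_bounded[of _ "\<bar>c\<bar>"]) auto

lemma locally_integrable_sum:
  "(\<And>i. i \<in> I \<Longrightarrow> locally_integrable (f i)) \<Longrightarrow> locally_integrable (\<lambda>x. \<Sum>i\<in>I. f i x)"
  by (induction I rule: infinite_finite_induct) (auto intro: locally_integrable_add locally_integrable_const)

lemma locally_integrable_measurable: "locally_integrable f \<Longrightarrow> f \<in> borel_measurable borel"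
  by (simp add: locally_integrable_def)

lemma integrable_mollifier_mult:
  fixes f :: "real^'n \<Rightarrow> real"
  assumes d: "d > 0" and f: "locally_integrable f"
  shows "integrable lborel (\<lambda>y. mollifier d (x - y) * f y)"
proof -
  obtain C where C: "\<And>y::real^'n. \<bar>mollifier d y\<bar> \<le> C"
    using bounded_supported[OF continuous_on_mollifier mollifier_supp[OF d]] by metis
  have "integrable lborel (\<lambda>y. mollifier d (x - y) * (indicator (ball x d) y *\<^sub>R f y))"
    by (rule integrable_bounded_mult[where C = C]) (use f C in \<open>auto simp: locally_integrable_def set_integrable_def\<close>)
  moreover have "mollifier d (x - y) * (indicator (ball x d) y *\<^sub>R f y) = mollifier d (x - y) * f y" for y
    using mollifier_supp[OF d, of "x - y"] by (auto simp: indicator_def dist_norm)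
  ultimately show ?thesis by (simp only:)
qed

lemma mollify_bound:
  assumes d: "d > 0" and f: "f \<in> borel_measurable borel" "\<And>y. \<bar>f y\<bar> \<le> C"
  shows "\<bar>mollify d f x\<bar> \<le> C"
proof -
  have "\<bar>mollify d f x\<bar> \<le> (LINT y|lborel. \<bar>mollifier d (x - y) * f y\<bar>)"
    unfolding mollify_def by (rule integral_abs_bound)
  also have "\<dots> \<le> (LINT y|lborel. mollifier d (x - y) * C)"
  proof (rule integral_mono)
    show "integrable lborel (\<lambda>y. \<bar>mollifier d (x - y) * f y\<bar>)"
      by (intro integrable_abs integrable_mollifier_mult[OF d locally_integrable_bounded[OF f]])
    show "integrable lborel (\<lambda>y. mollifier d (x - y) * C)"
      by (intro integrable_mult_left integrable_mollifier_shift[OF d])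
    show "\<bar>mollifier d (x - y) * f y\<bar> \<le> mollifier d (x - y) * C" for y
      using mult_left_mono[OF f(2)[of y] mollifier_nonneg[OF d, of "x - y"]] mollifier_nonneg[OF d, of "x - y"]
      by (simp add: abs_mult)
  qed
  also have "\<dots> = C" by (simp add: integral_mollifier_shift[OF d])
  finally show ?thesis .
qed

text \<open>For \<open>z\<close> within \<open>d\<close> of \<open>x\<close> the kernel centred at
  \<open>z\<close> lives in \<open>ball x (2 * d)\<close> and is at most a constant over the
  \<open>CARD('n)\<close>-th power of \<open>d\<close>; the volume of that ball turns this bound
  into an average. One constant serves all \<open>f\<close>, \<open>c\<close>, \<open>d\<close>,
  \<open>x\<close> and \<open>z\<close>.\<close>

lemma mollify_near_bound:
  "\<exists>K>0. \<forall>f c d. \<forall>x z::real^'n. locally_integrable f \<and> d > 0 \<and> dist z x \<le> d \<longrightarrow>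
     \<bar>mollify d f z - c\<bar> \<le> K * ball_average (\<lambda>y. \<bar>f y - c\<bar>) x (2 * d)"
proof -
  obtain K where K: "K > 0" "\<And>d x::real^'n. d > 0 \<Longrightarrow> mollifier d x \<le> K / d ^ CARD('n)"
    using mollifier_bound by metis
  obtain V where V_def: "unit_ball_vol (real CARD('n)) = V" and V: "V > 0"
    using unit_ball_vol_pos[of "real CARD('n)"] by simp
  show ?thesis
  proof (intro exI[of _ "K * 2 ^ CARD('n) * V"] conjI allI impI)
    show "K * 2 ^ CARD('n) * V > 0" using K V by simp
    fix f :: "real^'n \<Rightarrow> real" and c d and x z :: "real^'n"
    assume *: "locally_integrable f \<and> d > 0 \<and> dist z x \<le> d"
    then have f: "locally_integrable f" and d: "d > 0" and z: "dist z x \<le> d" by auto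
    have fm [measurable]: "f \<in> borel_measurable borel" by (rule locally_integrable_measurable[OF f])
    have fc: "locally_integrable (\<lambda>y. f y - c)" by (rule locally_integrable_diff[OF f locally_integrable_const])
    have "mollify d f z - c = (LINT y|lborel. mollifier d (z - y) * f y - mollifier d (z - y) * c)"
      using integrable_mollifier_mult[OF d f, of z] integrable_mollifier_shift[OF d, of z]
      by (simp add: mollify_def integral_mollifier_shift[OF d])
    then have "\<bar>mollify d f z - c\<bar> = \<bar>LINT y|lborel. mollifier d (z - y) * (f y - c)\<bar>"
      by (simp add: right_diff_distrib)
    also have "\<dots> \<le> (LINT y|lborel. \<bar>mollifier d (z - y) * (f y - c)\<bar>)" by (rule integral_abs_bound)
    also have "\<dots> \<le> (LINT y|lborel. K / d ^ CARD('n) * (indicator (ball x (2 * d)) y *\<^sub>R \<bar>f y - c\<bar>))"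
    proof (rule integral_mono)
      have "integrable lborel (\<lambda>y. mollifier d (z - y) * (f y - c))"
        by (rule integrable_mollifier_mult[OF d fc])
      then show "integrable lborel (\<lambda>y. \<bar>mollifier d (z - y) * (f y - c)\<bar>)" by (rule integrable_abs)
      have "integrable lborel (\<lambda>y. indicator (ball x (2 * d)) y *\<^sub>R \<bar>f y - c\<bar>)"
        using locally_integrable_abs[OF fc] by (simp add: locally_integrable_def set_integrable_def)
      then show "integrable lborel (\<lambda>y. K / d ^ CARD('n) * (indicator (ball x (2 * d)) y *\<^sub>R \<bar>f y - c\<bar>))"
        by (rule integrable_mult_right)
      fix y
      show "\<bar>mollifier d (z - y) * (f y - c)\<bar> \<le> K / d ^ CARD('n) * (indicator (ball x (2 * d)) y *\<^sub>R \<bar>f y - c\<bar>)"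
      proof (cases "norm (z - y) < d")
        case True
        have "dist x y \<le> dist z x + dist z y" by (metis dist_commute dist_triangle)
        then have "y \<in> ball x (2 * d)" using True z by (simp add: dist_norm)
        then show ?thesis
          using mult_right_mono[OF K(2)[OF d, of "z - y"], of "\<bar>f y - c\<bar>"] mollifier_nonneg[OF d, of "z - y"]
          by (simp add: abs_mult)
      next
        case False
        then show ?thesis using mollifier_supp[OF d, of "z - y"] K(1) d by simp
      qed
    qed
    also have "\<dots> = K / d ^ CARD('n) * (set_lebesgue_integral lebesgue (ball x (2 * d)) (\<lambda>y. \<bar>f y - c\<bar>))"
      by (subst set_lebesgue_integral_lebesgue_eq_lborel) (auto simp: set_lebesgue_integral_def)
    also have "\<dots> = K * 2 ^ CARD('n) * V * ball_average (\<lambda>y. \<bar>f y - c\<bar>) x (2 * d)"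
      using d V by (simp add: ball_average_def content_ball V_def power_mult_distrib)
    finally show "\<bar>mollify d f z - c\<bar> \<le> K * 2 ^ CARD('n) * V * ball_average (\<lambda>y. \<bar>f y - c\<bar>) x (2 * d)" .
  qed
qed

text \<open>The convergence is uniform over all \<open>z\<close> within \<open>d\<close> of
  \<open>x\<close>. The chain rule uses this strength, since there a function of the mollification
  is averaged once more over a ball of radius \<open>d\<close>.\<close>

lemma mollify_uniform_limit:
  fixes f :: "real^'n \<Rightarrow> real"
  assumes f: "locally_integrable f" and lp: "lebesgue_point f x" and e: "e > 0"
  shows "eventually (\<lambda>d. \<forall>z. dist z x \<le> d \<longrightarrow> \<bar>mollify d f z - f x\<bar> < e) (at_right 0)"
proof -
  obtain K where K: "K > 0" "\<And>f c d. \<And>x z::real^'n. locally_integrable f \<Longrightarrow> d > 0 \<Longrightarrow> dist z x \<le> d \<Longrightarrow>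
     \<bar>mollify d f z - c\<bar> \<le> K * ball_average (\<lambda>y. \<bar>f y - c\<bar>) x (2 * d)"
    using mollify_near_bound by metis
  have "((\<lambda>d. ball_average (\<lambda>y. \<bar>f y - f x\<bar>) x (2 * d)) \<longlongrightarrow> 0) (at_right 0)"
  proof (rule filterlim_compose[OF lp[unfolded lebesgue_point_def]])
    show "filterlim (\<lambda>d. 2 * d) (at_right 0) (at_right (0::real))"
      unfolding filterlim_at
      by (auto intro!: tendsto_eq_intros eventually_mono[OF eventually_at_right_less[of 0]])
  qed
  then have "eventually (\<lambda>d. dist (ball_average (\<lambda>y. \<bar>f y - f x\<bar>) x (2 * d)) 0 < e / K) (at_right 0)"
    by (rule tendstoD) (use e K in simp)
  then show ?thesis
    using eventually_at_right_less[of 0]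
  proof eventually_elim
    case (elim d)
    have "ball_average (\<lambda>y. \<bar>f y - f x\<bar>) x (2 * d) < e / K"
      using elim(1) unfolding dist_real_def by linarith
    then have "K * ball_average (\<lambda>y. \<bar>f y - f x\<bar>) x (2 * d) < e" using K(1) by (simp add: field_simps)
    then show ?case using K(2)[OF f elim(2), where c = "f x" and x = x] by fastforce
  qed
qed

section \<open>Approximate limits and approximate gradients\<close>

lemma set_integrable_lebesgue_ball_bounded:
  fixes f :: "'a::euclidean_space \<Rightarrow> 'b::{banach, second_countable_topology}"
  assumes f: "f \<in> borel_measurable borel" and C: "\<And>y. y \<in> ball x r \<Longrightarrow> norm (f y) \<le> C"
  shows "set_integrable lebesgue (ball x r) f"
proof -
  have "set_integrable lborel (ball x r) f"
    unfolding set_integrable_def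
  proof (rule integrableI_bounded_set[where A = "ball x r" and B = C])
    show "(\<lambda>y. indicator (ball x r) y *\<^sub>R f y) \<in> borel_measurable lborel"
      by (intro borel_measurable_scaleR borel_measurable_indicator) (use f in auto)
    show "emeasure lborel (ball x r) < \<infinity>" using emeasure_lborel_ball_finite[of x r] by simp
  qed (use C in \<open>auto simp: indicator_def\<close>)
  then show ?thesis using f by (subst set_integrable_lebesgue_iff_lborel) auto
qed

lemma borel_measurable_vec_nth [measurable (raw)]:
  fixes u :: "'a \<Rightarrow> real^'m"
  shows "u \<in> borel_measurable M \<Longrightarrow> (\<lambda>y. u y $ i) \<in> borel_measurable M"
  by (rule measurable_compose[OF _ borel_measurable_continuous_onI])
    (auto intro: continuous_intros)

lemma continuous_on_matrix_vector_mult: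
  "continuous_on S f \<Longrightarrow> continuous_on S (\<lambda>y. (A :: real^'n^'m) *v f y)"
  by (rule bounded_linear.continuous_on[OF matrix_vector_mul_bounded_linear])

lemma matrix_of_bounded_linear: "bounded_linear f \<Longrightarrow> matrix f *v x = (f :: real^'n \<Rightarrow> real^'m) x"
  by (simp add: matrix_works linear_matrix_vector_mul_eq bounded_linear.linear)

lemma norm_matrix_vector_mult_le: "norm (A *v x) \<le> onorm ((*v) A) * norm (x :: real^'n)"
  by (rule onorm[OF matrix_vector_mul_bounded_linear])

text \<open>The average is invariant under scaling about \<open>x\<close>, so a bound independent of
  \<open>r\<close> is possible: near \<open>x + r *\<^sub>R h\<close> with
  \<open>H *v h \<noteq> 0\<close> the integrand is at least \<open>norm (H *v h) / 2\<close>. This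
  is the source of the uniqueness of approximate gradients.\<close>

lemma ball_average_norm_matrix_lower:
  fixes H :: "real^'n^'m"
  assumes "H \<noteq> 0"
  obtains c where "c > 0" "\<And>x r. r > 0 \<Longrightarrow> c \<le> ball_average (\<lambda>y. norm (H *v (y - x)) / r) x r"
proof -
  obtain h0 where h0: "H *v h0 \<noteq> 0" using assms matrix_eq[of H 0] by auto
  \<comment> \<open>With \<open>norm h = 1 / 2\<close> the ball of radius
    \<open>\<delta> * r\<close> about \<open>x + r *\<^sub>R h\<close> stays inside
    \<open>ball x r\<close> as long as \<open>\<delta> \<le> 1 / 2\<close>.\<close>
  define h where "h = (1 / (2 * norm h0)) *\<^sub>R h0"
  have "h0 \<noteq> 0" using h0 by auto
  then have h: "norm h = 1 / 2" "H *v h \<noteq> 0"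
    using h0 by (auto simp: h_def matrix_vector_mult_scaleR)
  define M where "M = onorm ((*v) H) + 1"
  have M: "M > 0" unfolding M_def using onorm_pos_le[OF matrix_vector_mul_bounded_linear, of H] by linarith
  define \<delta> where "\<delta> = min (1/2) (norm (H *v h) / (2 * M))"
  have \<delta>: "\<delta> > 0" "\<delta> \<le> 1/2" "M * \<delta> \<le> norm (H *v h) / 2"
  proof -
    show "\<delta> > 0" "\<delta> \<le> 1/2" using h M by (auto simp: \<delta>_def)
    have "\<delta> \<le> norm (H *v h) / (2 * M)" by (simp add: \<delta>_def)
    then show "M * \<delta> \<le> norm (H *v h) / 2" using M by (simp add: field_simps)
  qed
  define c where "c = norm (H *v h) / 2 * \<delta> ^ CARD('n)"
  have "c > 0" using \<delta> h by (simp add: c_def)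
  moreover have "c \<le> ball_average (\<lambda>y. norm (H *v (y - x)) / r) x r" if r: "r > 0" for x r
  proof -
    let ?B = "ball (x + r *\<^sub>R h) (\<delta> * r)"
    have sub: "?B \<subseteq> ball x r"
    proof
      fix y assume "y \<in> ?B"
      then have "dist (x + r *\<^sub>R h) y < \<delta> * r" by simp
      also have "\<dots> \<le> 1/2 * r" using \<delta> r by (intro mult_right_mono) auto
      finally have "dist (x + r *\<^sub>R h) y < 1/2 * r" .
      moreover have "dist x (x + r *\<^sub>R h) = 1/2 * r" using h r by (simp add: dist_norm)
      ultimately have "dist x y < r" using dist_triangle[of x y "x + r *\<^sub>R h"] by linarith
      then show "y \<in> ball x r" by simp
    qed
    have low: "norm (H *v h) / 2 * indicator ?B y \<le> norm (H *v (y - x)) / r" for y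
    proof (cases "y \<in> ?B")
      case True
      have "H *v (y - x) = H *v (r *\<^sub>R h + (y - x - r *\<^sub>R h))" by simp
      also have "\<dots> = r *\<^sub>R (H *v h) + H *v (y - x - r *\<^sub>R h)"
        by (simp only: matrix_vector_right_distrib matrix_vector_mult_scaleR)
      finally have "H *v (y - x) = r *\<^sub>R (H *v h) + H *v (y - x - r *\<^sub>R h)" .
      then have "norm (H *v (y - x)) \<ge> norm (r *\<^sub>R (H *v h)) - norm (H *v (y - x - r *\<^sub>R h))"
        by (metis norm_diff_ineq)
      moreover have "norm (H *v (y - x - r *\<^sub>R h)) \<le> M * (\<delta> * r)"
      proof -
        have "norm (H *v (y - x - r *\<^sub>R h)) \<le> onorm ((*v) H) * norm (y - x - r *\<^sub>R h)"
          by (rule norm_matrix_vector_mult_le)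
        also have "\<dots> \<le> M * (\<delta> * r)"
        proof (rule mult_mono)
          show "norm (y - x - r *\<^sub>R h) \<le> \<delta> * r"
            using True by (simp add: dist_norm norm_minus_commute diff_diff_eq)
        qed (use M in \<open>auto simp: M_def\<close>)
        finally show ?thesis .
      qed
      moreover have "M * (\<delta> * r) \<le> norm (H *v h) / 2 * r"
        using mult_right_mono[OF \<delta>(3), of r] r by (simp add: mult.assoc)
      moreover have "norm (r *\<^sub>R (H *v h)) = 2 * (norm (H *v h) / 2 * r)" using r by simp
      ultimately have "norm (H *v (y - x)) \<ge> norm (H *v h) / 2 * r" by linarith
      then show ?thesis using True r by (simp add: field_simps)
    next
      case False
      then show ?thesis using r by simp
    qed
    have "c = ball_average (\<lambda>y. norm (H *v h) / 2 * indicator ?B y) x r"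
    proof -
      have "set_lebesgue_integral lebesgue (ball x r) (\<lambda>y. indicator ?B y) = measure lebesgue ?B"
      proof -
        have "(\<lambda>y. indicator (ball x r) y *\<^sub>R indicator ?B y) = (indicator ?B :: _ \<Rightarrow> real)"
          using sub by (auto simp: indicator_def fun_eq_iff)
        then show ?thesis by (simp add: set_lebesgue_integral_def)
      qed
      moreover obtain V where "unit_ball_vol (real CARD('n)) = V" "V > 0"
        using unit_ball_vol_pos[of "real CARD('n)"] by simp
      ultimately show ?thesis
        using r \<delta> by (simp add: ball_average_def c_def content_ball power_mult_distrib)
    qed
    also have "\<dots> \<le> ball_average (\<lambda>y. norm (H *v (y - x)) / r) x r"
    proof (rule ball_average_mono)
      have "norm (H *v (y - x)) / r \<le> M" if "y \<in> ball x r" for y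
      proof -
        have "norm (H *v (y - x)) \<le> onorm ((*v) H) * norm (y - x)" by (rule norm_matrix_vector_mult_le)
        also have "\<dots> \<le> M * r"
          using that M by (intro mult_mono) (auto simp: M_def dist_norm norm_minus_commute)
        finally show ?thesis using r by (simp add: field_simps)
      qed
      moreover have "(\<lambda>y. norm (H *v (y - x)) / r) \<in> borel_measurable borel"
        by (intro borel_measurable_continuous_onI continuous_intros continuous_on_matrix_vector_mult) (use r in auto)
      ultimately show "set_integrable lebesgue (ball x r) (\<lambda>y. norm (H *v (y - x)) / r)"
        using r by (intro set_integrable_lebesgue_ball_bounded[where C = M]) auto
    qed (use low in auto)
    finally show ?thesis .
  qed
  ultimately show thesis using that by blast
qed

lemma borel_measurable_affine_diff [measurable]:
  fixes G :: "real^'n^'m"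
  assumes [measurable]: "u \<in> borel_measurable borel"
  shows "(\<lambda>y. u y - z - G *v (y - x)) \<in> borel_measurable borel"
proof -
  have "(\<lambda>y. G *v (y - x)) \<in> borel_measurable borel"
    by (intro borel_measurable_continuous_onI continuous_intros continuous_on_matrix_vector_mult)
  then show ?thesis by measurable
qed

section \<open>Approximate limits and gradients of functions bounded by 1\<close>

context
  fixes u :: "real^'n \<Rightarrow> real^'m"
  assumes um [measurable]: "u \<in> borel_measurable borel" and u1: "\<And>y. norm (u y) \<le> 1"
begin

lemma integrable_norm_diff: "set_integrable lebesgue (ball x r) (\<lambda>y. norm (u y - z))"
proof (rule set_integrable_lebesgue_ball_bounded)
  show "norm (norm (u y - z)) \<le> 1 + norm z" for y
    using u1[of y] norm_triangle_ineq4[of "u y" z] by simp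
qed measurable

lemma integrable_norm_affine_diff: "set_integrable lebesgue (ball x r) (\<lambda>y. norm (u y - z - G *v (y - x)) / s)"
proof (rule set_integrable_lebesgue_ball_bounded)
  fix y assume y: "y \<in> ball x r"
  have "norm (u y - z - G *v (y - x)) \<le> norm (u y) + norm z + norm (G *v (y - x))"
    by (metis (no_types, lifting) add_mono_thms_linordered_semiring(3) norm_triangle_ineq4 order_trans)
  also have "\<dots> \<le> 1 + norm z + onorm ((*v) G) * r"
  proof -
    have "norm (G *v (y - x)) \<le> onorm ((*v) G) * norm (y - x)" by (rule norm_matrix_vector_mult_le)
    also have "\<dots> \<le> onorm ((*v) G) * r"
      using y by (intro mult_left_mono onorm_pos_le matrix_vector_mul_bounded_linear) (auto simp: dist_norm norm_minus_commute)
    finally show ?thesis using u1[of y] by simp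
  qed
  finally show "norm (norm (u y - z - G *v (y - x)) / s) \<le> (1 + norm z + onorm ((*v) G) * r) / \<bar>s\<bar>"
    by (simp add: divide_right_mono)
qed measurable

lemma has_approx_limit_unique:
  assumes "has_approx_limit u x z" "has_approx_limit u x z'"
  shows "z = z'"
proof -
  have "((\<lambda>r. ball_average (\<lambda>y. norm (u y - z)) x r + ball_average (\<lambda>y. norm (u y - z')) x r) \<longlongrightarrow> 0 + 0) (at_right 0)"
    using assms unfolding has_approx_limit_def by (rule tendsto_add)
  moreover have "norm (z - z') \<le> ball_average (\<lambda>y. norm (u y - z)) x r + ball_average (\<lambda>y. norm (u y - z')) x r"
    if "r > 0" for r
  proof -
    have "norm (z - z') = ball_average (\<lambda>y. norm (z - z')) x r" using that by (simp add: ball_average_const)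
    also have "\<dots> \<le> ball_average (\<lambda>y. norm (u y - z) + norm (u y - z')) x r"
    proof (rule ball_average_mono)
      show "set_integrable lebesgue (ball x r) (\<lambda>y. norm (u y - z) + norm (u y - z'))"
        by (intro set_integral_add integrable_norm_diff)
      have "norm (z - z') \<le> norm (u y - z) + norm (u y - z')" for y
        using norm_triangle_ineq4[of "u y - z'" "u y - z"] by simp
      then show "AE y in lebesgue. y \<in> ball x r \<longrightarrow> 0 \<le> norm (z - z') \<and> norm (z - z') \<le> norm (u y - z) + norm (u y - z')"
        by (intro AE_I2) simp
    qed
    also have "\<dots> = ball_average (\<lambda>y. norm (u y - z)) x r + ball_average (\<lambda>y. norm (u y - z')) x r"
      by (intro ball_average_add integrable_norm_diff)
    finally show ?thesis .
  qed
  ultimately have "norm (z - z') \<le> 0"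
    by (intro tendsto_lowerbound[where F = "at_right (0::real)"]) (auto intro: eventually_mono[OF eventually_at_right_less[of 0]])
  then show ?thesis by simp
qed

text \<open>The limits \<open>z\<close> agree first. Then two different gradients would make the
  average of \<open>norm ((G - G') *v (y - x)) / r\<close> tend to 0, contrary to the lower bound
  for a nonzero matrix.\<close>

lemma has_approx_gradient_unique:
  assumes "has_approx_gradient u x G" "has_approx_gradient u x G'"
  shows "G = G'"
proof (rule ccontr)
  assume "G \<noteq> G'"
  then have "G - G' \<noteq> 0" by simp
  then obtain c where c: "c > 0" "\<And>x r. r > 0 \<Longrightarrow> c \<le> ball_average (\<lambda>y. norm ((G - G') *v (y - x)) / r) x r"
    using ball_average_norm_matrix_lower by blast
  obtain z z' where z: "has_approx_limit u x z"
      "((\<lambda>r. ball_average (\<lambda>y. norm (u y - z - G *v (y - x)) / r) x r) \<longlongrightarrow> 0) (at_right 0)"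
    and z': "has_approx_limit u x z'"
      "((\<lambda>r. ball_average (\<lambda>y. norm (u y - z' - G' *v (y - x)) / r) x r) \<longlongrightarrow> 0) (at_right 0)"
    using assms unfolding has_approx_gradient_def by blast
  have "z' = z" by (rule has_approx_limit_unique[OF z'(1) z(1)])
  note z'' = z'(2)[unfolded this]
  have "((\<lambda>r. ball_average (\<lambda>y. norm (u y - z - G *v (y - x)) / r) x r +
      ball_average (\<lambda>y. norm (u y - z - G' *v (y - x)) / r) x r) \<longlongrightarrow> 0 + 0) (at_right 0)"
    using z(2) z'' by (rule tendsto_add)
  moreover have "c \<le> ball_average (\<lambda>y. norm (u y - z - G *v (y - x)) / r) x r +
      ball_average (\<lambda>y. norm (u y - z - G' *v (y - x)) / r) x r" if r: "r > 0" for r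
  proof -
    have "c \<le> ball_average (\<lambda>y. norm ((G - G') *v (y - x)) / r) x r" using c r by simp
    also have "\<dots> \<le> ball_average (\<lambda>y. norm (u y - z - G *v (y - x)) / r + norm (u y - z - G' *v (y - x)) / r) x r"
    proof (rule ball_average_mono)
      show "set_integrable lebesgue (ball x r) (\<lambda>y. norm (u y - z - G *v (y - x)) / r + norm (u y - z - G' *v (y - x)) / r)"
        by (intro set_integral_add integrable_norm_affine_diff)
      have "norm ((G - G') *v (y - x)) / r \<le> norm (u y - z - G *v (y - x)) / r + norm (u y - z - G' *v (y - x)) / r" for y
      proof -
        have "norm ((G - G') *v (y - x)) \<le> norm (u y - z - G *v (y - x)) + norm (u y - z - G' *v (y - x))"
          using norm_triangle_ineq4[of "u y - z - G' *v (y - x)" "u y - z - G *v (y - x)"]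
          by (simp add: matrix_vector_mult_diff_rdistrib)
        then show ?thesis using r by (simp add: divide_right_mono flip: add_divide_distrib)
      qed
      then show "AE y in lebesgue. y \<in> ball x r \<longrightarrow> 0 \<le> norm ((G - G') *v (y - x)) / r \<and> norm ((G - G') *v (y - x)) / r \<le>
         norm (u y - z - G *v (y - x)) / r + norm (u y - z - G' *v (y - x)) / r"
        using r by (intro AE_I2) simp
    qed
    also have "\<dots> = ball_average (\<lambda>y. norm (u y - z - G *v (y - x)) / r) x r +
        ball_average (\<lambda>y. norm (u y - z - G' *v (y - x)) / r) x r"
      by (intro ball_average_add integrable_norm_affine_diff)
    finally show ?thesis .
  qed
  ultimately have "c \<le> 0"
    by (intro tendsto_lowerbound[where F = "at_right (0::real)"]) (auto intro: eventually_mono[OF eventually_at_right_less[of 0]])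
  then show False using c by simp
qed

lemma approx_gradient_eqI: "has_approx_gradient u x G \<Longrightarrow> approx_gradient u x = G"
  unfolding approx_gradient_def by (blast intro: the_equality has_approx_gradient_unique)

text \<open>Where \<open>u y\<close> is within \<open>d\<close> of \<open>z\<close> the continuity
  of \<open>F\<close> applies; elsewhere the bound on \<open>F\<close> is paid for by
  \<open>norm (u y - z) \<ge> d\<close>, as in Chebyshev's inequality.\<close>

lemma has_approx_limit_compose:
  fixes F :: "real^'n \<Rightarrow> real^'m \<Rightarrow> real^'k"
  assumes z: "has_approx_limit u x z"
    and C: "\<And>y q. norm q \<le> 1 \<Longrightarrow> norm (F y q) \<le> C"
    and cont: "\<And>e. e > 0 \<Longrightarrow> \<exists>d>0. \<forall>y q. dist y x < d \<and> dist q z < d \<and> norm q \<le> 1 \<longrightarrow> norm (F y q - F x z) \<le> e"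
  shows "has_approx_limit (\<lambda>y. F y (u y)) x (F x z)"
  unfolding has_approx_limit_def
proof (rule tendstoI)
  fix e :: real assume e: "e > 0"
  obtain d where d: "d > 0" "\<And>y q. dist y x < d \<Longrightarrow> dist q z < d \<Longrightarrow> norm q \<le> 1 \<Longrightarrow> norm (F y q - F x z) \<le> e / 2"
    using cont[of "e / 2"] e by auto
  \<comment> \<open>Chosen so that \<open>K * d\<close> dominates
    \<open>norm (F y (u y) - F x z)\<close>; the added 1 keeps \<open>K\<close> positive.\<close>
  define K where "K = (\<bar>C\<bar> + norm (F x z) + 1) / d"
  have K: "K > 0" using d by (auto simp: K_def intro!: divide_pos_pos add_nonneg_pos)
  have bd: "norm (F y (u y) - F x z) \<le> e / 2 + K * norm (u y - z)" if y: "dist y x < d" for y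
  proof (cases "norm (u y - z) < d")
    case True
    then have "norm (F y (u y) - F x z) \<le> e / 2" using d(2)[OF y, of "u y"] u1 by (simp add: dist_norm)
    then show ?thesis using K by (smt (verit) mult_nonneg_nonneg norm_ge_zero)
  next
    case False
    have "norm (F y (u y) - F x z) \<le> \<bar>C\<bar> + norm (F x z) + 1"
      using norm_triangle_ineq4[of "F y (u y)" "F x z"] C[OF u1, of y y] by linarith
    also have "\<dots> = K * d" using d by (simp add: K_def)
    also have "\<dots> \<le> K * norm (u y - z)" using False K by (intro mult_left_mono) auto
    finally show ?thesis using e by linarith
  qed
  have "eventually (\<lambda>r. dist (ball_average (\<lambda>y. norm (u y - z)) x r) 0 < e / (2 * K)) (at_right 0)"
    using z e K unfolding has_approx_limit_def by (intro tendstoD) auto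
  moreover have "eventually (\<lambda>r. r > 0 \<and> r < d) (at_right 0)"
    using d by (auto simp: eventually_at_right_field intro!: exI[of _ d])
  ultimately show "eventually (\<lambda>r. dist (ball_average (\<lambda>y. norm (F y (u y) - F x z)) x r) 0 < e) (at_right 0)"
  proof eventually_elim
    case (elim r)
    have "ball_average (\<lambda>y. norm (F y (u y) - F x z)) x r \<le> ball_average (\<lambda>y. e / 2 + K * norm (u y - z)) x r"
    proof (rule ball_average_mono)
      show "set_integrable lebesgue (ball x r) (\<lambda>y. e / 2 + K * norm (u y - z))"
        by (intro set_integral_add set_integrable_ball_const set_integrable_mult_right integrable_norm_diff)
      show "AE y in lebesgue. y \<in> ball x r \<longrightarrow> 0 \<le> norm (F y (u y) - F x z) \<and> norm (F y (u y) - F x z) \<le> e / 2 + K * norm (u y - z)"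
        using bd elim by (intro AE_I2) (auto simp: dist_commute)
    qed
    also have "\<dots> = e / 2 + K * ball_average (\<lambda>y. norm (u y - z)) x r"
      using elim by (subst ball_average_add)
        (auto intro: set_integrable_ball_const set_integrable_mult_right integrable_norm_diff simp: ball_average_const ball_average_cmult)
    also have "K * ball_average (\<lambda>y. norm (u y - z)) x r < e / 2"
    proof -
      have "ball_average (\<lambda>y. norm (u y - z)) x r < e / (2 * K)"
        using elim(1) unfolding dist_real_def by linarith
      then show ?thesis using mult_strict_left_mono[OF _ K] K by fastforce
    qed
    finally show ?case
      using ball_average_nonneg[of "\<lambda>y. norm (F y (u y) - F x z)" x r] by (simp add: dist_real_def)
  qed
qed

text \<open>The splitting used for limits, applied to the remainder of the linearisation of
  \<open>F\<close>. Far from \<open>z\<close> this remainder is only bounded, but there the affine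
  error of \<open>u\<close> is at least \<open>d / 2\<close>, so the bound is absorbed by a multiple
  of that error.\<close>

lemma has_approx_gradient_compose:
  fixes F :: "real^'n \<Rightarrow> real^'m \<Rightarrow> real^'k"
  assumes z: "has_approx_limit u x z"
      "((\<lambda>r. ball_average (\<lambda>y. norm (u y - z - G *v (y - x)) / r) x r) \<longlongrightarrow> 0) (at_right 0)"
    and C: "\<And>y q. norm q \<le> 1 \<Longrightarrow> norm (F y q) \<le> C"
    and bl: "bounded_linear FX" "bounded_linear FP"
    and diff: "\<And>e. e > 0 \<Longrightarrow> \<exists>d>0. \<forall>y q. dist y x < d \<and> dist q z < d \<and> norm q \<le> 1 \<longrightarrow>
        norm (F y q - F x z - FX (y - x) - FP (q - z)) \<le> e * (norm (y - x) + norm (q - z))"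
  shows "has_approx_gradient (\<lambda>y. F y (u y)) x (matrix (\<lambda>h. FX h + FP (G *v h)))"
proof -
  let ?H = "matrix (\<lambda>h. FX h + FP (G *v h))"
  have H: "?H *v h = FX h + FP (G *v h)" for h
  proof -
    have "bounded_linear (\<lambda>h. FX h + FP (G *v h))"
      by (intro bounded_linear_add bl(1) bounded_linear_compose[OF bl(2)] matrix_vector_mul_bounded_linear)
    then show ?thesis by (rule matrix_of_bounded_linear)
  qed
  obtain K1 where K1: "K1 > 0" "\<And>h. norm (FX h) \<le> norm h * K1" using bounded_linear.pos_bounded[OF bl(1)] by blast
  obtain K2 where K2: "K2 > 0" "\<And>h. norm (FP h) \<le> norm h * K2" using bounded_linear.pos_bounded[OF bl(2)] by blast
  define g where "g = onorm ((*v) G)"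
  have g: "g \<ge> 0" unfolding g_def by (rule onorm_pos_le[OF matrix_vector_mul_bounded_linear])
  have Gn: "norm (G *v h) \<le> g * norm h" for h unfolding g_def by (rule norm_matrix_vector_mult_le)
  have "has_approx_limit (\<lambda>y. F y (u y)) x (F x z)"
  proof (rule has_approx_limit_compose[OF z(1)])
    show "norm (F y q) \<le> C" if "norm q \<le> 1" for y q using C that .
    fix e :: real assume e: "e > 0"
    obtain d where d: "d > 0" "\<And>y q. dist y x < d \<Longrightarrow> dist q z < d \<Longrightarrow> norm q \<le> 1 \<Longrightarrow>
        norm (F y q - F x z - FX (y - x) - FP (q - z)) \<le> 1 * (norm (y - x) + norm (q - z))"
      using diff[of 1] by auto
    define d' where "d' = min d (e / (2 + K1 + K2))"
    have d': "d' > 0" "d' \<le> d" "(2 + K1 + K2) * d' \<le> e"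
    proof -
      show "d' > 0" "d' \<le> d" using d e K1 K2 by (auto simp: d'_def)
      have "d' \<le> e / (2 + K1 + K2)" by (simp add: d'_def)
      then show "(2 + K1 + K2) * d' \<le> e" using K1 K2 by (simp add: field_simps)
    qed
    have "norm (F y q - F x z) \<le> e" if y: "dist y x < d'" "dist q z < d'" "norm q \<le> 1" for y q
    proof -
      have "norm (F y q - F x z) = norm ((F y q - F x z - FX (y - x) - FP (q - z)) + FX (y - x) + FP (q - z))" by simp
      also have "\<dots> \<le> norm (F y q - F x z - FX (y - x) - FP (q - z)) + norm (FX (y - x)) + norm (FP (q - z))"
        by (meson add_mono norm_triangle_ineq order_refl order_trans)
      also have "\<dots> \<le> (norm (y - x) + norm (q - z)) + norm (y - x) * K1 + norm (q - z) * K2"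
        using d(2)[of y q] y d' K1 K2 by (intro add_mono) auto
      also have "\<dots> \<le> (d' + d') + d' * K1 + d' * K2"
        using y K1 K2 by (intro add_mono mult_right_mono) (auto simp: dist_norm)
      also have "\<dots> \<le> e" using d'(3) by (simp add: algebra_simps)
      finally show ?thesis .
    qed
    then show "\<exists>d>0. \<forall>y q. dist y x < d \<and> dist q z < d \<and> norm q \<le> 1 \<longrightarrow> norm (F y q - F x z) \<le> e"
      using d'(1) by blast
  qed
  moreover have "((\<lambda>r. ball_average (\<lambda>y. norm (F y (u y) - F x z - ?H *v (y - x)) / r) x r) \<longlongrightarrow> 0) (at_right 0)"
  proof (rule tendstoI)
    fix e' :: real assume e': "e' > 0"
    \<comment> \<open>The factor \<open>1 + g\<close> collects the contributions of
      \<open>y - x\<close> and of \<open>G *v (y - x)\<close> to the first order error.\<close>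
    define e where "e = e' / (2 * (1 + g))"
    have e: "e > 0" "e * (1 + g) = e' / 2" using e' g by (auto simp: e_def field_simps)
    obtain d where d: "d > 0" "\<And>y q. dist y x < d \<Longrightarrow> dist q z < d \<Longrightarrow> norm q \<le> 1 \<Longrightarrow>
        norm (F y q - F x z - FX (y - x) - FP (q - z)) \<le> e * (norm (y - x) + norm (q - z))"
      using diff[OF e(1)] by auto
    define C2 where "C2 = \<bar>C\<bar> + norm (F x z) + K1 + (1 + norm z) * K2"
    define M where "M = e + 2 * C2 / d + K2"
    have C2: "C2 > 0"
      unfolding C2_def using K1(1) K2(1)
      by (intro add_pos_nonneg add_nonneg_pos mult_nonneg_nonneg add_nonneg_nonneg) auto
    have M: "M > 0" using e C2 d K2 by (auto simp: M_def intro!: add_pos_pos divide_pos_pos)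
    \<comment> \<open>Small enough that, in the far case, \<open>G *v (y - x)\<close> accounts for
      at most half of the distance \<open>d\<close> between \<open>u y\<close> and
      \<open>z\<close>.\<close>
    define r0 where "r0 = min (min d 1) (d / (2 * (1 + g)))"
    have r0: "r0 > 0" "r0 \<le> d" "r0 \<le> 1" "g * r0 \<le> d / 2"
    proof -
      show "r0 > 0" "r0 \<le> d" "r0 \<le> 1" using d g by (auto simp: r0_def)
      have "r0 \<le> d / (2 * (1 + g))" by (simp add: r0_def)
      then have "(1 + g) * r0 \<le> d / 2" using g by (simp add: field_simps)
      then show "g * r0 \<le> d / 2" using \<open>r0 > 0\<close> by (simp add: algebra_simps)
    qed
    have bd: "norm (F y (u y) - F x z - ?H *v (y - x)) / r \<le> e' / 2 + M * (norm (u y - z - G *v (y - x)) / r)"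
      if r: "0 < r" "r < r0" and y: "dist x y < r" for y r
    proof -
      let ?p = "norm (u y - z - G *v (y - x))"
      have yx: "norm (y - x) < r" using y by (simp add: dist_norm norm_minus_commute)
      have Gr: "norm (G *v (y - x)) \<le> g * r"
        using Gn[of "y - x"] mult_left_mono[OF less_imp_le[OF yx] g] by linarith
      have uz: "norm (u y - z) \<le> ?p + g * r"
        using norm_triangle_ineq[of "u y - z - G *v (y - x)" "G *v (y - x)"] Gr by simp
      let ?rem = "F y (u y) - F x z - FX (y - x) - FP (u y - z)"
      have rem: "norm ?rem \<le> e * (1 + g) * r + (e + 2 * C2 / d) * ?p"
      proof (cases "norm (u y - z) < d")
        case True
        then have "norm ?rem \<le> e * (norm (y - x) + norm (u y - z))"
          using d(2)[of y "u y"] u1 r r0 yx by (simp add: dist_norm)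
        also have "\<dots> \<le> e * (r + (?p + g * r))" using yx uz e by (intro mult_left_mono add_mono) auto
        also have "\<dots> = e * (1 + g) * r + e * ?p" by (simp add: algebra_simps)
        also have "\<dots> \<le> e * (1 + g) * r + (e + 2 * C2 / d) * ?p"
          using C2 d by (intro add_left_mono mult_right_mono) auto
        finally show ?thesis .
      next
        case False
        have "g * r \<le> g * r0" using r g by (intro mult_left_mono) auto
        then have p: "?p \<ge> d / 2" using uz False r0 by linarith
        have "norm ?rem \<le> norm (F y (u y)) + norm (F x z) + norm (FX (y - x)) + norm (FP (u y - z))"
          by (meson add_mono norm_triangle_ineq4 order_refl order_trans)
        also have "\<dots> \<le> \<bar>C\<bar> + norm (F x z) + K1 + (1 + norm z) * K2"
        proof (intro add_mono)
          show "norm (F y (u y)) \<le> \<bar>C\<bar>" using C[OF u1, of y y] by linarith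
          have "norm (y - x) * K1 \<le> 1 * K1" using yx r r0 K1 by (intro mult_right_mono) auto
          then show "norm (FX (y - x)) \<le> K1" using K1(2)[of "y - x"] by linarith
          have "norm (u y - z) * K2 \<le> (1 + norm z) * K2"
            using K2 u1[of y] norm_triangle_ineq4[of "u y" z] by (intro mult_right_mono) auto
          then show "norm (FP (u y - z)) \<le> (1 + norm z) * K2" using K2(2)[of "u y - z"] by linarith
        qed auto
        also have "\<dots> = 2 * C2 / d * (d / 2)" using d by (simp add: C2_def)
        also have "\<dots> \<le> 2 * C2 / d * ?p" using p C2 d by (intro mult_left_mono) auto
        also have "\<dots> \<le> e * (1 + g) * r + (e + 2 * C2 / d) * ?p"
        proof -
          have "0 \<le> e * (1 + g) * r" "0 \<le> e * ?p" using e g r by simp_all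
          then show ?thesis by (simp add: distrib_right)
        qed
        finally show ?thesis .
      qed
      interpret FP: bounded_linear FP by fact
      have "F y (u y) - F x z - ?H *v (y - x) = ?rem + FP (u y - z - G *v (y - x))"
        by (simp only: H FP.diff[of "u y - z"]) simp
      then have "norm (F y (u y) - F x z - ?H *v (y - x)) \<le> norm ?rem + norm (FP (u y - z - G *v (y - x)))"
        by (simp only: norm_triangle_ineq)
      also have "\<dots> \<le> (e * (1 + g) * r + (e + 2 * C2 / d) * ?p) + ?p * K2"
        using rem K2 by (intro add_mono) auto
      also have "\<dots> = (e * (1 + g)) * r + M * ?p" by (simp add: M_def algebra_simps)
      also have "\<dots> = e' / 2 * r + M * ?p" by (simp only: e(2))
      finally show ?thesis using r by (simp add: field_simps)
    qed
    have "eventually (\<lambda>r. dist (ball_average (\<lambda>y. norm (u y - z - G *v (y - x)) / r) x r) 0 < e' / (2 * M)) (at_right 0)"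
      using z(2) e' M by (intro tendstoD) auto
    moreover have "eventually (\<lambda>r. r > 0 \<and> r < r0) (at_right 0)"
      using r0 by (auto simp: eventually_at_right_field intro!: exI[of _ r0])
    ultimately show "eventually (\<lambda>r. dist (ball_average (\<lambda>y. norm (F y (u y) - F x z - ?H *v (y - x)) / r) x r) 0 < e') (at_right 0)"
    proof eventually_elim
      case (elim r)
      have "ball_average (\<lambda>y. norm (F y (u y) - F x z - ?H *v (y - x)) / r) x r \<le>
          ball_average (\<lambda>y. e' / 2 + M * (norm (u y - z - G *v (y - x)) / r)) x r"
      proof (rule ball_average_mono)
        show "set_integrable lebesgue (ball x r) (\<lambda>y. e' / 2 + M * (norm (u y - z - G *v (y - x)) / r))"
          by (intro set_integral_add set_integrable_ball_const set_integrable_mult_right integrable_norm_affine_diff)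
        show "AE y in lebesgue. y \<in> ball x r \<longrightarrow> 0 \<le> norm (F y (u y) - F x z - ?H *v (y - x)) / r \<and>
           norm (F y (u y) - F x z - ?H *v (y - x)) / r \<le> e' / 2 + M * (norm (u y - z - G *v (y - x)) / r)"
          using bd elim by (intro AE_I2) auto
      qed
      also have "\<dots> = e' / 2 + M * ball_average (\<lambda>y. norm (u y - z - G *v (y - x)) / r) x r"
        using elim by (subst ball_average_add)
          (auto intro: set_integrable_ball_const set_integrable_mult_right integrable_norm_affine_diff
            simp only: ball_average_const ball_average_cmult)
      also have "M * ball_average (\<lambda>y. norm (u y - z - G *v (y - x)) / r) x r < e' / 2"
      proof -
        have "ball_average (\<lambda>y. norm (u y - z - G *v (y - x)) / r) x r < e' / (2 * M)"
          using elim(1) unfolding dist_real_def by linarith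
        then show ?thesis using mult_strict_left_mono[OF _ M] M by fastforce
      qed
      finally show ?case
        using ball_average_nonneg[of "\<lambda>y. norm (F y (u y) - F x z - ?H *v (y - x)) / r" x r] elim by (simp add: dist_real_def)
    qed
  qed
  ultimately show ?thesis unfolding has_approx_gradient_def by blast
qed

end

text \<open>For small radii the averages see only points of \<open>\<Omega>\<close>. The equivalence
  holds at every point of \<open>\<Omega>\<close>, so discontinuity set and approximate gradient do
  not depend on the representative.\<close>

lemma has_approx_cong_AE:
  fixes u u' :: "real^'n \<Rightarrow> real^'m"
  assumes \<Omega>: "open \<Omega>" "x \<in> \<Omega>" and ae: "AE y in lebesgue. y \<in> \<Omega> \<longrightarrow> u y = u' y"
    and um [measurable]: "u' \<in> borel_measurable borel"
  shows "has_approx_limit u x z \<longleftrightarrow> has_approx_limit u' x z"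
    "has_approx_gradient u x G \<longleftrightarrow> has_approx_gradient u' x G"
proof -
  obtain d where d: "d > 0" "ball x d \<subseteq> \<Omega>" using \<Omega> open_contains_ball by blast
  have cong: "ball_average (\<lambda>y. f r y (u y)) x r = ball_average (\<lambda>y. f r y (u' y)) x r"
    if "r < d" "(\<lambda>y. f r y (u' y)) \<in> borel_measurable borel" for r and f :: "real \<Rightarrow> real^'n \<Rightarrow> real^'m \<Rightarrow> real"
  proof (rule ball_average_cong_AE[symmetric])
    show "AE y in lebesgue. y \<in> ball x r \<longrightarrow> f r y (u' y) = f r y (u y)"
      using ae by eventually_elim (use d that subset_ball[of r d x] in auto)
    show "set_borel_measurable lebesgue (ball x r) (\<lambda>y. f r y (u' y))"
      unfolding set_borel_measurable_def
      by (rule measurable_completion, intro borel_measurable_scaleR borel_measurable_indicator) (use that in auto)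
  qed
  have ev: "eventually (\<lambda>r. r < d) (at_right 0)" using d by (auto simp: eventually_at_right_field intro!: exI[of _ d])
  show lim: "has_approx_limit u x z \<longleftrightarrow> has_approx_limit u' x z" for z
    unfolding has_approx_limit_def
    by (rule tendsto_cong, rule eventually_mono[OF ev]) (rule cong[of _ "\<lambda>r y v. norm (v - z)"], auto)
  have "((\<lambda>r. ball_average (\<lambda>y. norm (u y - z - G *v (y - x)) / r) x r) \<longlongrightarrow> 0) (at_right 0) \<longleftrightarrow>
     ((\<lambda>r. ball_average (\<lambda>y. norm (u' y - z - G *v (y - x)) / r) x r) \<longlongrightarrow> 0) (at_right 0)" for z
    by (rule tendsto_cong, rule eventually_mono[OF ev]) (rule cong[of _ "\<lambda>r y v. norm (v - z - G *v (y - x)) / r"], auto)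
  then show "has_approx_gradient u x G \<longleftrightarrow> has_approx_gradient u' x G"
    unfolding has_approx_gradient_def lim by blast
qed

lemma approx_gradient_cong_AE:
  fixes u u' :: "real^'n \<Rightarrow> real^'m"
  assumes "open \<Omega>" "x \<in> \<Omega>" "AE y in lebesgue. y \<in> \<Omega> \<longrightarrow> u y = u' y" "u' \<in> borel_measurable borel"
  shows "approx_gradient u x = approx_gradient u' x"
  unfolding approx_gradient_def by (rule arg_cong[where f = The], rule ext, rule has_approx_cong_AE(2)[OF assms])

lemma approx_disc_set_cong_AE:
  fixes u u' :: "real^'n \<Rightarrow> real^'m"
  assumes "open \<Omega>" "AE y in lebesgue. y \<in> \<Omega> \<longrightarrow> u y = u' y" "u' \<in> borel_measurable borel"
  shows "approx_disc_set \<Omega> u = approx_disc_set \<Omega> u'"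
  unfolding approx_disc_set_def using has_approx_cong_AE(1)[OF assms(1) _ assms(2,3)] by auto

lemma has_approx_limit_lebesgue_point:
  fixes u :: "real^'n \<Rightarrow> real^'m"
  assumes um [measurable]: "u \<in> borel_measurable borel" and u1: "\<And>y. norm (u y) \<le> 1"
    and lp: "\<And>i. lebesgue_point (\<lambda>y. u y $ i) x"
  shows "has_approx_limit u x (u x)"
  unfolding has_approx_limit_def
proof (rule tendsto_sandwich[OF _ _ tendsto_const])
  show "((\<lambda>r. \<Sum>i\<in>UNIV. ball_average (\<lambda>y. \<bar>u y $ i - u x $ i\<bar>) x r) \<longlongrightarrow> 0) (at_right 0)"
    by (rule tendsto_null_sum) (use lp in \<open>simp add: lebesgue_point_def\<close>)
  show "eventually (\<lambda>r. 0 \<le> ball_average (\<lambda>y. norm (u y - u x)) x r) (at_right 0)"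
    by (intro always_eventually allI ball_average_nonneg) auto
  have int: "set_integrable lebesgue (ball x r) (\<lambda>y. \<bar>u y $ i - u x $ i\<bar>)" for r i
  proof (rule set_integrable_lebesgue_ball_bounded)
    show "norm \<bar>u y $ i - u x $ i\<bar> \<le> 2" for y
      using component_le_norm_cart[of "u y" i] component_le_norm_cart[of "u x" i] u1[of x] u1[of y] by simp
  qed measurable
  have "ball_average (\<lambda>y. norm (u y - u x)) x r \<le> (\<Sum>i\<in>UNIV. ball_average (\<lambda>y. \<bar>u y $ i - u x $ i\<bar>) x r)" for r
  proof -
    have "ball_average (\<lambda>y. norm (u y - u x)) x r \<le> ball_average (\<lambda>y. \<Sum>i\<in>UNIV. \<bar>u y $ i - u x $ i\<bar>) x r"
    proof (rule ball_average_mono)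
      show "set_integrable lebesgue (ball x r) (\<lambda>y. \<Sum>i\<in>UNIV. \<bar>u y $ i - u x $ i\<bar>)"
        using int unfolding set_integrable_def scaleR_sum_right by (intro Bochner_Integration.integrable_sum) auto
      show "AE y in lebesgue. y \<in> ball x r \<longrightarrow> 0 \<le> norm (u y - u x) \<and> norm (u y - u x) \<le> (\<Sum>i\<in>UNIV. \<bar>u y $ i - u x $ i\<bar>)"
        using norm_le_l1_cart[of "u y - u x" for y] by (intro AE_I2) simp
    qed
    also have "\<dots> = (\<Sum>i\<in>UNIV. ball_average (\<lambda>y. \<bar>u y $ i - u x $ i\<bar>) x r)"
      by (rule ball_average_sum[OF int])
    finally show ?thesis .
  qed
  then show "eventually (\<lambda>r. ball_average (\<lambda>y. norm (u y - u x)) x r \<le> (\<Sum>i\<in>UNIV. ball_average (\<lambda>y. \<bar>u y $ i - u x $ i\<bar>) x r)) (at_right 0)"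
    by (intro always_eventually allI)
qed

section \<open>Approximate differentiability\<close>

definition mollifier_deriv :: "real \<Rightarrow> real^'n \<Rightarrow> real^'n \<Rightarrow> real" where
  "mollifier_deriv d x = frechet_derivative (mollifier d) (at x)"

definition mollify_deriv :: "real \<Rightarrow> (real^'n \<Rightarrow> real) \<Rightarrow> real^'n \<Rightarrow> real^'n \<Rightarrow> real" where
  "mollify_deriv d f x h = (LINT y|lborel. mollifier_deriv d (x - y) h * f y)"

lemma
  fixes x h :: "real^'n"
  shows has_derivative_mollifier: "(mollifier d has_derivative mollifier_deriv d x) (at x)"
  and continuous_on_mollifier_deriv: "continuous_on UNIV (\<lambda>x. mollifier_deriv d x h)"
proof -
  obtain \<rho>' where \<rho>': "\<And>x::real^'n. (mollifier d has_derivative \<rho>' x) (at x)" "\<And>h. continuous_on UNIV (\<lambda>x. \<rho>' x h)"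
    using Ck_mollifier[of "Suc 0" d] by auto
  have eq: "mollifier_deriv d x = \<rho>' x" for x :: "real^'n"
    unfolding mollifier_deriv_def using frechet_derivative_at[OF \<rho>'(1)] by simp
  show "(mollifier d has_derivative mollifier_deriv d x) (at x)"
    unfolding eq by (rule \<rho>'(1))
  show "continuous_on UNIV (\<lambda>x. mollifier_deriv d x h)"
    unfolding eq by (rule \<rho>'(2))
qed

lemma has_derivative_mollify:
  assumes "d > 0" "integrable lborel f"
  shows "(mollify d f has_derivative mollify_deriv d f x) (at x)"
  using has_derivative_convolution[OF has_derivative_mollifier continuous_on_mollifier_deriv mollifier_supp[OF assms(1)] assms(2), of d x]
  by (simp add: mollify_def[abs_def] mollify_deriv_def[abs_def])

lemma continuous_on_mollify_deriv:
  assumes "d > 0" "integrable lborel f"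
  shows "continuous_on UNIV (\<lambda>x. mollify_deriv d f x h)"
  unfolding mollify_deriv_def
  by (rule continuous_on_convolution_deriv[OF has_derivative_mollifier continuous_on_mollifier_deriv mollifier_supp[OF assms(1)] assms(2)])

lemma mollify_deriv_dist_deriv:
  fixes f :: "real^'n \<Rightarrow> real"
  assumes d: "d > 0" and sub: "cball x d \<subseteq> V"
    and f: "f \<in> borel_measurable borel" "\<And>y. y \<notin> \<Omega> \<Longrightarrow> f y = 0" and \<Omega>: "open \<Omega>"
    and L: "\<And>\<phi>. \<phi> \<in> test_functions V \<Longrightarrow>
      (LINT x:\<Omega>|lebesgue. f x * frechet_derivative \<phi> (at x) (axis j 1)) = - L \<phi>"
  shows "mollify_deriv d f x (axis j 1) = L (\<lambda>y. mollifier d (x - y))"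
  unfolding mollify_deriv_def
  by (rule convolution_dist_deriv[OF Ck_mollifier has_derivative_mollifier mollifier_supp[OF d] sub f \<Omega> L])

lemma bounded_linear_mollify_deriv: "d > 0 \<Longrightarrow> integrable lborel f \<Longrightarrow> bounded_linear (mollify_deriv d f x)"
  using has_derivative_mollify has_derivative_bounded_linear by blast

lemma mollifier_measurable [measurable]: "mollifier d \<in> borel_measurable borel"
  by (rule borel_measurable_continuous_onI[OF continuous_on_mollifier])

lemma mollify_measurable [measurable]:
  assumes [measurable]: "f \<in> borel_measurable borel"
  shows "mollify d f \<in> borel_measurable borel"
proof -
  have "(\<lambda>x. LINT y|lborel. mollifier d (x - y) * f y) \<in> borel_measurable borel"
    by (rule lborel.borel_measurable_lebesgue_integral) measurable
  then show ?thesis by (simp add: mollify_def[abs_def])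
qed

lemma mollify_nonneg: "d > 0 \<Longrightarrow> (\<And>y. f y \<ge> 0) \<Longrightarrow> mollify d f x \<ge> 0"
  unfolding mollify_def by (intro integral_nonneg_AE AE_I2 mult_nonneg_nonneg mollifier_nonneg)

lemma nn_integral_affine:
  fixes x :: "'a::euclidean_space"
  assumes t: "t > 0" and f [measurable]: "f \<in> borel_measurable borel"
  shows "(\<integral>\<^sup>+y. f y \<partial>lborel) = ennreal (t ^ DIM('a)) * (\<integral>\<^sup>+y. f (x + t *\<^sub>R (y - x)) \<partial>lborel)"
proof -
  have "(\<integral>\<^sup>+y. f y \<partial>lborel) = (\<integral>\<^sup>+y. f y \<partial>density (distr lborel borel (\<lambda>y. (x - t *\<^sub>R x) + t *\<^sub>R y)) (\<lambda>_. ennreal (\<bar>t\<bar> ^ DIM('a))))"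
    by (subst lborel_affine[of t "x - t *\<^sub>R x"]) (use t in auto)
  also have "\<dots> = (\<integral>\<^sup>+y. ennreal (\<bar>t\<bar> ^ DIM('a)) * f y \<partial>distr lborel borel (\<lambda>y. (x - t *\<^sub>R x) + t *\<^sub>R y))"
    by (rule nn_integral_density) auto
  also have "\<dots> = (\<integral>\<^sup>+y. ennreal (\<bar>t\<bar> ^ DIM('a)) * f ((x - t *\<^sub>R x) + t *\<^sub>R y) \<partial>lborel)"
    by (rule nn_integral_distr) auto
  also have "\<dots> = ennreal (\<bar>t\<bar> ^ DIM('a)) * (\<integral>\<^sup>+y. f ((x - t *\<^sub>R x) + t *\<^sub>R y) \<partial>lborel)"
    by (rule nn_integral_cmult) auto
  finally show ?thesis using t by (simp add: scaleR_diff_right algebra_simps)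
qed

lemma base_mollifier_measurable [measurable]: "base_mollifier \<in> borel_measurable borel"
  by (rule borel_measurable_continuous_onI[OF Ck_continuous[OF Ck_base_mollifier]])

text \<open>The integration is over the first argument of the difference. The kernel is not known to
  be even, so this is a different fact from \<open>integral_mollifier_shift\<close>.\<close>

lemma nn_integral_mollifier_center:
  fixes \<xi> :: "real^'n"
  assumes d: "d > 0"
  shows "(\<integral>\<^sup>+\<eta>. ennreal (mollifier d (\<eta> - \<xi>)) \<partial>lborel) = 1"
proof -
  have "(\<integral>\<^sup>+\<eta>. ennreal (mollifier d (\<eta> - \<xi>)) \<partial>lborel)
      = ennreal (d ^ CARD('n)) * (\<integral>\<^sup>+y. ennreal (mollifier d (\<xi> + d *\<^sub>R (y - \<xi>) - \<xi>)) \<partial>lborel)"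
    by (subst nn_integral_affine[OF d, of _ \<xi>]) auto
  also have "\<dots> = (\<integral>\<^sup>+y. ennreal (d ^ CARD('n)) * ennreal (mollifier d (\<xi> + d *\<^sub>R (y - \<xi>) - \<xi>)) \<partial>lborel)"
    by (rule nn_integral_cmult[symmetric]) auto
  also have "\<dots> = (\<integral>\<^sup>+y. ennreal (base_mollifier (y - \<xi>)) \<partial>lborel)"
    using d by (intro nn_integral_cong) (auto simp: mollifier_def base_mollifier_nonneg simp flip: ennreal_mult)
  also have "\<dots> = (\<integral>\<^sup>+y. ennreal (base_mollifier y) \<partial>distr lborel borel ((+) (- \<xi>)))"
    by (subst nn_integral_distr) auto
  also have "\<dots> = (\<integral>\<^sup>+(y::real^'n). ennreal (base_mollifier y) \<partial>lborel)"
    by (simp add: lborel_distr_plus)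
  also have "\<dots> = ennreal (integral\<^sup>L lborel (base_mollifier :: real^'n \<Rightarrow> real))"
  proof (rule nn_integral_eq_integral)
    show "integrable lborel (base_mollifier :: real^'n \<Rightarrow> real)"
      by (rule integrable_continuous_supported[OF Ck_continuous[OF Ck_base_mollifier] compact_cball[of 0 1]])
        (auto intro: base_mollifier_supp)
  qed (auto simp: base_mollifier_nonneg)
  finally show ?thesis by (simp add: integral_base_mollifier)
qed

lemma set_integrable_locally_integrable: "locally_integrable f \<Longrightarrow> set_integrable lebesgue (ball x r) f"
  by (subst set_integrable_lebesgue_iff_lborel) (auto simp: locally_integrable_def)

text \<open>\<open>s\<close> and \<open>d\<close> are unrelated because \<open>s\<close> will be
  \<open>t * r\<close> with arbitrarily small \<open>t\<close> at a fixed \<open>d\<close>. For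
  \<open>s \<le> d\<close> the mollification is bounded pointwise by the average over
  \<open>ball x (2 * d)\<close>; for \<open>s > d\<close> the kernel is integrated out first, which
  enlarges the ball only to \<open>ball x (2 * s)\<close>.\<close>

lemma nn_integral_mollify_ball:
  obtains K where "K > 0" "\<And>\<gamma> e r1 s d. \<And>x::real^'n. locally_integrable \<gamma> \<Longrightarrow> (\<And>y. \<gamma> y \<ge> 0) \<Longrightarrow> e > 0 \<Longrightarrow> d > 0 \<Longrightarrow> s > 0 \<Longrightarrow>
      2 * s < r1 \<Longrightarrow> 2 * d < r1 \<Longrightarrow> (\<And>s. 0 < s \<Longrightarrow> s < r1 \<Longrightarrow> ball_average \<gamma> x s \<le> e) \<Longrightarrow>
      (\<integral>\<^sup>+\<eta>. ennreal (mollify d \<gamma> \<eta>) * indicator (ball x s) \<eta> \<partial>lborel) \<le> ennreal (K * e) * emeasure lborel (ball x s)"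
proof -
  obtain K where K: "K > 0" "\<And>f c d. \<And>x z::real^'n. locally_integrable f \<Longrightarrow> d > 0 \<Longrightarrow> dist z x \<le> d \<Longrightarrow>
     \<bar>mollify d f z - c\<bar> \<le> K * ball_average (\<lambda>y. \<bar>f y - c\<bar>) x (2 * d)"
    using mollify_near_bound by metis
  show thesis
  proof (rule that[of "K + 2 ^ CARD('n)"])
    show "K + 2 ^ CARD('n) > 0" using K(1) by (simp add: add_pos_pos)
    fix \<gamma> e r1 s d and x :: "real^'n"
    assume li: "locally_integrable \<gamma>" and nn: "\<And>y. \<gamma> y \<ge> 0" and e: "e > 0" and d: "d > 0" and s: "s > 0"
      and sr: "2 * s < r1" and dr: "2 * d < r1" and avg: "\<And>s. 0 < s \<Longrightarrow> s < r1 \<Longrightarrow> ball_average \<gamma> x s \<le> e"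
    have \<gamma>m [measurable]: "\<gamma> \<in> borel_measurable borel" by (rule locally_integrable_measurable[OF li])
    have fin: "emeasure lborel (ball x s) = ennreal (measure lebesgue (ball x s))" for s
      using emeasure_lborel_ball_finite[of x s] by (simp add: emeasure_eq_ennreal_measure)
    show "(\<integral>\<^sup>+\<eta>. ennreal (mollify d \<gamma> \<eta>) * indicator (ball x s) \<eta> \<partial>lborel) \<le> ennreal ((K + 2 ^ CARD('n)) * e) * emeasure lborel (ball x s)"
    proof (cases "s \<le> d")
      case True
      have "(\<integral>\<^sup>+\<eta>. ennreal (mollify d \<gamma> \<eta>) * indicator (ball x s) \<eta> \<partial>lborel)
          \<le> (\<integral>\<^sup>+\<eta>. ennreal ((K + 2 ^ CARD('n)) * e) * indicator (ball x s) \<eta> \<partial>lborel)"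
      proof (rule nn_integral_mono)
        fix \<eta> :: "real^'n"
        have "mollify d \<gamma> \<eta> \<le> (K + 2 ^ CARD('n)) * e" if "\<eta> \<in> ball x s"
        proof -
          have "dist \<eta> x \<le> d" using that True by (simp add: dist_commute)
          from K(2)[OF li d this, of 0] have "mollify d \<gamma> \<eta> \<le> K * ball_average \<gamma> x (2 * d)"
            using nn by simp
          also have "\<dots> \<le> K * e" using avg[of "2 * d"] d dr K(1) by (intro mult_left_mono) auto
          also have "\<dots> \<le> (K + 2 ^ CARD('n)) * e" using e by (simp add: distrib_right)
          finally show ?thesis .
        qed
        then show "ennreal (mollify d \<gamma> \<eta>) * indicator (ball x s) \<eta> \<le> ennreal ((K + 2 ^ CARD('n)) * e) * indicator (ball x s) \<eta>"
          by (auto simp: indicator_def intro: ennreal_leI)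
      qed
      also have "\<dots> = ennreal ((K + 2 ^ CARD('n)) * e) * emeasure lborel (ball x s)"
        by (rule nn_integral_cmult_indicator) auto
      finally show ?thesis .
    next
      case False
      have "(\<integral>\<^sup>+\<eta>. ennreal (mollify d \<gamma> \<eta>) * indicator (ball x s) \<eta> \<partial>lborel)
          = (\<integral>\<^sup>+\<eta>. (\<integral>\<^sup>+\<xi>. ennreal (mollifier d (\<eta> - \<xi>) * \<gamma> \<xi>) * indicator (ball x s) \<eta> \<partial>lborel) \<partial>lborel)"
      proof (rule nn_integral_cong)
        fix \<eta> :: "real^'n"
        have "ennreal (mollify d \<gamma> \<eta>) = (\<integral>\<^sup>+\<xi>. ennreal (mollifier d (\<eta> - \<xi>) * \<gamma> \<xi>) \<partial>lborel)"
          unfolding mollify_def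
          by (rule nn_integral_eq_integral[symmetric, OF integrable_mollifier_mult[OF d li]])
            (intro AE_I2 mult_nonneg_nonneg nn mollifier_nonneg[OF d])
        then show "ennreal (mollify d \<gamma> \<eta>) * indicator (ball x s) \<eta> = (\<integral>\<^sup>+\<xi>. ennreal (mollifier d (\<eta> - \<xi>) * \<gamma> \<xi>) * indicator (ball x s) \<eta> \<partial>lborel)"
          by (simp add: nn_integral_multc)
      qed
      also have "\<dots> = (\<integral>\<^sup>+\<xi>. (\<integral>\<^sup>+\<eta>. ennreal (mollifier d (\<eta> - \<xi>) * \<gamma> \<xi>) * indicator (ball x s) \<eta> \<partial>lborel) \<partial>lborel)"
        by (rule lborel_pair.Fubini') (measurable, simp)
      also have "\<dots> \<le> (\<integral>\<^sup>+\<xi>. ennreal (\<gamma> \<xi>) * indicator (ball x (2 * s)) \<xi> \<partial>lborel)"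
      proof (rule nn_integral_mono)
        fix \<xi> :: "real^'n"
        have "(\<integral>\<^sup>+\<eta>. ennreal (mollifier d (\<eta> - \<xi>) * \<gamma> \<xi>) * indicator (ball x s) \<eta> \<partial>lborel)
            \<le> (\<integral>\<^sup>+\<eta>. ennreal (mollifier d (\<eta> - \<xi>)) * (ennreal (\<gamma> \<xi>) * indicator (ball x (2 * s)) \<xi>) \<partial>lborel)"
        proof (rule nn_integral_mono)
          fix \<eta> :: "real^'n"
          show "ennreal (mollifier d (\<eta> - \<xi>) * \<gamma> \<xi>) * indicator (ball x s) \<eta> \<le> ennreal (mollifier d (\<eta> - \<xi>)) * (ennreal (\<gamma> \<xi>) * indicator (ball x (2 * s)) \<xi>)"
          proof (cases "\<eta> \<in> ball x s \<and> norm (\<eta> - \<xi>) < d")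
            case True
            have "dist x \<xi> \<le> dist x \<eta> + dist \<eta> \<xi>" by (rule dist_triangle)
            then have "\<xi> \<in> ball x (2 * s)" using True False by (simp add: dist_norm)
            then show ?thesis using True by (simp add: ennreal_mult[OF mollifier_nonneg[OF d, of "\<eta> - \<xi>"] nn[of \<xi>]])
          next
            case False
            then show ?thesis using mollifier_supp[OF d, of "\<eta> - \<xi>"] by (auto simp: indicator_def)
          qed
        qed
        also have "\<dots> = (\<integral>\<^sup>+\<eta>. ennreal (mollifier d (\<eta> - \<xi>)) \<partial>lborel) * (ennreal (\<gamma> \<xi>) * indicator (ball x (2 * s)) \<xi>)"
          by (rule nn_integral_multc) auto
        finally show "(\<integral>\<^sup>+\<eta>. ennreal (mollifier d (\<eta> - \<xi>) * \<gamma> \<xi>) * indicator (ball x s) \<eta> \<partial>lborel) \<le> ennreal (\<gamma> \<xi>) * indicator (ball x (2 * s)) \<xi>"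
          by (simp add: nn_integral_mollifier_center[OF d])
      qed
      also have "\<dots> = (\<integral>\<^sup>+\<xi>. ennreal (indicator (ball x (2 * s)) \<xi> *\<^sub>R \<gamma> \<xi>) \<partial>lborel)"
        by (rule nn_integral_cong) (auto simp: indicator_def)
      also have "\<dots> = ennreal (LINT \<xi>|lborel. indicator (ball x (2 * s)) \<xi> *\<^sub>R \<gamma> \<xi>)"
        by (rule nn_integral_eq_integral)
          (use li nn in \<open>auto simp: locally_integrable_def set_integrable_def\<close>)
      also have "(LINT \<xi>|lborel. indicator (ball x (2 * s)) \<xi> *\<^sub>R \<gamma> \<xi>) = ball_average \<gamma> x (2 * s) * measure lebesgue (ball x (2 * s))"
        using measure_ball_pos[of "2 * s" x] s
        by (simp add: ball_average_def set_lebesgue_integral_lebesgue_eq_lborel \<gamma>m) (simp add: set_lebesgue_integral_def)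
      also have "\<dots> \<le> e * measure lebesgue (ball x (2 * s))"
        using avg[of "2 * s"] s sr by (intro mult_right_mono) auto
      also have "\<dots> = 2 ^ CARD('n) * e * measure lebesgue (ball x s)"
        using s by (simp add: content_ball power_mult_distrib)
      also have "\<dots> \<le> (K + 2 ^ CARD('n)) * e * measure lebesgue (ball x s)"
        using K e by (intro mult_right_mono) auto
      also have "ennreal ((K + 2 ^ CARD('n)) * e * measure lebesgue (ball x s)) = ennreal ((K + 2 ^ CARD('n)) * e) * emeasure lborel (ball x s)"
        using K e by (simp add: fin ennreal_mult)
      finally show ?thesis by (simp add: ennreal_leI)
    qed
  qed
qed


lemma linear_sum_axis:
  assumes "bounded_linear L"
  shows "L h = (\<Sum>j\<in>UNIV. h $ j *\<^sub>R L (axis j (1::real)))"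
proof -
  interpret bounded_linear L by fact
  have "L h = L (\<Sum>j\<in>UNIV. h $ j *\<^sub>R axis j 1)"
    using basis_expansion[of h] by (simp add: scalar_mult_eq_scaleR)
  also have "\<dots> = (\<Sum>j\<in>UNIV. h $ j *\<^sub>R L (axis j (1::real)))" by (simp add: sum scaleR)
  finally show ?thesis .
qed

text \<open>The fundamental theorem of calculus along the segment from \<open>x\<close> to
  \<open>y\<close>: the derivative of the mollification, minus the constant gradient, is a
  combination of mollifications of \<open>g j - g j x\<close>. The bound is a nonnegative integral
  so that the order of integration over \<open>t\<close> and \<open>y\<close> can be exchanged
  freely.\<close>

lemma mollify_affine_bound:
  fixes u :: "real^'n \<Rightarrow> real" and g :: "'n \<Rightarrow> real^'n \<Rightarrow> real" and x y :: "real^'n"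
  defines "\<gamma> \<equiv> \<lambda>\<xi>. \<Sum>j\<in>UNIV. \<bar>g j \<xi> - g j x\<bar>"
  assumes u: "integrable lborel u" and g: "\<And>j. locally_integrable (g j)" and d: "d > 0"
    and weak: "\<And>j z. dist x z < r \<Longrightarrow> mollify_deriv d u z (axis j 1) = mollify d (g j) z"
    and y: "dist x y < r"
  shows "ennreal \<bar>mollify d u y - mollify d u x - (\<Sum>j\<in>UNIV. g j x * (y - x) $ j)\<bar>
     \<le> (\<integral>\<^sup>+t. ennreal (r * mollify d \<gamma> (x + t *\<^sub>R (y - x))) * indicator {0..1} t \<partial>lborel)"
proof -
  define G where "G h = (\<Sum>j\<in>UNIV. g j x * h $ j)" for h :: "real^'n"
  have \<gamma>li: "locally_integrable \<gamma>"
    unfolding \<gamma>_def by (intro locally_integrable_sum locally_integrable_abs locally_integrable_diff g locally_integrable_const)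
  have \<gamma>nn: "\<gamma> y \<ge> 0" for y unfolding \<gamma>_def by (intro sum_nonneg) auto
  define p where "p t = x + t *\<^sub>R (y - x)" for t :: real
  have pr: "dist x (p t) < r" if "0 \<le> t" "t \<le> 1" for t
  proof -
    have "dist x (p t) = t * dist x y" using that by (simp add: p_def dist_norm norm_minus_commute)
    also have "\<dots> \<le> 1 * dist x y" using that by (intro mult_right_mono) auto
    finally show ?thesis using y by simp
  qed
  define f where "f t = mollify_deriv d u (p t) (y - x) - G (y - x)" for t
  define F where "F t = mollify d u (p t) - t * G (y - x)" for t
  have deriv: "DERIV F t :> f t" for t
  proof -
    have "((\<lambda>t. mollify d u (p t)) has_derivative (\<lambda>s. mollify_deriv d u (p t) (s *\<^sub>R (y - x)))) (at t)"
      by (rule has_derivative_compose[OF _ has_derivative_mollify[OF d u]])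
        (auto simp: p_def intro!: derivative_eq_intros)
    moreover have "mollify_deriv d u (p t) (s *\<^sub>R (y - x)) = mollify_deriv d u (p t) (y - x) * s" for s
      using linear_scale[OF bounded_linear.linear[OF bounded_linear_mollify_deriv[OF d u]]] by simp
    ultimately have "DERIV (\<lambda>t. mollify d u (p t)) t :> mollify_deriv d u (p t) (y - x)"
      by (simp add: has_field_derivative_def)
    then show ?thesis unfolding F_def f_def by (auto intro!: derivative_eq_intros)
  qed
  have contf: "isCont f t" for t
  proof -
    have "continuous_on UNIV (\<lambda>t. mollify_deriv d u (p t) (y - x))"
      by (rule continuous_on_compose2[OF continuous_on_mollify_deriv[OF d u]])
        (auto simp: p_def intro!: continuous_intros)
    then show ?thesis unfolding f_def
      by (intro continuous_intros) (simp add: continuous_on_eq_continuous_at)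
  qed
  have fb: "\<bar>f t\<bar> \<le> r * mollify d \<gamma> (p t)" if t: "0 \<le> t" "t \<le> 1" for t
  proof -
    have "f t = (\<Sum>j\<in>UNIV. (y - x) $ j * (mollify d (g j) (p t) - g j x))"
      unfolding f_def G_def linear_sum_axis[OF bounded_linear_mollify_deriv[OF d u], of "p t" "y - x"]
      by (simp add: weak[OF pr[OF t]] right_diff_distrib mult.commute sum_subtractf)
    then have "\<bar>f t\<bar> \<le> (\<Sum>j\<in>UNIV. \<bar>(y - x) $ j\<bar> * \<bar>mollify d (g j) (p t) - g j x\<bar>)"
      by (metis (no_types, lifting) abs_mult sum.cong sum_abs)
    also have "\<dots> \<le> (\<Sum>j\<in>UNIV. r * (LINT \<xi>|lborel. mollifier d (p t - \<xi>) * \<bar>g j \<xi> - g j x\<bar>))"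
    proof (intro sum_mono mult_mono)
      fix j
      have "norm (y - x) \<le> r" using y by (simp add: dist_norm norm_minus_commute)
      then show "\<bar>(y - x) $ j\<bar> \<le> r" using component_le_norm_cart[of "y - x" j] by linarith
      then show "0 \<le> r" by simp
      have "mollify d (g j) (p t) - g j x = (LINT \<xi>|lborel. mollifier d (p t - \<xi>) * (g j \<xi> - g j x))"
        using integrable_mollifier_mult[OF d g, of "p t"] integrable_mollifier_shift[OF d, of "p t"]
        by (simp add: mollify_def integral_mollifier_shift[OF d] right_diff_distrib)
      then have "\<bar>mollify d (g j) (p t) - g j x\<bar> \<le> (LINT \<xi>|lborel. \<bar>mollifier d (p t - \<xi>) * (g j \<xi> - g j x)\<bar>)"
        by (simp only: integral_abs_bound)
      then show "\<bar>mollify d (g j) (p t) - g j x\<bar> \<le> (LINT \<xi>|lborel. mollifier d (p t - \<xi>) * \<bar>g j \<xi> - g j x\<bar>)"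
        by (simp add: abs_mult abs_of_nonneg[OF mollifier_nonneg[OF d]])
    qed simp
    also have "\<dots> = r * (LINT \<xi>|lborel. (\<Sum>j\<in>UNIV. mollifier d (p t - \<xi>) * \<bar>g j \<xi> - g j x\<bar>))"
      by (subst Bochner_Integration.integral_sum)
        (auto simp: sum_distrib_left intro!: integrable_mollifier_mult[OF d] locally_integrable_abs locally_integrable_diff g locally_integrable_const)
    finally show ?thesis unfolding mollify_def \<gamma>_def by (simp add: sum_distrib_left)
  qed
  have F01: "F 1 - F 0 = mollify d u y - mollify d u x - (\<Sum>j\<in>UNIV. g j x * (y - x) $ j)"
    by (simp add: F_def p_def G_def)
  have int: "has_bochner_integral lborel (\<lambda>t. f t * indicator {0..1} t) (F 1 - F 0)"
    by (rule has_bochner_integral_FTC_Icc_real) (use deriv contf in auto)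
  have "ennreal \<bar>F 1 - F 0\<bar> = ennreal (norm (LINT t|lborel. f t * indicator {0..1} t))"
    using int by (simp add: has_bochner_integral_integral_eq)
  also have "\<dots> \<le> (\<integral>\<^sup>+t. ennreal (norm (f t * indicator {0..1} t)) \<partial>lborel)"
    by (rule integral_norm_bound_ennreal) (use int in \<open>auto simp: has_bochner_integral_iff\<close>)
  also have "\<dots> \<le> (\<integral>\<^sup>+t. ennreal (r * mollify d \<gamma> (p t)) * indicator {0..1} t \<partial>lborel)"
    by (rule nn_integral_mono) (auto simp: indicator_def fb intro!: ennreal_leI)
  finally show ?thesis by (simp only: F01 p_def)
qed

text \<open>
  A theorem of Calderon and Zygmund. At a fixed radius the increments of the mollifications of \<open>u\<close>
  along the segments issuing from \<open>x\<close> are compared with \<open>g x\<close>; then the mollification parameter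
  tends to \<open>0\<close>.
\<close>

lemma approx_differentiable_of_weak_deriv:
  fixes u :: "real^'n \<Rightarrow> real" and g :: "'n \<Rightarrow> real^'n \<Rightarrow> real"
  assumes V: "open V" "x \<in> V" and \<Omega>: "open \<Omega>"
    and u: "integrable lborel u" "\<And>y. y \<notin> \<Omega> \<Longrightarrow> u y = 0"
    and g: "\<And>j. integrable lborel (g j)"
    and weak: "\<And>j \<phi>. \<phi> \<in> test_functions V \<Longrightarrow>
      (LINT x:\<Omega>|lebesgue. u x * frechet_derivative \<phi> (at x) (axis j 1)) = - (LINT x|lborel. g j x * \<phi> x)"
    and lp: "lebesgue_point u x" "\<And>j. lebesgue_point (g j) x"
  shows "((\<lambda>r. ball_average (\<lambda>y. \<bar>u y - u x - (\<Sum>j\<in>UNIV. g j x * (y - x) $ j)\<bar> / r) x r) \<longlongrightarrow> 0) (at_right 0)"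
proof -
  define \<gamma> where "\<gamma> \<xi> = (\<Sum>j\<in>UNIV. \<bar>g j \<xi> - g j x\<bar>)" for \<xi>
  define w where "w y = u y - u x - (\<Sum>j\<in>UNIV. g j x * (y - x) $ j)" for y
  have gli: "locally_integrable (g j)" for j by (rule locally_integrable_integrable[OF g])
  have uli: "locally_integrable u" by (rule locally_integrable_integrable[OF u(1)])
  have um [measurable]: "u \<in> borel_measurable borel" using u(1) by auto
  have [measurable]: "ball x r \<in> sets borel" for r by simp
  have wm [measurable]: "w \<in> borel_measurable borel" unfolding w_def by measurable
  have gdl: "locally_integrable (\<lambda>\<xi>. \<bar>g j \<xi> - g j x\<bar>)" for j
    by (intro locally_integrable_abs locally_integrable_diff gli locally_integrable_const)
  have \<gamma>li: "locally_integrable \<gamma>" unfolding \<gamma>_def[abs_def] by (intro locally_integrable_sum gdl)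
  have \<gamma>nn: "\<gamma> y \<ge> 0" for y unfolding \<gamma>_def by (intro sum_nonneg) auto
  have \<gamma>m [measurable]: "\<gamma> \<in> borel_measurable borel" by (rule locally_integrable_measurable[OF \<gamma>li])
  have "((\<lambda>r. \<Sum>j\<in>UNIV. ball_average (\<lambda>\<xi>. \<bar>g j \<xi> - g j x\<bar>) x r) \<longlongrightarrow> 0) (at_right 0)"
    by (rule tendsto_null_sum) (use lp(2) in \<open>simp add: lebesgue_point_def\<close>)
  then have \<gamma>lim: "((\<lambda>r. ball_average \<gamma> x r) \<longlongrightarrow> 0) (at_right 0)"
    unfolding \<gamma>_def[abs_def] by (simp add: ball_average_sum set_integrable_locally_integrable[OF gdl])
  obtain R0 where R0: "R0 > 0" "cball x R0 \<subseteq> V" using V open_contains_cball by blast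
  obtain K where K: "K > 0" "\<And>\<gamma> e r1 s d. \<And>x::real^'n. locally_integrable \<gamma> \<Longrightarrow> (\<And>y. \<gamma> y \<ge> 0) \<Longrightarrow> e > 0 \<Longrightarrow> d > 0 \<Longrightarrow> s > 0 \<Longrightarrow>
      2 * s < r1 \<Longrightarrow> 2 * d < r1 \<Longrightarrow> (\<And>s. 0 < s \<Longrightarrow> s < r1 \<Longrightarrow> ball_average \<gamma> x s \<le> e) \<Longrightarrow>
      (\<integral>\<^sup>+\<eta>. ennreal (mollify d \<gamma> \<eta>) * indicator (ball x s) \<eta> \<partial>lborel) \<le> ennreal (K * e) * emeasure lborel (ball x s)"
    using nn_integral_mollify_ball by blast
  have fin: "emeasure lborel (ball x s) = ennreal (measure lebesgue (ball x s))" for s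
    using emeasure_lborel_ball_finite[of x s] by (simp add: emeasure_eq_ennreal_measure)
  have main: "eventually (\<lambda>r. ball_average (\<lambda>y. \<bar>w y\<bar> / r) x r \<le> K * e) (at_right 0)" if e: "e > 0" for e
  proof -
    have "eventually (\<lambda>r. dist (ball_average \<gamma> x r) 0 < e) (at_right 0)" by (rule tendstoD[OF \<gamma>lim e])
    then obtain r1 where r1: "r1 > 0" "\<And>s. 0 < s \<Longrightarrow> s < r1 \<Longrightarrow> ball_average \<gamma> x s \<le> e"
      unfolding eventually_at_right_field dist_real_def by fastforce
    have "ball_average (\<lambda>y. \<bar>w y\<bar> / r) x r \<le> K * e" if r: "0 < r" "r < min (r1 / 2) (R0 / 2)" for r
    proof -
      define B where "B = ennreal (r * (K * e)) * emeasure lborel (ball x r)"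
      \<comment> \<open>After the integrals are exchanged, the dilation about \<open>x\<close> by
        \<open>t\<close> turns the integral over \<open>ball x r\<close> into one over
        \<open>ball x (t * r)\<close>. The Jacobian \<open>t ^ CARD('n)\<close> cancels against the
        volume of that ball, so the bound is uniform in \<open>t\<close> and in
        \<open>d\<close>.\<close>
      have step: "(\<integral>\<^sup>+y. ennreal \<bar>mollify d u y - mollify d u x - (\<Sum>j\<in>UNIV. g j x * (y - x) $ j)\<bar> * indicator (ball x r) y \<partial>lborel) \<le> B"
        if d: "0 < d" "d < r" for d
      proof -
        have wk: "mollify_deriv d u z (axis j 1) = mollify d (g j) z" if z: "dist x z < r" for z j
        proof -
          have "cball z d \<subseteq> V"
          proof -
            have "cball z d \<subseteq> cball x R0"
            proof
              fix a assume "a \<in> cball z d"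
              then have "dist x a \<le> dist x z + d" using dist_triangle[of x a z] by simp
              then show "a \<in> cball x R0" using z d r by simp
            qed
            then show ?thesis using R0 by blast
          qed
          from mollify_deriv_dist_deriv[OF d(1) this um u(2) \<Omega> weak]
          show ?thesis by (simp add: mollify_def mult.commute)
        qed
        have [measurable]: "mollify d \<gamma> \<in> borel_measurable borel" by measurable
        have "(\<integral>\<^sup>+y. ennreal \<bar>mollify d u y - mollify d u x - (\<Sum>j\<in>UNIV. g j x * (y - x) $ j)\<bar> * indicator (ball x r) y \<partial>lborel)
          \<le> (\<integral>\<^sup>+y. (\<integral>\<^sup>+t. ennreal (r * mollify d \<gamma> (x + t *\<^sub>R (y - x))) * indicator {0..1} t * indicator (ball x r) y \<partial>lborel) \<partial>lborel)"
        proof (rule nn_integral_mono)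
          fix y
          show "ennreal \<bar>mollify d u y - mollify d u x - (\<Sum>j\<in>UNIV. g j x * (y - x) $ j)\<bar> * indicator (ball x r) y
            \<le> (\<integral>\<^sup>+t. ennreal (r * mollify d \<gamma> (x + t *\<^sub>R (y - x))) * indicator {0..1} t * indicator (ball x r) y \<partial>lborel)"
          proof (cases "y \<in> ball x r")
            case True
            then have "dist x y < r" by simp
            from mollify_affine_bound[OF u(1) gli d(1) wk this]
            show ?thesis using True by (simp add: \<gamma>_def[abs_def])
          qed simp
        qed
        also have "\<dots> = (\<integral>\<^sup>+t. (\<integral>\<^sup>+y. ennreal (r * mollify d \<gamma> (x + t *\<^sub>R (y - x))) * indicator {0..1} t * indicator (ball x r) y \<partial>lborel) \<partial>lborel)"
          by (rule lborel_pair.Fubini'[symmetric]) measurable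
        also have "\<dots> \<le> (\<integral>\<^sup>+t. B * indicator {0..1::real} t \<partial>lborel)"
        proof (rule nn_integral_mono_AE)
          \<comment> \<open>At \<open>t = 0\<close> the dilation degenerates; this single value is a
            null set.\<close>
          have "AE t in lborel. t \<noteq> (0::real)" by (rule AE_lborel_singleton)
          then show "AE t in lborel. (\<integral>\<^sup>+y. ennreal (r * mollify d \<gamma> (x + t *\<^sub>R (y - x))) * indicator {0..1} t * indicator (ball x r) y \<partial>lborel)
             \<le> B * indicator {0..1} t"
          proof eventually_elim
            case (elim t)
            show ?case
            proof (cases "t \<in> {0..1}")
              case True
              then have t: "0 < t" "t \<le> 1" using elim by auto
              have tr: "0 < t * r" "t * r \<le> r" using t r by (auto simp: mult_le_cancel_right1)
              have ind: "indicator (ball x (t * r)) (x + t *\<^sub>R (y - x)) = (indicator (ball x r) y :: ennreal)" for y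
                using t by (simp add: indicator_def dist_norm norm_minus_commute)
              have [measurable]: "(\<lambda>\<eta>. ennreal (mollify d \<gamma> \<eta>) * indicator (ball x (t * r)) \<eta>) \<in> borel_measurable borel"
                by (intro borel_measurable_times_ennreal borel_measurable_indicator measurable_compose[OF _ measurable_ennreal]) auto
              have "ennreal (t ^ CARD('n)) * (\<integral>\<^sup>+y. ennreal (mollify d \<gamma> (x + t *\<^sub>R (y - x))) * indicator (ball x r) y \<partial>lborel)
                = (\<integral>\<^sup>+\<eta>. ennreal (mollify d \<gamma> \<eta>) * indicator (ball x (t * r)) \<eta> \<partial>lborel)"
                by (subst nn_integral_affine[OF t(1), of "\<lambda>\<eta>. ennreal (mollify d \<gamma> \<eta>) * indicator (ball x (t * r)) \<eta>" x])
                  (auto simp: ind)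
              also have "\<dots> \<le> ennreal (K * e) * emeasure lborel (ball x (t * r))"
              proof (rule K(2)[OF \<gamma>li \<gamma>nn e d(1) tr(1) _ _ r1(2)])
                have "r < r1 / 2" using r by simp
                then show "2 * (t * r) < r1" "2 * d < r1" using tr(2) d by linarith+
              qed
              also have "\<dots> = ennreal (t ^ CARD('n)) * (ennreal (K * e) * emeasure lborel (ball x r))"
                using t r K(1) e by (simp add: fin content_ball power_mult_distrib mult_ac flip: ennreal_mult)
              finally have le: "(\<integral>\<^sup>+y. ennreal (mollify d \<gamma> (x + t *\<^sub>R (y - x))) * indicator (ball x r) y \<partial>lborel)
                  \<le> ennreal (K * e) * emeasure lborel (ball x r)"
                using t by (simp add: ennreal_mult_le_mult_iff)
              have "(\<integral>\<^sup>+y. ennreal (r * mollify d \<gamma> (x + t *\<^sub>R (y - x))) * indicator {0..1} t * indicator (ball x r) y \<partial>lborel)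
                 = (\<integral>\<^sup>+y. ennreal r * (ennreal (mollify d \<gamma> (x + t *\<^sub>R (y - x))) * indicator (ball x r) y) \<partial>lborel)"
              proof (rule nn_integral_cong)
                fix y
                have "mollify d \<gamma> (x + t *\<^sub>R (y - x)) \<ge> 0" by (rule mollify_nonneg[OF d(1) \<gamma>nn])
                then show "ennreal (r * mollify d \<gamma> (x + t *\<^sub>R (y - x))) * indicator {0..1} t * indicator (ball x r) y
                    = ennreal r * (ennreal (mollify d \<gamma> (x + t *\<^sub>R (y - x))) * indicator (ball x r) y)"
                  using True r by (simp add: ennreal_mult mult_ac)
              qed
              also have "\<dots> = ennreal r * (\<integral>\<^sup>+y. ennreal (mollify d \<gamma> (x + t *\<^sub>R (y - x))) * indicator (ball x r) y \<partial>lborel)"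
                by (rule nn_integral_cmult) measurable
              also have "\<dots> \<le> ennreal r * (ennreal (K * e) * emeasure lborel (ball x r))"
                by (rule mult_left_mono[OF le]) simp
              also have "\<dots> = B" using r K(1) e by (simp add: B_def ennreal_mult mult.assoc)
              finally show ?thesis using True by simp
            qed simp
          qed
        qed
        also have "\<dots> = B" by (subst nn_integral_cmult_indicator) auto
        finally show ?thesis .
      qed
      \<comment> \<open>The offset 2 keeps already \<open>\<delta> 0\<close> strictly below
        \<open>r\<close>, as \<open>step\<close> demands.\<close>
      define \<delta> where "\<delta> k = r / real (k + 2)" for k :: nat
      have \<delta>: "0 < \<delta> k" "\<delta> k < r" for k
        using r mult_strict_left_mono[of 1 "real k + 2" r] by (simp_all add: \<delta>_def pos_divide_less_eq add_pos_nonneg)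
      have \<delta>lim: "filterlim \<delta> (at_right 0) sequentially"
        unfolding filterlim_at
      proof (intro conjI always_eventually allI)
        show "\<delta> \<longlonglongrightarrow> 0" unfolding \<delta>_def
          by (intro real_tendsto_divide_at_top[OF tendsto_const] filterlim_compose[OF filterlim_real_sequentially] filterlim_add_const_nat_at_top)
        fix k
        show "\<delta> k \<in> {0<..}" using \<delta>(1) by simp
        show "\<delta> k \<noteq> 0" using \<delta>(1)[of k] by simp
      qed
      have mlim: "(\<lambda>k. mollify (\<delta> k) u y) \<longlonglongrightarrow> u y" if "lebesgue_point u y" for y
      proof (rule tendstoI)
        fix e' :: real assume "e' > 0"
        from filterlim_iff[THEN iffD1, OF \<delta>lim, rule_format, OF mollify_uniform_limit[OF uli that this]]
        show "eventually (\<lambda>k. dist (mollify (\<delta> k) u y) (u y) < e') sequentially"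
        proof eventually_elim
          case (elim k)
          have "dist y y \<le> \<delta> k" using \<delta>(1)[of k] by simp
          then show ?case using elim by (simp add: dist_real_def)
        qed
      qed
      let ?w = "\<lambda>k y. ennreal \<bar>mollify (\<delta> k) u y - mollify (\<delta> k) u x - (\<Sum>j\<in>UNIV. g j x * (y - x) $ j)\<bar> * indicator (ball x r) y"
      \<comment> \<open>Fatou's lemma: the mollifications converge at the Lebesgue points of
        \<open>u\<close>, hence almost everywhere.\<close>
      have "(\<integral>\<^sup>+y. ennreal \<bar>w y\<bar> * indicator (ball x r) y \<partial>lborel) = (\<integral>\<^sup>+y. liminf (\<lambda>k. ?w k y) \<partial>lborel)"
      proof (rule nn_integral_cong_AE)
        show "AE y in lborel. ennreal \<bar>w y\<bar> * indicator (ball x r) y = liminf (\<lambda>k. ?w k y)"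
          using AE_lebesgue_point[OF u(1)]
        proof eventually_elim
          case (elim y)
          have "(\<lambda>k. ?w k y) \<longlonglongrightarrow> ennreal \<bar>w y\<bar> * indicator (ball x r) y"
          proof (cases "y \<in> ball x r")
            case True
            have "(\<lambda>k. ennreal \<bar>mollify (\<delta> k) u y - mollify (\<delta> k) u x - (\<Sum>j\<in>UNIV. g j x * (y - x) $ j)\<bar>) \<longlonglongrightarrow> ennreal \<bar>w y\<bar>"
              unfolding w_def by (intro tendsto_ennrealI tendsto_rabs tendsto_diff tendsto_const mlim elim lp(1))
            then show ?thesis using True by simp
          qed simp
          then show ?case by (rule lim_imp_Liminf[symmetric, rotated]) simp
        qed
      qed
      also have "\<dots> \<le> liminf (\<lambda>k. \<integral>\<^sup>+y. ?w k y \<partial>lborel)"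
        by (rule nn_integral_liminf) measurable
      also have "\<dots> \<le> B"
        by (rule Liminf_le) (use step[OF \<delta>] in auto)
      finally have "(\<integral>\<^sup>+y. ennreal \<bar>w y\<bar> * indicator (ball x r) y \<partial>lborel) \<le> ennreal (r * (K * e) * measure lebesgue (ball x r))"
        using r K(1) e by (simp add: B_def fin ennreal_mult)
      moreover have "(\<integral>\<^sup>+y. ennreal \<bar>w y\<bar> * indicator (ball x r) y \<partial>lborel) = (\<integral>\<^sup>+y. ennreal (indicator (ball x r) y *\<^sub>R \<bar>w y\<bar>) \<partial>lborel)"
        by (rule nn_integral_cong) (auto simp: indicator_def)
      ultimately have "(LINT y|lborel. indicator (ball x r) y *\<^sub>R \<bar>w y\<bar>) \<le> r * (K * e) * measure lebesgue (ball x r)"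
        using r K(1) e by (intro integral_real_bounded) auto
      then have "set_lebesgue_integral lebesgue (ball x r) (\<lambda>y. \<bar>w y\<bar>) \<le> r * (K * e) * measure lebesgue (ball x r)"
        by (subst set_lebesgue_integral_lebesgue_eq_lborel) (auto simp: set_lebesgue_integral_def)
      then have "ball_average (\<lambda>y. \<bar>w y\<bar>) x r \<le> r * (K * e)"
        using measure_ball_pos[OF r(1), of x] by (simp add: ball_average_def pos_divide_le_eq)
      then have "(1 / r) * ball_average (\<lambda>y. \<bar>w y\<bar>) x r \<le> K * e" using r by (simp add: field_simps)
      then show ?thesis unfolding ball_average_cmult[symmetric] by simp
    qed
    then show ?thesis
      using r1(1) R0(1) unfolding eventually_at_right_field by (intro exI[of _ "min (r1 / 2) (R0 / 2)"]) auto
  qed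
  show ?thesis
  proof (rule tendstoI)
    fix e :: real assume e: "e > 0"
    have "eventually (\<lambda>r. ball_average (\<lambda>y. \<bar>w y\<bar> / r) x r \<le> K * (e / (2 * K))) (at_right 0)"
      by (rule main) (use e K in simp)
    then show "eventually (\<lambda>r. dist (ball_average (\<lambda>y. \<bar>u y - u x - (\<Sum>j\<in>UNIV. g j x * (y - x) $ j)\<bar> / r) x r) 0 < e) (at_right 0)"
      using eventually_at_right_less[of 0]
    proof eventually_elim
      case (elim r)
      have "ball_average (\<lambda>y. \<bar>w y\<bar> / r) x r \<ge> 0" using elim(2) by (intro ball_average_nonneg) auto
      moreover have "K * (e / (2 * K)) < e" using e K by simp
      ultimately show ?case using elim(1) unfolding w_def dist_real_def by linarith
    qed
  qed
qed

section \<open>Weak derivatives with a singular part\<close>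

lemma pos_functional_eqI:
  assumes m: "pos_functional m" "empty_continuous m" and m': "pos_functional m'" "empty_continuous m'"
    and eq: "\<And>B. B \<in> sets borel \<Longrightarrow> m (indicator B) = m' (indicator B)" and h: "h \<in> bounded_borel"
  shows "m h = m' h"
proof -
  obtain M where M: "finite_measure M" "sets M = sets borel"
    "\<And>B. B \<in> sets borel \<Longrightarrow> measure M B = m (indicator B)" "\<And>h. h \<in> bounded_borel \<Longrightarrow> integral\<^sup>L M h = m h"
    using measure_of_pos_functional[OF m] by blast
  obtain M' where M': "finite_measure M'" "sets M' = sets borel"
    "\<And>B. B \<in> sets borel \<Longrightarrow> measure M' B = m' (indicator B)" "\<And>h. h \<in> bounded_borel \<Longrightarrow> integral\<^sup>L M' h = m' h"
    using measure_of_pos_functional[OF m'] by blast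
  have "M = M'"
  proof (rule measure_eqI)
    fix A assume "A \<in> sets M"
    then have "measure M A = measure M' A" using M(2,3) M'(3) eq by auto
    then show "emeasure M A = emeasure M' A"
      using M(1) M'(1) by (simp add: finite_measure.emeasure_eq_measure)
  qed (use M(2) M'(2) in simp)
  then show ?thesis using M(4)[OF h] M'(4)[OF h] by simp
qed

lemma integrable_bounded_borel:
  assumes "finite_measure M" "sets M = sets borel" "h \<in> bounded_borel"
  shows "integrable M h"
proof -
  interpret finite_measure M by fact
  obtain C where C: "\<And>x. \<bar>h x\<bar> \<le> C" and hm: "h \<in> borel_measurable borel" using bounded_borelE[OF assms(3)] by blast
  have "h \<in> borel_measurable M" using hm measurable_cong_sets[OF assms(2) refl] by auto
  then show ?thesis by (rule integrable_const_bound[of _ C, rotated]) (use C in auto)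
qed

lemma pos_functional_weighted:
  assumes M: "sets M = sets borel" and w: "integrable M w" "\<And>x. w x \<ge> 0"
  shows "pos_functional (\<lambda>h. LINT x|M. h x * w x)" "empty_continuous (\<lambda>h. LINT x|M. h x * w x)"
proof -
  have int: "integrable M (\<lambda>x. h x * w x)" if h: "h \<in> bounded_borel" for h
  proof -
    obtain C where C: "\<And>x. \<bar>h x\<bar> \<le> C" and hm: "h \<in> borel_measurable borel" using bounded_borelE[OF h] by blast
    have "h \<in> borel_measurable M" using hm measurable_cong_sets[OF M refl] by auto
    then show ?thesis by (rule integrable_bounded_mult[OF w(1) _ C])
  qed
  show "pos_functional (\<lambda>h. LINT x|M. h x * w x)"
    unfolding pos_functional_def
    by (auto simp: int distrib_right mult.assoc w(2) intro!: integral_nonneg_AE)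
  have sp: "space M = UNIV" using sets_eq_imp_space_eq[OF M] by simp
  show "empty_continuous (\<lambda>h. LINT x|M. h x * w x)"
    unfolding empty_continuous_def
  proof (intro allI impI)
    fix A :: "nat \<Rightarrow> 'a set"
    assume A: "range A \<subseteq> sets borel \<and> decseq A \<and> (\<Inter>i. A i) = {}"
    have "(\<lambda>i. LINT x|M. indicator (A i) x * w x) \<longlonglongrightarrow> (LINT x|M. 0)"
    proof (rule integral_dominated_convergence[where w = w])
      show "(\<lambda>x. indicator (A i) x * w x) \<in> borel_measurable M" for i
        using A w(1) M by (intro borel_measurable_times borel_measurable_indicator) auto
      show "AE x in M. (\<lambda>i. indicator (A i) x * w x) \<longlonglongrightarrow> 0"
      proof (rule AE_I2)
        fix x
        obtain i where i: "x \<notin> A i" using A by blast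
        have "x \<notin> A k" if "k \<ge> i" for k using A i that by (auto simp: antimono_def decseq_def)
        then have "eventually (\<lambda>k. indicator (A k) x * w x = 0) sequentially"
          unfolding eventually_sequentially by (intro exI[of _ i]) auto
        then show "(\<lambda>i. indicator (A i) x * w x) \<longlonglongrightarrow> 0" by (rule tendsto_eventually)
      qed
      show "AE x in M. norm (indicator (A i) x * w x) \<le> w x" for i
        using w(2) by (intro AE_I2) (auto simp: indicator_def)
    qed (use w in auto)
    then show "(\<lambda>i. LINT x|M. indicator (A i) x * w x) \<longlonglongrightarrow> 0" by simp
  qed
qed

lemma pos_functional_plus:
  assumes "pos_functional m" "pos_functional m'"
  shows "pos_functional (\<lambda>h. m h + m' h)"
  using assms unfolding pos_functional_def by (auto simp: distrib_left)

lemma empty_continuous_plus: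
  assumes "empty_continuous m" "empty_continuous m'"
  shows "empty_continuous (\<lambda>h. m h + m' h)"
  using assms unfolding empty_continuous_def by (auto intro: tendsto_add_zero)

lemma pos_functional_zero_map: "pos_functional (\<lambda>h. 0)" "empty_continuous (\<lambda>h. 0)"
  by (auto simp: pos_functional_def empty_continuous_def)

lemma pos_functional_sum:
  "(\<And>i. i \<in> I \<Longrightarrow> pos_functional (m i)) \<Longrightarrow> pos_functional (\<lambda>h. \<Sum>i\<in>I. m i h)"
  by (induction I rule: infinite_finite_induct) (auto intro: pos_functional_plus pos_functional_zero_map)

lemma empty_continuous_sum:
  "(\<And>i. i \<in> I \<Longrightarrow> empty_continuous (m i)) \<Longrightarrow> empty_continuous (\<lambda>h. \<Sum>i\<in>I. m i h)"
  by (induction I rule: infinite_finite_induct) (auto intro: empty_continuous_plus pos_functional_zero_map)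

text \<open>Weighting both measures with the indicator of \<open>B\<close> reduces the claim to two
  functionals that agree on all indicators.\<close>

lemma integral_eq_of_measure_eq_on:
  assumes \<sigma>: "finite_measure \<sigma>" "sets \<sigma> = sets borel" and \<tau>: "finite_measure \<tau>" "sets \<tau> = sets borel"
    and B: "B \<in> sets borel" and eq: "\<And>A. A \<in> sets borel \<Longrightarrow> A \<subseteq> B \<Longrightarrow> measure \<sigma> A = measure \<tau> A"
    and h: "h \<in> bounded_borel" "\<And>x. x \<notin> B \<Longrightarrow> h x = 0"
  shows "integral\<^sup>L \<sigma> h = integral\<^sup>L \<tau> h"
proof -
  have sp: "space \<sigma> = UNIV" "space \<tau> = UNIV" using sets_eq_imp_space_eq[OF \<sigma>(2)] sets_eq_imp_space_eq[OF \<tau>(2)] by auto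
  have w: "integrable \<sigma> (indicator B :: _ \<Rightarrow> real)" "integrable \<tau> (indicator B :: _ \<Rightarrow> real)"
    using integrable_bounded_borel[OF \<sigma>] integrable_bounded_borel[OF \<tau>] B by auto
  have "(LINT x|\<sigma>. h x * indicator B x) = (LINT x|\<tau>. h x * indicator B x)"
  proof (rule pos_functional_eqI[OF pos_functional_weighted(1)[OF \<sigma>(2) w(1)] pos_functional_weighted(2)[OF \<sigma>(2) w(1)]
        pos_functional_weighted(1)[OF \<tau>(2) w(2)] pos_functional_weighted(2)[OF \<tau>(2) w(2)] _ h(1)])
    fix A :: "'a set" assume A: "A \<in> sets borel"
    have "(\<lambda>x. indicator A x * indicator B x :: real) = indicator (A \<inter> B)" by (auto simp: indicator_def fun_eq_iff)
    then show "(LINT x|\<sigma>. indicator A x * indicator B x) = (LINT x|\<tau>. indicator A x * (indicator B x :: real))"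
      using eq[of "A \<inter> B"] A B by (simp add: sp)
  qed auto
  moreover have "(\<lambda>x. h x * indicator B x) = h" using h(2) by (auto simp: indicator_def fun_eq_iff)
  ultimately show ?thesis by simp
qed

text \<open>Distributional derivative and Lebesgue decomposition merged into one identity: the
  derivative is the function \<open>g\<close> plus the singular measure
  \<open>\<sigma> - \<tau>\<close>. Here \<open>g\<close> is Borel and vanishes off
  \<open>\<Omega>\<close>, so that its integral needs neither the completion nor a restriction to
  \<open>\<Omega>\<close>.\<close>

definition weak_deriv_repr ::
  "(real^'n) set \<Rightarrow> (real^'n \<Rightarrow> real) \<Rightarrow> 'n \<Rightarrow> (real^'n \<Rightarrow> real) \<Rightarrow> (real^'n) measure \<Rightarrow> (real^'n) measure \<Rightarrow> bool" where
  "weak_deriv_repr \<Omega> v j g \<sigma> \<tau> \<longleftrightarrow>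
     integrable lborel g \<and> (\<forall>x. x \<notin> \<Omega> \<longrightarrow> g x = 0) \<and>
     finite_borel_measure_on \<Omega> \<sigma> \<and> lebesgue_singular \<sigma> \<and>
     finite_borel_measure_on \<Omega> \<tau> \<and> lebesgue_singular \<tau> \<and>
     (\<forall>\<phi>\<in>test_functions \<Omega>. (LINT x:\<Omega>|lebesgue. v x * frechet_derivative \<phi> (at x) (axis j 1)) =
        - ((LINT x|lborel. g x * \<phi> x) + (LINT x|\<sigma>. \<phi> x) - (LINT x|\<tau>. \<phi> x)))"

lemma test_function_bounded_borel:
  assumes "\<phi> \<in> test_functions \<Omega>"
  shows "\<phi> \<in> bounded_borel" "continuous_on UNIV \<phi>" "\<And>x. x \<notin> \<Omega> \<Longrightarrow> \<phi> x = 0"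
    "\<exists>R. \<forall>x. norm x \<ge> R \<longrightarrow> \<phi> x = (0::real)"
proof -
  have Ck: "Ck 0 \<phi>" and K: "compact (closure {x. \<phi> x \<noteq> 0})" "closure {x. \<phi> x \<noteq> 0} \<subseteq> \<Omega>"
    using assms unfolding test_functions_def by blast+
  show c: "continuous_on UNIV \<phi>" using Ck by simp
  show "\<phi> x = 0" if "x \<notin> \<Omega>" for x using that K(2) closure_subset[of "{x. \<phi> x \<noteq> 0}"] by blast
  obtain R where R: "\<And>x. x \<in> closure {x. \<phi> x \<noteq> 0} \<Longrightarrow> norm x \<le> R"
    using compact_imp_bounded[OF K(1)] unfolding bounded_iff by blast
  have z: "\<phi> x = 0" if "norm x \<ge> R + 1" for x
  proof (rule ccontr)
    assume "\<phi> x \<noteq> 0"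
    then have "x \<in> closure {x. \<phi> x \<noteq> 0}" using closure_subset[of "{x. \<phi> x \<noteq> 0}"] by auto
    from R[OF this] that show False by simp
  qed
  then show "\<exists>R. \<forall>x. norm x \<ge> R \<longrightarrow> \<phi> x = 0" by blast
  obtain C where "\<And>x. \<bar>\<phi> x\<bar> \<le> C" using bounded_supported[OF c z] by blast
  then show "\<phi> \<in> bounded_borel" using c by (intro bounded_borelI) (auto intro: borel_measurable_continuous_onI)
qed

lemma set_integrable_borel_representative:
  fixes g :: "'a::euclidean_space \<Rightarrow> real"
  assumes g: "set_integrable lebesgue \<Omega> g" and \<Omega>: "\<Omega> \<in> sets borel"
  obtains g' where "integrable lborel g'" "\<And>x. x \<notin> \<Omega> \<Longrightarrow> g' x = 0"
    "\<And>A. A \<in> sets borel \<Longrightarrow> A \<subseteq> \<Omega> \<Longrightarrow> (LINT x:A|lebesgue. g x) = (LINT x|lborel. indicator A x * g' x)"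
proof -
  let ?h = "\<lambda>x. indicator \<Omega> x *\<^sub>R g x"
  have h: "integrable lebesgue ?h" using g by (simp add: set_integrable_def)
  then have "?h \<in> borel_measurable (completion lborel)" by auto
  then obtain g0 where g0: "g0 \<in> borel_measurable lborel" "AE x in lborel. ?h x = g0 x"
    using completion_ex_borel_measurable_real by blast
  define g' where "g' x = indicator \<Omega> x * g0 x" for x
  have g'm: "g' \<in> borel_measurable borel"
    unfolding g'_def by (intro borel_measurable_times borel_measurable_indicator) (use g0 \<Omega> in auto)
  have ae: "AE x in lebesgue. ?h x = g' x"
    using AE_completion[OF g0(2)] by eventually_elim (auto simp: g'_def indicator_def)
  have g'm': "g' \<in> borel_measurable lebesgue" by (rule measurable_completion) (use g'm in simp)
  have "integrable lebesgue g'"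
    using h integrable_cong_AE[OF borel_measurable_integrable[OF h] g'm' ae] by blast
  then have 1: "integrable lborel g'" using g'm by (simp add: integrable_completion)
  moreover have "(LINT x:A|lebesgue. g x) = (LINT x|lborel. indicator A x * g' x)" if A: "A \<in> sets borel" "A \<subseteq> \<Omega>" for A
  proof -
    have m: "(\<lambda>x. indicator A x * g' x) \<in> borel_measurable borel"
      by (intro borel_measurable_times borel_measurable_indicator) (use g'm A in auto)
    have ae': "AE x in lebesgue. indicator A x *\<^sub>R g x = indicator A x * g' x"
      using ae by eventually_elim (use A in \<open>auto simp: indicator_def\<close>)
    have m': "(\<lambda>x. indicator A x * g' x) \<in> borel_measurable lebesgue"
      by (rule measurable_completion) (use m in simp)
    have "(\<lambda>x. indicator A x *\<^sub>R g x) \<in> borel_measurable lebesgue"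
      by (rule borel_measurable_AE[OF m']) (use ae' in \<open>auto elim: eventually_mono\<close>)
    then have "(LINT x:A|lebesgue. g x) = (LINT x|lebesgue. indicator A x * g' x)"
      unfolding set_lebesgue_integral_def using m' ae' by (intro integral_cong_AE)
    then show ?thesis using m by (simp add: integral_completion)
  qed
  ultimately show thesis using that[of g'] by (simp add: g'_def)
qed

text \<open>The decomposition is given on Borel sets only; the work is to extend it to integrals of
  test functions.\<close>

lemma SBV_weak_deriv_repr:
  fixes u :: "real^'n \<Rightarrow> real^'m"
  assumes u: "u \<in> SBV \<Omega>" and \<Omega>: "open \<Omega>"
  obtains g \<sigma> \<tau> where "weak_deriv_repr \<Omega> (\<lambda>x. u x $ i) j g \<sigma> \<tau>"
    "\<And>B. B \<in> sets borel \<Longrightarrow> B \<subseteq> \<Omega> - approx_disc_set \<Omega> u \<Longrightarrow> measure \<sigma> B = measure \<tau> B"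
proof -
  obtain \<mu> \<nu> g0 \<sigma> \<tau> where dd: "dist_deriv_measure \<Omega> u i j \<mu> \<nu>" and dec: "lebesgue_decomposition \<Omega> \<mu> \<nu> g0 \<sigma> \<tau>"
    and van: "\<forall>B\<in>sets borel. B \<subseteq> \<Omega> - approx_disc_set \<Omega> u \<longrightarrow> measure \<sigma> B - measure \<tau> B = 0"
    using u unfolding SBV_def by blast
  have \<Omega>b: "\<Omega> \<in> sets borel" using \<Omega> by auto
  have fin: "finite_borel_measure_on \<Omega> \<mu>" "finite_borel_measure_on \<Omega> \<nu>" "finite_borel_measure_on \<Omega> \<sigma>" "finite_borel_measure_on \<Omega> \<tau>"
    and g0: "set_integrable lebesgue \<Omega> g0"
    using dd dec unfolding dist_deriv_measure_def lebesgue_decomposition_def by blast+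
  obtain g where g: "integrable lborel g" "\<And>x. x \<notin> \<Omega> \<Longrightarrow> g x = 0"
    "\<And>A. A \<in> sets borel \<Longrightarrow> A \<subseteq> \<Omega> \<Longrightarrow> (LINT x:A|lebesgue. g0 x) = (LINT x|lborel. indicator A x * g x)"
    using set_integrable_borel_representative[OF g0 \<Omega>b] by blast
  have M: "finite_measure M" "sets M = sets borel" "space M = UNIV" if "finite_borel_measure_on \<Omega> M" for M
    using that sets_eq_imp_space_eq[of M borel] by (auto simp: finite_borel_measure_on_def)
  have mI: "measure M B = measure M (B \<inter> \<Omega>)" if "finite_borel_measure_on \<Omega> M" "B \<in> sets borel" for M B
  proof -
    have "- \<Omega> \<in> null_sets M" using that(1) \<Omega>b M[OF that(1)] by (auto simp: finite_borel_measure_on_def)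
    then have "emeasure M (B - (- \<Omega>)) = emeasure M B" using M[OF that(1)] that(2) by (intro emeasure_Diff_null_set) auto
    moreover have "B - (- \<Omega>) = B \<inter> \<Omega>" by auto
    ultimately show ?thesis by (simp add: measure_def)
  qed
  define gp where "gp x = max 0 (g x)" for x
  define gm where "gm x = max 0 (- g x)" for x
  have gpm: "integrable lborel gp" "integrable lborel gm" "\<And>x. gp x \<ge> 0" "\<And>x. gm x \<ge> 0" "\<And>x. g x = gp x - gm x"
    using g(1) unfolding gp_def gm_def by auto
  \<comment> \<open>Signed terms are moved across the identity so that both sides become positive
    functionals: \<open>\<mu>\<close>, \<open>gm\<close> and \<open>\<tau>\<close> on one side,
    \<open>\<nu>\<close>, \<open>gp\<close> and \<open>\<sigma>\<close> on the other.\<close>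
  have key: "integral\<^sup>L \<mu> h + ((LINT x|lborel. h x * gm x) + integral\<^sup>L \<tau> h)
      = integral\<^sup>L \<nu> h + ((LINT x|lborel. h x * gp x) + integral\<^sup>L \<sigma> h)" if h: "h \<in> bounded_borel" for h
  proof (rule pos_functional_eqI[OF _ _ _ _ _ h])
    show "pos_functional (\<lambda>h. integral\<^sup>L \<mu> h + ((LINT x|lborel. h x * gm x) + integral\<^sup>L \<tau> h))"
      "pos_functional (\<lambda>h. integral\<^sup>L \<nu> h + ((LINT x|lborel. h x * gp x) + integral\<^sup>L \<sigma> h))"
      by (intro pos_functional_plus integral_pos_functional(1) pos_functional_weighted(1) M[OF fin(1)] M[OF fin(2)] M[OF fin(3)] M[OF fin(4)] gpm; simp)+
    show "empty_continuous (\<lambda>h. integral\<^sup>L \<mu> h + ((LINT x|lborel. h x * gm x) + integral\<^sup>L \<tau> h))"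
      "empty_continuous (\<lambda>h. integral\<^sup>L \<nu> h + ((LINT x|lborel. h x * gp x) + integral\<^sup>L \<sigma> h))"
      by (intro empty_continuous_plus integral_pos_functional(2) pos_functional_weighted(2) M[OF fin(1)] M[OF fin(2)] M[OF fin(3)] M[OF fin(4)] gpm; simp)+
    fix B :: "(real^'n) set" assume B: "B \<in> sets borel"
    have "measure \<mu> (B \<inter> \<Omega>) - measure \<nu> (B \<inter> \<Omega>) = (LINT x:B \<inter> \<Omega>|lebesgue. g0 x) + (measure \<sigma> (B \<inter> \<Omega>) - measure \<tau> (B \<inter> \<Omega>))"
      using dec B \<Omega>b unfolding lebesgue_decomposition_def by auto
    then have "measure \<mu> B - measure \<nu> B = (LINT x:B \<inter> \<Omega>|lebesgue. g0 x) + (measure \<sigma> B - measure \<tau> B)"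
      using mI[OF fin(1) B] mI[OF fin(2) B] mI[OF fin(3) B] mI[OF fin(4) B] by simp
    also have "(LINT x:B \<inter> \<Omega>|lebesgue. g0 x) = (LINT x|lborel. indicator (B \<inter> \<Omega>) x * g x)"
      by (rule g(3)) (use B \<Omega>b in auto)
    also have "\<dots> = (LINT x|lborel. indicator B x * gp x - indicator B x * gm x)"
      by (rule Bochner_Integration.integral_cong) (use g(2) gpm(5) in \<open>auto simp: indicator_def\<close>)
    also have "\<dots> = (LINT x|lborel. indicator B x * gp x) - (LINT x|lborel. indicator B x * gm x)"
      using B gpm(1,2) by (intro Bochner_Integration.integral_diff integrable_real_mult_indicator[of _ lborel, simplified mult.commute]) 
       (auto simp: mult.commute intro: integrable_real_mult_indicator)
    finally show "integral\<^sup>L \<mu> (indicator B) + ((LINT x|lborel. indicator B x * gm x) + integral\<^sup>L \<tau> (indicator B))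
      = integral\<^sup>L \<nu> (indicator B) + ((LINT x|lborel. indicator B x * gp x) + integral\<^sup>L \<sigma> (indicator B))"
      using M(3)[OF fin(1)] M(3)[OF fin(2)] M(3)[OF fin(3)] M(3)[OF fin(4)] by simp
  qed
  have "weak_deriv_repr \<Omega> (\<lambda>x. u x $ i) j g \<sigma> \<tau>"
    unfolding weak_deriv_repr_def
  proof (intro conjI ballI allI impI)
    fix \<phi> :: "real^'n \<Rightarrow> real" assume \<phi>: "\<phi> \<in> test_functions \<Omega>"
    have b: "\<phi> \<in> bounded_borel" by (rule test_function_bounded_borel(1)[OF \<phi>])
    obtain C where C: "\<And>x. \<bar>\<phi> x\<bar> \<le> C" and \<phi>m: "\<phi> \<in> borel_measurable borel" using bounded_borelE[OF b] by blast
    have i: "integrable lborel (\<lambda>x. \<phi> x * gp x)" "integrable lborel (\<lambda>x. \<phi> x * gm x)"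
      by (rule integrable_bounded_mult[OF gpm(1) _ C], use \<phi>m in simp) (rule integrable_bounded_mult[OF gpm(2) _ C], use \<phi>m in simp)
    have "(LINT x|lborel. g x * \<phi> x) = (LINT x|lborel. \<phi> x * gp x - \<phi> x * gm x)"
      by (simp add: gpm(5) algebra_simps)
    also have "\<dots> = (LINT x|lborel. \<phi> x * gp x) - (LINT x|lborel. \<phi> x * gm x)"
      by (rule Bochner_Integration.integral_diff[OF i])
    finally show "(LINT x:\<Omega>|lebesgue. u x $ i * frechet_derivative \<phi> (at x) (axis j 1)) =
        - ((LINT x|lborel. g x * \<phi> x) + (LINT x|\<sigma>. \<phi> x) - (LINT x|\<tau>. \<phi> x))"
      using dd \<phi> key[OF b] unfolding dist_deriv_measure_def by auto
  qed (use g fin dec in \<open>auto simp: lebesgue_decomposition_def\<close>)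
  then show thesis using that van by auto
qed

text \<open>The way back: adding the positive part of \<open>g\<close> to \<open>\<sigma>\<close>
  and the negative part to \<open>\<tau>\<close> yields two finite measures with the required
  difference and decomposition.\<close>

lemma SBV_I_weak_deriv_repr:
  fixes w :: "real^'n \<Rightarrow> real^'m"
  assumes \<Omega>: "open \<Omega>" and w: "set_integrable lebesgue \<Omega> w"
    and repr: "\<And>i j. \<exists>g \<sigma> \<tau>. weak_deriv_repr \<Omega> (\<lambda>x. w x $ i) j g \<sigma> \<tau> \<and>
       (\<forall>B\<in>sets borel. B \<subseteq> \<Omega> - approx_disc_set \<Omega> w \<longrightarrow> measure \<sigma> B = measure \<tau> B)"
  shows "w \<in> SBV \<Omega>"
proof -
  have \<Omega>b: "\<Omega> \<in> sets borel" using \<Omega> by auto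
  have "\<exists>\<mu> \<nu> g \<sigma> \<tau>. dist_deriv_measure \<Omega> w i j \<mu> \<nu> \<and> lebesgue_decomposition \<Omega> \<mu> \<nu> g \<sigma> \<tau> \<and>
     (\<forall>B \<in> sets borel. B \<subseteq> \<Omega> - approx_disc_set \<Omega> w \<longrightarrow> measure \<sigma> B - measure \<tau> B = 0)" for i j
  proof -
    obtain g \<sigma> \<tau> where R: "weak_deriv_repr \<Omega> (\<lambda>x. w x $ i) j g \<sigma> \<tau>"
      and van: "\<forall>B\<in>sets borel. B \<subseteq> \<Omega> - approx_disc_set \<Omega> w \<longrightarrow> measure \<sigma> B = measure \<tau> B"
      using repr by blast
    have g: "integrable lborel g" "\<And>x. x \<notin> \<Omega> \<Longrightarrow> g x = 0" and fin: "finite_borel_measure_on \<Omega> \<sigma>" "finite_borel_measure_on \<Omega> \<tau>"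
      using R unfolding weak_deriv_repr_def by blast+
    have M: "finite_measure M" "sets M = sets borel" "space M = UNIV" "emeasure M (- \<Omega>) = 0" if "finite_borel_measure_on \<Omega> M" for M
      using that sets_eq_imp_space_eq[of M borel] by (auto simp: finite_borel_measure_on_def)
    \<comment> \<open>Used with \<open>s = 1\<close> for the positive and with \<open>s = -1\<close>
      for the negative part of \<open>g\<close>.\<close>
    have build: "\<exists>\<mu>. finite_borel_measure_on \<Omega> \<mu> \<and> (\<forall>h\<in>bounded_borel. integral\<^sup>L \<mu> h = (LINT x|lborel. h x * max 0 (s * g x)) + integral\<^sup>L \<sigma> h) \<and>
        (\<forall>B\<in>sets borel. measure \<mu> B = (LINT x|lborel. indicator B x * max 0 (s * g x)) + measure \<sigma> B)"
      if \<sigma>: "finite_borel_measure_on \<Omega> \<sigma>" for s :: real and \<sigma>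
    proof -
      let ?m = "\<lambda>h. (LINT x|lborel. h x * max 0 (s * g x)) + integral\<^sup>L \<sigma> h"
      have gi: "integrable lborel (\<lambda>x. max 0 (s * g x))" using g(1) by auto
      have "pos_functional ?m" "empty_continuous ?m"
        by (intro pos_functional_plus integral_pos_functional(1) pos_functional_weighted(1) M[OF \<sigma>] gi; simp)
          (intro empty_continuous_plus integral_pos_functional(2) pos_functional_weighted(2) M[OF \<sigma>] gi; simp)
      then obtain \<mu> where \<mu>: "finite_measure \<mu>" "sets \<mu> = sets borel" "\<And>B. B \<in> sets borel \<Longrightarrow> measure \<mu> B = ?m (indicator B)"
          "\<And>h. h \<in> bounded_borel \<Longrightarrow> integral\<^sup>L \<mu> h = ?m h"
        using measure_of_pos_functional[of ?m] by blast
      have eq: "measure \<mu> B = (LINT x|lborel. indicator B x * max 0 (s * g x)) + measure \<sigma> B" if "B \<in> sets borel" for B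
        using \<mu>(3)[OF that] M(3)[OF \<sigma>] by simp
      have "(LINT x|lborel. indicator (- \<Omega>) x * max 0 (s * g x)) = (LINT (x::real^'n)|lborel. 0)"
      proof (rule Bochner_Integration.integral_cong)
        fix x show "indicator (- \<Omega>) x * max 0 (s * g x) = 0" by (cases "x \<in> \<Omega>") (auto simp: g(2))
      qed simp
      moreover have "measure \<sigma> (- \<Omega>) = 0" using M(4)[OF \<sigma>] by (simp add: measure_def)
      ultimately have "measure \<mu> (- \<Omega>) = 0" using eq[of "- \<Omega>"] \<Omega>b by auto
      then have "emeasure \<mu> (- \<Omega>) = 0" using \<mu>(1) by (simp add: finite_measure.emeasure_eq_measure)
      then have "finite_borel_measure_on \<Omega> \<mu>" using \<mu> by (simp add: finite_borel_measure_on_def)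
      then show ?thesis using \<mu>(4) eq by blast
    qed
    obtain \<mu> where \<mu>: "finite_borel_measure_on \<Omega> \<mu>"
      "\<And>h. h \<in> bounded_borel \<Longrightarrow> integral\<^sup>L \<mu> h = (LINT x|lborel. h x * max 0 (1 * g x)) + integral\<^sup>L \<sigma> h"
      "\<And>B. B \<in> sets borel \<Longrightarrow> measure \<mu> B = (LINT x|lborel. indicator B x * max 0 (1 * g x)) + measure \<sigma> B"
      using build[OF fin(1), of 1] by blast
    obtain \<nu> where \<nu>: "finite_borel_measure_on \<Omega> \<nu>"
      "\<And>h. h \<in> bounded_borel \<Longrightarrow> integral\<^sup>L \<nu> h = (LINT x|lborel. h x * max 0 (- 1 * g x)) + integral\<^sup>L \<tau> h"
      "\<And>B. B \<in> sets borel \<Longrightarrow> measure \<nu> B = (LINT x|lborel. indicator B x * max 0 (- 1 * g x)) + measure \<tau> B"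
      using build[OF fin(2), of "-1"] by blast
    have diff: "(LINT x|lborel. h x * max 0 (1 * g x)) - (LINT x|lborel. h x * max 0 (- 1 * g x)) = (LINT x|lborel. g x * h x)"
      if h: "h \<in> bounded_borel" for h
    proof -
      obtain C where C: "\<And>x. \<bar>h x\<bar> \<le> C" and hm: "h \<in> borel_measurable borel" using bounded_borelE[OF h] by blast
      have "integrable lborel (\<lambda>x. h x * max 0 (s * g x))" for s :: real
        by (rule integrable_bounded_mult[OF _ _ C]) (use hm g(1) in auto)
      then have "(LINT x|lborel. h x * max 0 (1 * g x)) - (LINT x|lborel. h x * max 0 (- 1 * g x))
         = (LINT x|lborel. h x * max 0 (1 * g x) - h x * max 0 (- 1 * g x))"
        by (intro Bochner_Integration.integral_diff[symmetric])
      also have "\<dots> = (LINT x|lborel. g x * h x)"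
        by (rule Bochner_Integration.integral_cong) (auto simp: max_def)
      finally show ?thesis .
    qed
    have "dist_deriv_measure \<Omega> w i j \<mu> \<nu>"
      unfolding dist_deriv_measure_def
    proof (intro conjI ballI \<mu>(1) \<nu>(1))
      fix \<phi> :: "real^'n \<Rightarrow> real" assume \<phi>: "\<phi> \<in> test_functions \<Omega>"
      have b: "\<phi> \<in> bounded_borel" by (rule test_function_bounded_borel(1)[OF \<phi>])
      show "(LINT x:\<Omega>|lebesgue. w x $ i * frechet_derivative \<phi> (at x) (axis j 1)) = - ((LINT x|\<mu>. \<phi> x) - (LINT x|\<nu>. \<phi> x))"
        using R \<phi> \<mu>(2)[OF b] \<nu>(2)[OF b] diff[OF b] unfolding weak_deriv_repr_def by simp
    qed
    moreover have "lebesgue_decomposition \<Omega> \<mu> \<nu> g \<sigma> \<tau>"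
      unfolding lebesgue_decomposition_def
    proof (intro conjI ballI impI)
      have "integrable lborel (\<lambda>x. indicator \<Omega> x *\<^sub>R g x)" by (rule integrable_mult_indicator[OF _ g(1)]) (use \<Omega>b in auto)
      moreover have gm: "g \<in> borel_measurable borel" using g(1) by auto
      ultimately show "set_integrable lebesgue \<Omega> g"
        using \<Omega>b by (subst set_integrable_lebesgue_iff_lborel) (auto simp: set_integrable_def)
      fix B assume B: "B \<in> sets borel" "B \<subseteq> \<Omega>"
      have "(LINT x:B|lebesgue. g x) = (LINT x|lborel. g x * indicator B x)"
        using B gm by (subst set_lebesgue_integral_lebesgue_eq_lborel) (auto simp: set_lebesgue_integral_def mult.commute)
      then show "measure \<mu> B - measure \<nu> B = (LINT x:B|lebesgue. g x) + (measure \<sigma> B - measure \<tau> B)"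
        using \<mu>(3)[OF B(1)] \<nu>(3)[OF B(1)] diff[of "indicator B"] B by simp
    qed (use R fin in \<open>auto simp: weak_deriv_repr_def\<close>)
    ultimately show ?thesis using van by fastforce
  qed
  then show ?thesis using w unfolding SBV_def BV_def by blast
qed

text \<open>\<open>\<sigma>\<close> and \<open>\<tau>\<close> coincide inside \<open>V\<close>, so
  their integrals of a function supported in \<open>V\<close> cancel, although neither measure has
  to vanish there.\<close>

lemma weak_deriv_repr_on_regular_set:
  assumes R: "weak_deriv_repr \<Omega> v j g \<sigma> \<tau>" and V: "open V" "V \<subseteq> \<Omega>"
    and eq: "\<And>B. B \<in> sets borel \<Longrightarrow> B \<subseteq> V \<Longrightarrow> measure \<sigma> B = measure \<tau> B" and \<phi>: "\<phi> \<in> test_functions V"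
  shows "(LINT x:\<Omega>|lebesgue. v x * frechet_derivative \<phi> (at x) (axis j 1)) = - (LINT x|lborel. g x * \<phi> x)"
proof -
  have "\<phi> \<in> test_functions \<Omega>" using \<phi> V(2) unfolding test_functions_def by blast
  moreover have "integral\<^sup>L \<sigma> \<phi> = integral\<^sup>L \<tau> \<phi>"
    by (rule integral_eq_of_measure_eq_on[where B = V])
      (use R V eq test_function_bounded_borel[OF \<phi>] in \<open>auto simp: weak_deriv_repr_def finite_borel_measure_on_def\<close>)
  ultimately show ?thesis using R unfolding weak_deriv_repr_def by simp
qed

section \<open>The chain rule\<close>

text \<open>By translation invariance the increment \<psi>(x + s h) - \<psi>(x) has integral 0,
  while by uniform differentiability its integral differs from \<open>s\<close> times the integral
  of the derivative only by o(s).\<close>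

lemma integral_deriv_compact_support:
  fixes \<psi> :: "'a::euclidean_space \<Rightarrow> real"
  assumes deriv: "\<And>x. (\<psi> has_derivative \<psi>' x) (at x)" and cont: "\<And>h. continuous_on UNIV (\<lambda>x. \<psi>' x h)"
    and supp: "\<And>x. norm x \<ge> R \<Longrightarrow> \<psi> x = 0"
  shows "(LINT x|lborel. \<psi>' x h) = 0"
proof (rule ccontr)
  assume ne: "(LINT x|lborel. \<psi>' x h) \<noteq> 0"
  define V where "V = measure lborel (cball (0::'a) (R + 2))"
  define I where "I = \<bar>LINT x|lborel. \<psi>' x h\<bar>"
  have I: "I > 0" using ne by (simp add: I_def)
  have Vn: "V \<ge> 0" by (simp add: V_def)
  define P where "P = (norm h + 1) * (V + 1)"
  have P: "P > 0" unfolding P_def using Vn by (intro mult_pos_pos add_nonneg_pos) auto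
  define e where "e = I / (2 * P)"
  have e: "e > 0" using I P by (simp add: e_def)
  have c\<psi>: "continuous_on UNIV \<psi>" by (rule continuous_on_kernel[OF deriv cont supp])
  have int\<psi>: "integrable lborel \<psi>"
    by (rule integrable_continuous_supported[OF c\<psi> compact_cball[of 0 R]]) (use supp in auto)
  have int\<psi>': "integrable lborel (\<lambda>x. \<psi>' x h)"
    by (rule integrable_continuous_supported[OF cont compact_cball[of 0 "R + 1"]])
      (use kernel_deriv_supp[OF deriv cont supp] in auto)
  obtain d where d: "d > 0" "\<And>a h. norm h < d \<Longrightarrow> \<bar>\<psi> (a + h) - \<psi> a - \<psi>' a h\<bar> \<le> e * norm h"
    using kernel_uniformly_differentiable[OF deriv cont supp e] by blast
  \<comment> \<open>The first bound makes the uniform remainder estimate applicable; the second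
    keeps the translation within distance 1, so that everything happens inside
    \<open>cball 0 (R + 2)\<close>.\<close>
  define s where "s = min (d / (2 * (norm h + 1))) (1 / (norm h + 1))"
  have s: "s > 0" using d(1) by (simp add: s_def add_nonneg_pos)
  have snh: "s * norm h < d" "s * norm h \<le> 1"
  proof -
    have "s \<le> d / (2 * (norm h + 1))" "s \<le> 1 / (norm h + 1)" by (auto simp: s_def)
    then have "s * (norm h + 1) \<le> d / 2" "s * (norm h + 1) \<le> 1" using norm_ge_zero[of h]
      by (auto simp: field_simps add_nonneg_pos)
    then show "s * norm h < d" "s * norm h \<le> 1" using s d(1) by (auto simp: algebra_simps)
  qed
  have shift: "integrable lborel (\<lambda>x. \<psi> (s *\<^sub>R h + x))" "(LINT x|lborel. \<psi> (s *\<^sub>R h + x)) = integral\<^sup>L lborel \<psi>"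
  proof -
    have *: "distr lborel borel ((+) (s *\<^sub>R h)) = lborel" by (rule lborel_distr_plus)
    have m: "\<psi> \<in> borel_measurable borel" by (rule borel_measurable_continuous_onI[OF c\<psi>])
    show "integrable lborel (\<lambda>x. \<psi> (s *\<^sub>R h + x))"
      using int\<psi> m by (subst (asm) *[symmetric]) (simp add: integrable_distr_eq)
    show "(LINT x|lborel. \<psi> (s *\<^sub>R h + x)) = integral\<^sup>L lborel \<psi>"
      using m by (subst (2) *[symmetric]) (simp add: integral_distr)
  qed
  have lin: "\<psi>' x (s *\<^sub>R h) = s * \<psi>' x h" for x
    using linear_scale[OF has_derivative_linear[OF deriv]] by simp
  have "s * I = \<bar>LINT x|lborel. s * \<psi>' x h\<bar>" using s by (simp add: I_def abs_mult)
  also have "\<dots> = \<bar>LINT x|lborel. \<psi> (s *\<^sub>R h + x) - \<psi> x - s * \<psi>' x h\<bar>"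
    using shift int\<psi> int\<psi>' by simp
  also have "\<dots> \<le> (LINT x|lborel. \<bar>\<psi> (s *\<^sub>R h + x) - \<psi> x - s * \<psi>' x h\<bar>)" by (rule integral_abs_bound)
  also have "\<dots> \<le> (LINT x|lborel. e * (s * norm h) * indicator (cball (0::'a) (R + 2)) x)"
  proof (rule integral_mono)
    show "integrable lborel (\<lambda>x. \<bar>\<psi> (s *\<^sub>R h + x) - \<psi> x - s * \<psi>' x h\<bar>)"
      using shift(1) int\<psi> int\<psi>' by auto
    show "integrable lborel (\<lambda>x. e * (s * norm h) * indicator (cball (0::'a) (R + 2)) x)"
      by (intro integrable_mult_right integrable_real_indicator) (use emeasure_lborel_cball_finite[of "0::'a" "R + 2"] in auto)
    fix x :: 'a
    show "\<bar>\<psi> (s *\<^sub>R h + x) - \<psi> x - s * \<psi>' x h\<bar> \<le> e * (s * norm h) * indicator (cball (0::'a) (R + 2)) x"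
    proof (cases "x \<in> cball 0 (R + 2)")
      case True
      then show ?thesis using d(2)[of "s *\<^sub>R h" x] snh s by (simp add: lin add.commute)
    next
      case False
      then have n: "norm x > R + 2" by auto
      have "norm x \<le> norm (s *\<^sub>R h + x) + norm (s *\<^sub>R h)" by (metis add_diff_cancel_left' norm_triangle_sub add.commute norm_minus_commute norm_triangle_ineq4)
      then have "norm (s *\<^sub>R h + x) \<ge> R" using n snh s by simp
      then show ?thesis using n supp kernel_deriv_supp[OF deriv cont supp] False by simp
    qed
  qed
  also have "\<dots> = e * (s * norm h) * V" by (simp add: V_def)
  also have "\<dots> \<le> s * (e * P)"
    using e s Vn by (simp add: P_def mult.assoc mult.left_commute mult_mono)
  also have "e * P = I / 2" using P by (simp add: e_def)
  finally show False using s I by simp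
qed

lemma integral_mollifier_center:
  fixes y :: "real^'n"
  assumes d: "d > 0"
  shows "integrable lborel (\<lambda>x. mollifier d (x - y))" "(LINT x|lborel. mollifier d (x - y)) = 1"
proof -
  show "integrable lborel (\<lambda>x. mollifier d (x - y))"
  proof (rule integrable_continuous_supported[where S = "cball y d"])
    show "continuous_on UNIV (\<lambda>x. mollifier d (x - y))"
      by (intro continuous_on_compose2[OF continuous_on_mollifier] continuous_intros) auto
  qed (auto simp: dist_norm norm_minus_commute intro!: mollifier_supp[OF d])
  have "(LINT x|lborel. mollifier d (x - y)) = enn2real (\<integral>\<^sup>+x. ennreal (mollifier d (x - y)) \<partial>lborel)"
    by (rule integral_eq_nn_integral) (auto intro: mollifier_nonneg[OF d])
  then show "(LINT x|lborel. mollifier d (x - y)) = 1" by (simp add: nn_integral_mollifier_center[OF d])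
qed

text \<open>Averages over the first argument of the kernel, as they arise when Fubini's theorem
  moves the mollifier from one factor to the other.\<close>

lemma reflected_mollify:
  fixes F :: "real^'n \<Rightarrow> real"
  assumes d: "d > 0" and F: "F \<in> borel_measurable borel" "\<And>x. \<bar>F x\<bar> \<le> B"
  shows reflected_mollify_integrable: "integrable lborel (\<lambda>x. mollifier d (x - y) * F x)"
    and reflected_mollify_near: "(\<And>x. dist x y < d \<Longrightarrow> \<bar>F x - c\<bar> \<le> e) \<Longrightarrow> \<bar>(LINT x|lborel. mollifier d (x - y) * F x) - c\<bar> \<le> e"
    and reflected_mollify_bound: "\<bar>LINT x|lborel. mollifier d (x - y) * F x\<bar> \<le> B"
proof -
  note [measurable] = F(1)
  show int: "integrable lborel (\<lambda>x. mollifier d (x - y) * F x)"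
    using integrable_bounded_mult[OF integral_mollifier_center(1)[OF d], of F B y] F by (simp add: mult.commute)
  show near: "\<bar>(LINT x|lborel. mollifier d (x - y) * F x) - c\<bar> \<le> e" if near: "\<And>x. dist x y < d \<Longrightarrow> \<bar>F x - c\<bar> \<le> e" for c e
  proof -
    have "(LINT x|lborel. mollifier d (x - y) * F x) - c = (LINT x|lborel. mollifier d (x - y) * F x - mollifier d (x - y) * c)"
      using int integral_mollifier_center[OF d, of y] by simp
    then have "\<bar>(LINT x|lborel. mollifier d (x - y) * F x) - c\<bar> \<le> (LINT x|lborel. \<bar>mollifier d (x - y) * F x - mollifier d (x - y) * c\<bar>)"
      by (simp only: integral_abs_bound)
    also have "\<dots> \<le> (LINT x|lborel. mollifier d (x - y) * e)"
    proof (rule integral_mono)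
      show "integrable lborel (\<lambda>x. \<bar>mollifier d (x - y) * F x - mollifier d (x - y) * c\<bar>)"
        using int integral_mollifier_center(1)[OF d, of y] by auto
      show "integrable lborel (\<lambda>x. mollifier d (x - y) * e)" using integral_mollifier_center(1)[OF d, of y] by auto
      fix x
      show "\<bar>mollifier d (x - y) * F x - mollifier d (x - y) * c\<bar> \<le> mollifier d (x - y) * e"
      proof (cases "dist x y < d")
        case True
        have "\<bar>mollifier d (x - y) * F x - mollifier d (x - y) * c\<bar> = mollifier d (x - y) * \<bar>F x - c\<bar>"
          using mollifier_nonneg[OF d, of "x - y"] by (simp add: abs_mult flip: right_diff_distrib)
        also have "\<dots> \<le> mollifier d (x - y) * e"
          by (rule mult_left_mono[OF near[OF True] mollifier_nonneg[OF d]])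
        finally show ?thesis .
      next
        case False
        then show ?thesis using mollifier_supp[OF d, of "x - y"] by (simp add: dist_norm)
      qed
    qed
    also have "\<dots> = e" using integral_mollifier_center(2)[OF d, of y] by simp
    finally show ?thesis .
  qed
  show "\<bar>LINT x|lborel. mollifier d (x - y) * F x\<bar> \<le> B"
    using near[of 0 B] F(2) by simp
qed

text \<open>One statement for the absolutely continuous part (\<open>M = lborel\<close> with
  \<open>r\<close> the density) and for the singular parts (\<open>M\<close> a finite measure and
  \<open>r\<close> constantly 1).\<close>

lemma mollifier_Fubini:
  fixes q :: "real^'n \<Rightarrow> real"
  assumes d: "d > 0" and q: "integrable lborel q"
    and M: "sigma_finite_measure M" "sets M = sets borel" and r: "integrable M r"
  shows "integrable lborel (\<lambda>x. q x * (LINT y|M. mollifier d (x - y) * r y))"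
    and "(LINT x|lborel. q x * (LINT y|M. mollifier d (x - y) * r y)) = (LINT y|M. (LINT x|lborel. mollifier d (x - y) * q x) * r y)"
proof -
  interpret M: sigma_finite_measure M by fact
  interpret P: pair_sigma_finite lborel M ..
  note [measurable_cong] = M(2)
  have [measurable]: "q \<in> borel_measurable borel" "r \<in> borel_measurable M" using q r by auto
  obtain C where C: "\<And>y::real^'n. \<bar>mollifier d y\<bar> \<le> C"
    using bounded_supported[OF continuous_on_mollifier mollifier_supp[OF d]] by metis
  have int1: "integrable M (\<lambda>y. mollifier d (x - y) * r y)" for x
    by (rule integrable_bounded_mult[OF r _ C]) measurable
  let ?f = "\<lambda>(x, y). q x * (mollifier d (x - y) * r y)"
  have int: "integrable (lborel \<Otimes>\<^sub>M M) ?f"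
  proof (rule P.Fubini_integrable)
    show "?f \<in> borel_measurable (lborel \<Otimes>\<^sub>M M)" by measurable
    show "integrable lborel (\<lambda>x. LINT y|M. norm (?f (x, y)))"
    proof (rule Bochner_Integration.integrable_bound)
      show "integrable lborel (\<lambda>x. q x * (C * (LINT y|M. \<bar>r y\<bar>)))" using q by simp
      show "(\<lambda>x. LINT y|M. norm (?f (x, y))) \<in> borel_measurable lborel" by measurable
      have "norm (LINT y|M. norm (?f (x, y))) \<le> norm (q x * (C * (LINT y|M. \<bar>r y\<bar>)))" for x
      proof -
        have "(LINT y|M. norm (?f (x, y))) \<le> (LINT y|M. \<bar>q x\<bar> * (C * \<bar>r y\<bar>))"
        proof (rule integral_mono)
          show "integrable M (\<lambda>y. norm (?f (x, y)))" using int1[of x] by simp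
          show "integrable M (\<lambda>y. \<bar>q x\<bar> * (C * \<bar>r y\<bar>))" using r by simp
          show "norm (?f (x, y)) \<le> \<bar>q x\<bar> * (C * \<bar>r y\<bar>)" for y
            using C[of "x - y"] by (simp add: abs_mult mult_left_mono mult_right_mono)
        qed
        then have "(LINT y|M. norm (?f (x, y))) \<le> \<bar>q x\<bar> * (C * (LINT y|M. \<bar>r y\<bar>))" by simp
        moreover have "(LINT y|M. norm (?f (x, y))) \<ge> 0" by (rule integral_nonneg_AE) simp
        moreover have "C * (LINT y|M. \<bar>r y\<bar>) \<ge> 0"
          using C[of 0] by (intro mult_nonneg_nonneg integral_nonneg_AE) auto
        moreover have "\<bar>C\<bar> = C" using C[of 0] by simp
        ultimately show ?thesis by (simp add: abs_mult)
      qed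
      then show "AE x in lborel. norm (LINT y|M. norm (?f (x, y))) \<le> norm (q x * (C * (LINT y|M. \<bar>r y\<bar>)))" by simp
    qed
    show "AE x in lborel. integrable M (\<lambda>y. ?f (x, y))" using int1 by simp
  qed
  show "integrable lborel (\<lambda>x. q x * (LINT y|M. mollifier d (x - y) * r y))"
    using P.integrable_fst'[OF int] int1 by simp
  have "(LINT x|lborel. q x * (LINT y|M. mollifier d (x - y) * r y)) = (LINT x|lborel. (LINT y|M. q x * (mollifier d (x - y) * r y)))"
    using int1 by simp
  also have "\<dots> = (LINT y|M. (LINT x|lborel. q x * (mollifier d (x - y) * r y)))"
    by (rule P.Fubini_integral[symmetric]) (use int in simp)
  also have "\<dots> = (LINT y|M. (LINT x|lborel. mollifier d (x - y) * q x) * r y)"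
  proof (rule Bochner_Integration.integral_cong[OF refl])
    fix y
    have "(LINT x|lborel. q x * (mollifier d (x - y) * r y)) = (LINT x|lborel. (mollifier d (x - y) * q x) * r y)"
      by (rule Bochner_Integration.integral_cong) (auto simp: mult_ac)
    then show "(LINT x|lborel. q x * (mollifier d (x - y) * r y)) = (LINT x|lborel. mollifier d (x - y) * q x) * r y"
      by simp
  qed
  finally show "(LINT x|lborel. q x * (LINT y|M. mollifier d (x - y) * r y)) = (LINT y|M. (LINT x|lborel. mollifier d (x - y) * q x) * r y)" .
qed

definition vmollify :: "real \<Rightarrow> (real^'n \<Rightarrow> real^'m) \<Rightarrow> real^'n \<Rightarrow> real^'m" where
  "vmollify d u x = (\<chi> l. mollify d (\<lambda>y. u y $ l) x)"

lemma integrable_vec_nth: "integrable M u \<Longrightarrow> integrable M (\<lambda>y. u y $ l)" for u :: "'a \<Rightarrow> real^'m"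
  by (rule integrable_bounded_linear[OF bounded_linear_vec_nth])

text \<open>Pair the value \<open>a\<close> of the mollification with itself:
  \<open>a \<bullet> a\<close> is an average of the numbers \<open>a \<bullet> u y\<close>, hence at
  most \<open>norm a\<close>. So mollifications stay in the ball on which \<open>chain_map\<close>
  controls \<open>f\<close>.\<close>

lemma norm_vmollify:
  fixes u :: "real^'n \<Rightarrow> real^'m"
  assumes d: "d > 0" and um [measurable]: "u \<in> borel_measurable borel" and u1: "\<And>y. norm (u y) \<le> 1"
  shows "norm (vmollify d u x) \<le> 1"
proof -
  define a where "a = vmollify d u x"
  have li: "locally_integrable (\<lambda>y. u y $ l)" for l
    by (rule locally_integrable_bounded[of _ 1]) (auto intro: order_trans[OF component_le_norm_cart u1])
  have "a \<bullet> a = (\<Sum>l\<in>UNIV. a $ l * mollify d (\<lambda>y. u y $ l) x)"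
    by (simp add: inner_vec_def a_def vmollify_def)
  also have "\<dots> = (LINT y|lborel. (\<Sum>l\<in>UNIV. a $ l * (mollifier d (x - y) * u y $ l)))"
    unfolding mollify_def
    by (subst Bochner_Integration.integral_sum) (auto intro!: integrable_mollifier_mult[OF d li])
  also have "\<dots> = mollify d (\<lambda>y. a \<bullet> u y) x"
    unfolding mollify_def by (rule Bochner_Integration.integral_cong) (auto simp: inner_vec_def sum_distrib_left mult_ac)
  also have "\<dots> \<le> norm a"
  proof -
    have "\<bar>a \<bullet> u y\<bar> \<le> norm a" for y
      using Cauchy_Schwarz_ineq2[of a "u y"] u1[of y] mult_left_mono[OF u1[of y] norm_ge_zero[of a]] by simp
    then have "\<bar>mollify d (\<lambda>y. a \<bullet> u y) x\<bar> \<le> norm a" by (intro mollify_bound[OF d]) auto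
    then show ?thesis by simp
  qed
  finally have "norm a * norm a \<le> norm a * 1" by (simp add: dot_square_norm power2_eq_square)
  then show ?thesis unfolding a_def[symmetric] by (cases "norm a = 0") (auto simp: mult_le_cancel_left)
qed

lemma has_derivative_vmollify:
  fixes u :: "real^'n \<Rightarrow> real^'m"
  assumes d: "d > 0" and u: "integrable lborel u"
  shows "(vmollify d u has_derivative (\<lambda>h. \<chi> l. mollify_deriv d (\<lambda>y. u y $ l) x h)) (at x)"
proof -
  have 1: "((\<lambda>x. \<Sum>l\<in>UNIV. mollify d (\<lambda>y. u y $ l) x *\<^sub>R axis l (1::real)) has_derivative
      (\<lambda>h. \<Sum>l\<in>UNIV. mollify_deriv d (\<lambda>y. u y $ l) x h *\<^sub>R axis l (1::real))) (at x)"
    by (intro has_derivative_sum has_derivative_scaleR_left has_derivative_mollify[OF d integrable_vec_nth[OF u]])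
  have 2: "(\<Sum>l\<in>UNIV. a l *\<^sub>R axis l (1::real)) = (\<chi> l. a l)" for a :: "'m \<Rightarrow> real"
    using basis_expansion[of "\<chi> l. a l"] by (simp add: scalar_mult_eq_scaleR)
  show ?thesis using 1 unfolding 2 vmollify_def[abs_def] .
qed

lemma vmollify_uniform_limit:
  fixes u :: "real^'n \<Rightarrow> real^'m"
  assumes um: "integrable lborel u" and lp: "\<And>l. lebesgue_point (\<lambda>y. u y $ l) x" and e: "e > 0"
  shows "eventually (\<lambda>d. \<forall>z. dist z x \<le> d \<longrightarrow> norm (vmollify d u z - u x) < e) (at_right 0)"
proof -
  define e' where "e' = e / real CARD('m)"
  have e': "e' > 0" using e by (simp add: e'_def)
  have "eventually (\<lambda>d. \<forall>z. dist z x \<le> d \<longrightarrow> \<bar>mollify d (\<lambda>y. u y $ l) z - u x $ l\<bar> < e') (at_right 0)" for l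
    by (rule mollify_uniform_limit[OF locally_integrable_integrable[OF integrable_vec_nth[OF um]] lp e'])
  then have "eventually (\<lambda>d. \<forall>l. \<forall>z. dist z x \<le> d \<longrightarrow> \<bar>mollify d (\<lambda>y. u y $ l) z - u x $ l\<bar> < e') (at_right 0)"
    by (simp add: eventually_all_finite)
  then show ?thesis
  proof eventually_elim
    case (elim d)
    show ?case
    proof (intro allI impI)
      fix z assume z: "dist z x \<le> d"
      have "norm (vmollify d u z - u x) \<le> (\<Sum>l\<in>UNIV. \<bar>(vmollify d u z - u x) $ l\<bar>)" by (rule norm_le_l1_cart)
      also have "\<dots> < (\<Sum>l\<in>(UNIV::'m set). e')"
        by (rule sum_strict_mono) (use elim z in \<open>auto simp: vmollify_def\<close>)
      also have "\<dots> = e" by (simp add: e'_def)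
      finally show "norm (vmollify d u z - u x) < e" .
    qed
  qed
qed

text \<open>Everything is required only for \<open>norm p \<le> 1\<close>, where \<open>u\<close>
  and its mollifications take their values, but the derivative at such a point is the unrestricted
  one, which makes the classical chain rule applicable. \<open>fX\<close> is the derivative in
  \<open>x\<close>, and \<open>fp l\<close> the partial derivative in the component \<open>l\<close>
  of \<open>p\<close>.\<close>

locale chain_map =
  fixes f :: "real^'n \<Rightarrow> real^'m \<Rightarrow> real" and fX :: "real^'n \<Rightarrow> real^'m \<Rightarrow> real^'n \<Rightarrow> real"
    and fp :: "'m \<Rightarrow> real^'n \<Rightarrow> real^'m \<Rightarrow> real" and C :: real
  assumes deriv: "\<And>x p. norm p \<le> 1 \<Longrightarrow> ((\<lambda>z. f (fst z) (snd z)) has_derivative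
      (\<lambda>h. fX x p (fst h) + (\<Sum>l\<in>UNIV. fp l x p * snd h $ l))) (at (x, p))"
    and contX: "\<And>h. continuous_on (UNIV \<times> cball 0 1) (\<lambda>z. fX (fst z) (snd z) h)"
    and contp: "\<And>l. continuous_on (UNIV \<times> cball 0 1) (\<lambda>z. fp l (fst z) (snd z))"
    and bounds: "\<And>x p. norm p \<le> 1 \<Longrightarrow> \<bar>f x p\<bar> \<le> C" "\<And>x p j. norm p \<le> 1 \<Longrightarrow> \<bar>fX x p (axis j 1)\<bar> \<le> C"
      "\<And>l x p. norm p \<le> 1 \<Longrightarrow> \<bar>fp l x p\<bar> \<le> C"

lemma measurable_compose_on_cball:
  fixes q :: "real^'n \<Rightarrow> real^'m \<Rightarrow> real"
  assumes q: "continuous_on (UNIV \<times> cball 0 1) (\<lambda>z. q (fst z) (snd z))"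
    and u: "u \<in> borel_measurable borel" "\<And>y. norm (u y) \<le> 1"
  shows "(\<lambda>x. q x (u x)) \<in> borel_measurable borel"
proof -
  have "(\<lambda>z. indicator (UNIV \<times> cball 0 1) z *\<^sub>R q (fst z) (snd z)) \<in> borel_measurable borel"
    by (rule borel_measurable_continuous_on_indicator[OF _ q]) (auto intro!: borel_closed closed_Times)
  moreover have "(\<lambda>x. (x, u x)) \<in> borel \<rightarrow>\<^sub>M borel" using u(1) by (intro borel_measurable_Pair) auto
  ultimately have "(\<lambda>x. indicator (UNIV \<times> cball 0 1) (x, u x) *\<^sub>R q (fst (x, u x)) (snd (x, u x))) \<in> borel_measurable borel"
    by (rule measurable_compose[rotated])
  then show ?thesis using u(2) by (simp add: indicator_def)
qed

lemma continuous_compose_on_cball: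
  fixes q :: "real^'n \<Rightarrow> real^'m \<Rightarrow> real"
  assumes q: "continuous_on (UNIV \<times> cball 0 1) (\<lambda>z. q (fst z) (snd z))"
    and u: "continuous_on UNIV u" "\<And>y. norm (u y) \<le> 1"
  shows "continuous_on UNIV (\<lambda>x. q x (u x))"
proof -
  have "continuous_on UNIV (\<lambda>x. (x, u x))" by (intro continuous_intros u(1))
  moreover have "(\<lambda>x. (x, u x)) ` UNIV \<subseteq> UNIV \<times> cball 0 1" using u(2) by auto
  ultimately show ?thesis using continuous_on_compose2[OF q] by fastforce
qed

lemma tendsto_compose_on_cball:
  fixes q :: "real^'n \<Rightarrow> real^'m \<Rightarrow> real"
  assumes q: "continuous_on (UNIV \<times> cball 0 1) (\<lambda>z. q (fst z) (snd z))"
    and U: "\<And>k. norm (U k) \<le> 1" "(U \<longlongrightarrow> p) F" and p: "norm p \<le> 1"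
  shows "((\<lambda>k. q x (U k)) \<longlongrightarrow> q x p) F"
proof -
  have "((\<lambda>k. (x, U k)) \<longlongrightarrow> (x, p)) F" by (intro tendsto_intros U)
  from continuous_on_tendsto_compose[OF q this] U(1) p show ?thesis by auto
qed


lemma finite_borel_measure_onD:
  assumes "finite_borel_measure_on \<Omega> M"
  shows "finite_measure M" "sets M = sets borel" "space M = UNIV" "emeasure M (- \<Omega>) = 0"
  using assms sets_eq_imp_space_eq[of M borel] by (auto simp: finite_borel_measure_on_def)

lemma set_lebesgue_integral_supported:
  fixes h :: "'a::euclidean_space \<Rightarrow> real"
  assumes "h \<in> borel_measurable borel" "\<Omega> \<in> sets borel" "\<And>x. x \<notin> \<Omega> \<Longrightarrow> h x = 0"
  shows "(LINT x:\<Omega>|lebesgue. h x) = (LINT x|lborel. h x)"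
proof -
  have "(LINT x:\<Omega>|lebesgue. h x) = (LINT x:\<Omega>|lborel. h x)"
    by (rule set_lebesgue_integral_lebesgue_eq_lborel[OF assms(1,2)])
  also have "\<dots> = (LINT x|lborel. h x)"
    unfolding set_lebesgue_integral_def
    by (rule Bochner_Integration.integral_cong) (use assms(3) in \<open>auto simp: indicator_def\<close>)
  finally show ?thesis .
qed

context chain_map
begin

lemma contf: "continuous_on (UNIV \<times> cball 0 1) (\<lambda>z. f (fst z) (snd z))"
proof (rule continuous_at_imp_continuous_on, rule ballI)
  fix z :: "(real^'n) \<times> (real^'m)" assume "z \<in> UNIV \<times> cball 0 1"
  then show "isCont (\<lambda>z. f (fst z) (snd z)) z"
    using has_derivative_continuous[OF deriv[of "snd z" "fst z"]] by auto
qed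

lemma C_nonneg: "C \<ge> 0"
  using bounds(1)[of 0 undefined] by (simp add: order_trans[OF abs_ge_zero])

text \<open>
  The singular part of the derivative of the composition is not identified: it is obtained as a weak
  limit and only shown to vanish wherever the singular parts of the derivatives of \<open>u\<close> do, which
  suffices for the preservation of \<open>SBV\<close>.
\<close>

lemma weak_deriv_compose:
  fixes u :: "real^'n \<Rightarrow> real^'m"
  assumes \<Omega>: "open \<Omega>" "emeasure lborel \<Omega> < \<infinity>"
    and ui: "integrable lborel u" and u1: "\<And>y. norm (u y) \<le> 1" and u0: "\<And>y. y \<notin> \<Omega> \<Longrightarrow> u y = 0"
    and R: "\<And>l. weak_deriv_repr \<Omega> (\<lambda>x. u x $ l) j (g l) (\<sigma> l) (\<tau> l)"
  obtains g' \<sigma>' \<tau>' where "weak_deriv_repr \<Omega> (\<lambda>x. f x (u x)) j g' \<sigma>' \<tau>'"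
    "\<And>B. B \<in> sets borel \<Longrightarrow> (\<And>l A. A \<in> sets borel \<Longrightarrow> A \<subseteq> B \<Longrightarrow> measure (\<sigma> l) A = measure (\<tau> l) A) \<Longrightarrow>
       measure \<sigma>' B = measure \<tau>' B"
proof -
  have um [measurable]: "u \<in> borel_measurable borel" using ui by auto
  have \<Omega>b: "\<Omega> \<in> sets borel" using \<Omega>(1) by auto
  note u_comp_i = integrable_vec_nth[OF ui]
  have g: "\<And>l. integrable lborel (g l)" "\<And>l x. x \<notin> \<Omega> \<Longrightarrow> g l x = 0"
    and fin\<sigma>: "\<And>l. finite_borel_measure_on \<Omega> (\<sigma> l)" and fin\<tau>: "\<And>l. finite_borel_measure_on \<Omega> (\<tau> l)"
    and sing: "\<And>l. lebesgue_singular (\<sigma> l)" "\<And>l. lebesgue_singular (\<tau> l)"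
    using R unfolding weak_deriv_repr_def by blast+
  note M\<sigma> = finite_borel_measure_onD[OF fin\<sigma>] and M\<tau> = finite_borel_measure_onD[OF fin\<tau>]
  define d where "d k = 1 / real (Suc k)" for k
  have d: "d k > 0" for k by (simp add: d_def)
  have dlim: "filterlim d (at_right 0) sequentially"
    unfolding filterlim_at d_def
    using LIMSEQ_inverse_real_of_nat by (auto simp: inverse_eq_divide)
  have dsmall: "eventually (\<lambda>k. d k < e) sequentially" if "e > 0" for e
    using dlim that by (auto simp: filterlim_at intro: order_tendstoD)
  define U where "U k = vmollify (d k) u" for k
  have U1: "norm (U k x) \<le> 1" for k x unfolding U_def by (rule norm_vmollify[OF d um u1])
  have Uder: "(U k has_derivative (\<lambda>h. \<chi> l. mollify_deriv (d k) (\<lambda>y. u y $ l) x h)) (at x)" for k x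
    unfolding U_def by (rule has_derivative_vmollify[OF d ui])
  have Uc: "continuous_on UNIV (U k)" for k
    by (rule continuous_at_imp_continuous_on) (blast intro: has_derivative_continuous Uder)
  have Um [measurable]: "U k \<in> borel_measurable borel" for k by (rule borel_measurable_continuous_onI[OF Uc])
  have AElp: "AE x in lborel. \<forall>l. lebesgue_point (\<lambda>y. u y $ l) x"
    using AE_lebesgue_point[OF u_comp_i] by (simp add: AE_all_countable)
  have Unif: "eventually (\<lambda>k. \<forall>z. dist z x \<le> d k \<longrightarrow> norm (U k z - u x) < e) sequentially"
    if "\<forall>l. lebesgue_point (\<lambda>y. u y $ l) x" "e > 0" for x e
    unfolding U_def
    using filterlim_iff[THEN iffD1, OF dlim, rule_format, OF vmollify_uniform_limit[OF ui _ that(2)]] that(1) by simp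
  have Ulim: "(\<lambda>k. U k x) \<longlonglongrightarrow> u x" if "\<forall>l. lebesgue_point (\<lambda>y. u y $ l) x" for x
  proof (rule tendstoI)
    fix e :: real assume "e > 0"
    from Unif[OF that this] show "eventually (\<lambda>k. dist (U k x) (u x) < e) sequentially"
    proof eventually_elim
      case (elim k)
      have "dist x x \<le> d k" using d[of k] by simp
      then show ?case using elim by (simp add: dist_norm)
    qed
  qed
  define c where "c k l x = fp l x (U k x)" for k l x
  have cc: "continuous_on UNIV (c k l)" for k l
    unfolding c_def by (rule continuous_compose_on_cball[OF contp Uc U1])
  have cm [measurable]: "c k l \<in> borel_measurable borel" for k l by (rule borel_measurable_continuous_onI[OF cc])
  have cC: "\<bar>c k l x\<bar> \<le> C" for k l x unfolding c_def by (rule bounds(3)[OF U1])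
  \<comment> \<open>The averages of the coefficients after the mollifier has been moved off the
    measures. They do not involve the test function, so a single weak limit serves all test
    functions.\<close>
  define a where "a k l y = (LINT x|lborel. mollifier (d k) (x - y) * c k l x)" for k l y
  have am [measurable]: "a k l \<in> borel_measurable borel" for k l
  proof -
    have "(\<lambda>y. LINT x|lborel. mollifier (d k) (x - y) * c k l x) \<in> borel_measurable borel"
      by (rule lborel.borel_measurable_lebesgue_integral) measurable
    then show ?thesis by (simp add: a_def[abs_def])
  qed
  have aC: "\<bar>a k l y\<bar> \<le> C" for k l y unfolding a_def by (rule reflected_mollify_bound[OF d cm cC])
  have aC': "a k l y + C \<ge> 0" "C - a k l y \<ge> 0" "a k l y + C \<le> 2 * C" "C - a k l y \<le> 2 * C" for k l y
    using aC[of k l y] by linarith+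
  have ab: "a k l \<in> bounded_borel" for k l by (rule bounded_borelI[OF am aC])
  have apb: "(\<lambda>y. a k l y + C) \<in> bounded_borel" "(\<lambda>y. C - a k l y) \<in> bounded_borel" for k l
    by (intro bounded_borel_add bounded_borel_diff ab bounded_borel_const)+
  note i\<sigma> = integrable_bounded_borel[OF M\<sigma>(1,2)] and i\<tau> = integrable_bounded_borel[OF M\<tau>(1,2)]
  \<comment> \<open>\<open>a k l\<close> may change sign. The shifts by \<open>C\<close> make
    \<open>m k\<close> positive, and \<open>T\<close> removes them again: \<open>m k h - T h\<close>
    integrates \<open>h y * a k l y\<close> against \<open>\<sigma> l - \<tau> l\<close>, summed
    over \<open>l\<close>. \<open>N\<close> dominates every \<open>m k\<close>.\<close>
  define m where "m k h = (\<Sum>l\<in>UNIV. (LINT y|\<sigma> l. h y * (a k l y + C)) + (LINT y|\<tau> l. h y * (C - a k l y)))" for k h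
  define N where "N h = (\<Sum>l\<in>UNIV. (LINT y|\<sigma> l. h y * (2 * C)) + (LINT y|\<tau> l. h y * (2 * C)))" for h
  define T where "T h = (\<Sum>l\<in>UNIV. (LINT y|\<sigma> l. h y * C) + (LINT y|\<tau> l. h y * C))" for h
  have posm: "pos_functional (m k)" for k
    unfolding m_def[abs_def]
    by (intro pos_functional_sum pos_functional_plus pos_functional_weighted(1) M\<sigma>(2) M\<tau>(2) i\<sigma> i\<tau> apb aC')
  have constpos: "pos_functional (\<lambda>h. \<Sum>l\<in>UNIV. (LINT y|\<sigma> l. h y * K) + (LINT y|\<tau> l. h y * K))"
    "empty_continuous (\<lambda>h. \<Sum>l\<in>UNIV. (LINT y|\<sigma> l. h y * K) + (LINT y|\<tau> l. h y * K))" if "K \<ge> 0" for K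
    by (intro pos_functional_sum pos_functional_plus pos_functional_weighted(1) M\<sigma>(2) M\<tau>(2) i\<sigma> i\<tau> bounded_borel_const that)
      (intro empty_continuous_sum empty_continuous_plus pos_functional_weighted(2) M\<sigma>(2) M\<tau>(2) i\<sigma> i\<tau> bounded_borel_const that)
  have posN: "pos_functional N" "empty_continuous N"
    unfolding N_def[abs_def] using constpos[of "2 * C"] C_nonneg by auto
  have posT: "pos_functional T" "empty_continuous T"
    unfolding T_def[abs_def] using constpos[of C] C_nonneg by auto
  have dom: "m k h \<le> N h" if h: "h \<in> bounded_borel" "\<And>x. h x \<ge> 0" for k h
    unfolding m_def N_def
  proof (intro sum_mono add_mono integral_mono)
    fix l y
    show "integrable (\<sigma> l) (\<lambda>y. h y * (a k l y + C))" "integrable (\<tau> l) (\<lambda>y. h y * (C - a k l y))"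
      by (intro i\<sigma> i\<tau> bounded_borel_mult h(1) apb)+
    show "integrable (\<sigma> l) (\<lambda>y. h y * (2 * C))" "integrable (\<tau> l) (\<lambda>y. h y * (2 * C))"
      by (intro i\<sigma> i\<tau> bounded_borel_mult h(1) bounded_borel_const)+
    show "h y * (a k l y + C) \<le> h y * (2 * C)" "h y * (C - a k l y) \<le> h y * (2 * C)"
      by (intro mult_left_mono aC' h(2))+
  qed
  have mT: "m k h - T h = (\<Sum>l\<in>UNIV. (LINT y|\<sigma> l. h y * a k l y) - (LINT y|\<tau> l. h y * a k l y))"
    if h: "h \<in> bounded_borel" for k h
  proof -
    have "(LINT y|\<sigma> l. h y * (a k l y + C)) = (LINT y|\<sigma> l. h y * a k l y) + (LINT y|\<sigma> l. h y * C)" for l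
      unfolding distrib_left
      by (rule Bochner_Integration.integral_add) (intro i\<sigma> bounded_borel_mult h ab bounded_borel_const)+
    moreover have "(LINT y|\<tau> l. h y * (C - a k l y)) = (LINT y|\<tau> l. h y * C) - (LINT y|\<tau> l. h y * a k l y)" for l
      unfolding right_diff_distrib
      by (rule Bochner_Integration.integral_diff) (intro i\<tau> bounded_borel_mult h ab bounded_borel_const)+
    ultimately show ?thesis
      unfolding m_def T_def by (simp only: sum_subtractf[symmetric]) (rule sum.cong, auto)
  qed
  obtain G L where G: "G \<noteq> bot" "G \<le> sequentially" and L: "pos_functional L" "empty_continuous L"
    and Llim: "\<And>h. h \<in> bounded_borel \<Longrightarrow> ((\<lambda>k. m k h) \<longlongrightarrow> L h) G"
    and LN: "\<And>h. h \<in> bounded_borel \<Longrightarrow> (\<And>x. h x \<ge> 0) \<Longrightarrow> L h \<le> N h"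
  proof (rule pos_functional_limit[where m = m and N = N])
    show "pos_functional (m k)" for k by (rule posm)
    show "pos_functional N" "empty_continuous N" by (rule posN)+
    show "m k h \<le> N h" if "h \<in> bounded_borel" "\<And>x. h x \<ge> 0" for k h by (rule dom[OF that])
  next
    fix G and L :: "(real^'n \<Rightarrow> real) \<Rightarrow> real"
    assume "G \<noteq> bot" "G \<le> sequentially" "pos_functional L" "empty_continuous L"
      "\<And>h. h \<in> bounded_borel \<Longrightarrow> ((\<lambda>k. m k h) \<longlongrightarrow> L h) G"
      "\<And>h. h \<in> bounded_borel \<Longrightarrow> (\<And>x. h x \<ge> 0) \<Longrightarrow> L h \<le> N h"
    show thesis by (rule that) fact+
  qed
  obtain \<sigma>' where \<sigma>': "finite_measure \<sigma>'" "sets \<sigma>' = sets borel"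
    "\<And>B. B \<in> sets borel \<Longrightarrow> measure \<sigma>' B = L (indicator B)" "\<And>h. h \<in> bounded_borel \<Longrightarrow> integral\<^sup>L \<sigma>' h = L h"
    using measure_of_pos_functional[OF L] by blast
  obtain \<tau>' where \<tau>': "finite_measure \<tau>'" "sets \<tau>' = sets borel"
    "\<And>B. B \<in> sets borel \<Longrightarrow> measure \<tau>' B = T (indicator B)" "\<And>h. h \<in> bounded_borel \<Longrightarrow> integral\<^sup>L \<tau>' h = T h"
    using measure_of_pos_functional[OF posT] by blast
  \<comment> \<open>Domination by \<open>N\<close> makes the limit vanish wherever all
    \<open>\<sigma> l\<close> and \<open>\<tau> l\<close> do; both the concentration on
    \<open>\<Omega>\<close> and the singularity follow from this.\<close>
  have null: "emeasure \<sigma>' B = 0 \<and> emeasure \<tau>' B = 0"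
    if B: "B \<in> sets borel" "\<And>l. emeasure (\<sigma> l) B = 0" "\<And>l. emeasure (\<tau> l) B = 0" for B
  proof -
    have "measure (\<sigma> l) B = 0" "measure (\<tau> l) B = 0" for l using B by (simp_all add: measure_def)
    then have z: "(\<Sum>l\<in>UNIV. (LINT y|\<sigma> l. indicator B y * K) + (LINT y|\<tau> l. indicator B y * K)) = 0" for K :: real
      using M\<sigma>(3) M\<tau>(3) by simp
    have "L (indicator B) \<le> 0" using LN[of "indicator B"] B z[of "2 * C"] by (simp add: N_def)
    then have "measure \<sigma>' B = 0"
      using \<sigma>'(3)[OF B(1)] measure_nonneg[of \<sigma>' B] by simp
    moreover have "measure \<tau>' B = 0" using \<tau>'(3)[OF B(1)] z[of C] by (simp add: T_def)
    ultimately show ?thesis using \<sigma>'(1) \<tau>'(1) by (simp add: finite_measure.emeasure_eq_measure)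
  qed
  have fin': "finite_borel_measure_on \<Omega> \<sigma>'" "finite_borel_measure_on \<Omega> \<tau>'"
    unfolding finite_borel_measure_on_def using \<sigma>' \<tau>' null[of "- \<Omega>"] M\<sigma>(4) M\<tau>(4) \<Omega>b by auto
  have sing': "lebesgue_singular \<sigma>'" "lebesgue_singular \<tau>'"
  proof -
    obtain Z1 where Z1: "\<And>l. Z1 l \<in> sets borel" "\<And>l. emeasure lborel (Z1 l) = 0" "\<And>l. emeasure (\<sigma> l) (- Z1 l) = 0"
      using sing(1) unfolding lebesgue_singular_def by metis
    obtain Z2 where Z2: "\<And>l. Z2 l \<in> sets borel" "\<And>l. emeasure lborel (Z2 l) = 0" "\<And>l. emeasure (\<tau> l) (- Z2 l) = 0"
      using sing(2) unfolding lebesgue_singular_def by metis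
    define Z where "Z = (\<Union>l. Z1 l \<union> Z2 l)"
    have Zb: "Z \<in> sets borel" unfolding Z_def using Z1(1) Z2(1) by (intro sets.countable_UN') auto
    have "Z \<in> null_sets lborel"
      unfolding Z_def using Z1 Z2 by (intro null_sets_UN' null_sets.Un) auto
    then have Z0: "emeasure lborel Z = 0" by auto
    have "emeasure (\<sigma> l) (- Z) = 0" for l
      by (rule emeasure_eq_0[OF _ Z1(3)[of l]]) (use Z1(1) M\<sigma>(2) in \<open>auto simp: Z_def\<close>)
    moreover have "emeasure (\<tau> l) (- Z) = 0" for l
      by (rule emeasure_eq_0[OF _ Z2(3)[of l]]) (use Z2(1) M\<tau>(2) in \<open>auto simp: Z_def\<close>)
    ultimately show "lebesgue_singular \<sigma>'" "lebesgue_singular \<tau>'"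
      using null[of "- Z"] Zb Z0 unfolding lebesgue_singular_def by auto
  qed
  have van: "measure \<sigma>' B = measure \<tau>' B"
    if B: "B \<in> sets borel" and eq: "\<And>l A. A \<in> sets borel \<Longrightarrow> A \<subseteq> B \<Longrightarrow> measure (\<sigma> l) A = measure (\<tau> l) A" for B
  proof -
    have ib: "indicator B \<in> bounded_borel" using B by simp
    \<comment> \<open>Where \<open>\<sigma> l\<close> and \<open>\<tau> l\<close> coincide,
      \<open>m k\<close> equals \<open>T\<close> for every \<open>k\<close>, hence so does the
      limit.\<close>
    have "(LINT y|\<sigma> l. indicator B y * a k l y) = (LINT y|\<tau> l. indicator B y * a k l y)" for k l
      by (rule integral_eq_of_measure_eq_on[OF M\<sigma>(1,2) M\<tau>(1,2) B eq]) (auto intro: bounded_borel_mult ib ab)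
    then have "m k (indicator B) = T (indicator B)" for k using mT[OF ib, of k] by simp
    then have "((\<lambda>k. T (indicator B)) \<longlongrightarrow> L (indicator B)) G" using Llim[OF ib] by simp
    then have "L (indicator B) = T (indicator B)" using tendsto_unique[OF G(1)] tendsto_const by blast
    then show ?thesis using \<sigma>'(3)[OF B] \<tau>'(3)[OF B] by simp
  qed
  \<comment> \<open>The factor \<open>indicator \<Omega> x\<close> is there because
    \<open>fX x 0\<close> need not vanish off \<open>\<Omega>\<close>, where \<open>u\<close> is
    0.\<close>
  define g' where "g' x = indicator \<Omega> x * fX x (u x) (axis j 1) + (\<Sum>l\<in>UNIV. fp l x (u x) * g l x)" for x
  have fXm [measurable]: "(\<lambda>x. fX x (u x) (axis j 1)) \<in> borel_measurable borel"
    by (rule measurable_compose_on_cball[OF contX um u1])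
  have fpm [measurable]: "(\<lambda>x. fp l x (u x)) \<in> borel_measurable borel" for l
    by (rule measurable_compose_on_cball[OF contp um u1])
  have fm [measurable]: "(\<lambda>x. f x (u x)) \<in> borel_measurable borel"
    by (rule measurable_compose_on_cball[OF contf um u1])
  have iX: "integrable lborel (\<lambda>x. indicator \<Omega> x * fX x (u x) (axis j 1))"
    using integrable_bounded_mult[of lborel "indicator \<Omega>" "\<lambda>x. fX x (u x) (axis j 1)" C] bounds(2)[OF u1] \<Omega>(2) \<Omega>b
    by (simp add: mult.commute)
  have ip: "integrable lborel (\<lambda>x. fp l x (u x) * g l x)" for l
    by (rule integrable_bounded_mult[OF g(1) _ bounds(3)[OF u1]]) measurable
  have g'i: "integrable lborel g'"
    unfolding g'_def by (intro Bochner_Integration.integrable_add Bochner_Integration.integrable_sum iX ip)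
  have g'0: "g' x = 0" if "x \<notin> \<Omega>" for x using that g(2) by (simp add: g'_def)
  have weak: "(LINT x:\<Omega>|lebesgue. f x (u x) * frechet_derivative \<phi> (at x) (axis j 1)) =
        - ((LINT x|lborel. g' x * \<phi> x) + (LINT x|\<sigma>'. \<phi> x) - (LINT x|\<tau>'. \<phi> x))"
    if \<phi>: "\<phi> \<in> test_functions \<Omega>" for \<phi> :: "real^'n \<Rightarrow> real"
  proof -
    note \<phi>facts = test_function_bounded_borel[OF \<phi>]
    have \<phi>b: "\<phi> \<in> bounded_borel" and \<phi>c: "continuous_on UNIV \<phi>" by (rule \<phi>facts)+
    have \<phi>0: "\<And>x. x \<notin> \<Omega> \<Longrightarrow> \<phi> x = 0" by (rule \<phi>facts)
    obtain r where r: "\<And>x. norm x \<ge> r \<Longrightarrow> \<phi> x = 0" using \<phi>facts(4) by blast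
    have \<phi>m [measurable]: "\<phi> \<in> borel_measurable borel" by (rule borel_measurable_continuous_onI[OF \<phi>c])
    obtain P where P: "P > 0" "\<And>x. \<bar>\<phi> x\<bar> \<le> P" using bounded_borelE[OF \<phi>b] by blast
    have "Ck (Suc 0) \<phi>" using \<phi> unfolding test_functions_def by blast
    then obtain \<phi>' where \<phi>': "\<And>x. (\<phi> has_derivative \<phi>' x) (at x)" "\<And>h. continuous_on UNIV (\<lambda>x. \<phi>' x h)" by auto
    have \<phi>'0: "\<phi>' x h = 0" if "norm x \<ge> r + 1" for x h by (rule kernel_deriv_supp[OF \<phi>' r that])
    have K: "compact (closure {x. \<phi> x \<noteq> 0})" "closure {x. \<phi> x \<noteq> 0} \<subseteq> \<Omega>"
      using \<phi> unfolding test_functions_def by blast+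
    have \<phi>i: "integrable lborel \<phi>"
      by (rule integrable_continuous_supported[OF \<phi>c compact_cball[of 0 r]]) (use r in auto)
    have \<phi>'i: "integrable lborel (\<lambda>x. \<phi>' x (axis j 1))"
      by (rule integrable_continuous_supported[OF \<phi>'(2) compact_cball[of 0 "r + 1"]]) (use \<phi>'0 in auto)
    have \<phi>'m [measurable]: "(\<lambda>x. \<phi>' x (axis j 1)) \<in> borel_measurable borel" by (rule borel_measurable_continuous_onI[OF \<phi>'(2)])
    have \<phi>'0': "\<phi>' x h = 0" if x: "x \<notin> \<Omega>" for x h
    proof -
      have "((\<lambda>x. 0) has_derivative (\<lambda>h. 0)) (at x)" by simp
      then have "(\<phi> has_derivative (\<lambda>h. 0)) (at x)"
      proof (rule has_derivative_transform_within_open[of _ _ _ _ "- closure {x. \<phi> x \<noteq> 0}"])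
        show "x \<in> - closure {x. \<phi> x \<noteq> 0}" using K(2) x by blast
        show "0 = \<phi> y" if "y \<in> - closure {x. \<phi> x \<noteq> 0}" for y using that closure_subset[of "{x. \<phi> x \<noteq> 0}"] by auto
      qed auto
      then show ?thesis using has_derivative_unique[OF \<phi>'(1)] by metis
    qed
    have lhs: "(LINT x:\<Omega>|lebesgue. f x (u x) * frechet_derivative \<phi> (at x) (axis j 1)) = (LINT x|lborel. f x (u x) * \<phi>' x (axis j 1))"
      using \<phi>'0' by (simp add: frechet_derivative_at[OF \<phi>'(1), symmetric] set_lebesgue_integral_supported \<Omega>b)
    \<comment> \<open>As \<open>a k l\<close>, but with the test function inside the average; this
      is what Fubini's theorem produces.\<close>
    define b where "b k l y = (LINT x|lborel. mollifier (d k) (x - y) * (\<phi> x * c k l x))" for k l y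
    have bm [measurable]: "b k l \<in> borel_measurable borel" for k l
    proof -
      have "(\<lambda>y. LINT x|lborel. mollifier (d k) (x - y) * (\<phi> x * c k l x)) \<in> borel_measurable borel"
        by (rule lborel.borel_measurable_lebesgue_integral) measurable
      then show ?thesis by (simp add: b_def[abs_def])
    qed
    have \<phi>cP: "\<bar>\<phi> x * c k l x\<bar> \<le> P * C" for k l x
      unfolding abs_mult using P(2)[of x] cC[of k l x] P(1) by (intro mult_mono) auto
    have bP: "\<bar>b k l y\<bar> \<le> P * C" for k l y
      unfolding b_def by (rule reflected_mollify_bound[OF d _ \<phi>cP]) measurable
    have bb: "b k l \<in> bounded_borel" for k l by (rule bounded_borelI[OF bm bP])
    define I1 where "I1 k = (LINT x|lborel. f x (U k x) * \<phi>' x (axis j 1))" for k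
    define I2 where "I2 k = (LINT x|lborel. \<phi> x * fX x (U k x) (axis j 1))" for k
    define I3 where "I3 k = (\<Sum>l\<in>UNIV. LINT y|lborel. b k l y * g l y)" for k
    define I4 where "I4 k = (\<Sum>l\<in>UNIV. (LINT y|\<sigma> l. b k l y) - (LINT y|\<tau> l. b k l y))" for k
    obtain e0 where e0: "e0 > 0" "(\<Union>x\<in>closure {x. \<phi> x \<noteq> 0}. cball x e0) \<subseteq> \<Omega>"
      using compact_subset_open_imp_cball_epsilon_subset[OF K(1) \<Omega>(1) K(2)] by blast
    \<comment> \<open>Integration by parts for the differentiable function
      \<open>f x (U k x)\<close>. The condition on \<open>d k\<close> keeps the mollifier balls
      around the support of \<open>\<phi>\<close> inside \<open>\<Omega>\<close>, so that there the
      derivative of \<open>U k\<close> is the mollified derivative measure of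
      \<open>u\<close>.\<close>
    have parts: "I1 k = - (I2 k + I3 k + I4 k)" if dk: "d k \<le> e0" for k
    proof -
      define D where "D x h = (\<chi> l. mollify_deriv (d k) (\<lambda>y. u y $ l) x h)" for x h
      have fU: "((\<lambda>x. f x (U k x)) has_derivative (\<lambda>h. fX x (U k x) h + (\<Sum>l\<in>UNIV. c k l x * D x h $ l))) (at x)" for x
      proof -
        have "((\<lambda>x. (x, U k x)) has_derivative (\<lambda>h. (h, D x h))) (at x)"
          unfolding D_def by (intro has_derivative_Pair has_derivative_ident Uder)
        from has_derivative_compose[OF this deriv[OF U1]] show ?thesis by (simp add: c_def)
      qed
      define \<psi>' where "\<psi>' x h = \<phi> x * (fX x (U k x) h + (\<Sum>l\<in>UNIV. c k l x * D x h $ l)) + \<phi>' x h * f x (U k x)" for x h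
      have \<psi>: "((\<lambda>x. \<phi> x * f x (U k x)) has_derivative \<psi>' x) (at x)" for x
        unfolding \<psi>'_def[abs_def] by (rule has_derivative_mult[OF \<phi>'(1) fU])
      have fUc: "continuous_on UNIV (\<lambda>x. f x (U k x))" by (rule continuous_compose_on_cball[OF contf Uc U1])
      have \<psi>c: "continuous_on UNIV (\<lambda>x. \<psi>' x h)" for h
        unfolding \<psi>'_def D_def
        by (auto intro!: continuous_intros \<phi>c \<phi>'(2) fUc cc continuous_compose_on_cball[OF contX Uc U1]
            continuous_on_mollify_deriv[OF d u_comp_i])
      have z: "(LINT x|lborel. \<psi>' x (axis j 1)) = 0"
        by (rule integral_deriv_compact_support[OF \<psi> \<psi>c, of r]) (use r in auto)
      have i1: "integrable lborel (\<lambda>x. f x (U k x) * \<phi>' x (axis j 1))"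
        by (rule integrable_bounded_mult[OF \<phi>'i _ bounds(1)[OF U1]]) (use fUc in \<open>simp add: borel_measurable_continuous_onI\<close>)
      have fXUm: "(\<lambda>x. fX x (U k x) (axis j 1)) \<in> borel_measurable lborel"
        using borel_measurable_continuous_onI[OF continuous_compose_on_cball[OF contX Uc U1]] by simp
      have i2: "integrable lborel (\<lambda>x. \<phi> x * fX x (U k x) (axis j 1))"
        using integrable_bounded_mult[OF \<phi>i fXUm bounds(2)[OF U1]] by (simp add: mult.commute)
      have i\<phi>c: "integrable lborel (\<lambda>x. \<phi> x * c k l x)" for l
      proof -
        have "c k l \<in> borel_measurable lborel" by simp
        from integrable_bounded_mult[OF \<phi>i this cC] show ?thesis by (simp add: mult.commute)
      qed
      have trm: "integrable lborel (\<lambda>x. \<phi> x * (c k l x * D x (axis j 1) $ l)) \<and>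
        (LINT x|lborel. \<phi> x * (c k l x * D x (axis j 1) $ l)) = (LINT y|lborel. b k l y * g l y) + ((LINT y|\<sigma> l. b k l y) - (LINT y|\<tau> l. b k l y))" for l
      proof -
        let ?q = "\<lambda>x. \<phi> x * c k l x"
        have sf: "sigma_finite_measure (\<sigma> l)" "sigma_finite_measure (\<tau> l)"
          using M\<sigma>(1) M\<tau>(1) finite_measure.axioms(1) by blast+
        have one: "integrable (\<sigma> l) (\<lambda>y. 1 :: real)" "integrable (\<tau> l) (\<lambda>y. 1 :: real)"
          by (intro i\<sigma> i\<tau> bounded_borel_const)+
        note F1 = mollifier_Fubini[OF d[of k] i\<phi>c[of l] lborel.sigma_finite_measure_axioms sets_lborel g(1)[of l]]
        note F2 = mollifier_Fubini[OF d[of k] i\<phi>c[of l] sf(1) M\<sigma>(2) one(1)]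
        note F3 = mollifier_Fubini[OF d[of k] i\<phi>c[of l] sf(2) M\<tau>(2) one(2)]
        have eq: "\<phi> x * (c k l x * D x (axis j 1) $ l) = ?q x * (LINT y|lborel. mollifier (d k) (x - y) * g l y)
            + (?q x * (LINT y|\<sigma> l. mollifier (d k) (x - y) * 1) - ?q x * (LINT y|\<tau> l. mollifier (d k) (x - y) * 1))" for x
        proof (cases "\<phi> x = 0")
          case False
          then have "x \<in> closure {x. \<phi> x \<noteq> 0}" using closure_subset[of "{x. \<phi> x \<noteq> 0}"] by auto
          then have "cball x e0 \<subseteq> \<Omega>" using e0(2) by blast
          then have sub: "cball x (d k) \<subseteq> \<Omega>" using dk by force
          have md: "mollify_deriv (d k) (\<lambda>y. u y $ l) x (axis j 1)
             = (LINT y|lborel. g l y * mollifier (d k) (x - y)) + (LINT y|\<sigma> l. mollifier (d k) (x - y)) - (LINT y|\<tau> l. mollifier (d k) (x - y))"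
            by (rule mollify_deriv_dist_deriv[OF d sub _ _ \<Omega>(1),
                where L = "\<lambda>\<phi>. (LINT y|lborel. g l y * \<phi> y) + (LINT y|\<sigma> l. \<phi> y) - (LINT y|\<tau> l. \<phi> y)"])
              (use R[of l] u0 in \<open>auto simp: weak_deriv_repr_def\<close>)
          show ?thesis unfolding D_def vec_lambda_beta md by (simp add: algebra_simps)
        qed simp
        have "(LINT x|lborel. \<phi> x * (c k l x * D x (axis j 1) $ l)) =
           (LINT x|lborel. ?q x * (LINT y|lborel. mollifier (d k) (x - y) * g l y)) +
           ((LINT x|lborel. ?q x * (LINT y|\<sigma> l. mollifier (d k) (x - y) * 1)) - (LINT x|lborel. ?q x * (LINT y|\<tau> l. mollifier (d k) (x - y) * 1)))"
          unfolding eq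
          by (subst Bochner_Integration.integral_add Bochner_Integration.integral_diff; (intro Bochner_Integration.integrable_diff F1(1) F2(1) F3(1))?)+ simp
        then have "(LINT x|lborel. \<phi> x * (c k l x * D x (axis j 1) $ l)) = (LINT y|lborel. b k l y * g l y) + ((LINT y|\<sigma> l. b k l y) - (LINT y|\<tau> l. b k l y))"
          unfolding F1(2) F2(2) F3(2) b_def by simp
        moreover have "integrable lborel (\<lambda>x. \<phi> x * (c k l x * D x (axis j 1) $ l))"
          unfolding eq by (intro Bochner_Integration.integrable_add Bochner_Integration.integrable_diff F1(1) F2(1) F3(1))
        ultimately show ?thesis by blast
      qed
      have "0 = (LINT x|lborel. (\<phi> x * fX x (U k x) (axis j 1) + (\<Sum>l\<in>UNIV. \<phi> x * (c k l x * D x (axis j 1) $ l))) + f x (U k x) * \<phi>' x (axis j 1))"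
        unfolding z[symmetric] \<psi>'_def by (rule Bochner_Integration.integral_cong) (simp_all add: distrib_left sum_distrib_left mult.commute)
      also have "\<dots> = (I2 k + (\<Sum>l\<in>UNIV. LINT x|lborel. \<phi> x * (c k l x * D x (axis j 1) $ l))) + I1 k"
        unfolding I1_def I2_def
        using i1 i2 trm by (simp add: Bochner_Integration.integrable_sum)
      also have "(\<Sum>l\<in>UNIV. LINT x|lborel. \<phi> x * (c k l x * D x (axis j 1) $ l)) = I3 k + I4 k"
        unfolding I3_def I4_def using trm by (simp add: sum.distrib)
      finally show ?thesis by simp
    qed
    have ev: "eventually (\<lambda>k. d k \<le> e0) sequentially"
      using dsmall[OF e0(1)] by eventually_elim simp
    have lim1: "I1 \<longlonglongrightarrow> (LINT x|lborel. f x (u x) * \<phi>' x (axis j 1))"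
      unfolding I1_def
    proof (rule integral_dominated_convergence[where w = "\<lambda>x. C * \<bar>\<phi>' x (axis j 1)\<bar>"])
      show "AE x in lborel. (\<lambda>k. f x (U k x) * \<phi>' x (axis j 1)) \<longlonglongrightarrow> f x (u x) * \<phi>' x (axis j 1)"
        using AElp by eventually_elim (intro tendsto_mult tendsto_const tendsto_compose_on_cball[OF contf U1 Ulim u1])
      show "AE x in lborel. norm (f x (U k x) * \<phi>' x (axis j 1)) \<le> C * \<bar>\<phi>' x (axis j 1)\<bar>" for k
        using bounds(1)[OF U1] by (intro AE_I2) (simp add: abs_mult mult_right_mono)
      show "(\<lambda>x. f x (U k x) * \<phi>' x (axis j 1)) \<in> borel_measurable lborel" for k
        using borel_measurable_continuous_onI[OF continuous_compose_on_cball[OF contf Uc U1]] by measurable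
    qed (use \<phi>'i in auto)
    have lim2: "I2 \<longlonglongrightarrow> (LINT x|lborel. \<phi> x * fX x (u x) (axis j 1))"
      unfolding I2_def
    proof (rule integral_dominated_convergence[where w = "\<lambda>x. \<bar>\<phi> x\<bar> * C"])
      show "AE x in lborel. (\<lambda>k. \<phi> x * fX x (U k x) (axis j 1)) \<longlonglongrightarrow> \<phi> x * fX x (u x) (axis j 1)"
        using AElp by eventually_elim (intro tendsto_mult tendsto_const tendsto_compose_on_cball[OF contX U1 Ulim u1])
      show "AE x in lborel. norm (\<phi> x * fX x (U k x) (axis j 1)) \<le> \<bar>\<phi> x\<bar> * C" for k
        using bounds(2)[OF U1] by (intro AE_I2) (simp add: abs_mult mult_left_mono)
      show "(\<lambda>x. \<phi> x * fX x (U k x) (axis j 1)) \<in> borel_measurable lborel" for k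
        using borel_measurable_continuous_onI[OF continuous_compose_on_cball[OF contX Uc U1]] by measurable
    qed (use \<phi>i in auto)
    \<comment> \<open>At a Lebesgue point \<open>y\<close> of \<open>u\<close> the mollification is
      uniformly close to \<open>u y\<close> on the ball over which \<open>b k l y\<close> averages,
      so \<open>b k l y\<close> tends to \<open>\<phi> y * fp l y (u y)\<close>.\<close>
    have lim3: "I3 \<longlonglongrightarrow> (\<Sum>l\<in>UNIV. LINT x|lborel. (\<phi> x * fp l x (u x)) * g l x)"
      unfolding I3_def
    proof (rule tendsto_sum, rule integral_dominated_convergence[where w = "\<lambda>x. P * C * \<bar>g l x\<bar>" for l])
      fix l
      show "AE y in lborel. (\<lambda>k. b k l y * g l y) \<longlonglongrightarrow> (\<phi> y * fp l y (u y)) * g l y"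
        using AElp
      proof eventually_elim
        case (elim y)
        have "(\<lambda>k. b k l y) \<longlonglongrightarrow> \<phi> y * fp l y (u y)"
        proof (rule tendstoI)
          fix e :: real assume e: "e > 0"
          define H where "H z = \<phi> (fst z) * fp l (fst z) (snd z)" for z
          have "continuous_on (UNIV \<times> cball 0 1) H"
            unfolding H_def
            by (intro continuous_on_mult contp continuous_on_compose2[OF \<phi>c] continuous_intros) auto
          then obtain \<delta> where \<delta>: "\<delta> > 0" "\<And>z. z \<in> UNIV \<times> cball 0 1 \<Longrightarrow> dist z (y, u y) < \<delta> \<Longrightarrow> dist (H z) (H (y, u y)) < e / 2"
            unfolding continuous_on_iff using u1[of y] e by (metis (no_types, lifting) UNIV_I half_gt_zero mem_Sigma_iff mem_cball_0)
          have "eventually (\<lambda>k. d k < \<delta> / 2) sequentially"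
            by (rule dsmall) (use \<delta>(1) in simp)
          moreover have "eventually (\<lambda>k. \<forall>z. dist z y \<le> d k \<longrightarrow> norm (U k z - u y) < \<delta> / 2) sequentially"
            by (rule Unif[OF elim]) (use \<delta>(1) in simp)
          ultimately show "eventually (\<lambda>k. dist (b k l y) (\<phi> y * fp l y (u y)) < e) sequentially"
          proof eventually_elim
            case (elim k)
            have "\<bar>b k l y - \<phi> y * fp l y (u y)\<bar> \<le> e / 2"
              unfolding b_def
            proof (rule reflected_mollify_near[OF d _ \<phi>cP])
              show "(\<lambda>x. \<phi> x * c k l x) \<in> borel_measurable borel" by measurable
              fix x assume x: "dist x y < d k"
              have "dist (x, U k x) (y, u y) \<le> dist x y + dist (U k x) (u y)"
                unfolding dist_Pair_Pair by (rule sqrt_sum_squares_le_sum) auto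
              also have "\<dots> < \<delta>" using x elim by (simp add: dist_norm) (smt (verit) field_sum_of_halves)
              finally have "dist (H (x, U k x)) (H (y, u y)) < e / 2" by (intro \<delta>(2)) (use U1 in auto)
              then show "\<bar>\<phi> x * c k l x - \<phi> y * fp l y (u y)\<bar> \<le> e / 2"
                by (simp add: H_def c_def dist_real_def)
            qed
            then show ?case using e by (simp add: dist_real_def)
          qed
        qed
        then show ?case by (rule tendsto_mult_right)
      qed
      show "AE y in lborel. norm (b k l y * g l y) \<le> P * C * \<bar>g l y\<bar>" for k
        using bP by (intro AE_I2) (simp add: abs_mult mult_right_mono)
      show "integrable lborel (\<lambda>x. P * C * \<bar>g l x\<bar>)" using g(1) by simp
      show "(\<lambda>x. b k l x * g l x) \<in> borel_measurable lborel" for k using g(1)[of l] by measurable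
      show "(\<lambda>x. (\<phi> x * fp l x (u x)) * g l x) \<in> borel_measurable lborel" using g(1)[of l] by measurable
    qed
    \<comment> \<open>For the singular measures no pointwise limit of the averages is available.
      What does tend to 0, uniformly by the uniform continuity of \<open>\<phi>\<close>, is
      \<open>b k l y - \<phi> y * a k l y\<close>; this reduces the term to the weak limit of
      \<open>m k\<close>.\<close>
    have lim4: "((\<lambda>k. I4 k - (m k \<phi> - T \<phi>)) \<longlongrightarrow> 0) sequentially"
    proof -
      have "((\<lambda>k. \<Sum>l\<in>UNIV. ((LINT y|\<sigma> l. b k l y - \<phi> y * a k l y) - (LINT y|\<tau> l. b k l y - \<phi> y * a k l y))) \<longlongrightarrow> (\<Sum>l\<in>(UNIV::'m set). 0 - 0)) sequentially"
      proof (intro tendsto_sum tendsto_diff)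
        fix l
        have ba: "eventually (\<lambda>k. \<forall>y. \<bar>b k l y - \<phi> y * a k l y\<bar> \<le> e) sequentially" if e: "e > 0" for e
        proof -
          have "e / (C + 1) > 0" using e C_nonneg by simp
          then obtain \<delta> where \<delta>: "\<delta> > 0" "\<And>x y. dist x y < \<delta> \<Longrightarrow> \<bar>\<phi> x - \<phi> y\<bar> < e / (C + 1)"
            using uniformly_continuous_supported[OF \<phi>c r] by blast
          have "eventually (\<lambda>k. d k < \<delta>) sequentially"
            by (rule dsmall[OF \<delta>(1)])
          then show ?thesis
          proof eventually_elim
            case (elim k)
            show ?case
            proof
              fix y
              have "b k l y - \<phi> y * a k l y = (LINT x|lborel. mollifier (d k) (x - y) * ((\<phi> x - \<phi> y) * c k l x))"
              proof -
                have "b k l y - \<phi> y * a k l y = (LINT x|lborel. mollifier (d k) (x - y) * (\<phi> x * c k l x)) - (LINT x|lborel. \<phi> y * (mollifier (d k) (x - y) * c k l x))"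
                  by (simp add: b_def a_def)
                also have "\<dots> = (LINT x|lborel. mollifier (d k) (x - y) * (\<phi> x * c k l x) - \<phi> y * (mollifier (d k) (x - y) * c k l x))"
                  by (intro Bochner_Integration.integral_diff[symmetric] integrable_mult_right reflected_mollify_integrable[OF d _ \<phi>cP]
                      reflected_mollify_integrable[OF d _ cC]) measurable
                finally show ?thesis by (simp add: algebra_simps)
              qed
              also have "\<bar>\<dots>\<bar> \<le> e"
              proof -
                have "\<bar>(\<phi> x - \<phi> y) * c k l x\<bar> \<le> (P + P) * C" for x
                  unfolding abs_mult using P(2)[of x] P(2)[of y] cC[of k l x] P(1) by (intro mult_mono) auto
                moreover have "\<bar>(\<phi> x - \<phi> y) * c k l x - 0\<bar> \<le> e" if "dist x y < d k" for x
                proof -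
                  have "\<bar>(\<phi> x - \<phi> y) * c k l x\<bar> \<le> e / (C + 1) * C"
                    unfolding abs_mult using \<delta>(2)[of x y] that elim cC[of k l x] e C_nonneg by (intro mult_mono) auto
                  also have "\<dots> = e * (C / (C + 1))" by simp
                  also have "\<dots> \<le> e * 1" using e C_nonneg by (intro mult_left_mono) auto
                  finally show ?thesis by simp
                qed
                ultimately have "\<bar>(LINT x|lborel. mollifier (d k) (x - y) * ((\<phi> x - \<phi> y) * c k l x)) - 0\<bar> \<le> e"
                  by (intro reflected_mollify_near[OF d]) auto
                then show ?thesis by simp
              qed
              finally show "\<bar>b k l y - \<phi> y * a k l y\<bar> \<le> e" .
            qed
          qed
        qed
        have lim0: "((\<lambda>k. LINT y|M. b k l y - \<phi> y * a k l y) \<longlongrightarrow> 0) sequentially"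
          if M: "finite_measure M" "sets M = sets borel" for M
        proof (rule tendstoI)
          fix e :: real assume e: "e > 0"
          interpret finite_measure M by fact
          let ?V = "measure M (space M)"
          have "e / (2 * (?V + 1)) > 0" using e by (intro divide_pos_pos mult_pos_pos add_nonneg_pos) auto
          from ba[OF this] show "eventually (\<lambda>k. dist (LINT y|M. b k l y - \<phi> y * a k l y) 0 < e) sequentially"
          proof eventually_elim
            case (elim k)
            have bbd: "(\<lambda>y. b k l y - \<phi> y * a k l y) \<in> bounded_borel"
              by (intro bounded_borel_diff bounded_borel_mult bb \<phi>b ab)
            have "\<bar>LINT y|M. b k l y - \<phi> y * a k l y\<bar> \<le> (LINT y|M. \<bar>b k l y - \<phi> y * a k l y\<bar>)"
              by (rule integral_abs_bound)
            also have "\<dots> \<le> (LINT y|M. e / (2 * (?V + 1)))"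
              by (rule integral_mono) (use integrable_bounded_borel[OF M bbd] elim in auto)
            also have "\<dots> = e / 2 * (?V / (?V + 1))" by (simp add: mult.commute)
            also have "\<dots> \<le> e / 2 * 1" using e by (intro mult_left_mono) (auto simp: divide_le_eq_1 add_nonneg_pos)
            finally show ?case using e by (simp add: dist_real_def)
          qed
        qed
        show "((\<lambda>k. LINT y|\<sigma> l. b k l y - \<phi> y * a k l y) \<longlongrightarrow> 0) sequentially" by (rule lim0[OF M\<sigma>(1,2)])
        show "((\<lambda>k. LINT y|\<tau> l. b k l y - \<phi> y * a k l y) \<longlongrightarrow> 0) sequentially" by (rule lim0[OF M\<tau>(1,2)])
      qed
      moreover have "(\<Sum>l\<in>UNIV. ((LINT y|\<sigma> l. b k l y - \<phi> y * a k l y) - (LINT y|\<tau> l. b k l y - \<phi> y * a k l y))) = I4 k - (m k \<phi> - T \<phi>)" for k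
      proof -
        have "(LINT y|\<sigma> l. b k l y - \<phi> y * a k l y) = (LINT y|\<sigma> l. b k l y) - (LINT y|\<sigma> l. \<phi> y * a k l y)" for l
          by (rule Bochner_Integration.integral_diff) (intro i\<sigma> bounded_borel_mult bb \<phi>b ab)+
        moreover have "(LINT y|\<tau> l. b k l y - \<phi> y * a k l y) = (LINT y|\<tau> l. b k l y) - (LINT y|\<tau> l. \<phi> y * a k l y)" for l
          by (rule Bochner_Integration.integral_diff) (intro i\<tau> bounded_borel_mult bb \<phi>b ab)+
        ultimately show ?thesis
          unfolding mT[OF \<phi>b] I4_def by (simp only: sum_subtractf[symmetric]) (rule sum.cong, auto)
      qed
      ultimately show ?thesis by simp
    qed
    \<comment> \<open>\<open>G\<close> is finer than \<open>sequentially\<close>, so the ordinary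
      limits hold along \<open>G\<close> as well and can be combined with the weak limit.\<close>
    have "((\<lambda>k. (I4 k - (m k \<phi> - T \<phi>)) + (m k \<phi> - T \<phi>)) \<longlongrightarrow> 0 + (L \<phi> - T \<phi>)) G"
      by (intro tendsto_add tendsto_mono[OF G(2) lim4] tendsto_diff Llim \<phi>b tendsto_const)
    then have lim4': "(I4 \<longlongrightarrow> L \<phi> - T \<phi>) G" by simp
    have "((\<lambda>k. - (I2 k + I3 k + I4 k)) \<longlongrightarrow> - ((LINT x|lborel. \<phi> x * fX x (u x) (axis j 1)) + (\<Sum>l\<in>UNIV. LINT x|lborel. (\<phi> x * fp l x (u x)) * g l x) + (L \<phi> - T \<phi>))) G"
      by (intro tendsto_minus tendsto_add tendsto_mono[OF G(2) lim2] tendsto_mono[OF G(2) lim3] lim4')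
    moreover have "eventually (\<lambda>k. - (I2 k + I3 k + I4 k) = I1 k) G"
      using filter_leD[OF G(2) ev] by eventually_elim (simp add: parts)
    ultimately have "(I1 \<longlongrightarrow> - ((LINT x|lborel. \<phi> x * fX x (u x) (axis j 1)) + (\<Sum>l\<in>UNIV. LINT x|lborel. (\<phi> x * fp l x (u x)) * g l x) + (L \<phi> - T \<phi>))) G"
      by (rule Lim_transform_eventually)
    then have "(LINT x|lborel. f x (u x) * \<phi>' x (axis j 1)) = - ((LINT x|lborel. \<phi> x * fX x (u x) (axis j 1)) + (\<Sum>l\<in>UNIV. LINT x|lborel. (\<phi> x * fp l x (u x)) * g l x) + (L \<phi> - T \<phi>))"
      using tendsto_unique[OF G(1) tendsto_mono[OF G(2) lim1]] by blast
    moreover have "(LINT x|lborel. g' x * \<phi> x) = (LINT x|lborel. \<phi> x * fX x (u x) (axis j 1)) + (\<Sum>l\<in>UNIV. LINT x|lborel. (\<phi> x * fp l x (u x)) * g l x)"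
    proof -
      have e1: "g' x * \<phi> x = \<phi> x * fX x (u x) (axis j 1) + (\<Sum>l\<in>UNIV. (\<phi> x * fp l x (u x)) * g l x)" for x
        using \<phi>0[of x] by (cases "x \<in> \<Omega>") (auto simp: g'_def algebra_simps sum_distrib_left)
      have "integrable lborel (\<lambda>x. \<phi> x * fX x (u x) (axis j 1))"
      proof -
        have "(\<lambda>x. fX x (u x) (axis j 1)) \<in> borel_measurable lborel" by simp
        from integrable_bounded_mult[OF \<phi>i this bounds(2)[OF u1]] show ?thesis by (simp add: mult.commute)
      qed
      moreover have "integrable lborel (\<lambda>x. (\<phi> x * fp l x (u x)) * g l x)" for l
        using integrable_bounded_mult[OF ip[of l] _ P(2)] by (simp add: mult.assoc)
      ultimately show ?thesis unfolding e1 by (simp add: Bochner_Integration.integrable_sum)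
    qed
    ultimately show ?thesis unfolding lhs using \<sigma>'(4)[OF \<phi>b] \<tau>'(4)[OF \<phi>b] by simp
  qed
  have "weak_deriv_repr \<Omega> (\<lambda>x. f x (u x)) j g' \<sigma>' \<tau>'"
    unfolding weak_deriv_repr_def using g'i g'0 fin' sing' weak by blast
  then show thesis using that van by blast
qed

end

section \<open>Conformal maps of the sphere\<close>

text \<open>On the sphere this is the square of \<open>norm (p + a)\<close>. With 1 in place of
  \<open>p \<bullet> p\<close> it is affine in \<open>p\<close> and, for
  \<open>norm a \<le> 1 / 2\<close>, bounded below on the whole unit ball, whereas the square
  vanishes at \<open>p = - a\<close>.\<close>

definition mobD :: "'a::real_inner \<Rightarrow> 'a \<Rightarrow> real" where
  "mobD a p = 1 + 2 * (a \<bullet> p) + a \<bullet> a"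

definition mobN :: "'a::real_inner \<Rightarrow> 'a \<Rightarrow> 'a" where
  "mobN a p = (2 * (p \<bullet> p + a \<bullet> p)) *\<^sub>R a + (1 - a \<bullet> a) *\<^sub>R p"

text \<open>
  For \<open>norm p = 1\<close> the map below is the conformal automorphism
  \<open>p \<mapsto> a + ((1 - a \<bullet> a) / (norm (p + a))\<^sup>2) *\<^sub>R (p + a)\<close> of the sphere. Over the
  common denominator the coefficient of \<open>a\<close> is \<open>2 * (1 + a \<bullet> p)\<close>; writing \<open>p \<bullet> p\<close> for this \<open>1\<close>
  makes \<open>0\<close> a fixed point too.
\<close>

definition mob :: "'a::real_inner \<Rightarrow> 'a \<Rightarrow> 'a" where
  "mob a p = inverse (mobD a p) *\<^sub>R mobN a p"

text \<open>The primed functions are derivatives in the direction \<open>(a', p')\<close>, kept in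
  explicit algebraic form so that continuity and linearity in the direction can be read off.\<close>

definition mobD' :: "'a::real_inner \<Rightarrow> 'a \<Rightarrow> 'a \<Rightarrow> 'a \<Rightarrow> real" where
  "mobD' a p a' p' = 2 * (a' \<bullet> p) + 2 * (a \<bullet> p') + 2 * (a \<bullet> a')"

definition mobN' :: "'a::real_inner \<Rightarrow> 'a \<Rightarrow> 'a \<Rightarrow> 'a \<Rightarrow> 'a" where
  "mobN' a p a' p' = (2 * (2 * (p \<bullet> p') + a' \<bullet> p + a \<bullet> p')) *\<^sub>R a + (2 * (p \<bullet> p + a \<bullet> p)) *\<^sub>R a'
     - (2 * (a \<bullet> a')) *\<^sub>R p + (1 - a \<bullet> a) *\<^sub>R p'"

definition mob' :: "'a::real_inner \<Rightarrow> 'a \<Rightarrow> 'a \<Rightarrow> 'a \<Rightarrow> 'a" where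
  "mob' a p a' p' = inverse (mobD a p) *\<^sub>R mobN' a p a' p' - (mobD' a p a' p' * (inverse (mobD a p))\<^sup>2) *\<^sub>R mobN a p"

lemma mobD_pos:
  assumes "norm a \<le> 1 / 2" "norm p \<le> 1"
  shows "mobD a p \<ge> 1 / 4"
proof -
  have "\<bar>a \<bullet> p\<bar> \<le> norm a * norm p" by (rule Cauchy_Schwarz_ineq2)
  also have "\<dots> \<le> norm a * 1" using assms by (intro mult_left_mono) auto
  finally have "mobD a p \<ge> 1 - 2 * norm a + norm a * norm a"
    unfolding mobD_def by (simp add: dot_square_norm power2_eq_square)
  also have "1 - 2 * norm a + norm a * norm a = (1 - norm a) * (1 - norm a)" by (simp add: algebra_simps)
  moreover have "(1 - norm a) * (1 - norm a) \<ge> 1 / 2 * (1 / 2)" using assms by (intro mult_mono) auto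
  ultimately show ?thesis by simp
qed

lemma mob_zero_left [simp]: "mob 0 p = p"
  by (simp add: mob_def mobD_def mobN_def)

lemma mob_zero_right [simp]: "mob a 0 = 0"
  by (simp add: mob_def mobN_def)

text \<open>For \<open>p \<bullet> p = 1\<close> the numerator satisfies the polynomial identity
  \<open>mobN a p \<bullet> mobN a p = (mobD a p)\<^sup>2\<close>.\<close>

lemma norm_mob:
  assumes a: "norm a \<le> 1 / 2" and p: "norm p = 1"
  shows "norm (mob a p) = 1"
proof -
  have pp: "p \<bullet> p = 1" using p by (simp add: dot_square_norm)
  have D: "mobD a p > 0" using mobD_pos[OF a, of p] p by simp
  have "mobN a p \<bullet> mobN a p = (mobD a p)\<^sup>2"
    unfolding mobN_def mobD_def
    by (simp add: inner_add_left inner_add_right pp inner_commute[of p a])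
      (simp add: power2_eq_square algebra_simps)
  then have "norm (mobN a p) = mobD a p" using D by (simp add: norm_eq_sqrt_inner)
  then show ?thesis using D by (simp add: mob_def)
qed

text \<open>All vectors lie in the span of \<open>a\<close> and \<open>p\<close>, so the claim is
  arithmetic in \<open>w = a \<bullet> a\<close> and \<open>t = a \<bullet> p\<close>. The
  denominator at the image point is \<open>(1 - w)\<^sup>2 / D\<close>, nonzero because
  \<open>w \<le> 1 / 4\<close>, and the components along \<open>a\<close> cancel.\<close>

lemma mob_inverse:
  assumes a: "norm a \<le> 1 / 2" and p: "norm p = 1 \<or> p = 0"
  shows "mob (- a) (mob a p) = p"
proof (cases "p = 0")
  case False
  then have p1: "norm p = 1" using p by simp
  have pp: "p \<bullet> p = 1" using p1 by (simp add: dot_square_norm)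
  define q where "q = mob a p"
  define D where "D = mobD a p"
  define w where "w = a \<bullet> a"
  define t where "t = a \<bullet> p"
  have D: "D > 0" using mobD_pos[OF a, of p] p1 by (simp add: D_def)
  have Dt: "D = 1 + 2 * t + w" by (simp add: D_def mobD_def t_def w_def)
  have "w \<le> 1 / 2 * (1 / 2)" unfolding w_def dot_square_norm power2_eq_square using a by (intro mult_mono) auto
  then have w1: "1 - w > 0" by simp
  have qq: "q \<bullet> q = 1" using norm_mob[OF a p1] by (simp add: q_def dot_square_norm)
  have q: "q = (1 / D) *\<^sub>R ((2 * (1 + t)) *\<^sub>R a + (1 - w) *\<^sub>R p)"
    by (simp add: q_def mob_def mobN_def D_def pp t_def w_def divide_inverse)
  have aq: "a \<bullet> q = (2 * (1 + t) * w + (1 - w) * t) / D"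
    unfolding q by (simp add: inner_add_right t_def w_def)
  have D2: "mobD (- a) q = (1 - w)\<^sup>2 / D"
  proof -
    have "mobD (- a) q * D = ((1 + w) * D - 2 * (2 * (1 + t) * w + (1 - w) * t))"
      using D by (simp add: mobD_def aq w_def[symmetric] field_simps)
    also have "\<dots> = (1 - w)\<^sup>2" by (simp add: Dt power2_eq_square algebra_simps)
    finally show ?thesis using D by (simp add: field_simps)
  qed
  have c: "1 - a \<bullet> q = (1 - w) * (1 + t) / D"
  proof -
    have "(1 - a \<bullet> q) * D = D - (2 * (1 + t) * w + (1 - w) * t)" using D by (simp add: aq field_simps)
    also have "\<dots> = (1 - w) * (1 + t)" by (simp add: Dt algebra_simps)
    finally show ?thesis using D by (simp add: field_simps)
  qed
  have "mobN (- a) q = (1 - w) *\<^sub>R q - (2 * (1 - a \<bullet> q)) *\<^sub>R a"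
    by (simp add: mobN_def qq w_def algebra_simps)
  also have "(1 - w) *\<^sub>R q = ((1 - w) * (2 * (1 + t)) / D) *\<^sub>R a + ((1 - w)\<^sup>2 / D) *\<^sub>R p"
    unfolding q by (simp add: scaleR_add_right power2_eq_square)
  also have "2 * (1 - a \<bullet> q) = (1 - w) * (2 * (1 + t)) / D" by (simp add: c)
  finally have "mobN (- a) q = ((1 - w)\<^sup>2 / D) *\<^sub>R p" by simp
  then have "mob (- a) q = p" using D w1 by (simp add: mob_def D2)
  then show ?thesis by (simp add: q_def)
qed simp

lemma has_derivative_mob:
  fixes a p :: "'a::real_inner"
  assumes "mobD a p \<noteq> 0"
  shows "((\<lambda>z. mob (fst z) (snd z)) has_derivative (\<lambda>h. mob' a p (fst h) (snd h))) (at (a, p))"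
proof -
  have f: "(fst has_derivative fst) (at (a, p))" "(snd has_derivative snd) (at (a, p))"
    by (auto intro: bounded_linear_imp_has_derivative bounded_linear_fst bounded_linear_snd)
  have D: "((\<lambda>z. mobD (fst z) (snd z)) has_derivative (\<lambda>h. mobD' a p (fst h) (snd h))) (at (a, p))"
    unfolding mobD_def mobD'_def
    by (rule has_derivative_eq_rhs, (rule f has_derivative_add has_derivative_const has_derivative_mult_right has_derivative_inner)+)
      (auto simp: fun_eq_iff inner_commute algebra_simps)
  have N: "((\<lambda>z. mobN (fst z) (snd z)) has_derivative (\<lambda>h. mobN' a p (fst h) (snd h))) (at (a, p))"
    unfolding mobN_def mobN'_def
    by (rule has_derivative_eq_rhs, (rule f has_derivative_add has_derivative_diff has_derivative_const has_derivative_mult_right has_derivative_inner has_derivative_scaleR)+)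
      (auto simp: fun_eq_iff inner_commute algebra_simps)
  have I: "((\<lambda>z. inverse (mobD (fst z) (snd z))) has_derivative
      (\<lambda>h. - (inverse (mobD a p) * mobD' a p (fst h) (snd h) * inverse (mobD a p)))) (at (a, p))"
    using Deriv.has_derivative_inverse[OF _ D] assms by simp
  show ?thesis
    unfolding mob_def mob'_def
    by (rule has_derivative_eq_rhs[OF has_derivative_scaleR[OF I N]])
      (auto simp: fun_eq_iff power2_eq_square algebra_simps)
qed

text \<open>The difference quotient of \<open>mob (s *\<^sub>R b) p\<close> in \<open>s\<close>,
  with \<open>s\<close> cancelled, so that it makes sense and is continuous at \<open>s = 0\<close>.
  \<open>mobY\<close> does the same for the derivative \<open>mob'\<close>.\<close>

definition mobX :: "real \<Rightarrow> 'a::real_inner \<Rightarrow> 'a \<Rightarrow> 'a" where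
  "mobX s b p = inverse (mobD (s *\<^sub>R b) p) *\<^sub>R
     ((2 * (p \<bullet> p + s * (b \<bullet> p))) *\<^sub>R b - (s * (b \<bullet> b)) *\<^sub>R p - (2 * (b \<bullet> p) + s * (b \<bullet> b)) *\<^sub>R p)"

definition mobY :: "real \<Rightarrow> 'a::real_inner \<Rightarrow> 'a \<Rightarrow> 'a \<Rightarrow> 'a \<Rightarrow> 'a" where
  "mobY s b p b' p' = inverse (mobD (s *\<^sub>R b) p) *\<^sub>R
       ((2 * (2 * (p \<bullet> p') + s * (b' \<bullet> p) + s * (b \<bullet> p'))) *\<^sub>R b + (2 * (p \<bullet> p + s * (b \<bullet> p))) *\<^sub>R b'
          - (2 * s * (b \<bullet> b')) *\<^sub>R p - (s * (b \<bullet> b)) *\<^sub>R p' - (2 * (b \<bullet> p) + s * (b \<bullet> b)) *\<^sub>R p')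
     - ((2 * (b' \<bullet> p) + 2 * (b \<bullet> p') + 2 * s * (b \<bullet> b')) * (inverse (mobD (s *\<^sub>R b) p))\<^sup>2) *\<^sub>R mobN (s *\<^sub>R b) p"

lemma mob_expansion:
  assumes "mobD (s *\<^sub>R b) p \<noteq> 0"
  shows "mob (s *\<^sub>R b) p = p + s *\<^sub>R mobX s b p"
proof -
  let ?D = "mobD (s *\<^sub>R b) p"
  have "p = inverse ?D *\<^sub>R (?D *\<^sub>R p)" using assms by simp
  then have "p + s *\<^sub>R mobX s b p = inverse ?D *\<^sub>R (?D *\<^sub>R p + s *\<^sub>R
     ((2 * (p \<bullet> p + s * (b \<bullet> p))) *\<^sub>R b - (s * (b \<bullet> b)) *\<^sub>R p - (2 * (b \<bullet> p) + s * (b \<bullet> b)) *\<^sub>R p))"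
    unfolding mobX_def by (simp add: scaleR_add_right mult.commute)
  also have "?D *\<^sub>R p + s *\<^sub>R
     ((2 * (p \<bullet> p + s * (b \<bullet> p))) *\<^sub>R b - (s * (b \<bullet> b)) *\<^sub>R p - (2 * (b \<bullet> p) + s * (b \<bullet> b)) *\<^sub>R p) = mobN (s *\<^sub>R b) p"
    by (simp add: mobD_def mobN_def algebra_simps)
  finally show ?thesis by (simp add: mob_def)
qed

lemma mob'_expansion:
  assumes "mobD (s *\<^sub>R b) p \<noteq> 0"
  shows "mob' (s *\<^sub>R b) p (s *\<^sub>R b') p' = p' + s *\<^sub>R mobY s b p b' p'"
proof -
  let ?D = "mobD (s *\<^sub>R b) p"
  let ?V = "(2 * (2 * (p \<bullet> p') + s * (b' \<bullet> p) + s * (b \<bullet> p'))) *\<^sub>R b + (2 * (p \<bullet> p + s * (b \<bullet> p))) *\<^sub>R b'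
          - (2 * s * (b \<bullet> b')) *\<^sub>R p - (s * (b \<bullet> b)) *\<^sub>R p' - (2 * (b \<bullet> p) + s * (b \<bullet> b)) *\<^sub>R p'"
  have p': "p' = inverse ?D *\<^sub>R (?D *\<^sub>R p')" using assms by simp
  have "p' + s *\<^sub>R inverse ?D *\<^sub>R ?V = inverse ?D *\<^sub>R (?D *\<^sub>R p' + s *\<^sub>R ?V)"
    by (subst p') (simp add: scaleR_add_right mult.commute)
  also have "?D *\<^sub>R p' + s *\<^sub>R ?V = mobN' (s *\<^sub>R b) p (s *\<^sub>R b') p'"
    by (simp add: mobD_def mobN'_def algebra_simps)
  finally have 1: "p' + s *\<^sub>R inverse ?D *\<^sub>R ?V = inverse ?D *\<^sub>R mobN' (s *\<^sub>R b) p (s *\<^sub>R b') p'" .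
  have 2: "mobD' (s *\<^sub>R b) p (s *\<^sub>R b') p' = s * (2 * (b' \<bullet> p) + 2 * (b \<bullet> p') + 2 * s * (b \<bullet> b'))"
    by (simp add: mobD'_def algebra_simps)
  show ?thesis
    unfolding mob'_def mobY_def 1[symmetric] 2 by (simp add: scaleR_diff_right mult.assoc)
qed

text \<open>For b = v / 2 and \<open>p \<bullet> p = 1\<close> this is v - (v \<bullet> p) p, the
  tangential part of v; the two factors 2 are the reason for halving v.\<close>

lemma mobX_0: "mobX 0 b p = (2 * (p \<bullet> p)) *\<^sub>R b - (2 * (b \<bullet> p)) *\<^sub>R p"
  by (simp add: mobX_def mobD_def)

lemma mobY_0: "mobY 0 b p b' p' = (4 * (p \<bullet> p')) *\<^sub>R b + (2 * (p \<bullet> p)) *\<^sub>R b' - (2 * (b \<bullet> p)) *\<^sub>R p'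
    - (2 * (b' \<bullet> p) + 2 * (b \<bullet> p')) *\<^sub>R p"
  by (simp add: mobY_def mobD_def mobN_def)

lemma mob'_scale: "mob' a p (c *\<^sub>R a') (c *\<^sub>R p') = c *\<^sub>R mob' a p a' p'"
  by (simp add: mob'_def mobN'_def mobD'_def algebra_simps)

lemma mobY_scale: "mobY s b p (c *\<^sub>R b') (c *\<^sub>R p') = c *\<^sub>R mobY s b p b' p'"
  by (simp add: mobY_def algebra_simps)

lemma mob'_add: "mob' a p (a' + a'') (p' + p'') = mob' a p a' p' + mob' a p a'' p''"
  by (simp add: mob'_def mobN'_def mobD'_def algebra_simps)

section \<open>Continuity and uniform bounds of the conformal maps\<close>

lemma continuous_on_mobD [continuous_intros]:
  "continuous_on S f \<Longrightarrow> continuous_on S g \<Longrightarrow> continuous_on S (\<lambda>z. mobD (f z) (g z))"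
  unfolding mobD_def by (intro continuous_intros)

lemma continuous_on_mobN [continuous_intros]:
  "continuous_on S f \<Longrightarrow> continuous_on S g \<Longrightarrow> continuous_on S (\<lambda>z. mobN (f z) (g z))"
  unfolding mobN_def by (intro continuous_intros)

lemma continuous_on_mob:
  "continuous_on S f \<Longrightarrow> continuous_on S g \<Longrightarrow> (\<And>z. z \<in> S \<Longrightarrow> mobD (f z) (g z) \<noteq> 0) \<Longrightarrow> continuous_on S (\<lambda>z. mob (f z) (g z))"
  unfolding mob_def by (intro continuous_intros) auto

lemma continuous_on_mob':
  "continuous_on S f \<Longrightarrow> continuous_on S g \<Longrightarrow> continuous_on S f' \<Longrightarrow> continuous_on S g' \<Longrightarrow>
   (\<And>z. z \<in> S \<Longrightarrow> mobD (f z) (g z) \<noteq> 0) \<Longrightarrow> continuous_on S (\<lambda>z. mob' (f z) (g z) (f' z) (g' z))"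
  unfolding mob'_def mobN'_def mobD'_def by (intro continuous_intros) auto

lemma continuous_on_mobX:
  "continuous_on S \<sigma> \<Longrightarrow> continuous_on S f \<Longrightarrow> continuous_on S g \<Longrightarrow>
   (\<And>z. z \<in> S \<Longrightarrow> mobD (\<sigma> z *\<^sub>R f z) (g z) \<noteq> 0) \<Longrightarrow> continuous_on S (\<lambda>z. mobX (\<sigma> z) (f z) (g z))"
  unfolding mobX_def by (intro continuous_intros) auto

lemma continuous_on_mobY:
  "continuous_on S \<sigma> \<Longrightarrow> continuous_on S f \<Longrightarrow> continuous_on S g \<Longrightarrow> continuous_on S f' \<Longrightarrow> continuous_on S g' \<Longrightarrow>
   (\<And>z. z \<in> S \<Longrightarrow> mobD (\<sigma> z *\<^sub>R f z) (g z) \<noteq> 0) \<Longrightarrow> continuous_on S (\<lambda>z. mobY (\<sigma> z) (f z) (g z) (f' z) (g' z))"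
  unfolding mobY_def by (intro continuous_intros) auto

text \<open>Joint homogeneity in the last two arguments reduces a linear bound to arguments of norm
  at most 1, where compactness applies.\<close>

lemma homogeneous_bound:
  fixes F :: "'c::metric_space \<Rightarrow> 'a::euclidean_space \<Rightarrow> 'a \<Rightarrow> 'b::real_normed_vector"
  assumes S: "compact S" and cont: "continuous_on (S \<times> (cball 0 1 \<times> cball 0 1)) (\<lambda>z. F (fst z) (fst (snd z)) (snd (snd z)))"
    and hom: "\<And>c x a p. F x (c *\<^sub>R a) (c *\<^sub>R p) = c *\<^sub>R F x a p"
  obtains K where "K > 0" "\<And>x a p. x \<in> S \<Longrightarrow> norm (F x a p) \<le> K * (norm a + norm p)"
proof -
  have "compact ((\<lambda>z. F (fst z) (fst (snd z)) (snd (snd z))) ` (S \<times> (cball 0 1 \<times> cball 0 1)))"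
    by (intro compact_continuous_image cont compact_Times S compact_cball)
  then obtain K where K: "K > 0" "\<And>z. z \<in> S \<times> (cball 0 1 \<times> cball 0 1) \<Longrightarrow> norm (F (fst z) (fst (snd z)) (snd (snd z))) \<le> K"
    using compact_imp_bounded[of "(\<lambda>z. F (fst z) (fst (snd z)) (snd (snd z))) ` (S \<times> (cball 0 1 \<times> cball 0 1))"]
    unfolding bounded_pos by blast
  have "norm (F x a p) \<le> K * (norm a + norm p)" if x: "x \<in> S" for x a p
  proof (cases "norm a + norm p = 0")
    case True
    then have "a = 0" "p = 0" using norm_ge_zero[of a] norm_ge_zero[of p] by (auto simp: add_nonneg_eq_0_iff)
    then show ?thesis using hom[of x 0 a p] by simp
  next
    case False
    define c where "c = norm a + norm p"
    have c: "c > 0" using False norm_ge_zero[of a] norm_ge_zero[of p] unfolding c_def by linarith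
    have "norm ((1 / c) *\<^sub>R a) \<le> 1" "norm ((1 / c) *\<^sub>R p) \<le> 1" using c by (auto simp: c_def divide_le_eq)
    then have "norm (F x ((1 / c) *\<^sub>R a) ((1 / c) *\<^sub>R p)) \<le> K" using K(2)[of "(x, (1 / c) *\<^sub>R a, (1 / c) *\<^sub>R p)"] x by simp
    then have "norm (F x a p) / c \<le> K" unfolding hom using c by simp
    then show ?thesis using c by (simp add: c_def[symmetric] divide_le_eq)
  qed
  then show thesis by (rule that[OF K(1)])
qed

lemma mob_bounds:
  fixes B :: real
  assumes B: "B \<ge> 0"
  obtains K where "K > 0"
    "\<And>a p :: real^'m. norm a \<le> 1 / 2 \<Longrightarrow> norm p \<le> 1 \<Longrightarrow> norm (mob a p) \<le> K"
    "\<And>a p a' p' :: real^'m. norm a \<le> 1 / 2 \<Longrightarrow> norm p \<le> 1 \<Longrightarrow> norm (mob' a p a' p') \<le> K * (norm a' + norm p')"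
    "\<And>s (b :: real^'m) p. \<bar>s\<bar> * B \<le> 1 / 2 \<Longrightarrow> \<bar>s\<bar> \<le> 1 \<Longrightarrow> norm b \<le> B \<Longrightarrow> norm p \<le> 1 \<Longrightarrow> norm (mobX s b p) \<le> K"
    "\<And>s (b :: real^'m) p b' p'. \<bar>s\<bar> * B \<le> 1 / 2 \<Longrightarrow> \<bar>s\<bar> \<le> 1 \<Longrightarrow> norm b \<le> B \<Longrightarrow> norm p \<le> 1 \<Longrightarrow>
        norm (mobY s b p b' p') \<le> K * (norm b' + norm p')"
proof -
  let ?S1 = "cball 0 (1 / 2) \<times> cball 0 1 :: ((real^'m) \<times> (real^'m)) set"
  \<comment> \<open>The largest parameter with \<open>s0 \<le> 1\<close> and
    \<open>s0 * B \<le> 1 / 2\<close>, so that the parameters range over a compact set. The case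
    \<open>B = 0\<close> is separate because division by zero gives 0.\<close>
  define s0 where "s0 = (if B = 0 then 1 else min 1 (1 / (2 * B)))"
  have s0: "s0 * B \<le> 1 / 2" "s0 \<ge> 0" using B by (auto simp: s0_def min_def field_simps)
  have s0': "\<bar>s\<bar> \<le> s0" if "\<bar>s\<bar> * B \<le> 1 / 2" "\<bar>s\<bar> \<le> 1" for s
    using that B by (auto simp: s0_def field_simps)
  let ?S2 = "{-s0..s0} \<times> cball 0 B \<times> cball 0 1 :: (real \<times> (real^'m) \<times> (real^'m)) set"
  have D1: "mobD a p \<noteq> 0" if "norm a \<le> 1 / 2" "norm p \<le> 1" for a p :: "real^'m"
    using mobD_pos[OF that] by simp
  have D2: "mobD (s *\<^sub>R b) p \<noteq> 0" if "\<bar>s\<bar> \<le> s0" "norm b \<le> B" "norm p \<le> 1" for s and b p :: "real^'m"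
  proof (rule D1[OF _ that(3)])
    have "\<bar>s\<bar> * norm b \<le> s0 * B" using that s0 B by (intro mult_mono) auto
    then show "norm (s *\<^sub>R b) \<le> 1 / 2" using s0(1) by simp
  qed
  have c1: "compact ?S1" and c2: "compact ?S2" by (intro compact_Times compact_cball compact_Icc)+
  have "compact ((\<lambda>z. mob (fst z) (snd z)) ` ?S1)"
    by (intro compact_continuous_image c1 continuous_on_mob continuous_intros) (auto simp: D1)
  then obtain K1 where K1: "K1 > 0" "\<And>z. z \<in> ?S1 \<Longrightarrow> norm (mob (fst z) (snd z)) \<le> K1"
    using compact_imp_bounded[of "(\<lambda>z. mob (fst z) (snd z)) ` ?S1"] unfolding bounded_pos by blast
  have "compact ((\<lambda>z. mobX (fst z) (fst (snd z)) (snd (snd z))) ` ?S2)"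
    by (intro compact_continuous_image c2 continuous_on_mobX continuous_intros) (auto simp: D2 abs_le_iff)
  then obtain K2 where K2: "K2 > 0" "\<And>z. z \<in> ?S2 \<Longrightarrow> norm (mobX (fst z) (fst (snd z)) (snd (snd z))) \<le> K2"
    using compact_imp_bounded[of "(\<lambda>z. mobX (fst z) (fst (snd z)) (snd (snd z))) ` ?S2"] unfolding bounded_pos by blast
  obtain K3 where K3: "K3 > 0" "\<And>x a p. x \<in> ?S1 \<Longrightarrow> norm (mob' (fst x) (snd x) a p) \<le> K3 * (norm a + norm p)"
  proof (rule homogeneous_bound[OF c1, of "\<lambda>x a p. mob' (fst x) (snd x) a p"])
    show "continuous_on (?S1 \<times> (cball 0 1 \<times> cball 0 1)) (\<lambda>z. mob' (fst (fst z)) (snd (fst z)) (fst (snd z)) (snd (snd z)))"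
      by (intro continuous_on_mob' continuous_intros) (auto simp: D1)
  qed (auto simp: mob'_scale)
  obtain K4 where K4: "K4 > 0" "\<And>x a p. x \<in> ?S2 \<Longrightarrow> norm (mobY (fst x) (fst (snd x)) (snd (snd x)) a p) \<le> K4 * (norm a + norm p)"
  proof (rule homogeneous_bound[OF c2, of "\<lambda>x a p. mobY (fst x) (fst (snd x)) (snd (snd x)) a p"])
    show "continuous_on (?S2 \<times> (cball 0 1 \<times> cball 0 1)) (\<lambda>z. mobY (fst (fst z)) (fst (snd (fst z))) (snd (snd (fst z))) (fst (snd z)) (snd (snd z)))"
      by (intro continuous_on_mobY continuous_intros) (auto simp: D2 abs_le_iff)
  qed (auto simp: mobY_scale)
  define K where "K = K1 + K2 + K3 + K4"
  have KK: "K1 \<le> K" "K2 \<le> K" "K3 \<le> K" "K4 \<le> K" "K > 0" using K1(1) K2(1) K3(1) K4(1) by (auto simp: K_def)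
  show thesis
  proof (rule that[OF KK(5)])
    fix a p a' p' :: "real^'m" assume ap: "norm a \<le> 1 / 2" "norm p \<le> 1"
    then have S: "(a, p) \<in> ?S1" by simp
    show "norm (mob a p) \<le> K" using K1(2)[OF S] KK(1) by simp
    have "norm (mob' a p a' p') \<le> K3 * (norm a' + norm p')" using K3(2)[OF S] by simp
    also have "\<dots> \<le> K * (norm a' + norm p')" using KK by (intro mult_right_mono) auto
    finally show "norm (mob' a p a' p') \<le> K * (norm a' + norm p')" .
  next
    fix s and b p b' p' :: "real^'m" assume "\<bar>s\<bar> * B \<le> 1 / 2" "\<bar>s\<bar> \<le> 1" "norm b \<le> B" "norm p \<le> 1"
    then have S: "(s, b, p) \<in> ?S2" using s0'[of s] by (simp add: abs_le_iff)
    show "norm (mobX s b p) \<le> K" using K2(2)[OF S] KK(2) by simp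
    have "norm (mobY s b p b' p') \<le> K4 * (norm b' + norm p')" using K4(2)[OF S] by simp
    also have "\<dots> \<le> K * (norm b' + norm p')" using KK by (intro mult_right_mono) auto
    finally show "norm (mobY s b p b' p') \<le> K * (norm b' + norm p')" .
  qed
qed

lemma mobX_tendsto: "((\<lambda>s. mobX s b p) \<longlongrightarrow> mobX 0 b p) (at 0)"
  unfolding mobX_def mobD_def by (auto intro!: tendsto_eq_intros)

lemma mobY_tendsto: "((\<lambda>s. mobY s b p b' p') \<longlongrightarrow> mobY 0 b p b' p') (at 0)"
  unfolding mobY_def mobD_def mobN_def by (auto intro!: tendsto_eq_intros)

section \<open>Composition of sphere-valued functions\<close>

text \<open>Places the approximate limit in the unit ball, where the maps to be composed with
  \<open>u\<close> are known to be differentiable.\<close>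

lemma has_approx_limit_norm_le:
  fixes u :: "real^'n \<Rightarrow> real^'m"
  assumes um: "u \<in> borel_measurable borel" and u1: "\<And>y. norm (u y) \<le> 1" and z: "has_approx_limit u x z"
  shows "norm z \<le> 1"
proof -
  have lim: "((\<lambda>r. 1 + ball_average (\<lambda>y. norm (u y - z)) x r) \<longlongrightarrow> 1 + 0) (at_right 0)"
    using z unfolding has_approx_limit_def by (intro tendsto_add tendsto_const)
  have le: "norm z \<le> 1 + ball_average (\<lambda>y. norm (u y - z)) x r" if r: "r > 0" for r
  proof -
    have "norm z = ball_average (\<lambda>y. norm z) x r" using r by (simp add: ball_average_const)
    also have "\<dots> \<le> ball_average (\<lambda>y. 1 + norm (u y - z)) x r"
    proof (rule ball_average_mono)
      show "set_integrable lebesgue (ball x r) (\<lambda>y. 1 + norm (u y - z))"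
        by (intro set_integral_add set_integrable_ball_const integrable_norm_diff um u1)
      have "norm z \<le> 1 + norm (u y - z)" for y
        using norm_triangle_ineq4[of "u y" "u y - z"] u1[of y] by simp
      then show "AE y in lebesgue. y \<in> ball x r \<longrightarrow> 0 \<le> norm z \<and> norm z \<le> 1 + norm (u y - z)"
        by (intro AE_I2) simp
    qed
    also have "\<dots> = 1 + ball_average (\<lambda>y. norm (u y - z)) x r"
      using r by (subst ball_average_add) (auto intro: set_integrable_ball_const integrable_norm_diff um u1 simp: ball_average_const)
    finally show ?thesis .
  qed
  have "norm z \<le> 1 + 0"
    by (rule tendsto_lowerbound[OF lim eventually_mono[OF eventually_at_right_less[of 0] le]]) auto
  then show ?thesis by simp
qed

lemma has_approx_limit_compose_isCont:
  fixes u :: "real^'n \<Rightarrow> real^'m" and F :: "real^'n \<Rightarrow> real^'m \<Rightarrow> real^'k"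
  assumes um: "u \<in> borel_measurable borel" and u1: "\<And>y. norm (u y) \<le> 1" and z: "has_approx_limit u x z"
    and C: "\<And>y q. norm q \<le> 1 \<Longrightarrow> norm (F y q) \<le> C" and cont: "isCont (\<lambda>w. F (fst w) (snd w)) (x, z)"
  shows "has_approx_limit (\<lambda>y. F y (u y)) x (F x z)"
proof (rule has_approx_limit_compose[OF um u1 z C])
  fix e :: real assume "e > 0"
  then obtain d where d: "d > 0" "\<And>w. dist w (x, z) < d \<Longrightarrow> dist (F (fst w) (snd w)) (F x z) < e"
    using cont unfolding continuous_at_eps_delta by fastforce
  have "norm (F y q - F x z) \<le> e" if "dist y x < d / 2" "dist q z < d / 2" for y q
  proof -
    have "dist (y, q) (x, z) \<le> dist y x + dist q z"
      unfolding dist_Pair_Pair by (rule sqrt_sum_squares_le_sum) auto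
    then show ?thesis using d(2)[of "(y, q)"] that by (simp add: dist_norm)
  qed
  then show "\<exists>d>0. \<forall>y q. dist y x < d \<and> dist q z < d \<and> norm q \<le> 1 \<longrightarrow> norm (F y q - F x z) \<le> e"
    using d(1) by (intro exI[of _ "d / 2"]) auto
qed

lemma has_approx_gradient_compose_deriv:
  fixes u :: "real^'n \<Rightarrow> real^'m" and F :: "real^'n \<Rightarrow> real^'m \<Rightarrow> real^'k"
  assumes um: "u \<in> borel_measurable borel" and u1: "\<And>y. norm (u y) \<le> 1"
    and z: "has_approx_limit u x z"
      "((\<lambda>r. ball_average (\<lambda>y. norm (u y - z - G *v (y - x)) / r) x r) \<longlongrightarrow> 0) (at_right 0)"
    and C: "\<And>y q. norm q \<le> 1 \<Longrightarrow> norm (F y q) \<le> C"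
    and deriv: "((\<lambda>w. F (fst w) (snd w)) has_derivative F') (at (x, z))"
  shows "has_approx_gradient (\<lambda>y. F y (u y)) x (matrix (\<lambda>h. F' (h, G *v h)))"
proof -
  have bl: "bounded_linear F'" using deriv has_derivative_bounded_linear by blast
  interpret F': bounded_linear F' by (rule bl)
  have split: "F' (h, k) = F' (h, 0) + F' (0, k)" for h k using F'.add[of "(h, 0)" "(0, k)"] by simp
  have "has_approx_gradient (\<lambda>y. F y (u y)) x (matrix (\<lambda>h. F' (h, 0) + F' (0, G *v h)))"
  proof (rule has_approx_gradient_compose[OF um u1 z C])
    show "bounded_linear (\<lambda>h. F' (h, 0))" "bounded_linear (\<lambda>k. F' (0, k))"
      by (intro bounded_linear_compose[OF bl] bounded_linear_Pair bounded_linear_ident bounded_linear_zero)+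
    fix e :: real assume e: "e > 0"
    from deriv[unfolded has_derivative_at_alt, THEN conjunct2, rule_format, OF e]
    obtain d where d: "d > 0" "\<And>w. norm (w - (x, z)) < d \<Longrightarrow>
        norm (F (fst w) (snd w) - F x z - F' (w - (x, z))) \<le> e * norm (w - (x, z))"
      by auto
    have "norm (F y q - F x z - F' (y - x, 0) - F' (0, q - z)) \<le> e * (norm (y - x) + norm (q - z))"
      if "dist y x < d / 2" "dist q z < d / 2" for y q
    proof -
      have le: "norm (y - x, q - z) \<le> norm (y - x) + norm (q - z)"
        unfolding norm_Pair by (rule sqrt_sum_squares_le_sum) auto
      then have "norm ((y, q) - (x, z)) < d" using that by (simp add: dist_norm)
      from d(2)[OF this] have "norm (F y q - F x z - F' (y - x, q - z)) \<le> e * norm (y - x, q - z)" by simp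
      also have "\<dots> \<le> e * (norm (y - x) + norm (q - z))" using le e by (intro mult_left_mono) auto
      moreover have "F y q - F x z - F' (y - x, 0) - F' (0, q - z) = F y q - F x z - F' (y - x, q - z)"
        by (simp add: split[of "y - x" "q - z"] algebra_simps)
      ultimately show ?thesis by (simp only:)
    qed
    then show "\<exists>d>0. \<forall>y q. dist y x < d \<and> dist q z < d \<and> norm q \<le> 1 \<longrightarrow>
        norm (F y q - F x z - F' (y - x, 0) - F' (0, q - z)) \<le> e * (norm (y - x) + norm (q - z))"
      using d(1) by (intro exI[of _ "d / 2"]) auto
  qed
  then show ?thesis by (simp add: split[symmetric])
qed

text \<open>The map q \<mapsto> (q \<bullet> q) q fixes 0 and the sphere, so the chain rule and the
  uniqueness of the approximate gradient give, with p = u x, the identity G h = (p \<bullet> p) G h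
  + 2 (p \<bullet> G h) p. At p = 0 its right-hand side vanishes; on the sphere G h cancels and the
  last term must be 0.\<close>

lemma approx_gradient_sphere_valued:
  fixes u :: "real^'n \<Rightarrow> real^'m"
  assumes um: "u \<in> borel_measurable borel" and us: "\<And>y. norm (u y) = 1 \<or> u y = 0"
    and z: "has_approx_limit u x (u x)"
      "((\<lambda>r. ball_average (\<lambda>y. norm (u y - u x - G *v (y - x)) / r) x r) \<longlongrightarrow> 0) (at_right 0)"
  shows "u x = 0 \<Longrightarrow> G = 0" and "u x \<bullet> (G *v h) = 0"
proof -
  have u1: "norm (u y) \<le> 1" for y using us[of y] by auto
  define F :: "real^'n \<Rightarrow> real^'m \<Rightarrow> real^'m" where "F y q = (q \<bullet> q) *\<^sub>R q" for y q
  define F' where "F' w = (u x \<bullet> u x) *\<^sub>R snd w + (2 * (u x \<bullet> snd w)) *\<^sub>R u x" for w :: "(real^'n) \<times> (real^'m)"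
  have sd: "(snd has_derivative snd) (at (x, u x))"
    by (intro bounded_linear_imp_has_derivative bounded_linear_snd)
  have deriv: "((\<lambda>w. F (fst w) (snd w)) has_derivative F') (at (x, u x))"
    unfolding F_def F'_def
    by (rule has_derivative_eq_rhs[OF has_derivative_scaleR[OF has_derivative_inner[OF sd sd] sd]])
      (auto simp: fun_eq_iff inner_commute)
  have bd: "norm (F y q) \<le> 1" if "norm q \<le> 1" for y q
  proof -
    have "norm (F y q) = norm q * norm q * norm q" by (simp add: F_def dot_square_norm power2_eq_square)
    also have "\<dots> \<le> 1 * 1 * 1" using that by (intro mult_mono) auto
    finally show ?thesis by simp
  qed
  have "has_approx_gradient (\<lambda>y. F y (u y)) x (matrix (\<lambda>h. F' (h, G *v h)))"
    by (rule has_approx_gradient_compose_deriv[OF um u1 z bd deriv])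
  moreover have "F y (u y) = u y" for y using us[of y] by (auto simp: F_def dot_square_norm)
  ultimately have "has_approx_gradient u x (matrix (\<lambda>h. F' (h, G *v h)))" by simp
  moreover have "has_approx_gradient u x G" using z unfolding has_approx_gradient_def by blast
  ultimately have eq: "G = matrix (\<lambda>h. F' (h, G *v h))" using has_approx_gradient_unique[OF um u1] by blast
  have "bounded_linear (\<lambda>h. F' (h, G *v h))"
    by (rule bounded_linear_compose[OF has_derivative_bounded_linear[OF deriv]
          bounded_linear_Pair[OF bounded_linear_ident matrix_vector_mul_bounded_linear]])
  from matrix_of_bounded_linear[OF this] have G: "G *v h = (u x \<bullet> u x) *\<^sub>R (G *v h) + (2 * (u x \<bullet> (G *v h))) *\<^sub>R u x" for h
    unfolding eq[symmetric] by (simp add: F'_def)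
  show "G = 0" if "u x = 0"
    using G that by (auto simp: matrix_eq)
  show "u x \<bullet> (G *v h) = 0"
  proof (cases "u x = 0")
    case False
    then have n1: "norm (u x) = 1" using us[of x] by auto
    then have "(u x \<bullet> (G *v h)) *\<^sub>R u x = 0" using G[of h] by (simp add: dot_square_norm)
    then show ?thesis using False by simp
  qed simp
qed

text \<open>On \<open>V\<close> the singular parts cancel, so the scalar theorem applies to each
  component at common Lebesgue points of \<open>u\<close> and of its weak derivatives.\<close>

lemma AE_has_approx_gradient:
  fixes u :: "real^'n \<Rightarrow> real^'m"
  assumes \<Omega>: "open \<Omega>" and V: "open V" "V \<subseteq> \<Omega>"
    and ui: "integrable lborel u" and u1: "\<And>y. norm (u y) \<le> 1" and u0: "\<And>y. y \<notin> \<Omega> \<Longrightarrow> u y = 0"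
    and R: "\<And>l j. weak_deriv_repr \<Omega> (\<lambda>x. u x $ l) j (g l j) (\<sigma> l j) (\<tau> l j)"
    and eq: "\<And>l j B. B \<in> sets borel \<Longrightarrow> B \<subseteq> V \<Longrightarrow> measure (\<sigma> l j) B = measure (\<tau> l j) B"
  shows "AE x in lborel. x \<in> V \<longrightarrow> (\<exists>G. has_approx_limit u x (u x) \<and>
      ((\<lambda>r. ball_average (\<lambda>y. norm (u y - u x - G *v (y - x)) / r) x r) \<longlongrightarrow> 0) (at_right 0))"
proof -
  have um: "u \<in> borel_measurable borel" using ui by auto
  have gi: "integrable lborel (g l j)" for l j using R[of l j] unfolding weak_deriv_repr_def by blast
  have "AE x in lborel. \<forall>l. lebesgue_point (\<lambda>y. u y $ l) x"
    using AE_lebesgue_point[OF integrable_vec_nth[OF ui]] by (simp add: AE_all_countable)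
  moreover have "AE x in lborel. \<forall>l j. lebesgue_point (g l j) x"
    using AE_lebesgue_point[OF gi] by (simp add: AE_all_countable)
  ultimately show ?thesis
  proof eventually_elim
    case (elim x)
    show ?case
    proof
      assume x: "x \<in> V"
      define G where "G = (\<chi> l j. g l j x)"
      have lim: "has_approx_limit u x (u x)" by (rule has_approx_limit_lebesgue_point[OF um u1]) (use elim in auto)
      have comp: "((\<lambda>r. ball_average (\<lambda>y. \<bar>u y $ l - u x $ l - (\<Sum>j\<in>UNIV. g l j x * (y - x) $ j)\<bar> / r) x r) \<longlongrightarrow> 0) (at_right 0)" for l
        by (rule approx_differentiable_of_weak_deriv[OF V(1) x \<Omega> integrable_vec_nth[OF ui] _ gi
              weak_deriv_repr_on_regular_set[OF R V eq]])
          (use u0 elim in auto)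
      have Gl: "(u y - u x - G *v (y - x)) $ l = u y $ l - u x $ l - (\<Sum>j\<in>UNIV. g l j x * (y - x) $ j)" for y l
        by (simp add: G_def matrix_vector_mult_def)
      have "((\<lambda>r. ball_average (\<lambda>y. norm (u y - u x - G *v (y - x)) / r) x r) \<longlongrightarrow> 0) (at_right 0)"
      proof (rule tendsto_sandwich[OF _ _ tendsto_const])
        show "((\<lambda>r. \<Sum>l\<in>UNIV. ball_average (\<lambda>y. \<bar>u y $ l - u x $ l - (\<Sum>j\<in>UNIV. g l j x * (y - x) $ j)\<bar> / r) x r) \<longlongrightarrow> 0) (at_right 0)"
          by (rule tendsto_null_sum) (rule comp)
        show "eventually (\<lambda>r. 0 \<le> ball_average (\<lambda>y. norm (u y - u x - G *v (y - x)) / r) x r) (at_right 0)"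
          using eventually_at_right_less[of 0] by eventually_elim (intro ball_average_nonneg, simp)
        show "eventually (\<lambda>r. ball_average (\<lambda>y. norm (u y - u x - G *v (y - x)) / r) x r \<le>
            (\<Sum>l\<in>UNIV. ball_average (\<lambda>y. \<bar>u y $ l - u x $ l - (\<Sum>j\<in>UNIV. g l j x * (y - x) $ j)\<bar> / r) x r)) (at_right 0)"
          using eventually_at_right_less[of 0]
        proof eventually_elim
          case (elim r)
          have int: "set_integrable lebesgue (ball x r) (\<lambda>y. \<bar>u y $ l - u x $ l - (\<Sum>j\<in>UNIV. g l j x * (y - x) $ j)\<bar> / r)" for l
          proof -
            have "set_integrable lebesgue (ball x r) (\<lambda>y. \<bar>(u y - u x - G *v (y - x)) $ l\<bar> / r)"
            proof (rule set_integrable_bound[OF integrable_norm_affine_diff[OF um u1, of x r "u x" G r]])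
              show "set_borel_measurable lebesgue (ball x r) (\<lambda>y. \<bar>(u y - u x - G *v (y - x)) $ l\<bar> / r)"
              proof -
                have "(\<lambda>y. \<bar>(u y - u x - G *v (y - x)) $ l\<bar> / r) \<in> borel_measurable borel" using um by measurable
                then show ?thesis unfolding set_borel_measurable_def
                  by (intro measurable_completion borel_measurable_scaleR borel_measurable_indicator) auto
              qed
              show "AE y in lebesgue. y \<in> ball x r \<longrightarrow> norm (\<bar>(u y - u x - G *v (y - x)) $ l\<bar> / r) \<le> norm (norm (u y - u x - G *v (y - x)) / r)"
                using elim by (intro AE_I2) (simp add: divide_right_mono component_le_norm_cart del: vector_minus_component)
            qed
            then show ?thesis unfolding Gl .
          qed
          have "ball_average (\<lambda>y. norm (u y - u x - G *v (y - x)) / r) x r \<le>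
            ball_average (\<lambda>y. \<Sum>l\<in>UNIV. \<bar>u y $ l - u x $ l - (\<Sum>j\<in>UNIV. g l j x * (y - x) $ j)\<bar> / r) x r"
          proof (rule ball_average_mono)
            show "set_integrable lebesgue (ball x r) (\<lambda>y. \<Sum>l\<in>UNIV. \<bar>u y $ l - u x $ l - (\<Sum>j\<in>UNIV. g l j x * (y - x) $ j)\<bar> / r)"
              using int unfolding set_integrable_def scaleR_sum_right by (intro Bochner_Integration.integrable_sum) auto
            have "norm (u y - u x - G *v (y - x)) / r \<le> (\<Sum>l\<in>UNIV. \<bar>u y $ l - u x $ l - (\<Sum>j\<in>UNIV. g l j x * (y - x) $ j)\<bar> / r)" for y
              using norm_le_l1_cart[of "u y - u x - G *v (y - x)"] elim
              unfolding Gl sum_divide_distrib[symmetric] by (intro divide_right_mono) auto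
            then show "AE y in lebesgue. y \<in> ball x r \<longrightarrow> 0 \<le> norm (u y - u x - G *v (y - x)) / r \<and>
              norm (u y - u x - G *v (y - x)) / r \<le> (\<Sum>l\<in>UNIV. \<bar>u y $ l - u x $ l - (\<Sum>j\<in>UNIV. g l j x * (y - x) $ j)\<bar> / r)"
              using elim by (intro AE_I2) auto
          qed
          also have "\<dots> = (\<Sum>l\<in>UNIV. ball_average (\<lambda>y. \<bar>u y $ l - u x $ l - (\<Sum>j\<in>UNIV. g l j x * (y - x) $ j)\<bar> / r) x r)"
            by (rule ball_average_sum) (rule int)
          finally show ?case .
        qed
      qed
      with lim show "\<exists>G. has_approx_limit u x (u x) \<and>
          ((\<lambda>r. ball_average (\<lambda>y. norm (u y - u x - G *v (y - x)) / r) x r) \<longlongrightarrow> 0) (at_right 0)" by blast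
    qed
  qed
qed

section \<open>Matrices by columns, Borel representatives, linearity of the curl\<close>

lemma norm_matrix_L2_columns: "norm A = L2_set (\<lambda>j. norm (A *v axis j 1)) UNIV" for A :: "real^'n^'m"
proof -
  have "(norm A)\<^sup>2 = (\<Sum>i\<in>UNIV. \<Sum>j\<in>UNIV. (A $ i $ j)\<^sup>2)"
    by (simp add: norm_eq_sqrt_inner inner_vec_def power2_eq_square sum_nonneg)
  also have "\<dots> = (\<Sum>j\<in>UNIV. \<Sum>i\<in>UNIV. (A $ i $ j)\<^sup>2)" by (rule sum.swap)
  also have "\<dots> = (\<Sum>j\<in>UNIV. (norm (A *v axis j 1))\<^sup>2)"
    by (simp add: norm_eq_sqrt_inner inner_vec_def power2_eq_square sum_nonneg matrix_vector_mult_basis column_def)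
  finally show ?thesis unfolding L2_set_def by (metis norm_ge_zero real_sqrt_unique)
qed

lemma norm_matrix_le_columns: "norm A \<le> (\<Sum>j\<in>UNIV. norm (A *v axis j 1))" for A :: "real^'n^'m"
  unfolding norm_matrix_L2_columns by (rule L2_set_le_sum) simp

lemma norm_column_le: "norm (A *v axis j 1) \<le> norm A" for A :: "real^'n^'m"
  unfolding norm_matrix_L2_columns by (rule member_le_L2_set) auto

lemma matrix_eqI_columns: "(\<And>j. A *v axis j 1 = B *v axis j 1) \<Longrightarrow> A = (B :: real^'n^'m)"
  by (simp add: vec_eq_iff matrix_vector_mult_basis column_def)

lemma borel_measurable_vecI:
  fixes f :: "'a \<Rightarrow> ('b::euclidean_space)^'n"
  assumes "\<And>i. (\<lambda>x. f x $ i) \<in> borel_measurable M"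
  shows "f \<in> borel_measurable M"
proof -
  have ax: "bounded_linear (axis i :: 'b \<Rightarrow> 'b^'n)" for i :: 'n
  proof -
    have "linear (axis i :: 'b \<Rightarrow> 'b^'n)" by (rule linearI) (auto simp: vec_eq_iff axis_def)
    then show ?thesis by (simp add: linear_conv_bounded_linear)
  qed
  have "(\<lambda>x. \<Sum>i\<in>UNIV. axis i (f x $ i)) \<in> borel_measurable M"
  proof (rule borel_measurable_sum)
    fix i
    have "(axis i :: 'b \<Rightarrow> 'b^'n) \<in> borel_measurable borel"
      by (rule borel_measurable_continuous_onI[OF linear_continuous_on[OF ax]])
    then show "(\<lambda>x. axis i (f x $ i)) \<in> borel_measurable M" by (rule measurable_compose[OF assms])
  qed
  moreover have "(\<Sum>i\<in>UNIV. axis i (f x $ i)) = f x" for x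
    by (simp add: vec_eq_iff axis_def if_distrib[where f = "\<lambda>v. v $ _"] sum.delta' cong: if_cong)
  ultimately show ?thesis by simp
qed

lemma set_lebesgue_integral_cong_AE_borel:
  fixes f f' :: "'a::euclidean_space \<Rightarrow> real"
  assumes "AE x in lebesgue. x \<in> A \<longrightarrow> f x = f' x" "f' \<in> borel_measurable borel" "A \<in> sets borel"
  shows "(LINT x:A|lebesgue. f x) = (LINT x:A|lebesgue. f' x)"
proof -
  have ae: "AE x in lebesgue. indicator A x *\<^sub>R f' x = indicator A x *\<^sub>R f x"
    using assms(1) by eventually_elim (auto simp: indicator_def)
  have m: "(\<lambda>x. indicator A x *\<^sub>R f' x) \<in> borel_measurable lebesgue"
    by (rule measurable_completion, intro borel_measurable_scaleR borel_measurable_indicator) (use assms in auto)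
  show ?thesis
    unfolding set_lebesgue_integral_def
    by (rule integral_cong_AE[OF borel_measurable_AE[OF m ae] m]) (use ae in \<open>auto elim: eventually_mono\<close>)
qed

text \<open>Setting the function to 0 wherever its value is not admissible makes the constraint hold
  at every point, so that the pointwise arguments about \<open>mob\<close> need no exceptional
  set.\<close>

lemma sphere_valued_borel_representative:
  fixes n :: "real^'n \<Rightarrow> real^'m"
  assumes n: "set_integrable lebesgue \<Omega> n" and \<Omega>: "open \<Omega>"
    and s: "AE x in lebesgue. x \<in> \<Omega> \<longrightarrow> n x \<in> sphere 0 1 \<union> {0}"
  obtains u where "u \<in> borel_measurable borel" "\<And>y. norm (u y) = 1 \<or> u y = 0" "\<And>y. y \<notin> \<Omega> \<Longrightarrow> u y = 0"
    "AE y in lebesgue. y \<in> \<Omega> \<longrightarrow> n y = u y"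
proof -
  let ?h = "\<lambda>x. indicator \<Omega> x *\<^sub>R n x"
  have "?h \<in> borel_measurable lebesgue" using n by (simp add: set_integrable_def)
  then have "(\<lambda>x. ?h x $ i) \<in> borel_measurable (completion lborel)" for i by (rule borel_measurable_vec_nth)
  then have "\<exists>g. g \<in> borel_measurable lborel \<and> (AE x in lborel. ?h x $ i = g x)" for i
    using completion_ex_borel_measurable_real by blast
  then have "\<forall>i. \<exists>g. g \<in> borel_measurable lborel \<and> (AE x in lborel. ?h x $ i = g x)" by (rule allI)
  then obtain g where "\<forall>i. g i \<in> borel_measurable lborel \<and> (AE x in lborel. ?h x $ i = g i x)"
    by (rule choice[THEN exE])
  then have g: "\<And>i. g i \<in> borel_measurable lborel" "\<And>i. AE x in lborel. ?h x $ i = g i x" by blast+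
  define u0 where "u0 x = (\<chi> i. g i x)" for x
  have u0m: "u0 \<in> borel_measurable borel"
    by (rule borel_measurable_vecI) (use g(1) in \<open>simp add: u0_def\<close>)
  have "AE x in lborel. \<forall>i. ?h x $ i = g i x" using g(2) by (simp add: AE_all_countable)
  then have ae0: "AE x in lebesgue. ?h x = u0 x"
    by (intro AE_completion, eventually_elim) (simp add: vec_eq_iff u0_def)
  define A where "A = \<Omega> \<inter> u0 -` (sphere 0 1 \<union> {0})"
  have "u0 -` (sphere 0 1 \<union> {0}) \<inter> space borel \<in> sets borel"
    by (rule measurable_sets[OF u0m]) auto
  then have Ab: "A \<in> sets borel" unfolding A_def using \<Omega> by (intro sets.Int) auto
  define u where "u x = indicator A x *\<^sub>R u0 x" for x
  show thesis
  proof (rule that[of u])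
    show "u \<in> borel_measurable borel" unfolding u_def
      by (intro borel_measurable_scaleR borel_measurable_indicator u0m Ab)
    show "norm (u y) = 1 \<or> u y = 0" for y by (auto simp: u_def A_def indicator_def)
    show "u y = 0" if "y \<notin> \<Omega>" for y using that by (auto simp: u_def A_def)
    show "AE y in lebesgue. y \<in> \<Omega> \<longrightarrow> n y = u y"
      using ae0 s by eventually_elim (auto simp: u_def A_def indicator_def)
  qed
qed

lemma curl_of_add: "curl_of (A + B) = curl_of A + curl_of B"
  by (simp add: curl_of_def vec_eq_iff forall_3)

lemma curl_of_scaleR: "curl_of (c *\<^sub>R A) = c *\<^sub>R curl_of A"
  by (simp add: curl_of_def vec_eq_iff forall_3 algebra_simps)

lemma bounded_linear_curl_of: "bounded_linear curl_of"
proof -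
  have "linear curl_of" by (rule linearI) (simp_all add: curl_of_add curl_of_scaleR)
  then show ?thesis by (simp add: linear_conv_bounded_linear)
qed

lemma mobY_add: "mobY s c p (a' + a'') (p' + p'') = mobY s c p a' p' + mobY s c p a'' p''"
  by (simp add: mobY_def algebra_simps)

lemma derivative_zero_off_closed:
  assumes v: "\<And>x. (v has_derivative v' x) (at x)" and C: "closed C" "\<And>x. x \<notin> C \<Longrightarrow> v x = 0" and x: "x \<notin> C"
  shows "v' x h = 0"
proof -
  have "((\<lambda>x. 0) has_derivative v' x) (at x)"
    by (rule has_derivative_transform_within_open[OF v open_Compl[OF C(1)]]) (simp_all add: x C(2))
  then have "v' x = (\<lambda>h. 0)" by (rule has_derivative_unique[OF _ has_derivative_const])
  then show ?thesis by simp
qed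

text \<open>\<open>b\<close> stands for v / 2, and \<open>s0\<close> keeps
  \<open>norm (s *\<^sub>R b x)\<close> at most 1/2, where \<open>mob\<close> is controlled. The
  constant of \<open>mob_bounds\<close> enters as the parameter \<open>K\<close> so that all
  estimates share it.\<close>

locale variation =
  fixes \<Omega> :: "(real^'n) set" and u :: "real^'n \<Rightarrow> real^'m" and b :: "real^'n \<Rightarrow> real^'m"
    and b' :: "real^'n \<Rightarrow> real^'n \<Rightarrow> real^'m" and B :: real and s0 :: real and K :: real
  assumes \<Omega>: "open \<Omega>" "emeasure lborel \<Omega> < \<infinity>"
    and ui: "integrable lborel u" and us: "\<And>y. norm (u y) = 1 \<or> u y = 0" and u0: "\<And>y. y \<notin> \<Omega> \<Longrightarrow> u y = 0"
    and b: "\<And>x. (b has_derivative b' x) (at x)" and b'c: "\<And>h. continuous_on UNIV (\<lambda>x. b' x h)"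
    and B: "B \<ge> 0" "\<And>x. norm (b x) \<le> B" "\<And>x j. norm (b' x (axis j 1)) \<le> B"
    and s0: "0 < s0" "s0 \<le> 1" "s0 * B \<le> 1 / 2"
    and K: "K > 0"
      "\<And>a p :: real^'m. norm a \<le> 1 / 2 \<Longrightarrow> norm p \<le> 1 \<Longrightarrow> norm (mob a p) \<le> K"
      "\<And>a p a' p' :: real^'m. norm a \<le> 1 / 2 \<Longrightarrow> norm p \<le> 1 \<Longrightarrow> norm (mob' a p a' p') \<le> K * (norm a' + norm p')"
      "\<And>s (b :: real^'m) p. \<bar>s\<bar> * B \<le> 1 / 2 \<Longrightarrow> \<bar>s\<bar> \<le> 1 \<Longrightarrow> norm b \<le> B \<Longrightarrow> norm p \<le> 1 \<Longrightarrow> norm (mobX s b p) \<le> K"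
      "\<And>s (b :: real^'m) p b' p'. \<bar>s\<bar> * B \<le> 1 / 2 \<Longrightarrow> \<bar>s\<bar> \<le> 1 \<Longrightarrow> norm b \<le> B \<Longrightarrow> norm p \<le> 1 \<Longrightarrow>
        norm (mobY s b p b' p') \<le> K * (norm b' + norm p')"
    and sbv: "\<And>i j. \<exists>g \<sigma> \<tau>. weak_deriv_repr \<Omega> (\<lambda>x. u x $ i) j g \<sigma> \<tau> \<and>
       (\<forall>B\<in>sets borel. B \<subseteq> \<Omega> - approx_disc_set \<Omega> u \<longrightarrow> measure \<sigma> B = measure \<tau> B)"
begin

lemma um: "u \<in> borel_measurable borel" using ui by auto

lemma u1: "norm (u y) \<le> 1" using us[of y] by auto

lemma bc: "continuous_on UNIV b"
  by (rule continuous_at_imp_continuous_on) (blast intro: has_derivative_continuous b)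

lemma s_bounds: "\<bar>s\<bar> \<le> s0 \<Longrightarrow> \<bar>s\<bar> * B \<le> 1 / 2" "\<bar>s\<bar> \<le> s0 \<Longrightarrow> \<bar>s\<bar> \<le> 1"
  using s0 B(1) mult_right_mono[of "\<bar>s\<bar>" s0 B] by linarith+

lemma norm_sb: "\<bar>s\<bar> \<le> s0 \<Longrightarrow> norm (s *\<^sub>R b x) \<le> 1 / 2"
  using s_bounds(1)[of s] mult_left_mono[OF B(2)[of x], of "\<bar>s\<bar>"] by simp

definition w :: "real \<Rightarrow> real^'n \<Rightarrow> real^'m" where "w s x = mob (s *\<^sub>R b x) (u x)"

lemma D_ne: "\<bar>s\<bar> \<le> s0 \<Longrightarrow> norm p \<le> 1 \<Longrightarrow> mobD (s *\<^sub>R b x) p \<noteq> 0"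
  using mobD_pos[OF norm_sb[of s x], of p] by linarith

lemma w_sphere: "\<bar>s\<bar> \<le> s0 \<Longrightarrow> norm (w s y) = 1 \<or> w s y = 0"
  unfolding w_def using us[of y] norm_mob[OF norm_sb] by auto

lemma w_u: "\<bar>s\<bar> \<le> s0 \<Longrightarrow> mob ((- s) *\<^sub>R b x) (w s x) = u x"
  unfolding w_def using mob_inverse[OF norm_sb us] by simp

text \<open>Because the modulus is preserved, the energy term with the factor
  \<open>t\<^sup>2\<close> does not vary.\<close>

lemma norm_w: "\<bar>s\<bar> \<le> s0 \<Longrightarrow> norm (w s y) = norm (u y)"
  unfolding w_def using us[of y] norm_mob[OF norm_sb] by auto

lemma has_derivative_mob_b:
  assumes s: "\<bar>s\<bar> \<le> s0" and p: "norm p \<le> 1"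
  shows "((\<lambda>z. mob (s *\<^sub>R b (fst z)) (snd z)) has_derivative
    (\<lambda>h. mob' (s *\<^sub>R b x) p (s *\<^sub>R b' x (fst h)) (snd h))) (at (x, p))"
proof -
  have f: "(fst has_derivative fst) (at (x, p))" "(snd has_derivative snd) (at (x, p))"
    by (auto intro: bounded_linear_imp_has_derivative bounded_linear_fst bounded_linear_snd)
  have "((\<lambda>z. b (fst z)) has_derivative (\<lambda>h. b' x (fst h))) (at (x, p))"
    by (rule has_derivative_compose[OF f(1)]) (simp add: b)
  then have "((\<lambda>z. (s *\<^sub>R b (fst z), snd z)) has_derivative (\<lambda>h. (s *\<^sub>R b' x (fst h), snd h))) (at (x, p))"
    by (intro has_derivative_Pair has_derivative_scaleR_right f(2))
  from has_derivative_compose[OF this, of "\<lambda>z. mob (fst z) (snd z)" "\<lambda>h. mob' (s *\<^sub>R b x) p (fst h) (snd h)"]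
    has_derivative_mob[OF D_ne[OF s p, of x]]
  show ?thesis by simp
qed

lemma w_measurable:
  assumes s: "\<bar>s\<bar> \<le> s0" shows "w s \<in> borel_measurable borel"
proof (rule borel_measurable_vecI)
  fix i
  have "continuous_on (UNIV \<times> cball 0 1) (\<lambda>z. mob (s *\<^sub>R b (fst z)) (snd z) $ i)"
    by (intro continuous_intros continuous_on_mob continuous_on_compose2[OF bc]) (use D_ne[OF s] in auto)
  from measurable_compose_on_cball[OF this um u1] show "(\<lambda>x. w s x $ i) \<in> borel_measurable borel"
    by (simp add: w_def)
qed

text \<open>The chain rule is scalar-valued and is therefore applied to one component
  \<open>i\<close> at a time; additivity of \<open>mob'\<close> in the direction separates the
  derivative in \<open>x\<close> from the partial derivatives in \<open>p\<close>. The constant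
  \<open>K * (B + 1)\<close> dominates both \<open>K\<close> and \<open>K * B\<close>.\<close>

lemma chain:
  assumes s: "\<bar>s\<bar> \<le> s0"
  shows "chain_map (\<lambda>x p. mob (s *\<^sub>R b x) p $ i) (\<lambda>x p h. mob' (s *\<^sub>R b x) p (s *\<^sub>R b' x h) 0 $ i)
    (\<lambda>l x p. mob' (s *\<^sub>R b x) p 0 (axis l 1) $ i) (K * (B + 1))"
proof
  fix x :: "real^'n" and p :: "real^'m" assume p: "norm p \<le> 1"
  have KB: "K \<le> K * (B + 1)" "K * B \<le> K * (B + 1)" using K(1) B(1) by (simp_all add: distrib_left)
  have 1: "((\<lambda>z. mob (s *\<^sub>R b (fst z)) (snd z) $ i) has_derivative
    (\<lambda>h. mob' (s *\<^sub>R b x) p (s *\<^sub>R b' x (fst h)) (snd h) $ i)) (at (x, p))"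
    by (rule bounded_linear.has_derivative[OF bounded_linear_vec_nth has_derivative_mob_b[OF s p]])
  have 2: "mob' (s *\<^sub>R b x) p (s *\<^sub>R b' x h) k $ i =
      mob' (s *\<^sub>R b x) p (s *\<^sub>R b' x h) 0 $ i + (\<Sum>l\<in>UNIV. mob' (s *\<^sub>R b x) p 0 (axis l 1) $ i * k $ l)" for h k
  proof -
    have lin: "linear (\<lambda>k. mob' (s *\<^sub>R b x) p 0 k)"
    proof (rule linearI)
      show "mob' (s *\<^sub>R b x) p 0 (k + k') = mob' (s *\<^sub>R b x) p 0 k + mob' (s *\<^sub>R b x) p 0 k'" for k k'
        using mob'_add[of "s *\<^sub>R b x" p 0 0 k k'] by simp
      show "mob' (s *\<^sub>R b x) p 0 (c *\<^sub>R k) = c *\<^sub>R mob' (s *\<^sub>R b x) p 0 k" for c k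
        using mob'_scale[of "s *\<^sub>R b x" p c 0 k] by simp
    qed
    then have "mob' (s *\<^sub>R b x) p 0 k = (\<Sum>l\<in>UNIV. k $ l *\<^sub>R mob' (s *\<^sub>R b x) p 0 (axis l 1))"
      by (intro linear_sum_axis) (simp add: linear_conv_bounded_linear)
    then show ?thesis
      using mob'_add[of "s *\<^sub>R b x" p "s *\<^sub>R b' x h" 0 0 k] by (simp add: sum_component mult.commute)
  qed
  show "((\<lambda>z. mob (s *\<^sub>R b (fst z)) (snd z) $ i) has_derivative
    (\<lambda>h. mob' (s *\<^sub>R b x) p (s *\<^sub>R b' x (fst h)) 0 $ i + (\<Sum>l\<in>UNIV. mob' (s *\<^sub>R b x) p 0 (axis l 1) $ i * snd h $ l))) (at (x, p))"
    by (rule has_derivative_eq_rhs[OF 1], rule ext, rule 2)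
  have n: "norm (s *\<^sub>R b x) \<le> 1 / 2" by (rule norm_sb[OF s])
  show "\<bar>mob (s *\<^sub>R b x) p $ i\<bar> \<le> K * (B + 1)"
    using component_le_norm_cart[of "mob (s *\<^sub>R b x) p" i] K(2)[OF n p] KB by linarith
  show "\<bar>mob' (s *\<^sub>R b x) p 0 (axis l 1) $ i\<bar> \<le> K * (B + 1)" for l
    using component_le_norm_cart[of "mob' (s *\<^sub>R b x) p 0 (axis l 1)" i] K(3)[OF n p, of 0 "axis l 1"] KB by simp
  show "\<bar>mob' (s *\<^sub>R b x) p (s *\<^sub>R b' x (axis j 1)) 0 $ i\<bar> \<le> K * (B + 1)" for j
  proof -
    have "norm (s *\<^sub>R b' x (axis j 1)) \<le> 1 * B"
      unfolding norm_scaleR using B s_bounds(2)[OF s] by (intro mult_mono) auto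
    then have "K * (norm (s *\<^sub>R b' x (axis j 1)) + norm (0::real^'m)) \<le> K * B" using K(1) by simp
    then show ?thesis
      using component_le_norm_cart[of "mob' (s *\<^sub>R b x) p (s *\<^sub>R b' x (axis j 1)) 0" i] K(3)[OF n p, of "s *\<^sub>R b' x (axis j 1)" 0] KB by linarith
  qed
next
  show "continuous_on (UNIV \<times> cball 0 1) (\<lambda>z. mob' (s *\<^sub>R b (fst z)) (snd z) (s *\<^sub>R b' (fst z) h) 0 $ i)" for h
    by (intro continuous_intros continuous_on_mob' continuous_on_compose2[OF bc] continuous_on_compose2[OF b'c]) (use D_ne[OF s] in auto)
  show "continuous_on (UNIV \<times> cball 0 1) (\<lambda>z. mob' (s *\<^sub>R b (fst z)) (snd z) 0 (axis l 1) $ i)" for l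
    by (intro continuous_intros continuous_on_mob' continuous_on_compose2[OF bc]) (use D_ne[OF s] in auto)
qed

text \<open>Stated for an arbitrary \<open>f\<close> because it is used twice: for \<open>u\<close>
  with \<open>s\<close>, and for \<open>w s\<close> with \<open>- s\<close>, which leads back to
  \<open>u\<close>. The two uses give the two inclusions between the discontinuity sets.\<close>

lemma has_approx_limit_mob_b:
  assumes s: "\<bar>s\<bar> \<le> s0" and f: "f \<in> borel_measurable borel" "\<And>y. norm (f y) \<le> 1" and z: "has_approx_limit f x z"
  shows "has_approx_limit (\<lambda>y. mob (s *\<^sub>R b y) (f y)) x (mob (s *\<^sub>R b x) z)"
proof (rule has_approx_limit_compose_isCont[OF f z])
  show "norm (mob (s *\<^sub>R b y) q) \<le> K" if "norm q \<le> 1" for y q by (rule K(2)[OF norm_sb[OF s] that])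
  show "isCont (\<lambda>w. mob (s *\<^sub>R b (fst w)) (snd w)) (x, z)"
    by (rule has_derivative_continuous[OF has_derivative_mob_b[OF s has_approx_limit_norm_le[OF f z]]])
qed

lemma approx_disc_set_w:
  assumes s: "\<bar>s\<bar> \<le> s0"
  shows "approx_disc_set \<Omega> (w s) = approx_disc_set \<Omega> u"
proof -
  have w1: "norm (w s y) \<le> 1" for y using w_sphere[OF s, of y] by auto
  have s': "\<bar>- s\<bar> \<le> s0" using s by simp
  have "(\<exists>z. has_approx_limit (w s) x z) \<longleftrightarrow> (\<exists>z. has_approx_limit u x z)" for x
  proof
    assume "\<exists>z. has_approx_limit u x z"
    then show "\<exists>z. has_approx_limit (w s) x z"
      using has_approx_limit_mob_b[OF s um u1, of x] by (auto simp: w_def[abs_def])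
  next
    assume "\<exists>z. has_approx_limit (w s) x z"
    then obtain z where "has_approx_limit (w s) x z" by blast
    from has_approx_limit_mob_b[OF s' w_measurable[OF s] w1 this]
    have "has_approx_limit (\<lambda>y. mob ((- s) *\<^sub>R b y) (w s y)) x (mob ((- s) *\<^sub>R b x) z)" .
    then show "\<exists>z. has_approx_limit u x z" unfolding w_u[OF s] by blast
  qed
  then show ?thesis by (simp add: approx_disc_set_def)
qed

lemma w_integrable: 
  assumes s: "\<bar>s\<bar> \<le> s0" shows "set_integrable lebesgue \<Omega> (w s)"
proof -
  have m: "w s \<in> borel_measurable borel" by (rule w_measurable[OF s])
  have "set_integrable lborel \<Omega> (w s)" unfolding set_integrable_def
  proof (rule integrableI_bounded_set[where A = \<Omega> and B = 1])
    show "(\<lambda>x. indicator \<Omega> x *\<^sub>R w s x) \<in> borel_measurable lborel"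
      by (intro borel_measurable_scaleR borel_measurable_indicator) (use m \<Omega>(1) in auto)
    have "norm (w s x) \<le> 1" for x using w_sphere[OF s, of x] by auto
    then show "AE x in lborel. x \<in> \<Omega> \<longrightarrow> norm (indicator \<Omega> x *\<^sub>R w s x) \<le> 1" by (simp add: indicator_def)
  qed (use \<Omega> in auto)
  then show ?thesis using m \<Omega>(1) by (subst set_integrable_lebesgue_iff_lborel) auto
qed

text \<open>\<open>w s\<close> and \<open>u\<close> have the same discontinuity set, so the sets on
  which the singular parts have to cancel are the same for both.\<close>

lemma w_SBV:
  assumes s: "\<bar>s\<bar> \<le> s0"
  shows "w s \<in> SBV \<Omega>"
proof (rule SBV_I_weak_deriv_repr[OF \<Omega>(1) w_integrable[OF s]])
  fix i j
  obtain g \<sigma> \<tau> where R: "\<And>l. weak_deriv_repr \<Omega> (\<lambda>x. u x $ l) j (g l) (\<sigma> l) (\<tau> l)"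
    and eq: "\<And>l B. B\<in>sets borel \<Longrightarrow> B \<subseteq> \<Omega> - approx_disc_set \<Omega> u \<Longrightarrow> measure (\<sigma> l) B = measure (\<tau> l) B"
    using sbv[of _ j] by metis
  interpret chain_map "\<lambda>x p. mob (s *\<^sub>R b x) p $ i" "\<lambda>x p h. mob' (s *\<^sub>R b x) p (s *\<^sub>R b' x h) 0 $ i"
    "\<lambda>l x p. mob' (s *\<^sub>R b x) p 0 (axis l 1) $ i" "K * (B + 1)" by (rule chain[OF s])
  obtain g' \<sigma>' \<tau>' where R': "weak_deriv_repr \<Omega> (\<lambda>x. mob (s *\<^sub>R b x) (u x) $ i) j g' \<sigma>' \<tau>'"
    and eq': "\<And>B. B \<in> sets borel \<Longrightarrow> (\<And>l A. A \<in> sets borel \<Longrightarrow> A \<subseteq> B \<Longrightarrow> measure (\<sigma> l) A = measure (\<tau> l) A) \<Longrightarrow>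
       measure \<sigma>' B = measure \<tau>' B"
    using weak_deriv_compose[OF \<Omega> ui u1 u0 R] by blast
  have "measure \<sigma>' B = measure \<tau>' B" if "B \<in> sets borel" "B \<subseteq> \<Omega> - approx_disc_set \<Omega> (w s)" for B
    by (rule eq'[OF that(1)]) (use eq that(2) in \<open>auto simp: approx_disc_set_w[OF s]\<close>)
  then show "\<exists>g \<sigma> \<tau>. weak_deriv_repr \<Omega> (\<lambda>x. w s x $ i) j g \<sigma> \<tau> \<and>
       (\<forall>B\<in>sets borel. B \<subseteq> \<Omega> - approx_disc_set \<Omega> (w s) \<longrightarrow> measure \<sigma> B = measure \<tau> B)"
    using R' unfolding w_def by blast
qed

definition X :: "real \<Rightarrow> real^'n \<Rightarrow> real^'m" where "X s x = mobX s (b x) (u x)"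

text \<open>The difference quotient of the approximate gradient of \<open>w s\<close>, wherever
  \<open>u\<close> is approximately differentiable at \<open>x\<close> with limit
  \<open>u x\<close>. Elsewhere it may involve an arbitrary value of
  \<open>approx_gradient u\<close>.\<close>

definition Y :: "real \<Rightarrow> real^'n \<Rightarrow> real^'n^'m" where
  "Y s x = matrix (\<lambda>h. mobY s (b x) (u x) (b' x h) (approx_gradient u x *v h))"

lemma w_X: "\<bar>s\<bar> \<le> s0 \<Longrightarrow> w s x = u x + s *\<^sub>R X s x"
  unfolding w_def X_def by (rule mob_expansion[OF D_ne[OF _ u1]])

lemma X_bound: "\<bar>s\<bar> \<le> s0 \<Longrightarrow> norm (X s x) \<le> K"
  unfolding X_def by (intro K(4) s_bounds B(2) u1)

lemma Y_mult: "Y s x *v h = mobY s (b x) (u x) (b' x h) (approx_gradient u x *v h)"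
proof -
  have "linear (b' x)" by (rule has_derivative_linear[OF b])
  then have "linear (\<lambda>h. mobY s (b x) (u x) (b' x h) (approx_gradient u x *v h))"
    by (intro linearI) (simp_all add: linear_add linear_scale matrix_vector_right_distrib mobY_add mobY_scale matrix_vector_mult_scaleR)
  then show ?thesis unfolding Y_def by (intro matrix_of_bounded_linear) (simp add: linear_conv_bounded_linear)
qed

lemma Y_bound: 
  assumes s: "\<bar>s\<bar> \<le> s0"
  shows "norm (Y s x) \<le> real CARD('n) * K * (B + norm (approx_gradient u x))"
proof -
  have "norm (Y s x) \<le> (\<Sum>j\<in>UNIV. norm (Y s x *v axis j 1))" by (rule norm_matrix_le_columns)
  also have "\<dots> \<le> (\<Sum>j\<in>(UNIV::'n set). K * (B + norm (approx_gradient u x)))"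
  proof (rule sum_mono)
    fix j
    have "norm (Y s x *v axis j 1) \<le> K * (norm (b' x (axis j 1)) + norm (approx_gradient u x *v axis j 1))"
      unfolding Y_mult by (intro K(5) s_bounds s B(2) u1)
    also have "\<dots> \<le> K * (B + norm (approx_gradient u x))"
      using K(1) B(3)[of x j] norm_column_le[of "approx_gradient u x" j] by (intro mult_left_mono add_mono) auto
    finally show "norm (Y s x *v axis j 1) \<le> K * (B + norm (approx_gradient u x))" .
  qed
  finally show ?thesis by simp
qed

lemma approx_gradient_w:
  assumes s: "\<bar>s\<bar> \<le> s0" and z: "has_approx_limit u x (u x)"
      "((\<lambda>r. ball_average (\<lambda>y. norm (u y - u x - G *v (y - x)) / r) x r) \<longlongrightarrow> 0) (at_right 0)"
  shows "approx_gradient u x = G" "approx_gradient (w s) x = approx_gradient u x + s *\<^sub>R Y s x"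
proof -
  show G: "approx_gradient u x = G"
    by (rule approx_gradient_eqI[OF um u1]) (use z in \<open>auto simp: has_approx_gradient_def\<close>)
  have w1: "norm (w s y) \<le> 1" for y using w_sphere[OF s, of y] by auto
  have "has_approx_gradient (\<lambda>y. mob (s *\<^sub>R b y) (u y)) x
      (matrix (\<lambda>h. mob' (s *\<^sub>R b x) (u x) (s *\<^sub>R b' x (fst (h, G *v h))) (snd (h, G *v h))))"
    by (rule has_approx_gradient_compose_deriv[OF um u1 z K(2)[OF norm_sb[OF s]] has_derivative_mob_b[OF s u1]])
  then have "approx_gradient (w s) x = matrix (\<lambda>h. mob' (s *\<^sub>R b x) (u x) (s *\<^sub>R b' x h) (G *v h))"
    unfolding w_def[symmetric] by (simp add: approx_gradient_eqI[OF w_measurable[OF s] w1])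
  also have "\<dots> = matrix (\<lambda>h. (G + s *\<^sub>R Y s x) *v h)"
  proof -
    have "mob' (s *\<^sub>R b x) (u x) (s *\<^sub>R b' x h) (G *v h) = (G + s *\<^sub>R Y s x) *v h" for h
      using mob'_expansion[OF D_ne[OF s u1], of x x "b' x h" "G *v h"]
      by (simp add: matrix_vector_mult_add_rdistrib scaleR_matrix_vector_assoc[symmetric] Y_mult G)
    then show ?thesis by simp
  qed
  finally show "approx_gradient (w s) x = approx_gradient u x + s *\<^sub>R Y s x" by (simp add: G)
qed

lemma Y_zero: "b x = 0 \<Longrightarrow> (\<And>h. b' x h = 0) \<Longrightarrow> Y s x = 0"
  by (rule matrix_eqI_columns) (simp add: Y_mult mobY_def)

lemma X_zero: "b x = 0 \<Longrightarrow> X s x = 0"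
  by (simp add: X_def mobX_def)

text \<open>Holds at every point off \<open>C\<close>, approximately differentiable or not:
  \<open>w s\<close> and \<open>u\<close> agree near \<open>x\<close>, so their approximate
  gradients are the same value, and \<open>Y s x\<close> is 0.\<close>

lemma approx_gradient_w_outside:
  assumes s: "\<bar>s\<bar> \<le> s0" and C: "closed C" "\<And>y. y \<notin> C \<Longrightarrow> b y = 0" and x: "x \<notin> C"
  shows "approx_gradient (w s) x = approx_gradient u x + s *\<^sub>R Y s x"
proof -
  have "w s y = u y" if "y \<notin> C" for y using C(2)[OF that] by (simp add: w_def)
  then have "approx_gradient (w s) x = approx_gradient u x"
    using C(1) x um by (intro approx_gradient_cong_AE[of "- C"]) auto
  moreover have "b' x h = 0" for h by (rule derivative_zero_off_closed[OF b C x])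
  ultimately show ?thesis using Y_zero[of x s] C(2)[OF x] by simp
qed

lemma X_tendsto: "((\<lambda>s. X s x) \<longlongrightarrow> X 0 x) (at 0)"
  unfolding X_def by (rule mobX_tendsto)

lemma Y_tendsto: "((\<lambda>s. Y s x) \<longlongrightarrow> Y 0 x) (at 0)"
proof -
  have "((\<lambda>s. Y s x $ i $ j) \<longlongrightarrow> Y 0 x $ i $ j) (at 0)" for i j
  proof -
    have eq: "Y s x $ i $ j = mobY s (b x) (u x) (b' x (axis j 1)) (approx_gradient u x *v axis j 1) $ i" for s
      unfolding Y_mult[symmetric] by (simp add: matrix_vector_mult_basis column_def)
    show ?thesis unfolding eq by (intro tendsto_vec_nth mobY_tendsto)
  qed
  then show ?thesis by (intro vec_tendstoI)
qed

lemma X_measurable: 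
  assumes s: "\<bar>s\<bar> \<le> s0" shows "X s \<in> borel_measurable borel"
proof (rule borel_measurable_vecI)
  fix i
  have "continuous_on (UNIV \<times> cball 0 1) (\<lambda>z. mobX s (b (fst z)) (snd z) $ i)"
    by (intro continuous_intros continuous_on_mobX continuous_on_compose2[OF bc]) (use D_ne[OF s] in auto)
  from measurable_compose_on_cball[OF this um u1] show "(\<lambda>x. X s x $ i) \<in> borel_measurable borel"
    by (simp add: X_def)
qed

lemma Y_measurable:
  assumes G: "set_borel_measurable lebesgue \<Omega> (approx_gradient u)"
  shows "(\<lambda>x. indicator \<Omega> x *\<^sub>R Y s x) \<in> borel_measurable lebesgue"
proof (intro borel_measurable_vecI)
  fix i j
  have bm: "b \<in> borel_measurable lebesgue" "(\<lambda>x. b' x h) \<in> borel_measurable lebesgue" "u \<in> borel_measurable lebesgue" for h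
    by (rule measurable_completion, simp add: um borel_measurable_continuous_onI[OF bc] borel_measurable_continuous_onI[OF b'c])+
  have Gm: "(\<lambda>x. (indicator \<Omega> x *\<^sub>R approx_gradient u x) *v axis j 1) \<in> borel_measurable lebesgue"
  proof (rule measurable_compose[OF G[unfolded set_borel_measurable_def] borel_measurable_continuous_onI])
    have "linear (\<lambda>A :: real^'n^'m. A *v axis j 1)"
      by (rule linearI) (simp_all add: matrix_vector_mult_add_rdistrib scaleR_matrix_vector_assoc)
    then show "continuous_on UNIV (\<lambda>A :: real^'n^'m. A *v axis j 1)"
      by (intro linear_continuous_on) (simp add: linear_conv_bounded_linear)
  qed
  \<comment> \<open>The gradient is known to be measurable only after truncation to
    \<open>\<Omega>\<close>; truncating it inside \<open>mobY\<close> changes nothing at points of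
    \<open>\<Omega>\<close>.\<close>
  have "(\<lambda>x. mobY s (b x) (u x) (b' x (axis j 1)) ((indicator \<Omega> x *\<^sub>R approx_gradient u x) *v axis j 1)) \<in> borel_measurable lebesgue"
    unfolding mobY_def mobD_def mobN_def using bm Gm by measurable
  then have "(\<lambda>x. indicator \<Omega> x *\<^sub>R mobY s (b x) (u x) (b' x (axis j 1)) ((indicator \<Omega> x *\<^sub>R approx_gradient u x) *v axis j 1) $ i) \<in> borel_measurable lebesgue"
    using \<Omega>(1) by (intro borel_measurable_scaleR borel_measurable_indicator borel_measurable_vec_nth) auto
  moreover have "indicator \<Omega> x *\<^sub>R mobY s (b x) (u x) (b' x (axis j 1)) ((indicator \<Omega> x *\<^sub>R approx_gradient u x) *v axis j 1) $ i
      = (indicator \<Omega> x *\<^sub>R Y s x) $ i $ j" for x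
  proof -
    have "A $ i $ j = (A *v axis j 1) $ i" for A :: "real^'n^'m" by (simp add: matrix_vector_mult_basis column_def)
    then have "(indicator \<Omega> x *\<^sub>R Y s x) $ i $ j = indicator \<Omega> x *\<^sub>R (Y s x *v axis j 1) $ i" by simp
    then show ?thesis unfolding Y_mult by (simp add: indicator_def)
  qed
  ultimately show "(\<lambda>x. (indicator \<Omega> x *\<^sub>R Y s x) $ i $ j) \<in> borel_measurable lebesgue" by (simp only:)
qed

end

section \<open>The first variation of the energy\<close>

lemma slab_eq_box: "slab L1 L2 a c = box (vector [- L1, - L2, a]) (vector [L1, L2, c])"
  by (auto simp: slab_def mem_box_cart forall_3)

lemma curl_of_0 [simp]: "curl_of 0 = 0"
  using curl_of_scaleR[of 0 0] by simp

lemma curl_of_diff: "curl_of (A - B) = curl_of A - curl_of B"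
  using curl_of_add[of A "(-1) *\<^sub>R B"] curl_of_scaleR[of "-1" B] by simp

definition outer :: "real^'m \<Rightarrow> real^'n \<Rightarrow> real^'n^'m" where
  "outer p \<rho> = (\<chi> i j. p $ i * \<rho> $ j)"

lemma outer_mult: "outer p \<rho> *v h = (\<rho> \<bullet> h) *\<^sub>R p"
  by (simp add: outer_def matrix_vector_mult_def vec_eq_iff inner_vec_def sum_distrib_left mult_ac)

lemma inner_outer: "G \<bullet> outer p \<rho> = (\<Sum>j\<in>UNIV. \<rho> $ j * (p \<bullet> (G *v axis j 1)))"
proof -
  have "G \<bullet> outer p \<rho> = (\<Sum>i\<in>UNIV. \<Sum>j\<in>UNIV. G $ i $ j * (p $ i * \<rho> $ j))"
    by (simp add: inner_vec_def outer_def)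
  also have "\<dots> = (\<Sum>j\<in>UNIV. \<Sum>i\<in>UNIV. G $ i $ j * (p $ i * \<rho> $ j))" by (rule sum.swap)
  finally show ?thesis
    by (simp add: inner_vec_def matrix_vector_mult_basis column_def sum_distrib_left mult_ac)
qed

text \<open>The curl of the rank-one matrix is the cross product of \<open>\<rho>\<close> and
  \<open>p\<close>, which is orthogonal to \<open>p\<close>.\<close>

lemma inner_curl_outer: "p \<bullet> curl_of (outer p \<rho>) = 0"
  by (simp add: curl_of_def outer_def inner_vec_def sum_3 algebra_simps)

text \<open>\<open>\<rho>\<close> is the gradient of n \<bullet> v, and \<open>Y0\<close> is the
  gradient J - (p \<bullet> v) G - p \<otimes> \<rho> of the tangential field v - (n \<bullet> v) n.
  The rank-one term contributes nothing: the columns of \<open>G\<close> are orthogonal to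
  \<open>p\<close>, and so is the curl of that term. At \<open>p = 0\<close> both \<open>G\<close>
  and \<open>Y0\<close> vanish, and with them both sides.\<close>

lemma variation_integrand:
  fixes p v :: "real^3" and G J Y0 :: "real^3^3"
  assumes p: "norm p = 1 \<or> p = 0" and G0: "p = 0 \<Longrightarrow> G = 0" and pG: "\<And>h. p \<bullet> (G *v h) = 0"
    and Y0: "\<And>h. Y0 *v h = mobY 0 ((1 / 2) *\<^sub>R v) p ((1 / 2) *\<^sub>R (J *v h)) (G *v h)"
    and X0: "X0 = mobX 0 ((1 / 2) *\<^sub>R v) p"
  shows "2 * (G \<bullet> Y0) + 2 * t * (X0 \<bullet> curl_of G + p \<bullet> curl_of Y0) =
    2 * (J \<bullet> G + t * (v \<bullet> curl_of G + p \<bullet> curl_of J) - (p \<bullet> v) * ((norm G)\<^sup>2 + 2 * t * (p \<bullet> curl_of G)))"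
proof (cases "p = 0")
  case True
  then have "G = 0" by (rule G0)
  then have "Y0 = 0" using True by (intro matrix_eqI_columns) (simp add: Y0 mobY_0)
  then show ?thesis using True \<open>G = 0\<close> by simp
next
  case False
  then have pp: "p \<bullet> p = 1" using p by (simp add: dot_square_norm)
  define \<rho> where "\<rho> = (\<chi> j. p \<bullet> (J *v axis j 1) + v \<bullet> (G *v axis j 1))"
  have Yeq: "Y0 = J - (p \<bullet> v) *\<^sub>R G - outer p \<rho>"
  proof (rule matrix_eqI_columns)
    fix j
    have "\<rho> \<bullet> axis j 1 = p \<bullet> (J *v axis j 1) + v \<bullet> (G *v axis j 1)"
      by (simp add: inner_axis \<rho>_def)
    then show "Y0 *v axis j 1 = (J - (p \<bullet> v) *\<^sub>R G - outer p \<rho>) *v axis j 1"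
      by (simp add: Y0 mobY_0 pG pp matrix_vector_mult_diff_rdistrib scaleR_matrix_vector_assoc[symmetric] outer_mult inner_commute)
  qed
  have Xeq: "X0 = v - (p \<bullet> v) *\<^sub>R p" by (simp add: X0 mobX_0 pp inner_commute)
  show ?thesis unfolding Yeq Xeq
    by (simp add: inner_diff_right inner_diff_left curl_of_diff curl_of_add curl_of_scaleR inner_add_right inner_outer pG inner_curl_outer dot_square_norm inner_commute algebra_simps)
qed

lemma weak_deriv_repr_cong_AE:
  assumes R: "weak_deriv_repr \<Omega> v j g \<sigma> \<tau>" and \<Omega>: "open \<Omega>"
    and ae: "AE x in lebesgue. x \<in> \<Omega> \<longrightarrow> v x = v' x" and m: "v' \<in> borel_measurable borel"
  shows "weak_deriv_repr \<Omega> v' j g \<sigma> \<tau>"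
proof -
  have "(LINT x:\<Omega>|lebesgue. v x * frechet_derivative \<phi> (at x) (axis j 1)) = (LINT x:\<Omega>|lebesgue. v' x * frechet_derivative \<phi> (at x) (axis j 1))"
    if \<phi>: "\<phi> \<in> test_functions \<Omega>" for \<phi> :: "real^'a \<Rightarrow> real"
  proof (rule set_lebesgue_integral_cong_AE_borel)
    have "Ck (Suc 0) \<phi>" using \<phi> unfolding test_functions_def by blast
    then obtain \<phi>' where \<phi>': "\<And>x. (\<phi> has_derivative \<phi>' x) (at x)" "\<And>h. continuous_on UNIV (\<lambda>x. \<phi>' x h)" by auto
    show "(\<lambda>x. v' x * frechet_derivative \<phi> (at x) (axis j 1)) \<in> borel_measurable borel"
      unfolding frechet_derivative_at[OF \<phi>'(1), symmetric]
      by (intro borel_measurable_times m borel_measurable_continuous_onI \<phi>'(2))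
    show "AE x in lebesgue. x \<in> \<Omega> \<longrightarrow> v x * frechet_derivative \<phi> (at x) (axis j 1) = v' x * frechet_derivative \<phi> (at x) (axis j 1)"
      using ae by eventually_elim simp
  qed (use \<Omega> in auto)
  then show ?thesis using R unfolding weak_deriv_repr_def by simp
qed

lemma negligible_C1_graph:
  fixes \<phi> :: "real^2 \<Rightarrow> real"
  assumes "C1_on D \<phi>"
  shows "negligible ((\<lambda>z. vector [z $ 1, z $ 2, \<phi> z] :: real^3) ` D)"
proof (rule negligible_differentiable_image_lowdim)
  show "DIM(real^2) < DIM(real^3)" by simp
  obtain \<phi>' where \<phi>': "\<And>x. x \<in> D \<Longrightarrow> (\<phi> has_derivative blinfun_apply (\<phi>' x)) (at x)"
    using assms unfolding C1_on_def by blast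
  have eq: "(vector [a, c, d] :: real^3) = a *\<^sub>R axis 1 1 + c *\<^sub>R axis 2 1 + d *\<^sub>R axis 3 1" for a c d :: real
    by (simp add: vec_eq_iff forall_3 axis_def)
  show "(\<lambda>z. vector [z $ 1, z $ 2, \<phi> z] :: real^3) differentiable_on D"
    unfolding differentiable_on_def differentiable_def
  proof
    fix x assume x: "x \<in> D"
    have nth: "((\<lambda>z::real^2. z $ i) has_derivative (\<lambda>h. h $ i)) (at x within D)" for i
      by (intro bounded_linear_imp_has_derivative bounded_linear_vec_nth)
    have "((\<lambda>z. z $ 1 *\<^sub>R axis 1 1 + z $ 2 *\<^sub>R axis 2 1 + \<phi> z *\<^sub>R axis 3 1 :: real^3) has_derivative
       (\<lambda>h. h $ 1 *\<^sub>R axis 1 1 + h $ 2 *\<^sub>R axis 2 1 + blinfun_apply (\<phi>' x) h *\<^sub>R axis 3 1)) (at x within D)"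
      by (intro has_derivative_add has_derivative_scaleR_left nth has_derivative_at_withinI[OF \<phi>'[OF x]])
    then show "\<exists>D'. ((\<lambda>z. vector [z $ 1, z $ 2, \<phi> z] :: real^3) has_derivative D') (at x within D)"
      unfolding eq by blast
  qed
qed

lemma bounded_of_zero_outside_compact:
  fixes f :: "'a::euclidean_space \<Rightarrow> 'b::real_normed_vector"
  assumes "continuous_on UNIV f" "compact K" "\<And>x. x \<notin> K \<Longrightarrow> f x = 0"
  shows "\<exists>C\<ge>0. \<forall>x. norm (f x) \<le> C"
proof -
  have "bounded (f ` K)"
    by (intro compact_imp_bounded compact_continuous_image assms(2) continuous_on_subset[OF assms(1)]) auto
  then obtain C where C: "C > 0" "\<And>y. y \<in> f ` K \<Longrightarrow> norm y \<le> C" unfolding bounded_pos by blast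
  have "norm (f x) \<le> C" for x
  proof (cases "x \<in> K")
    case True
    then show ?thesis using C(2) by blast
  qed (use assms(3) C(1) in simp)
  then show ?thesis using C(1) by (intro exI[of _ C]) simp
qed

lemma test_function_derivative:
  fixes v :: "real^'n \<Rightarrow> real^'m"
  assumes v: "v \<in> test_functions U"
  obtains v' Kv B where "\<And>x. (v has_derivative v' x) (at x)" "\<And>h. continuous_on UNIV (\<lambda>x. v' x h)"
    "compact Kv" "Kv \<subseteq> U" "\<And>x. x \<notin> Kv \<Longrightarrow> v x = 0" "\<And>x h. x \<notin> Kv \<Longrightarrow> v' x h = 0"
    "B \<ge> 0" "\<And>x. norm (v x) \<le> B" "\<And>x j. norm (v' x (axis j 1)) \<le> B"
proof -
  have "Ck (Suc 0) v" using v unfolding test_functions_def by blast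
  then obtain v' where v': "\<And>x. (v has_derivative v' x) (at x)" "\<And>h. continuous_on UNIV (\<lambda>x. v' x h)" by auto
  define Kv where "Kv = closure {x. v x \<noteq> 0}"
  have Kv: "compact Kv" "Kv \<subseteq> U" using v unfolding test_functions_def Kv_def by blast+
  have v0: "v x = 0" if "x \<notin> Kv" for x using that closure_subset[of "{x. v x \<noteq> 0}"] unfolding Kv_def by auto
  have "closed Kv" using Kv(1) by (rule compact_imp_closed)
  note v'0 = derivative_zero_off_closed[OF v'(1) this v0]
  have vc: "continuous_on UNIV v"
    by (rule continuous_at_imp_continuous_on) (blast intro: has_derivative_continuous v'(1))
  obtain C where C: "C \<ge> 0" "\<And>x. norm (v x) \<le> C"
    using bounded_of_zero_outside_compact[OF vc Kv(1) v0] by blast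
  have "\<forall>j. \<exists>C\<ge>0. \<forall>x. norm (v' x (axis j 1)) \<le> C"
    by (intro allI bounded_of_zero_outside_compact[OF v'(2) Kv(1) v'0])
  then obtain Cj where "\<forall>j. Cj j \<ge> 0 \<and> (\<forall>x. norm (v' x (axis j 1)) \<le> Cj j)" by (rule choice[THEN exE])
  then have Cj: "\<And>j. Cj j \<ge> 0" "\<And>j x. norm (v' x (axis j 1)) \<le> Cj j" by blast+
  define B where "B = C + (\<Sum>j\<in>UNIV. Cj j)"
  have s: "(\<Sum>j\<in>UNIV. Cj j) \<ge> 0" by (intro sum_nonneg Cj(1))
  have "norm (v' x (axis j 1)) \<le> B" for x j
  proof -
    have "Cj j \<le> (\<Sum>j\<in>UNIV. Cj j)" by (rule member_le_sum) (use Cj(1) in auto)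
    then show ?thesis using Cj(2)[of x j] C(1) unfolding B_def by linarith
  qed
  moreover have "norm (v x) \<le> B" for x using C(2)[of x] s unfolding B_def by linarith
  moreover have "B \<ge> 0" using C(1) s unfolding B_def by linarith
  ultimately show thesis by (intro that[OF v' Kv v0 v'0])
qed

theorem proposition7p3:
  fixes L1 L2 \<epsilon> t K :: real
    and n :: "real^3 \<Rightarrow> real^3"
    and U :: "(real^3) set"
    and D :: "(real^2) set"
    and \<phi> :: "real^2 \<Rightarrow> real"
  assumes "L1 > 0" and "L2 > 0" and "\<epsilon> > 0" and "K > 0"
    and "n \<in> admissible L1 L2 \<epsilon>"
    and "\<forall>m \<in> admissible L1 L2 \<epsilon>. energy L1 L2 \<epsilon> t K n \<le> energy L1 L2 \<epsilon> t K m"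
    and "open U" and "compact (closure U)" and "closure U \<subseteq> domain L1 L2"
    and "open D" and "C1_on D \<phi>"
    and "closure (approx_disc_set (extended_domain L1 L2 \<epsilon>) n) \<inter> U
           = (\<lambda>z. vector [z $ 1, z $ 2, \<phi> z]) ` D"
  shows "\<forall>v \<in> test_functions U.
    has_bochner_integral
      (lebesgue_on (U - closure (approx_disc_set (extended_domain L1 L2 \<epsilon>) n)))
      (\<lambda>x. jacobian v (at x) \<bullet> approx_gradient n x
         + t * (v x \<bullet> curl_of (approx_gradient n x) + n x \<bullet> curl_of (jacobian v (at x)))
         - (n x \<bullet> v x) * ((norm (approx_gradient n x))\<^sup>2
                            + 2 * t * (n x \<bullet> curl_of (approx_gradient n x))))
      0"
proof
  fix v :: "real^3 \<Rightarrow> real^3"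
  assume v: "v \<in> test_functions U"
  define \<Omega> where "\<Omega> = extended_domain L1 L2 \<epsilon>"
  define \<Omega>0 where "\<Omega>0 = domain L1 L2"
  define S where "S = approx_disc_set \<Omega> n"
  have \<Omega>: "open \<Omega>" "emeasure lborel \<Omega> < \<infinity>" and \<Omega>0: "open \<Omega>0" and sub: "\<Omega>0 \<subseteq> \<Omega>"
    using emeasure_lborel_box_finite[of "vector [- L1, - L2, - \<epsilon>] :: real^3" "vector [L1, L2, 1 + \<epsilon>]"] \<open>\<epsilon> > 0\<close>
    unfolding \<Omega>_def \<Omega>0_def by (simp_all add: slab_eq_box open_box) (auto simp: mem_box_cart forall_3)
  have U\<Omega>0: "U \<subseteq> \<Omega>0" using assms(9) closure_subset[of U] unfolding \<Omega>0_def by blast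
  have nS: "n \<in> SBV2 \<Omega>" and nae: "AE x in lebesgue. x \<in> \<Omega> \<longrightarrow> n x \<in> sphere 0 1 \<union> {0} \<and>
       (x $ 3 < 0 \<longrightarrow> n x = axis 1 1) \<and> (x $ 3 > 1 \<longrightarrow> n x = axis 3 1)"
    using assms(5) unfolding admissible_def \<Omega>_def by blast+
  have nSBV: "n \<in> SBV \<Omega>" and nG: "set_borel_measurable lebesgue \<Omega> (approx_gradient n)"
    "set_integrable lebesgue \<Omega> (\<lambda>x. (norm (approx_gradient n x))\<^sup>2)" and nH: "hausdorff_measure (CARD(3) - 1) S < \<infinity>"
    using nS unfolding SBV2_def S_def by blast+
  have ni: "set_integrable lebesgue \<Omega> n" using nSBV unfolding SBV_def BV_def by blast
  have nae1: "AE x in lebesgue. x \<in> \<Omega> \<longrightarrow> n x \<in> sphere 0 1 \<union> {0}" using nae by eventually_elim blast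
  \<comment> \<open>From here on \<open>n\<close> is replaced by a Borel representative with values
    in the sphere and 0 at every point; on \<open>\<Omega>\<close> the discontinuity set and the
    approximate gradient are unchanged.\<close>
  obtain u where um [measurable]: "u \<in> borel_measurable borel" and us: "\<And>y. norm (u y) = 1 \<or> u y = 0"
    and u0: "\<And>y. y \<notin> \<Omega> \<Longrightarrow> u y = 0" and uae: "AE y in lebesgue. y \<in> \<Omega> \<longrightarrow> n y = u y"
    using sphere_valued_borel_representative[OF ni \<Omega>(1) nae1] by blast
  have u1: "norm (u y) \<le> 1" for y using us[of y] by auto
  have Su: "S = approx_disc_set \<Omega> u" unfolding S_def by (rule approx_disc_set_cong_AE[OF \<Omega>(1) uae um])
  have Gu: "approx_gradient n x = approx_gradient u x" if "x \<in> \<Omega>" for x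
    by (rule approx_gradient_cong_AE[OF \<Omega>(1) that uae um])
  have ui: "integrable lborel u"
  proof (rule integrableI_bounded_set[where A = \<Omega> and B = 1])
    show "\<Omega> \<in> sets lborel" using \<Omega>(1) by simp
    show "emeasure lborel \<Omega> < \<infinity>" by (rule \<Omega>(2))
  qed (use u1 u0 in auto)
  have sbv: "\<exists>g \<sigma> \<tau>. weak_deriv_repr \<Omega> (\<lambda>x. u x $ i) j g \<sigma> \<tau> \<and>
       (\<forall>B\<in>sets borel. B \<subseteq> \<Omega> - approx_disc_set \<Omega> u \<longrightarrow> measure \<sigma> B = measure \<tau> B)" for i j
  proof -
    obtain g \<sigma> \<tau> where R: "weak_deriv_repr \<Omega> (\<lambda>x. n x $ i) j g \<sigma> \<tau>"
      and eq: "\<And>B. B \<in> sets borel \<Longrightarrow> B \<subseteq> \<Omega> - S \<Longrightarrow> measure \<sigma> B = measure \<tau> B"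
      using SBV_weak_deriv_repr[OF nSBV \<Omega>(1)] unfolding S_def by blast
    have "AE x in lebesgue. x \<in> \<Omega> \<longrightarrow> n x $ i = u x $ i" using uae by eventually_elim simp
    from weak_deriv_repr_cong_AE[OF R \<Omega>(1) this] have "weak_deriv_repr \<Omega> (\<lambda>x. u x $ i) j g \<sigma> \<tau>" by simp
    then show ?thesis using eq unfolding Su by blast
  qed
  obtain v' Kv B where v': "\<And>x. (v has_derivative v' x) (at x)" "\<And>h. continuous_on UNIV (\<lambda>x. v' x h)"
    and Kv: "compact Kv" "Kv \<subseteq> U" and v0: "\<And>x. x \<notin> Kv \<Longrightarrow> v x = 0" and v'0: "\<And>x h. x \<notin> Kv \<Longrightarrow> v' x h = 0"
    and B: "B \<ge> 0" "\<And>x. norm (v x) \<le> B" "\<And>x j. norm (v' x (axis j 1)) \<le> B"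
    by (rule test_function_derivative[OF v]) blast
  \<comment> \<open>On the sphere the derivative of \<open>mob a p\<close> in \<open>a\<close> at 0
    is twice the tangential projection; the half compensates this.\<close>
  define b where "b x = (1 / 2) *\<^sub>R v x" for x
  define b' where "b' x h = (1 / 2) *\<^sub>R v' x h" for x h
  \<comment> \<open>\<open>B + 1\<close> in place of \<open>B\<close> avoids a division by zero and
    ensures \<open>s0 \<le> 1\<close>.\<close>
  define s0 where "s0 = 1 / (2 * (B + 1))"
  have s0: "0 < s0" "s0 \<le> 1" "s0 * B \<le> 1 / 2" using B(1) by (auto simp: s0_def field_simps)
  obtain Km where Km: "Km > 0"
    "\<And>a p :: real^3. norm a \<le> 1 / 2 \<Longrightarrow> norm p \<le> 1 \<Longrightarrow> norm (mob a p) \<le> Km"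
    "\<And>a p a' p' :: real^3. norm a \<le> 1 / 2 \<Longrightarrow> norm p \<le> 1 \<Longrightarrow> norm (mob' a p a' p') \<le> Km * (norm a' + norm p')"
    "\<And>s (b :: real^3) p. \<bar>s\<bar> * B \<le> 1 / 2 \<Longrightarrow> \<bar>s\<bar> \<le> 1 \<Longrightarrow> norm b \<le> B \<Longrightarrow> norm p \<le> 1 \<Longrightarrow> norm (mobX s b p) \<le> Km"
    "\<And>s (b :: real^3) p b' p'. \<bar>s\<bar> * B \<le> 1 / 2 \<Longrightarrow> \<bar>s\<bar> \<le> 1 \<Longrightarrow> norm b \<le> B \<Longrightarrow> norm p \<le> 1 \<Longrightarrow>
        norm (mobY s b p b' p') \<le> Km * (norm b' + norm p')"
    by (rule mob_bounds[OF B(1), where 'm = 3]) blast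
  interpret variation \<Omega> u b b' B s0 Km
  proof (unfold_locales; (rule \<Omega> ui us u0 s0 Km sbv B; assumption)?)
    show "(b has_derivative b' x) (at x)" for x
      unfolding b_def b'_def by (rule has_derivative_scaleR_right[OF v'(1)])
    show "continuous_on UNIV (\<lambda>x. b' x h)" for h
      unfolding b'_def by (intro continuous_intros v'(2))
    show "norm (b x) \<le> B" for x unfolding b_def using B(1) B(2)[of x] by simp
    show "norm (b' x (axis j 1)) \<le> B" for x j unfolding b'_def using B(1) B(3)[of x j] by simp
  qed
  define G where "G = approx_gradient u"
  have negl: "U \<inter> closure S \<in> null_sets lebesgue"
    using negligible_C1_graph[OF assms(11)] assms(12) unfolding S_def \<Omega>_def
    by (simp add: negligible_iff_null_sets Int_commute)
  \<comment> \<open>Open and disjoint from \<open>S\<close>, so that the singular parts of the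
    derivative of \<open>u\<close> cancel on it.\<close>
  define A where "A = U - closure S"
  have A: "open A" "A \<subseteq> \<Omega>" "A \<subseteq> \<Omega>0" "A \<inter> S = {}"
    unfolding A_def using \<open>open U\<close> U\<Omega>0 sub closure_subset[of S] by (auto intro: open_Diff)
  obtain g \<sigma> \<tau> where R: "\<And>l j. weak_deriv_repr \<Omega> (\<lambda>x. u x $ l) j (g l j) (\<sigma> l j) (\<tau> l j)"
    and Req: "\<And>l j B. B \<in> sets borel \<Longrightarrow> B \<subseteq> \<Omega> - S \<Longrightarrow> measure (\<sigma> l j) B = measure (\<tau> l j) B"
    using sbv unfolding Su[symmetric] by metis
  have goodA: "AE x in lebesgue. x \<in> A \<longrightarrow> (\<exists>G. has_approx_limit u x (u x) \<and>
      ((\<lambda>r. ball_average (\<lambda>y. norm (u y - u x - G *v (y - x)) / r) x r) \<longlongrightarrow> 0) (at_right 0))"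
  proof (rule AE_completion, rule AE_has_approx_gradient[OF \<Omega>(1) A(1,2) ui u1 u0 R])
    show "measure (\<sigma> l j) B = measure (\<tau> l j) B" if "B \<in> sets borel" "B \<subseteq> A" for l j B
      by (rule Req[OF that(1)]) (use that(2) A in blast)
  qed
  have notnull: "AE x in lebesgue. x \<notin> U \<inter> closure S" by (rule AE_not_in[OF negl])
  \<comment> \<open>Almost every point of the support \<open>Kv\<close> lies in \<open>A\<close>,
    where the pointwise chain rule applies; off \<open>Kv\<close> the identity is exact.\<close>
  have Gw: "AE x in lebesgue. x \<in> \<Omega> \<longrightarrow> approx_gradient (w s) x = G x + s *\<^sub>R Y s x" if s: "\<bar>s\<bar> \<le> s0" for s
    using goodA notnull
  proof eventually_elim
    case (elim x)
    show ?case
    proof (cases "x \<in> Kv")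
      case True
      then have "x \<in> A" using elim(2) Kv(2) by (auto simp: A_def)
      then show ?thesis using elim(1) approx_gradient_w(2)[OF s] unfolding G_def by blast
    next
      case False
      then show ?thesis
        unfolding G_def
        using approx_gradient_w_outside[OF s compact_imp_closed[OF Kv(1)], of x] v0 by (simp add: b_def)
    qed
  qed
  \<comment> \<open>Measurability and square integrability of the gradient are available on
    \<open>\<Omega>\<close> only, hence the truncation.\<close>
  define GI where "GI x = indicator \<Omega> x *\<^sub>R G x" for x
  define YI where "YI s x = indicator \<Omega> x *\<^sub>R Y s x" for s x
  have GIm [measurable]: "GI \<in> borel_measurable lebesgue"
  proof -
    have "(\<lambda>x. indicator \<Omega> x *\<^sub>R approx_gradient n x) = GI"
      unfolding GI_def G_def using Gu by (auto simp: indicator_def fun_eq_iff)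
    then show ?thesis using nG(1) unfolding set_borel_measurable_def by simp
  qed
  have YIm [measurable]: "YI s \<in> borel_measurable lebesgue" for s
    unfolding YI_def by (rule Y_measurable) (use GIm in \<open>simp add: set_borel_measurable_def GI_def[abs_def] G_def\<close>)
  have XIm [measurable]: "X s \<in> borel_measurable lebesgue" if "\<bar>s\<bar> \<le> s0" for s
    using X_measurable[OF that] by (auto intro: measurable_completion)
  have uL [measurable]: "u \<in> borel_measurable lebesgue" by (rule measurable_completion) (use um in simp)
  have G2: "integrable lebesgue (\<lambda>x. (norm (GI x))\<^sup>2)"
  proof -
    have "(\<lambda>x. indicator \<Omega> x *\<^sub>R (norm (approx_gradient n x))\<^sup>2) = (\<lambda>x. (norm (GI x))\<^sup>2)"
      unfolding GI_def G_def using Gu by (auto simp: indicator_def fun_eq_iff)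
    then show ?thesis using nG(2) unfolding set_integrable_def by simp
  qed
  have ind\<Omega>: "integrable lebesgue (indicator \<Omega> :: _ \<Rightarrow> real)"
    using \<Omega> by (intro integrable_real_indicator) (auto simp: emeasure_completion)
  \<comment> \<open>Up to constants this is the integrable majorant of all integrands below,
    uniformly in \<open>s\<close>; the indicator, integrable as \<open>\<Omega>\<close> has finite
    measure, takes care of the bounded terms.\<close>
  define Q where "Q x = indicator \<Omega> x + (norm (GI x))\<^sup>2" for x
  have Qi: "integrable lebesgue Q" unfolding Q_def by (intro Bochner_Integration.integrable_add ind\<Omega> G2)
  have Qn: "Q x \<ge> 0" for x unfolding Q_def by (simp add: indicator_def)
  \<comment> \<open>The 3 is the dimension in \<open>Y_bound\<close>; \<open>B + 1\<close> dominates
    both \<open>B\<close> and 1.\<close>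
  define M where "M = 3 * Km * (B + 1)"
  have M: "M > 0" using Km(1) B(1) by (simp add: M_def)
  have YIb: "norm (YI s x) \<le> M * (indicator \<Omega> x + norm (GI x))" if s: "\<bar>s\<bar> \<le> s0" for s x
  proof (cases "x \<in> \<Omega>")
    case True
    have "norm (Y s x) \<le> 3 * Km * (B + norm (G x))" using Y_bound[OF s, of x] by (simp add: G_def)
    also have "\<dots> \<le> 3 * Km * ((B + 1) * (1 + norm (G x)))"
      using Km(1) B(1) by (intro mult_left_mono) (auto simp: algebra_simps)
    finally show ?thesis using True by (simp add: YI_def GI_def M_def mult.assoc)
  qed (simp add: YI_def GI_def)
  have sq: "(indicator \<Omega> x + norm (GI x))\<^sup>2 \<le> 2 * Q x" for x
  proof -
    have "(indicator \<Omega> x + norm (GI x))\<^sup>2 \<le> 2 * ((indicator \<Omega> x)\<^sup>2 + (norm (GI x))\<^sup>2)"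
      using sum_squares_bound[of "indicator \<Omega> x :: real" "norm (GI x)"] by (simp add: power2_sum)
    then show ?thesis by (cases "x \<in> \<Omega>") (simp_all add: Q_def)
  qed
  have adm: "w s \<in> admissible L1 L2 \<epsilon>" if s: "\<bar>s\<bar> \<le> s0" for s
  proof -
    have wG: "AE x in lebesgue. GI x + s *\<^sub>R YI s x = indicator \<Omega> x *\<^sub>R approx_gradient (w s) x"
      using Gw[OF s] by eventually_elim (auto simp: GI_def YI_def indicator_def)
    have m: "(\<lambda>x. GI x + s *\<^sub>R YI s x) \<in> borel_measurable lebesgue" by measurable
    have m1: "(\<lambda>x. indicator \<Omega> x *\<^sub>R approx_gradient (w s) x) \<in> borel_measurable lebesgue"
      by (rule borel_measurable_AE[OF m wG])
    have i2: "set_integrable lebesgue \<Omega> (\<lambda>x. (norm (approx_gradient (w s) x))\<^sup>2)"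
      unfolding set_integrable_def
    proof (rule Bochner_Integration.integrable_bound)
      show "integrable lebesgue (\<lambda>x. (1 + M)\<^sup>2 * (2 * Q x))" using Qi by simp
      have eq: "indicator \<Omega> x *\<^sub>R (norm (approx_gradient (w s) x))\<^sup>2 = (norm (indicator \<Omega> x *\<^sub>R approx_gradient (w s) x))\<^sup>2" for x
        by (simp add: indicator_def)
      show "(\<lambda>x. indicator \<Omega> x *\<^sub>R (norm (approx_gradient (w s) x))\<^sup>2) \<in> borel_measurable lebesgue"
        unfolding eq using m1 by measurable
      show "AE x in lebesgue. norm (indicator \<Omega> x *\<^sub>R (norm (approx_gradient (w s) x))\<^sup>2) \<le> norm ((1 + M)\<^sup>2 * (2 * Q x))"
        using wG
      proof eventually_elim
        case (elim x)
        have "norm (GI x + s *\<^sub>R YI s x) \<le> norm (GI x) + \<bar>s\<bar> * norm (YI s x)"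
          using norm_triangle_ineq[of "GI x" "s *\<^sub>R YI s x"] by simp
        also have "\<dots> \<le> (indicator \<Omega> x + norm (GI x)) + 1 * (M * (indicator \<Omega> x + norm (GI x)))"
          using s s0 YIb[OF s, of x] by (intro add_mono mult_mono) (auto simp: indicator_def)
        finally have "norm (GI x + s *\<^sub>R YI s x) \<le> (1 + M) * (indicator \<Omega> x + norm (GI x))" by (simp add: distrib_right)
        then have "(norm (GI x + s *\<^sub>R YI s x))\<^sup>2 \<le> ((1 + M) * (indicator \<Omega> x + norm (GI x)))\<^sup>2" by (intro power_mono) auto
        also have "\<dots> = (1 + M)\<^sup>2 * (indicator \<Omega> x + norm (GI x))\<^sup>2" by (rule power_mult_distrib)
        also have "\<dots> \<le> (1 + M)\<^sup>2 * (2 * Q x)" by (intro mult_left_mono sq) simp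
        finally show ?case unfolding eq elim[symmetric] using Qn[of x] by simp
      qed
    qed
    have "w s \<in> SBV2 \<Omega>"
      unfolding SBV2_def using w_SBV[OF s] m1 i2 nH approx_disc_set_w[OF s] Su
      by (simp add: set_borel_measurable_def)
    moreover have "AE x in lebesgue. x \<in> \<Omega> \<longrightarrow> w s x \<in> sphere 0 1 \<union> {0} \<and>
       (x $ 3 < 0 \<longrightarrow> w s x = axis 1 1) \<and> (x $ 3 > 1 \<longrightarrow> w s x = axis 3 1)"
      using nae uae
    proof eventually_elim
      case (elim x)
      \<comment> \<open>The boundary layers are untouched because the support of \<open>v\<close>
        lies in \<open>\<Omega>0\<close>.\<close>
      have out: "w s x = u x" if "x $ 3 < 0 \<or> x $ 3 > 1"
      proof -
        have "x \<notin> \<Omega>0" using that by (auto simp: \<Omega>0_def slab_def)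
        then have "x \<notin> Kv" using Kv(2) U\<Omega>0 by blast
        then show ?thesis by (simp add: w_def b_def v0)
      qed
      show ?case using elim out w_sphere[OF s, of x] by auto
    qed
    ultimately show ?thesis unfolding admissible_def \<Omega>_def by simp
  qed
  \<comment> \<open>Inserting u + s X for the values and G + s Y for the gradient, the energy
    integrand of \<open>w s\<close> becomes \<open>e0 x + s * q s x\<close>. Thus \<open>q s\<close>
    is its difference quotient, defined also at \<open>s = 0\<close>.\<close>
  define q where "q s x = 2 * (GI x \<bullet> YI s x) + s * (norm (YI s x))\<^sup>2
      + 2 * t * (X s x \<bullet> curl_of (GI x) + u x \<bullet> curl_of (YI s x) + s * (X s x \<bullet> curl_of (YI s x)))" for s x
  define e0 where "e0 x = (norm (GI x))\<^sup>2 + 2 * t * (u x \<bullet> curl_of (GI x)) + t\<^sup>2 * (norm (u x))\<^sup>2" for x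
  obtain c where c: "c > 0" "\<And>A. norm (curl_of A) \<le> norm A * c" using bounded_linear.pos_bounded[OF bounded_linear_curl_of] by blast
  have cb: "norm (curl_of A) \<le> c * z" if "norm A \<le> z" for A z
    using c(2)[of A] mult_right_mono[OF that, of c] c(1) by (simp only: mult.commute[of c]) linarith
  have curlm: "curl_of \<in> borel_measurable borel"
    by (intro borel_measurable_continuous_onI linear_continuous_on bounded_linear_curl_of)
  have cGm [measurable]: "(\<lambda>x. curl_of (GI x)) \<in> borel_measurable lebesgue" by (rule measurable_compose[OF GIm curlm])
  have cYm [measurable]: "(\<lambda>x. curl_of (YI s x)) \<in> borel_measurable lebesgue" for s by (rule measurable_compose[OF YIm curlm])
  define P where "P = (2 + M) * M + 2 * \<bar>t\<bar> * (Km * c + c * M + Km * (c * M))"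
  have qb: "\<bar>q s x\<bar> \<le> P * (2 * Q x)" if s: "\<bar>s\<bar> \<le> s0" for s x
  proof -
    define y where "y = indicator \<Omega> x + norm (GI x)"
    have y: "y \<ge> 0" "norm (GI x) \<le> y" "norm (YI s x) \<le> M * y" using YIb[OF s, of x] by (auto simp: y_def)
    \<comment> \<open>\<open>y\<close> is 0 off \<open>\<Omega>\<close> and at least 1 on it, so
      terms linear in \<open>y\<close> are absorbed by quadratic ones.\<close>
    have yy: "y \<le> y\<^sup>2"
    proof (cases "x \<in> \<Omega>")
      case True
      then have "y \<ge> 1" by (simp add: y_def)
      then show ?thesis by (simp add: power2_eq_square)
    qed (simp add: y_def GI_def)
    have s1: "\<bar>s\<bar> \<le> 1" using s s0 by simp
    have a1: "\<bar>2 * (GI x \<bullet> YI s x)\<bar> \<le> 2 * (y * (M * y))"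
      using Cauchy_Schwarz_ineq2[of "GI x" "YI s x"] mult_mono[OF y(2,3) y(1)] by simp
    have a2: "\<bar>s * (norm (YI s x))\<^sup>2\<bar> \<le> 1 * (M * y)\<^sup>2"
      unfolding abs_mult using s1 y(3) by (intro mult_mono) (auto intro: power_mono)
    have cu: "norm (curl_of (GI x)) \<le> c * y" "norm (curl_of (YI s x)) \<le> c * (M * y)" by (intro cb y(2,3))+
    have a3: "\<bar>X s x \<bullet> curl_of (GI x)\<bar> \<le> Km * (c * y)"
      using Cauchy_Schwarz_ineq2[of "X s x" "curl_of (GI x)"] mult_mono[OF X_bound[OF s, of x] cu(1)] Km(1) by simp
    have a4: "\<bar>u x \<bullet> curl_of (YI s x)\<bar> \<le> 1 * (c * (M * y))"
      using Cauchy_Schwarz_ineq2[of "u x" "curl_of (YI s x)"] mult_mono[OF u1[of x] cu(2)] by simp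
    have a5: "\<bar>s * (X s x \<bullet> curl_of (YI s x))\<bar> \<le> 1 * (Km * (c * (M * y)))"
    proof -
      have "\<bar>X s x \<bullet> curl_of (YI s x)\<bar> \<le> Km * (c * (M * y))"
        using Cauchy_Schwarz_ineq2[of "X s x" "curl_of (YI s x)"] mult_mono[OF X_bound[OF s, of x] cu(2)] Km(1) by simp
      then show ?thesis unfolding abs_mult using s1 by (intro mult_mono) auto
    qed
    have "\<bar>q s x\<bar> \<le> \<bar>2 * (GI x \<bullet> YI s x)\<bar> + \<bar>s * (norm (YI s x))\<^sup>2\<bar>
      + 2 * \<bar>t\<bar> * (\<bar>X s x \<bullet> curl_of (GI x)\<bar> + \<bar>u x \<bullet> curl_of (YI s x)\<bar> + \<bar>s * (X s x \<bullet> curl_of (YI s x))\<bar>)"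
    proof -
      have tri: "\<bar>X s x \<bullet> curl_of (GI x) + u x \<bullet> curl_of (YI s x) + s * (X s x \<bullet> curl_of (YI s x))\<bar>
        \<le> \<bar>X s x \<bullet> curl_of (GI x)\<bar> + \<bar>u x \<bullet> curl_of (YI s x)\<bar> + \<bar>s * (X s x \<bullet> curl_of (YI s x))\<bar>" by linarith
      have "\<bar>2 * t * (X s x \<bullet> curl_of (GI x) + u x \<bullet> curl_of (YI s x) + s * (X s x \<bullet> curl_of (YI s x)))\<bar>
        \<le> 2 * \<bar>t\<bar> * (\<bar>X s x \<bullet> curl_of (GI x)\<bar> + \<bar>u x \<bullet> curl_of (YI s x)\<bar> + \<bar>s * (X s x \<bullet> curl_of (YI s x))\<bar>)"
        using mult_left_mono[OF tri, of "2 * \<bar>t\<bar>"] by (simp add: abs_mult)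
      then show ?thesis unfolding q_def by linarith
    qed
    also have "\<dots> \<le> 2 * (y * (M * y)) + 1 * (M * y)\<^sup>2 + 2 * \<bar>t\<bar> * (Km * (c * y) + 1 * (c * (M * y)) + 1 * (Km * (c * (M * y))))"
      by (intro add_mono mult_left_mono a1 a2 a3 a4 a5) simp
    also have "\<dots> = (2 + M) * M * y\<^sup>2 + 2 * \<bar>t\<bar> * (Km * c + c * M + Km * (c * M)) * y"
      by (simp add: power2_eq_square algebra_simps)
    also have "\<dots> \<le> (2 + M) * M * y\<^sup>2 + 2 * \<bar>t\<bar> * (Km * c + c * M + Km * (c * M)) * y\<^sup>2"
      using Km(1) c(1) M by (intro add_left_mono mult_left_mono yy) simp
    also have "\<dots> = P * y\<^sup>2" by (simp add: P_def algebra_simps)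
    also have "\<dots> \<le> P * (2 * Q x)"
    proof (rule mult_left_mono)
      show "y\<^sup>2 \<le> 2 * Q x" using sq[of x] by (simp add: y_def)
      show "P \<ge> 0" using Km(1) c(1) M by (simp add: P_def)
    qed
    finally show ?thesis .
  qed
  have qm: "q s \<in> borel_measurable lebesgue" if s: "\<bar>s\<bar> \<le> s0" for s
    unfolding q_def using XIm[OF s] by measurable
  have \<Omega>0s: "\<Omega>0 \<in> sets lebesgue" using \<Omega>0 by auto
  have PQ: "integrable lebesgue (\<lambda>x. P * (2 * Q x))" using Qi by simp
  have qi: "integrable lebesgue (\<lambda>x. indicator \<Omega>0 x *\<^sub>R q s x)" if s: "\<bar>s\<bar> \<le> s0" for s
    by (rule integrable_mult_indicator[OF \<Omega>0s Bochner_Integration.integrable_bound[OF PQ qm[OF s]]])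
      (use qb[OF s] order_trans[OF _ abs_ge_self] in auto)
  have e0i: "integrable lebesgue (\<lambda>x. indicator \<Omega>0 x *\<^sub>R e0 x)"
  proof (rule Bochner_Integration.integrable_bound)
    let ?C = "1 + 2 * \<bar>t\<bar> * c + t\<^sup>2"
    show "integrable lebesgue (\<lambda>x. ?C * (2 * Q x))" using Qi by simp
    have "e0 \<in> borel_measurable lebesgue" unfolding e0_def by measurable
    then show "(\<lambda>x. indicator \<Omega>0 x *\<^sub>R e0 x) \<in> borel_measurable lebesgue"
      using \<Omega>0s by (intro borel_measurable_scaleR borel_measurable_indicator)
    have "\<bar>indicator \<Omega>0 x *\<^sub>R e0 x\<bar> \<le> ?C * (2 * Q x)" for x
    proof (cases "x \<in> \<Omega>0")
      case True
      then have x: "x \<in> \<Omega>" using sub by blast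
      define y where "y = 1 + norm (GI x)"
      have y: "y \<ge> 1" "norm (GI x) \<le> y" by (simp_all add: y_def)
      have yy: "y \<le> y\<^sup>2" "1 \<le> y\<^sup>2" using y(1) mult_mono[OF y(1) y(1)] by (simp_all add: power2_eq_square)
      have a1: "(norm (GI x))\<^sup>2 \<le> y\<^sup>2" using y by (intro power_mono) auto
      have "\<bar>u x \<bullet> curl_of (GI x)\<bar> \<le> 1 * (c * y)"
      proof -
        have "norm (curl_of (GI x)) \<le> c * y" by (rule cb[OF y(2)])
        then show ?thesis
          using Cauchy_Schwarz_ineq2[of "u x" "curl_of (GI x)"] mult_mono[OF u1[of x], of "norm (curl_of (GI x))" "c * y"] by simp
      qed
      with mult_left_mono[OF yy(1) less_imp_le[OF c(1)]] have a2: "\<bar>u x \<bullet> curl_of (GI x)\<bar> \<le> c * y\<^sup>2" by linarith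
      have a3: "(norm (u x))\<^sup>2 \<le> y\<^sup>2" using u1[of x] y(1) by (intro power_mono) auto
      have "\<bar>e0 x\<bar> \<le> (norm (GI x))\<^sup>2 + 2 * \<bar>t\<bar> * \<bar>u x \<bullet> curl_of (GI x)\<bar> + t\<^sup>2 * (norm (u x))\<^sup>2"
      proof -
        have "\<bar>2 * t * (u x \<bullet> curl_of (GI x))\<bar> = 2 * \<bar>t\<bar> * \<bar>u x \<bullet> curl_of (GI x)\<bar>" by (simp add: abs_mult)
        moreover have "t\<^sup>2 * (norm (u x))\<^sup>2 \<ge> 0" "(norm (GI x))\<^sup>2 \<ge> 0" by simp_all
        ultimately show ?thesis unfolding e0_def by linarith
      qed
      also have "\<dots> \<le> y\<^sup>2 + 2 * \<bar>t\<bar> * (c * y\<^sup>2) + t\<^sup>2 * y\<^sup>2" by (intro add_mono mult_left_mono a1 a2 a3) auto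
      also have "\<dots> = ?C * y\<^sup>2" by (simp add: algebra_simps)
      also have "\<dots> \<le> ?C * (2 * Q x)"
        using sq[of x] x c(1) by (intro mult_left_mono) (auto simp: y_def)
      finally show ?thesis using True by simp
    next
      case False
      then show ?thesis using Qn[of x] c(1) by simp
    qed
    then show "AE x in lebesgue. norm (indicator \<Omega>0 x *\<^sub>R e0 x) \<le> norm (?C * (2 * Q x))"
      by (intro AE_I2) (metis abs_ge_self order_trans real_norm_def)
  qed
  define Hs where "Hs = K * enn2real (hausdorff_measure 2 S)"
  have en: "energy L1 L2 \<epsilon> t K n = (LINT x|lebesgue. indicator \<Omega>0 x *\<^sub>R e0 x) + Hs"
  proof -
    have "(LINT x:\<Omega>0|lebesgue. (norm (approx_gradient n x))\<^sup>2 + 2 * t * (n x \<bullet> curl_of (approx_gradient n x)) + t\<^sup>2 * (norm (n x))\<^sup>2)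
        = (LINT x|lebesgue. indicator \<Omega>0 x *\<^sub>R e0 x)"
      unfolding set_lebesgue_integral_def
    proof (rule integral_cong_AE)
      have ae: "AE x in lebesgue. indicator \<Omega>0 x *\<^sub>R e0 x = indicator \<Omega>0 x *\<^sub>R
          ((norm (approx_gradient n x))\<^sup>2 + 2 * t * (n x \<bullet> curl_of (approx_gradient n x)) + t\<^sup>2 * (norm (n x))\<^sup>2)"
        using uae
      proof eventually_elim
        case (elim x)
        show ?case
        proof (cases "x \<in> \<Omega>0")
          case True
          then have "x \<in> \<Omega>" using sub by blast
          then show ?thesis using elim Gu by (simp add: e0_def GI_def G_def)
        qed simp
      qed
      show m: "(\<lambda>x. indicator \<Omega>0 x *\<^sub>R e0 x) \<in> borel_measurable lebesgue" using e0i by (rule borel_measurable_integrable)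
      show "(\<lambda>x. indicator \<Omega>0 x *\<^sub>R ((norm (approx_gradient n x))\<^sup>2 + 2 * t * (n x \<bullet> curl_of (approx_gradient n x)) + t\<^sup>2 * (norm (n x))\<^sup>2)) \<in> borel_measurable lebesgue"
        by (rule borel_measurable_AE[OF m ae])
      show "AE x in lebesgue. indicator \<Omega>0 x *\<^sub>R ((norm (approx_gradient n x))\<^sup>2 + 2 * t * (n x \<bullet> curl_of (approx_gradient n x)) + t\<^sup>2 * (norm (n x))\<^sup>2)
         = indicator \<Omega>0 x *\<^sub>R e0 x" using ae by eventually_elim (rule sym)
    qed
    then show ?thesis unfolding energy_def \<Omega>0_def[symmetric] \<Omega>_def[symmetric] S_def[symmetric] Hs_def by simp
  qed
  have ew: "energy L1 L2 \<epsilon> t K (w s) = (LINT x|lebesgue. indicator \<Omega>0 x *\<^sub>R e0 x + s * (indicator \<Omega>0 x *\<^sub>R q s x)) + Hs"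
    if s: "\<bar>s\<bar> \<le> s0" for s
  proof -
    let ?e = "\<lambda>x. (norm (approx_gradient (w s) x))\<^sup>2 + 2 * t * (w s x \<bullet> curl_of (approx_gradient (w s) x)) + t\<^sup>2 * (norm (w s x))\<^sup>2"
    have "(LINT x:\<Omega>0|lebesgue. ?e x) = (LINT x|lebesgue. indicator \<Omega>0 x *\<^sub>R e0 x + s * (indicator \<Omega>0 x *\<^sub>R q s x))"
      unfolding set_lebesgue_integral_def
    proof (rule integral_cong_AE)
      have ae: "AE x in lebesgue. indicator \<Omega>0 x *\<^sub>R e0 x + s * (indicator \<Omega>0 x *\<^sub>R q s x) = indicator \<Omega>0 x *\<^sub>R ?e x"
        using Gw[OF s]
      proof eventually_elim
        case (elim x)
        show ?case
        proof (cases "x \<in> \<Omega>0")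
          case True
          then have x: "x \<in> \<Omega>" using sub by blast
          then have 1: "approx_gradient (w s) x = GI x + s *\<^sub>R YI s x" using elim by (simp add: GI_def YI_def)
          have n2: "(norm (GI x + s *\<^sub>R YI s x))\<^sup>2 = (norm (GI x))\<^sup>2 + s * (2 * (GI x \<bullet> YI s x) + s * (norm (YI s x))\<^sup>2)"
            by (simp only: dot_square_norm[symmetric])
              (simp add: inner_add_left inner_add_right inner_commute[of "YI s x" "GI x"] algebra_simps)
          have n3: "w s x \<bullet> curl_of (GI x + s *\<^sub>R YI s x) = u x \<bullet> curl_of (GI x)
              + s * (X s x \<bullet> curl_of (GI x) + u x \<bullet> curl_of (YI s x) + s * (X s x \<bullet> curl_of (YI s x)))"
            unfolding w_X[OF s] curl_of_add curl_of_scaleR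
            by (simp add: inner_add_left inner_add_right algebra_simps)
          have "?e x = e0 x + s * q s x"
            unfolding 1 n2 n3 norm_w[OF s] e0_def q_def by (simp add: algebra_simps)
          then show ?thesis using True by simp
        qed simp
      qed
      show m: "(\<lambda>x. indicator \<Omega>0 x *\<^sub>R e0 x + s * (indicator \<Omega>0 x *\<^sub>R q s x)) \<in> borel_measurable lebesgue"
        by (intro borel_measurable_add borel_measurable_times borel_measurable_const borel_measurable_integrable[OF e0i] borel_measurable_integrable[OF qi[OF s]])
      show "(\<lambda>x. indicator \<Omega>0 x *\<^sub>R ?e x) \<in> borel_measurable lebesgue" by (rule borel_measurable_AE[OF m ae])
      show "AE x in lebesgue. indicator \<Omega>0 x *\<^sub>R ?e x = indicator \<Omega>0 x *\<^sub>R e0 x + s * (indicator \<Omega>0 x *\<^sub>R q s x)"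
        using ae by eventually_elim (rule sym)
    qed
    then show ?thesis
      unfolding energy_def \<Omega>0_def[symmetric] \<Omega>_def[symmetric] approx_disc_set_w[OF s] Su[symmetric] Hs_def by simp
  qed
  define I where "I s = (LINT x|lebesgue. indicator \<Omega>0 x *\<^sub>R q s x)" for s
  \<comment> \<open>The surface energies of \<open>n\<close> and \<open>w s\<close> are equal, so
    \<open>s * I s\<close> is the difference of the total energies. Minimality thus gives the sign
    of \<open>I s\<close> for either sign of \<open>s\<close>.\<close>
  have Ipos: "s * I s \<ge> 0" if s: "\<bar>s\<bar> \<le> s0" for s
  proof -
    have "energy L1 L2 \<epsilon> t K n \<le> energy L1 L2 \<epsilon> t K (w s)" using assms(6) adm[OF s] by blast
    moreover have "(LINT x|lebesgue. indicator \<Omega>0 x *\<^sub>R e0 x + s * (indicator \<Omega>0 x *\<^sub>R q s x)) = (LINT x|lebesgue. indicator \<Omega>0 x *\<^sub>R e0 x) + s * I s"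
      unfolding I_def by (subst Bochner_Integration.integral_add[OF e0i integrable_mult_right[OF qi[OF s]]]) simp
    ultimately show ?thesis unfolding en ew[OF s] by simp
  qed
  have Ilim: "(\<lambda>k. I (r k)) \<longlonglongrightarrow> I 0" if r: "filterlim r (at 0) sequentially" "\<And>k. \<bar>r k\<bar> \<le> s0" for r
    unfolding I_def
  proof (rule integral_dominated_convergence[where w = "\<lambda>x. P * (2 * Q x)"])
    show "(\<lambda>x. indicator \<Omega>0 x *\<^sub>R q (r k) x) \<in> borel_measurable lebesgue" for k
      by (rule borel_measurable_integrable[OF qi[OF r(2)]])
    show "(\<lambda>x. indicator \<Omega>0 x *\<^sub>R q 0 x) \<in> borel_measurable lebesgue"
      by (rule borel_measurable_integrable[OF qi]) (use s0 in simp)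
    show "integrable lebesgue (\<lambda>x. P * (2 * Q x))" by (rule PQ)
    show "AE x in lebesgue. norm (indicator \<Omega>0 x *\<^sub>R q (r k) x) \<le> P * (2 * Q x)" for k
    proof (rule AE_I2)
      fix x
      have "norm (indicator \<Omega>0 x *\<^sub>R q (r k) x) \<le> \<bar>q (r k) x\<bar>" by (simp add: indicator_def)
      then show "norm (indicator \<Omega>0 x *\<^sub>R q (r k) x) \<le> P * (2 * Q x)" using qb[OF r(2), of k x] by linarith
    qed
    show "AE x in lebesgue. (\<lambda>k. indicator \<Omega>0 x *\<^sub>R q (r k) x) \<longlonglongrightarrow> indicator \<Omega>0 x *\<^sub>R q 0 x"
    proof (rule AE_I2)
      fix x
      have r0: "r \<longlonglongrightarrow> 0" using r(1) by (simp add: filterlim_at)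
      have Xl: "(\<lambda>k. X (r k) x) \<longlonglongrightarrow> X 0 x" by (rule filterlim_compose[OF X_tendsto r(1)])
      have Yl: "(\<lambda>k. YI (r k) x) \<longlonglongrightarrow> YI 0 x" unfolding YI_def
        by (intro tendsto_scaleR tendsto_const filterlim_compose[OF Y_tendsto r(1)])
      have Cl: "(\<lambda>k. curl_of (YI (r k) x)) \<longlonglongrightarrow> curl_of (YI 0 x)" by (rule bounded_linear.tendsto[OF bounded_linear_curl_of Yl])
      show "(\<lambda>k. indicator \<Omega>0 x *\<^sub>R q (r k) x) \<longlonglongrightarrow> indicator \<Omega>0 x *\<^sub>R q 0 x"
        unfolding q_def
        by (intro tendsto_scaleR tendsto_const tendsto_add tendsto_mult tendsto_inner tendsto_power tendsto_norm Xl Yl Cl r0)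
    qed
  qed
  have I0: "I 0 = 0"
  proof -
    \<comment> \<open>The sequences \<open>r\<close> and \<open>- r\<close> approach 0 from the two
      sides without leaving the range of \<open>s0\<close>; \<open>I\<close> is nonnegative along
      the first and nonpositive along the second.\<close>
    define r where "r k = s0 / real (Suc k)" for k
    have r: "r k > 0" "\<bar>r k\<bar> \<le> s0" for k
      using s0(1) by (simp_all add: r_def divide_le_eq mult_le_cancel_left1)
    have rl: "r \<longlonglongrightarrow> 0" unfolding r_def using LIMSEQ_inverse_real_of_nat[THEN tendsto_mult_right, of s0]
      by (simp add: divide_inverse mult.commute)
    have f1: "filterlim r (at 0) sequentially" unfolding filterlim_at using rl r(1) by (simp add: less_imp_neq[symmetric])
    have rl': "(\<lambda>k. - r k) \<longlonglongrightarrow> 0" using tendsto_minus[OF rl] by simp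
    have f2: "filterlim (\<lambda>k. - r k) (at 0) sequentially" unfolding filterlim_at using rl' r(1) by (simp add: less_imp_neq[symmetric])
    have "I (r k) \<ge> 0" for k using Ipos[OF r(2)[of k]] r(1)[of k] by (simp add: zero_le_mult_iff)
    then have "I 0 \<ge> 0" by (intro LIMSEQ_le_const[OF Ilim[OF f1 r(2)]]) blast
    moreover have "I (- r k) \<le> 0" for k
      using Ipos[of "- r k"] r(2)[of k] r(1)[of k] by (simp add: mult_le_0_iff)
    then have "I 0 \<le> 0" using r(2) by (intro LIMSEQ_le_const2[OF Ilim[OF f2]]) auto
    ultimately show ?thesis by simp
  qed
  let ?T = "\<lambda>x. jacobian v (at x) \<bullet> approx_gradient n x
         + t * (v x \<bullet> curl_of (approx_gradient n x) + n x \<bullet> curl_of (jacobian v (at x)))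
         - (n x \<bullet> v x) * ((norm (approx_gradient n x))\<^sup>2
                            + 2 * t * (n x \<bullet> curl_of (approx_gradient n x)))"
  have Jv: "jacobian v (at x) *v h = v' x h" for x h
  proof -
    have "frechet_derivative v (at x) = v' x" using frechet_derivative_at[OF v'(1)] by simp
    then show ?thesis unfolding jacobian_def
      using matrix_of_bounded_linear[OF has_derivative_bounded_linear[OF v'(1)]] by simp
  qed
  \<comment> \<open>On \<open>A\<close> the first variation \<open>q 0\<close> is twice the
    integrand of the claim, whence the factor 1/2. Off \<open>A\<close> almost every point lies
    outside the support of \<open>v\<close>, where \<open>q 0\<close> vanishes.\<close>
  have ae: "AE x in lebesgue. (1 / 2) * (indicator \<Omega>0 x *\<^sub>R q 0 x) = indicator A x *\<^sub>R ?T x"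
    using goodA notnull uae
  proof eventually_elim
    case (elim x)
    show ?case
    proof (cases "x \<in> A")
      case True
      then have x: "x \<in> \<Omega>" "x \<in> \<Omega>0" using A by auto
      have nu: "n x = u x" using elim(3) x by blast
      have Gx: "approx_gradient n x = GI x" using x Gu by (simp add: GI_def G_def)
      have Yx: "YI 0 x = Y 0 x" using x by (simp add: YI_def)
      obtain G' where G': "has_approx_limit u x (u x)"
        "((\<lambda>r. ball_average (\<lambda>y. norm (u y - u x - G' *v (y - x)) / r) x r) \<longlongrightarrow> 0) (at_right 0)"
        using elim(1) True by blast
      have "G' = GI x" using approx_gradient_w(1)[OF _ G', of 0] s0 x by (simp add: GI_def G_def)
      note sph = approx_gradient_sphere_valued[OF um us G', unfolded this]
      have "2 * (GI x \<bullet> Y 0 x) + 2 * t * (X 0 x \<bullet> curl_of (GI x) + u x \<bullet> curl_of (Y 0 x)) =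
        2 * (jacobian v (at x) \<bullet> GI x + t * (v x \<bullet> curl_of (GI x) + u x \<bullet> curl_of (jacobian v (at x)))
          - (u x \<bullet> v x) * ((norm (GI x))\<^sup>2 + 2 * t * (u x \<bullet> curl_of (GI x))))"
      proof (rule variation_integrand[OF us sph])
        show "Y 0 x *v h = mobY 0 ((1 / 2) *\<^sub>R v x) (u x) ((1 / 2) *\<^sub>R (jacobian v (at x) *v h)) (GI x *v h)" for h
          using x by (simp add: Y_mult b_def b'_def Jv GI_def G_def)
        show "X 0 x = mobX 0 ((1 / 2) *\<^sub>R v x) (u x)" by (simp add: X_def b_def)
      qed
      then have "q 0 x = 2 * ?T x" unfolding q_def Yx nu Gx by simp
      then show ?thesis using True x by simp
    next
      case False
      have "q 0 x = 0" if "x \<in> \<Omega>0"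
      proof -
        have "x \<notin> Kv" using False elim(2) Kv(2) unfolding A_def by blast
        then have "b x = 0" "\<And>h. b' x h = 0" by (simp_all add: b_def b'_def v0 v'0)
        then show ?thesis using X_zero Y_zero by (simp add: q_def YI_def)
      qed
      then show ?thesis using False by (simp add: indicator_def)
    qed
  qed
  have hb: "has_bochner_integral lebesgue (\<lambda>x. (1 / 2) * (indicator \<Omega>0 x *\<^sub>R q 0 x)) 0"
  proof -
    have z: "\<bar>0::real\<bar> \<le> s0" using s0 by simp
    have "has_bochner_integral lebesgue (\<lambda>x. indicator \<Omega>0 x *\<^sub>R q 0 x) (I 0)"
      unfolding I_def by (rule has_bochner_integral_integrable[OF qi[OF z]])
    from has_bochner_integral_mult_right[OF this, of "1 / 2"] show ?thesis unfolding I0 by simp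
  qed
  have m1: "(\<lambda>x. (1 / 2) * (indicator \<Omega>0 x *\<^sub>R q 0 x)) \<in> borel_measurable lebesgue"
    using hb by (auto simp: has_bochner_integral_iff)
  \<comment> \<open>Equality almost everywhere also transfers measurability, which has not been
    established directly for the integrand of the claim.\<close>
  have "has_bochner_integral lebesgue (\<lambda>x. indicator A x *\<^sub>R ?T x) 0"
    using has_bochner_integral_cong_AE[OF m1 borel_measurable_AE[OF m1 ae] ae] hb by blast
  moreover have "A \<inter> space lebesgue \<in> sets lebesgue" using A(1) by auto
  ultimately have "has_bochner_integral (restrict_space lebesgue A) ?T 0"
    by (simp only: has_bochner_integral_restrict_space)
  then show "has_bochner_integral
      (lebesgue_on (U - closure (approx_disc_set (extended_domain L1 L2 \<epsilon>) n))) ?T 0"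
    unfolding A_def S_def \<Omega>_def .
qed

end
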